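(* Let $A$ be a finite-dimensional algebra over a field $K$. Then the following are equivalent: (1) $A$ has a faithful projective-injective $A$-module which has the double centraliser property. (2) $A$ is reflexive as a bimodule, i.e. as a module over $A^e=A\otimes_K A^{op}$.
   Context: All modules are finitely generated. $A$-bimodules are identified with left $A^e$-modules. A right $A$-module $M$ is a left $B$-module for $B=\operatorname{End}_A(M)$; $M$ has the double centraliser property if the canonical algebra homomorphism $f:A\to \operatorname{End}_{B^{op}}(M)^{op}$, $f(a)(x)=xa$ (to the opposite of the algebra of $B$-linear endomorphisms of the left $B$-module $M$), is an isomorphism. A module $M$ over a ring $R$ is reflexive if the canonical evaluation map $M\to M^{**}$ is an isomorphism, where $(-)^*=\operatorname{Hom}_R(-,R)$. *)

theory Defs
  imports "HOL-Algebra.Module" "HOL-Algebra.QuotRing"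
begin

section \<open>Modules over noncommutative rings\<close>

text \<open>The library locale \<^locale>\<open>module\<close> requires a commutative ring of scalars. Its record type is
  reused; the fields \<open>mult\<close> and \<open>one\<close> of a module record play no role for modules.\<close>

locale left_module = R?: ring R + M?: abelian_group M
  for R :: "('r, 'x) ring_scheme" (structure) and M :: "('r, 'm, 'y) module_scheme" (structure) +
  assumes smult_closed [simp, intro]:
      "\<lbrakk>a \<in> carrier R; x \<in> carrier M\<rbrakk> \<Longrightarrow> a \<odot>\<^bsub>M\<^esub> x \<in> carrier M"
    and smult_l_distr:
      "\<lbrakk>a \<in> carrier R; b \<in> carrier R; x \<in> carrier M\<rbrakk> \<Longrightarrow>
      (a \<oplus>\<^bsub>R\<^esub> b) \<odot>\<^bsub>M\<^esub> x = a \<odot>\<^bsub>M\<^esub> x \<oplus>\<^bsub>M\<^esub> b \<odot>\<^bsub>M\<^esub> x"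
    and smult_r_distr:
      "\<lbrakk>a \<in> carrier R; x \<in> carrier M; y \<in> carrier M\<rbrakk> \<Longrightarrow>
      a \<odot>\<^bsub>M\<^esub> (x \<oplus>\<^bsub>M\<^esub> y) = a \<odot>\<^bsub>M\<^esub> x \<oplus>\<^bsub>M\<^esub> a \<odot>\<^bsub>M\<^esub> y"
    and smult_assoc:
      "\<lbrakk>a \<in> carrier R; b \<in> carrier R; x \<in> carrier M\<rbrakk> \<Longrightarrow>
      (a \<otimes>\<^bsub>R\<^esub> b) \<odot>\<^bsub>M\<^esub> x = a \<odot>\<^bsub>M\<^esub> (b \<odot>\<^bsub>M\<^esub> x)"
    and smult_one [simp]: "x \<in> carrier M \<Longrightarrow> \<one>\<^bsub>R\<^esub> \<odot>\<^bsub>M\<^esub> x = x"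

definition finitely_generated ::
    "('r, 'x) ring_scheme \<Rightarrow> ('r, 'm, 'y) module_scheme \<Rightarrow> bool" where
  "finitely_generated R M \<longleftrightarrow>
    (\<exists>S. finite S \<and> S \<subseteq> carrier M \<and>
      (\<forall>x \<in> carrier M. \<exists>c \<in> S \<rightarrow> carrier R. x = (\<Oplus>\<^bsub>M\<^esub> s \<in> S. c s \<odot>\<^bsub>M\<^esub> s)))"

locale fg_left_module = left_module R M
  for R :: "('r, 'x) ring_scheme" (structure) and M :: "('r, 'm, 'y) module_scheme" (structure) +
  assumes finitely_generated: "finitely_generated R M"

text \<open>The opposite ring; only the multiplication is changed, so this also yields the opposite of an
  algebra. Right \<open>R\<close>-modules are left \<open>opp R\<close>-modules, with \<open>a \<odot> x\<close> standing for \<open>xa\<close>.\<close>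

definition opp :: "('r, 'x) ring_scheme \<Rightarrow> ('r, 'x) ring_scheme" where
  "opp R = R\<lparr>mult := \<lambda>x y. y \<otimes>\<^bsub>R\<^esub> x\<rparr>"

text \<open>Homomorphisms are extensional functions, so that equality of homomorphisms is equality on the
  carrier.\<close>

definition module_hom ::
    "('r, 'x) ring_scheme \<Rightarrow> ('r, 'm, 'y) module_scheme \<Rightarrow> ('r, 'n, 'z) module_scheme \<Rightarrow> ('m \<Rightarrow> 'n) set"
  where
  "module_hom R M N = {f \<in> carrier M \<rightarrow>\<^sub>E carrier N.
     (\<forall>x \<in> carrier M. \<forall>y \<in> carrier M. f (x \<oplus>\<^bsub>M\<^esub> y) = f x \<oplus>\<^bsub>N\<^esub> f y) \<and>
     (\<forall>a \<in> carrier R. \<forall>x \<in> carrier M. f (a \<odot>\<^bsub>M\<^esub> x) = a \<odot>\<^bsub>N\<^esub> f x)}"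

definition module_iso ::
    "('r, 'x) ring_scheme \<Rightarrow> ('r, 'm, 'y) module_scheme \<Rightarrow> ('r, 'n, 'z) module_scheme \<Rightarrow> ('m \<Rightarrow> 'n) set"
  where
  "module_iso R M N = {f \<in> module_hom R M N. bij_betw f (carrier M) (carrier N)}"


section \<open>Projective, injective and faithful modules\<close>

text \<open>All modules are finitely generated, so projectivity and injectivity are tested in the category
  of finitely generated modules. The test modules have to live in one type. The type chosen here
  contains an isomorphic copy of every finitely generated \<open>R\<close>-module, see \<open>fg_left_module_universe\<close>
  below.\<close>

type_synonym 'r fgmod = "('r, (nat \<Rightarrow> 'r) set) module"

definition projective :: "('r, 'x) ring_scheme \<Rightarrow> ('r, 'm, 'y) module_scheme \<Rightarrow> bool" where
  "projective R M \<longleftrightarrow>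
    (\<forall>(U :: 'r fgmod) (V :: 'r fgmod) g h.
       fg_left_module R U \<and> fg_left_module R V \<and>
       g \<in> module_hom R U V \<and> g ` carrier U = carrier V \<and> h \<in> module_hom R M V \<longrightarrow>
       (\<exists>h' \<in> module_hom R M U. \<forall>m \<in> carrier M. g (h' m) = h m))"

definition injective :: "('r, 'x) ring_scheme \<Rightarrow> ('r, 'm, 'y) module_scheme \<Rightarrow> bool" where
  "injective R M \<longleftrightarrow>
    (\<forall>(U :: 'r fgmod) (V :: 'r fgmod) g h.
       fg_left_module R U \<and> fg_left_module R V \<and>
       g \<in> module_hom R U V \<and> inj_on g (carrier U) \<and> h \<in> module_hom R U M \<longrightarrow>
       (\<exists>h' \<in> module_hom R V M. \<forall>x \<in> carrier U. h' (g x) = h x))"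

definition faithful :: "('r, 'x) ring_scheme \<Rightarrow> ('r, 'm, 'y) module_scheme \<Rightarrow> bool" where
  "faithful R M \<longleftrightarrow>
    (\<forall>a \<in> carrier R. (\<forall>x \<in> carrier M. a \<odot>\<^bsub>M\<^esub> x = \<zero>\<^bsub>M\<^esub>) \<longrightarrow> a = \<zero>\<^bsub>R\<^esub>)"


section \<open>Endomorphism rings and the double centraliser property\<close>

definition end_ring ::
    "('r, 'x) ring_scheme \<Rightarrow> ('r, 'm, 'y) module_scheme \<Rightarrow> ('m \<Rightarrow> 'm) ring" where
  "end_ring R M =
    \<lparr>carrier = module_hom R M M,
     mult = (\<lambda>g h. compose (carrier M) g h),
     one = (\<lambda>x \<in> carrier M. x),
     zero = (\<lambda>x \<in> carrier M. \<zero>\<^bsub>M\<^esub>),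
     add = (\<lambda>g h. \<lambda>x \<in> carrier M. g x \<oplus>\<^bsub>M\<^esub> h x)\<rparr>"

text \<open>A right \<open>A\<close>-module as a left module over its endomorphism ring.\<close>

definition over_end :: "('a, 'm, 'y) module_scheme \<Rightarrow> ('m \<Rightarrow> 'm, 'm) module" where
  "over_end M =
    \<lparr>carrier = carrier M, mult = mult M, one = one M, zero = zero M, add = add M,
     smult = (\<lambda>h x. h x)\<rparr>"

definition double_centraliser ::
    "('a, 'x) ring_scheme \<Rightarrow> ('a, 'm, 'y) module_scheme \<Rightarrow> bool" where
  "double_centraliser A M \<longleftrightarrow>
    (\<lambda>a. \<lambda>x \<in> carrier M. a \<odot>\<^bsub>M\<^esub> x)
      \<in> ring_iso A (opp (end_ring (end_ring (opp A) M) (over_end M)))"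


section \<open>Duals and reflexive modules\<close>

definition regular :: "('r, 'x) ring_scheme \<Rightarrow> ('r, 'r) module" where
  "regular R =
    \<lparr>carrier = carrier R, mult = mult R, one = one R, zero = zero R, add = add R,
     smult = mult R\<rparr>"

text \<open>The dual of a left \<open>R\<close>-module is a right \<open>R\<close>-module by \<open>(f r)(x) = f(x) r\<close>, that is, a
  left \<open>opp R\<close>-module. Its dual in turn, taken over \<open>opp R\<close>, is a left module over
  \<open>opp (opp R) = R\<close>. The fields \<open>mult\<close> and \<open>one\<close> have no meaning for a dual module.\<close>

definition dual ::
    "('r, 'x) ring_scheme \<Rightarrow> ('r, 'm, 'y) module_scheme \<Rightarrow> ('r, 'm \<Rightarrow> 'r) module" where
  "dual R M =
    \<lparr>carrier = module_hom R M (regular R),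
     mult = undefined, one = undefined,
     zero = (\<lambda>x \<in> carrier M. \<zero>\<^bsub>R\<^esub>),
     add = (\<lambda>f g. \<lambda>x \<in> carrier M. f x \<oplus>\<^bsub>R\<^esub> g x),
     smult = (\<lambda>r f. \<lambda>x \<in> carrier M. f x \<otimes>\<^bsub>R\<^esub> r)\<rparr>"

definition evaluation ::
    "('r, 'x) ring_scheme \<Rightarrow> ('r, 'm, 'y) module_scheme \<Rightarrow> 'm \<Rightarrow> ('m \<Rightarrow> 'r) \<Rightarrow> 'r" where
  "evaluation R M = (\<lambda>x \<in> carrier M. \<lambda>f \<in> carrier (dual R M). f x)"

definition reflexive :: "('r, 'x) ring_scheme \<Rightarrow> ('r, 'm, 'y) module_scheme \<Rightarrow> bool" where
  "reflexive R M \<longleftrightarrow> evaluation R M \<in> module_iso R M (dual (opp R) (dual R M))"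


section \<open>Finite-dimensional algebras and the enveloping algebra\<close>

text \<open>The library locale \<^locale>\<open>algebra\<close> is restricted to commutative algebras.\<close>

locale fd_algebra = K?: field K + A?: ring A + module K A
  for K :: "('k, 'x) ring_scheme" (structure) and A :: "('k, 'a, 'y) module_scheme" (structure) +
  assumes smult_mult_left:
      "\<lbrakk>k \<in> carrier K; x \<in> carrier A; y \<in> carrier A\<rbrakk> \<Longrightarrow>
      (k \<odot>\<^bsub>A\<^esub> x) \<otimes>\<^bsub>A\<^esub> y = k \<odot>\<^bsub>A\<^esub> (x \<otimes>\<^bsub>A\<^esub> y)"
    and smult_mult_right:
      "\<lbrakk>k \<in> carrier K; x \<in> carrier A; y \<in> carrier A\<rbrakk> \<Longrightarrow>
      x \<otimes>\<^bsub>A\<^esub> (k \<odot>\<^bsub>A\<^esub> y) = k \<odot>\<^bsub>A\<^esub> (x \<otimes>\<^bsub>A\<^esub> y)"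
    and finite_dimensional: "finitely_generated K A"

definition supp :: "('k, 'x) ring_scheme \<Rightarrow> ('g \<Rightarrow> 'k) \<Rightarrow> 'g set" where
  "supp K f = {p. f p \<noteq> \<zero>\<^bsub>K\<^esub>}"

text \<open>The monoid algebra \<open>K[G]\<close>, that is, the free \<open>K\<close>-module on \<open>G\<close> with the convolution
  product, as finitely supported functions.\<close>

definition monoid_alg ::
    "('k, 'x) ring_scheme \<Rightarrow> ('g, 'y) monoid_scheme \<Rightarrow> ('g \<Rightarrow> 'k) ring" where
  "monoid_alg K G =
    \<lparr>carrier = {f. range f \<subseteq> carrier K \<and> supp K f \<subseteq> carrier G \<and> finite (supp K f)},
     mult = (\<lambda>f g z. \<Oplus>\<^bsub>K\<^esub> p \<in> {p \<in> supp K f \<times> supp K g. fst p \<otimes>\<^bsub>G\<^esub> snd p = z}.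
                       f (fst p) \<otimes>\<^bsub>K\<^esub> g (snd p)),
     one = (\<lambda>p. if p = \<one>\<^bsub>G\<^esub> then \<one>\<^bsub>K\<^esub> else \<zero>\<^bsub>K\<^esub>),
     zero = (\<lambda>p. \<zero>\<^bsub>K\<^esub>),
     add = (\<lambda>f g p. f p \<oplus>\<^bsub>K\<^esub> g p)\<rparr>"

definition single :: "('k, 'x) ring_scheme \<Rightarrow> 'g \<Rightarrow> 'k \<Rightarrow> 'g \<Rightarrow> 'k" where
  "single K p k = (\<lambda>q. if q = p then k else \<zero>\<^bsub>K\<^esub>)"

text \<open>\<open>A \<otimes>\<^sub>K B\<close> is the free \<open>K\<close>-module on \<open>A \<times> B\<close> modulo the \<open>K\<close>-span of the bilinearity
  relations. Multiplying such a relation by a basis element on either side gives another one, so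
  this span is an ideal of \<open>K[A \<times> B]\<close>, and the quotient ring has the multiplication
  \<open>(a \<otimes> b)(a' \<otimes> b') = aa' \<otimes> bb'\<close>.\<close>

definition bilinear_relations ::
    "('k, 'x) ring_scheme \<Rightarrow> ('k, 'a, 'y) module_scheme \<Rightarrow> ('k, 'b, 'z) module_scheme \<Rightarrow>
     ('a \<times> 'b \<Rightarrow> 'k) set" where
  "bilinear_relations K A B =
    (let F = monoid_alg K (A \<times>\<times> B); e = (\<lambda>p. single K p \<one>\<^bsub>K\<^esub>) in
      {e (a \<oplus>\<^bsub>A\<^esub> a', b) \<ominus>\<^bsub>F\<^esub> (e (a, b) \<oplus>\<^bsub>F\<^esub> e (a', b)) | a a' b.
         a \<in> carrier A \<and> a' \<in> carrier A \<and> b \<in> carrier B} \<union>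
      {e (a, b \<oplus>\<^bsub>B\<^esub> b') \<ominus>\<^bsub>F\<^esub> (e (a, b) \<oplus>\<^bsub>F\<^esub> e (a, b')) | a b b'.
         a \<in> carrier A \<and> b \<in> carrier B \<and> b' \<in> carrier B} \<union>
      {e (k \<odot>\<^bsub>A\<^esub> a, b) \<ominus>\<^bsub>F\<^esub> single K (a, b) k | k a b.
         k \<in> carrier K \<and> a \<in> carrier A \<and> b \<in> carrier B} \<union>
      {e (a, k \<odot>\<^bsub>B\<^esub> b) \<ominus>\<^bsub>F\<^esub> single K (a, b) k | k a b.
         k \<in> carrier K \<and> a \<in> carrier A \<and> b \<in> carrier B})"

definition tensor_alg ::
    "('k, 'x) ring_scheme \<Rightarrow> ('k, 'a, 'y) module_scheme \<Rightarrow> ('k, 'b, 'z) module_scheme \<Rightarrow>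
     ('a \<times> 'b \<Rightarrow> 'k) set ring" where
  "tensor_alg K A B =
    (let F = monoid_alg K (A \<times>\<times> B) in F Quot (Idl\<^bsub>F\<^esub> (bilinear_relations K A B)))"

definition env_alg ::
    "('k, 'x) ring_scheme \<Rightarrow> ('k, 'a, 'y) module_scheme \<Rightarrow> ('a \<times> 'a \<Rightarrow> 'k) set ring" where
  "env_alg K A = tensor_alg K A (opp A)"

text \<open>The \<open>A\<close>-bimodule \<open>A\<close> as a left \<open>A\<^sup>e\<close>-module: \<open>(a \<otimes> b) x = axb\<close>. The image under
  \<open>the_elem\<close> is a singleton because the action of \<open>K[A \<times> A]\<close> kills the bilinearity relations.\<close>

definition regular_bimodule ::
    "('k, 'x) ring_scheme \<Rightarrow> ('k, 'a, 'y) module_scheme \<Rightarrow> (('a \<times> 'a \<Rightarrow> 'k) set, 'a) module"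
  where
  "regular_bimodule K A =
    \<lparr>carrier = carrier A, mult = mult A, one = one A, zero = zero A, add = add A,
     smult = (\<lambda>t x. the_elem ((\<lambda>f. \<Oplus>\<^bsub>A\<^esub> p \<in> supp K f.
               f p \<odot>\<^bsub>A\<^esub> (fst p \<otimes>\<^bsub>A\<^esub> x \<otimes>\<^bsub>A\<^esub> snd p)) ` t))\<rparr>"


section \<open>Every finitely generated module has a copy in the type of test modules\<close>

lemma (in left_module) transport:
  fixes \<iota> :: "'m \<Rightarrow> 'n"
  assumes inj: "inj_on \<iota> (carrier M)"
  obtains N :: "('r, 'n) module" and h where "left_module R N" and "h \<in> module_iso R M N"
proof -
  define g where "g = inv_into (carrier M) \<iota>"
  define N :: "('r, 'n) module" where "N =
    \<lparr>carrier = \<iota> ` carrier M, mult = undefined, one = undefined, zero = \<iota> \<zero>\<^bsub>M\<^esub>,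
     add = (\<lambda>x y. \<iota> (g x \<oplus>\<^bsub>M\<^esub> g y)), smult = (\<lambda>a x. \<iota> (a \<odot>\<^bsub>M\<^esub> g x))\<rparr>"
  have g [simp]: "g (\<iota> x) = x" if "x \<in> carrier M" for x
    using inj that by (simp add: g_def)
  have ab: "abelian_group N"
  proof (rule abelian_groupI)
    fix x assume "x \<in> carrier N"
    then obtain m where m: "m \<in> carrier M" "x = \<iota> m" by (auto simp: N_def)
    show "\<exists>y\<in>carrier N. y \<oplus>\<^bsub>N\<^esub> x = \<zero>\<^bsub>N\<^esub>"
      using m by (intro bexI[of _ "\<iota> (\<ominus>\<^bsub>M\<^esub> m)"]) (auto simp: N_def M.l_neg)
  qed (auto simp: N_def M.a_ac)
  have lm: "left_module R N"
    by (intro left_module.intro left_module_axioms.intro ab R.ring_axioms)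
      (auto simp: N_def smult_l_distr smult_r_distr smult_assoc)
  have "restrict \<iota> (carrier M) \<in> module_iso R M N"
    using inj by (auto simp: module_iso_def module_hom_def N_def bij_betw_def inj_on_def)
  with lm that show thesis by blast
qed

lemma (in left_module) module_iso_finitely_generated:
  fixes N :: "('r, 'n, 'z) module_scheme"
  assumes N: "left_module R N" and h: "h \<in> module_iso R M N" and fg: "finitely_generated R M"
  shows "finitely_generated R N"
proof -
  interpret N: left_module R N by fact
  have hc: "h x \<in> carrier N" if "x \<in> carrier M" for x
    using h that by (auto simp: module_iso_def module_hom_def)
  have ha: "h (x \<oplus>\<^bsub>M\<^esub> y) = h x \<oplus>\<^bsub>N\<^esub> h y" if "x \<in> carrier M" "y \<in> carrier M" for x y
    using h that by (auto simp: module_iso_def module_hom_def)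
  have hs: "h (a \<odot>\<^bsub>M\<^esub> x) = a \<odot>\<^bsub>N\<^esub> h x" if "a \<in> carrier R" "x \<in> carrier M" for a x
    using h that by (auto simp: module_iso_def module_hom_def)
  have bij: "inj_on h (carrier M)" "h ` carrier M = carrier N"
    using h by (auto simp: module_iso_def bij_betw_def)
  have h0: "h \<zero>\<^bsub>M\<^esub> = \<zero>\<^bsub>N\<^esub>"
    using ha[of "\<zero>\<^bsub>M\<^esub>" "\<zero>\<^bsub>M\<^esub>"] hc[of "\<zero>\<^bsub>M\<^esub>"] by (metis M.l_zero M.zero_closed N.add.r_cancel_one')
  have hsum: "h (\<Oplus>\<^bsub>M\<^esub> s \<in> S. f s) = (\<Oplus>\<^bsub>N\<^esub> s \<in> S. h (f s))"
    if "finite S" "f \<in> S \<rightarrow> carrier M" for S and f :: "'m \<Rightarrow> 'm"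
    using that
  proof (induction S rule: finite_induct)
    case (insert s S)
    then have 1: "f \<in> S \<rightarrow> carrier M" "f s \<in> carrier M" by auto
    then have 2: "(\<lambda>s. h (f s)) \<in> S \<rightarrow> carrier N" using hc by auto
    show ?case using insert 1 2 hc by (simp add: ha)
  qed (simp add: h0)
  obtain S where S: "finite S" "S \<subseteq> carrier M"
    "\<And>x. x \<in> carrier M \<Longrightarrow> \<exists>c \<in> S \<rightarrow> carrier R. x = (\<Oplus>\<^bsub>M\<^esub> s \<in> S. c s \<odot>\<^bsub>M\<^esub> s)"
    using fg by (auto simp: finitely_generated_def)
  have "\<exists>c \<in> h ` S \<rightarrow> carrier R. y = (\<Oplus>\<^bsub>N\<^esub> s \<in> h ` S. c s \<odot>\<^bsub>N\<^esub> s)" if y: "y \<in> carrier N" for y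
  proof -
    obtain x where x: "x \<in> carrier M" "y = h x" using y bij by auto
    obtain c where c: "c \<in> S \<rightarrow> carrier R" "x = (\<Oplus>\<^bsub>M\<^esub> s \<in> S. c s \<odot>\<^bsub>M\<^esub> s)"
      using S(3)[OF x(1)] by blast
    define d where "d = (\<lambda>t. c (inv_into S h t))"
    have injS: "inj_on h S" using bij(1) S(2) by (rule inj_on_subset)
    have d: "d (h s) = c s" if "s \<in> S" for s using injS that by (simp add: d_def)
    have "y = (\<Oplus>\<^bsub>N\<^esub> s \<in> S. h (c s \<odot>\<^bsub>M\<^esub> s))"
      unfolding x(2) c(2) by (rule hsum) (use S c in auto)
    also have "\<dots> = (\<Oplus>\<^bsub>N\<^esub> s \<in> S. d (h s) \<odot>\<^bsub>N\<^esub> h s)"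
      by (rule N.M.finsum_cong') (use S c hs hc d in \<open>auto simp: Pi_iff subset_iff\<close>)
    also have "\<dots> = (\<Oplus>\<^bsub>N\<^esub> s \<in> h ` S. d s \<odot>\<^bsub>N\<^esub> s)"
      by (rule N.M.finsum_reindex[symmetric]) (use S c hc d injS in \<open>auto simp: Pi_iff subset_iff\<close>)
    finally show ?thesis using c d by (intro bexI[of _ d]) auto
  qed
  then show ?thesis
    unfolding finitely_generated_def using S hc by (intro exI[of _ "h ` S"]) auto
qed

lemma (in fg_left_module) fg_left_module_universe:
  obtains N :: "'r fgmod" and h where "fg_left_module R N" and "h \<in> module_iso R M N"
proof -
  obtain S where S: "finite S" "S \<subseteq> carrier M"
    "\<And>x. x \<in> carrier M \<Longrightarrow> \<exists>c \<in> S \<rightarrow> carrier R. x = (\<Oplus>\<^bsub>M\<^esub> s \<in> S. c s \<odot>\<^bsub>M\<^esub> s)"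
    using finitely_generated by (auto simp: finitely_generated_def)
  obtain idx :: "'m \<Rightarrow> nat" where idx: "inj_on idx S"
    using finite_imp_inj_to_nat_seg[OF S(1)] by blast
  define \<iota> where "\<iota> = (\<lambda>m. {d :: nat \<Rightarrow> 'r. m = (\<Oplus>\<^bsub>M\<^esub> s \<in> S. d (idx s) \<odot>\<^bsub>M\<^esub> s)})"
  have ne: "\<iota> m \<noteq> {}" if m: "m \<in> carrier M" for m
  proof -
    obtain c where c: "c \<in> S \<rightarrow> carrier R" "m = (\<Oplus>\<^bsub>M\<^esub> s \<in> S. c s \<odot>\<^bsub>M\<^esub> s)"
      using S(3)[OF m] by blast
    have "(\<Oplus>\<^bsub>M\<^esub> s \<in> S. c s \<odot>\<^bsub>M\<^esub> s) = (\<Oplus>\<^bsub>M\<^esub> s \<in> S. c (inv_into S idx (idx s)) \<odot>\<^bsub>M\<^esub> s)"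
      by (rule M.finsum_cong') (use S c idx in \<open>auto simp: Pi_iff subset_iff\<close>)
    then have "(\<lambda>i. c (inv_into S idx i)) \<in> \<iota> m" using c(2) by (simp add: \<iota>_def)
    then show ?thesis by blast
  qed
  have "inj_on \<iota> (carrier M)"
  proof (rule inj_onI)
    fix x y assume "x \<in> carrier M" "y \<in> carrier M" "\<iota> x = \<iota> y"
    with ne obtain d where "d \<in> \<iota> x" "d \<in> \<iota> y" by blast
    then show "x = y" by (simp add: \<iota>_def)
  qed
  then obtain N :: "'r fgmod" and h where N: "left_module R N" "h \<in> module_iso R M N"
    by (rule transport)
  moreover have "finitely_generated R N"
    using N finitely_generated by (rule module_iso_finitely_generated)
  ultimately show thesis
    using that by (auto intro: fg_left_module.intro fg_left_module_axioms.intro)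
qed

end

theory Submission
  imports Defs
begin

text \<open>
  Write \<open>D\<close> for the dual space \<open>Hom\<^sub>K(A, K)\<close>, a bimodule, and \<open>H = Hom\<^sub>A(D, A)\<close> for the
  homomorphisms of right modules. Both conditions of the theorem are compared with a condition on
  \<open>D\<close> and \<open>H\<close> alone (\<open>dual_reflexive\<close>), which mentions neither \<open>A \<otimes> A\<close> nor a module \<open>M\<close>.

  Since \<open>A\<close> is finite-dimensional, \<open>a \<otimes> b \<mapsto> (\<xi> \<mapsto> \<xi>(a) b)\<close> identifies the enveloping algebra
  with the linear maps from \<open>D\<close> to \<open>A\<close> (\<open>env_slice_inject\<close>, \<open>env_slice_surj\<close>). Under this
  identification the bimodule dual of \<open>A\<close> becomes \<open>H\<close>, because a bimodule map is determined by its
  value at \<open>1\<close>, which must be a Casimir element; an element of the bidual becomes a map \<open>\<phi>\<close> sending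
  each \<open>h\<close> in \<open>H\<close> to a linear map \<open>\<phi>(h)\<close> from \<open>D\<close> to \<open>A\<close> and compatible with \<open>h \<mapsto> d h(c _)\<close>.
  Evaluation at \<open>x\<close> is \<open>\<phi>(h)(\<xi>) = h(\<xi>) x\<close>. So \<open>A\<close> is reflexive if and only if every \<open>\<phi>\<close> has
  this form for exactly one \<open>x\<close> (\<open>reflexive_iff_dual_reflexive\<close>).

  Suppose that \<open>M\<close> is a module as in the theorem. Projectivity gives \<open>m = \<Sum>\<^sub>s f\<^sub>s(m) s\<close>
  with \<open>f\<^sub>s : M \<rightarrow> A\<close>, and injectivity gives \<open>m = \<Sum>\<^sub>t r\<^sub>t(g\<^sub>t(m))\<close> with
  \<open>g\<^sub>t : M \<rightarrow> D\<close> and \<open>r\<^sub>t : D \<rightarrow> M\<close>. Each composite \<open>f r\<close> of maps \<open>r : D \<rightarrow> M\<close> and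
  \<open>f : M \<rightarrow> A\<close> lies in \<open>H\<close>, and the coordinates produce a map \<open>\<theta>\<close> on \<open>M\<close> with
  \<open>\<phi>(f r) = f \<theta> r\<close> for all \<open>f\<close> and \<open>r\<close> (\<open>phi_comp\<close>). As the \<open>f\<close> separate points and the \<open>r\<close> have
  jointly full image, \<open>\<theta>\<close> commutes with all endomorphisms of \<open>M\<close>; hence it is multiplication by some
  \<open>x\<close>, and faithfulness extends \<open>\<phi>(h) = h x\<close> from the composites to all of \<open>H\<close>.

  Conversely, the trace ideal \<open>I\<close> of \<open>D\<close>, generated by the values of all \<open>h\<close> in \<open>H\<close>, has zero right
  annihilator. The descending chain condition provides an idempotent \<open>e\<close> in \<open>I\<close> for which \<open>eA\<close> is
  already faithful (\<open>faithful_idempotent\<close>). Multiplication by \<open>e\<close> factors through a power of the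
  injective module \<open>D\<close>, so \<open>eA\<close> is injective. To a map \<open>\<theta>\<close> on \<open>eA\<close> commuting with all endomorphisms
  one attaches the map \<open>\<phi>\<close> for which \<open>y = \<phi>(h)(\<xi>)\<close> solves \<open>e a y = \<theta>(e a h(\<xi>))\<close> for all \<open>a\<close>.
  Such a \<open>y\<close> exists because faithfulness of \<open>eA\<close> forces \<open>D = D e A\<close>, and then \<open>h(\<xi>)\<close> lies
  in \<open>A e A\<close> (\<open>DA_generated\<close>, \<open>ex_solves\<close>). The element \<open>x\<close> that represents \<open>\<phi>\<close> represents \<open>\<theta>\<close>.
\<close>


section \<open>Additive maps and finite sums\<close>

definition additive_map :: "('g, 'x) ring_scheme \<Rightarrow> ('h, 'y) ring_scheme \<Rightarrow> ('g \<Rightarrow> 'h) \<Rightarrow> bool" where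
  "additive_map G H f \<longleftrightarrow> f \<in> carrier G \<rightarrow> carrier H \<and>
     (\<forall>x \<in> carrier G. \<forall>y \<in> carrier G. f (x \<oplus>\<^bsub>G\<^esub> y) = f x \<oplus>\<^bsub>H\<^esub> f y)"

lemma additive_mapD:
  assumes "additive_map G H f"
  shows "x \<in> carrier G \<Longrightarrow> f x \<in> carrier H"
    and "x \<in> carrier G \<Longrightarrow> y \<in> carrier G \<Longrightarrow> f (x \<oplus>\<^bsub>G\<^esub> y) = f x \<oplus>\<^bsub>H\<^esub> f y"
  using assms by (auto simp: additive_map_def)

lemma additive_map_zero:
  assumes "abelian_group G" "abelian_group H" "additive_map G H f"
  shows "f \<zero>\<^bsub>G\<^esub> = \<zero>\<^bsub>H\<^esub>"
proof -
  interpret G: abelian_group G by fact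
  interpret H: abelian_group H by fact
  have "f \<zero>\<^bsub>G\<^esub> = f \<zero>\<^bsub>G\<^esub> \<oplus>\<^bsub>H\<^esub> f \<zero>\<^bsub>G\<^esub>"
    using additive_mapD(2)[OF assms(3), of "\<zero>\<^bsub>G\<^esub>" "\<zero>\<^bsub>G\<^esub>"] by simp
  moreover have "f \<zero>\<^bsub>G\<^esub> \<in> carrier H" using additive_mapD(1)[OF assms(3)] by simp
  ultimately show ?thesis by (metis H.add.r_cancel_one')
qed

lemma additive_map_minus:
  assumes "abelian_group G" "abelian_group H" "additive_map G H f" "x \<in> carrier G" "y \<in> carrier G"
  shows "f (x \<ominus>\<^bsub>G\<^esub> y) = f x \<ominus>\<^bsub>H\<^esub> f y"
proof -
  interpret G: abelian_group G by fact
  interpret H: abelian_group H by fact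
  have c: "f x \<in> carrier H" "f y \<in> carrier H" "f (\<ominus>\<^bsub>G\<^esub> y) \<in> carrier H"
    using additive_mapD(1)[OF assms(3)] assms(4,5) by auto
  have "f (\<ominus>\<^bsub>G\<^esub> y) \<oplus>\<^bsub>H\<^esub> f y = f (\<ominus>\<^bsub>G\<^esub> y \<oplus>\<^bsub>G\<^esub> y)"
    using additive_mapD(2)[OF assms(3), of "\<ominus>\<^bsub>G\<^esub> y" y] assms(5) by simp
  also have "\<dots> = \<zero>\<^bsub>H\<^esub>" using additive_map_zero[OF assms(1-3)] assms(5) by (simp add: G.l_neg)
  finally have "f (\<ominus>\<^bsub>G\<^esub> y) = \<ominus>\<^bsub>H\<^esub> f y" using c by (metis H.minus_equality)
  then show ?thesis
    using additive_mapD(2)[OF assms(3), of x "\<ominus>\<^bsub>G\<^esub> y"] assms(4,5) by (simp add: a_minus_def)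
qed

lemma additive_map_finsum:
  assumes "abelian_group G" "abelian_group H" "additive_map G H f"
    and "finite S" "c \<in> S \<rightarrow> carrier G"
  shows "f (\<Oplus>\<^bsub>G\<^esub> s \<in> S. c s) = (\<Oplus>\<^bsub>H\<^esub> s \<in> S. f (c s))"
proof -
  interpret G: abelian_group G by fact
  interpret H: abelian_group H by fact
  from assms(4,5) show ?thesis
  proof (induction S rule: finite_induct)
    case empty then show ?case using additive_map_zero[OF assms(1-3)] by simp
  next
    case (insert s S)
    then have 1: "c \<in> S \<rightarrow> carrier G" "c s \<in> carrier G" by auto
    then have 2: "(\<lambda>s. f (c s)) \<in> S \<rightarrow> carrier H" "f (c s) \<in> carrier H"
      using additive_mapD(1)[OF assms(3)] by auto
    show ?case using insert 1 2 by (simp add: additive_mapD(2)[OF assms(3)])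
  qed
qed

lemma (in abelian_group) ex_a_inv: "x \<in> carrier G \<Longrightarrow> \<exists>y \<in> carrier G. y \<oplus> x = \<zero>"
  using l_neg by (intro bexI[of _ "\<ominus> x"]) auto

lemma (in abelian_group) minus_zero_imp_eq:
  assumes "x \<in> carrier G" "y \<in> carrier G" "x \<ominus> y = \<zero>"
  shows "x = y"
proof -
  have "x = x \<ominus> y \<oplus> y" using assms(1,2) by (simp add: minus_eq a_assoc l_neg)
  then show ?thesis using assms by simp
qed

lemma (in abelian_group) finsum_swap:
  assumes "finite I" "finite J" "\<And>i j. i \<in> I \<Longrightarrow> j \<in> J \<Longrightarrow> f i j \<in> carrier G"
  shows "(\<Oplus> i \<in> I. \<Oplus> j \<in> J. f i j) = (\<Oplus> j \<in> J. \<Oplus> i \<in> I. f i j)"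
  using assms(1,3)
proof (induction I rule: finite_induct)
  case empty
  then show ?case by (simp add: finsum_zero)
next
  case (insert a I)
  then have 1: "(\<lambda>j. f a j) \<in> J \<rightarrow> carrier G" "(\<lambda>j. \<Oplus> i \<in> I. f i j) \<in> J \<rightarrow> carrier G"
    "(\<lambda>i. \<Oplus> j \<in> J. f i j) \<in> I \<rightarrow> carrier G"
    by (auto intro!: finsum_closed)
  have "(\<Oplus> i \<in> insert a I. \<Oplus> j \<in> J. f i j) = (\<Oplus> j \<in> J. f a j) \<oplus> (\<Oplus> j \<in> J. \<Oplus> i \<in> I. f i j)"
    using insert 1 by (simp add: finsum_closed)
  also have "\<dots> = (\<Oplus> j \<in> J. f a j \<oplus> (\<Oplus> i \<in> I. f i j))"
    using 1 by (simp add: finsum_addf)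
  also have "\<dots> = (\<Oplus> j \<in> J. \<Oplus> i \<in> insert a I. f i j)"
    using insert 1 by (intro finsum_cong') (auto simp: Pi_iff)
  finally show ?case .
qed

lemma (in abelian_group) finsum_Times:
  assumes "finite I" "finite J" "\<And>i j. i \<in> I \<Longrightarrow> j \<in> J \<Longrightarrow> f (i, j) \<in> carrier G"
  shows "(\<Oplus> x \<in> I \<times> J. f x) = (\<Oplus> i \<in> I. \<Oplus> j \<in> J. f (i, j))"
  using assms(1,3)
proof (induction I rule: finite_induct)
  case empty
  then show ?case by simp
next
  case (insert a I)
  have c: "(\<lambda>j. f (a, j)) \<in> J \<rightarrow> carrier G" "(\<lambda>i. \<Oplus> j \<in> J. f (i, j)) \<in> I \<rightarrow> carrier G"
    using insert.prems by (auto intro!: finsum_closed)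
  have "insert a I \<times> J = Pair a ` J \<union> I \<times> J" by auto
  then have "(\<Oplus> x \<in> insert a I \<times> J. f x) = (\<Oplus> x \<in> Pair a ` J. f x) \<oplus> (\<Oplus> x \<in> I \<times> J. f x)"
    using insert.hyps insert.prems assms(2) by (simp only:, intro finsum_Un_disjoint) auto
  also have "(\<Oplus> x \<in> Pair a ` J. f x) = (\<Oplus> j \<in> J. f (a, j))"
    using insert.prems by (intro finsum_reindex) (auto simp: inj_on_def)
  also have "(\<Oplus> x \<in> I \<times> J. f x) = (\<Oplus> i \<in> I. \<Oplus> j \<in> J. f (i, j))"
    using insert.prems by (intro insert.IH) auto
  finally show ?case using insert.hyps c by (simp add: finsum_closed)
qed

lemma (in abelian_group) finsum_delta:
  assumes "finite S" "a \<in> S" "x \<in> carrier G"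
  shows "(\<Oplus> s \<in> S. if a = s then x else \<zero>) = x"
  using finsum_singleton[of a S "\<lambda>_. x"] assms by simp

lemma (in abelian_group) finsum_mem:
  assumes "finite S" "\<zero> \<in> U" "U \<subseteq> carrier G" "\<And>x y. x \<in> U \<Longrightarrow> y \<in> U \<Longrightarrow> x \<oplus> y \<in> U"
    and "\<And>s. s \<in> S \<Longrightarrow> f s \<in> U"
  shows "(\<Oplus> s \<in> S. f s) \<in> U"
  using assms(1,5)
proof (induction S rule: finite_induct)
  case (insert s S)
  then have "f \<in> S \<rightarrow> carrier G" "f s \<in> carrier G" using assms(3) by auto
  then show ?case using insert assms(4) by simp
qed (use assms in simp)


section \<open>Modules\<close>

lemma opp_simps [simp]:
  "carrier (opp R) = carrier R" "mult (opp R) = (\<lambda>x y. y \<otimes>\<^bsub>R\<^esub> x)" "one (opp R) = one R"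
  "zero (opp R) = zero R" "add (opp R) = add R"
  by (simp_all add: opp_def)

lemma opp_opp [simp]: "opp (opp R) = R"
  by (simp add: opp_def)

lemma (in ring) ring_opp: "ring (opp R)"
  by (rule ringI; (rule abelian_groupI monoidI)?)
    (auto simp: m_assoc a_ac l_distr r_distr intro: ex_a_inv)

lemma regular_simps [simp]:
  "carrier (regular R) = carrier R" "zero (regular R) = zero R" "add (regular R) = add R"
  "smult (regular R) = mult R"
  by (simp_all add: regular_def)

lemma (in ring) abelian_group_regular: "abelian_group (regular R)"
  by (rule abelian_groupI) (auto simp: a_ac intro: ex_a_inv)

lemma (in ring) left_module_regular: "left_module R (regular R)"
  by (intro left_module.intro left_module_axioms.intro abelian_group_regular ring_axioms)
    (auto simp: l_distr r_distr m_assoc)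

lemma finsum_add_monoid_cong:
  assumes "carrier G = carrier H" "add G = add H" "zero G = zero H"
  shows "finsum G f S = finsum H f S"
  using assms by (simp add: finsum_def finprod_def)

lemma finsum_regular [simp]: "finsum (regular R) f S = finsum R f S"
  and finsum_opp [simp]: "finsum (opp R) f S = finsum R f S"
  by (rule finsum_add_monoid_cong; simp)+

lemma module_homI:
  assumes "\<And>x. x \<in> carrier M \<Longrightarrow> f x \<in> carrier N"
    and "\<And>x y. x \<in> carrier M \<Longrightarrow> y \<in> carrier M \<Longrightarrow> f (x \<oplus>\<^bsub>M\<^esub> y) = f x \<oplus>\<^bsub>N\<^esub> f y"
    and "\<And>a x. a \<in> carrier R \<Longrightarrow> x \<in> carrier M \<Longrightarrow> f (a \<odot>\<^bsub>M\<^esub> x) = a \<odot>\<^bsub>N\<^esub> f x"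
    and "f \<in> extensional (carrier M)"
  shows "f \<in> module_hom R M N"
  using assms by (auto simp: module_hom_def PiE_def)

lemma module_homD:
  assumes "f \<in> module_hom R M N"
  shows "x \<in> carrier M \<Longrightarrow> f x \<in> carrier N"
    and "x \<in> carrier M \<Longrightarrow> y \<in> carrier M \<Longrightarrow> f (x \<oplus>\<^bsub>M\<^esub> y) = f x \<oplus>\<^bsub>N\<^esub> f y"
    and "a \<in> carrier R \<Longrightarrow> x \<in> carrier M \<Longrightarrow> f (a \<odot>\<^bsub>M\<^esub> x) = a \<odot>\<^bsub>N\<^esub> f x"
    and "f \<in> extensional (carrier M)"
  using assms by (auto simp: module_hom_def PiE_def)

lemma module_hom_additive: "f \<in> module_hom R M N \<Longrightarrow> additive_map M N f"
  by (auto simp: module_hom_def additive_map_def)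

lemma (in left_module) restrict_module_homI:
  assumes "\<And>x. x \<in> carrier M \<Longrightarrow> f x \<in> carrier N"
    and "\<And>x y. x \<in> carrier M \<Longrightarrow> y \<in> carrier M \<Longrightarrow> f (x \<oplus>\<^bsub>M\<^esub> y) = f x \<oplus>\<^bsub>N\<^esub> f y"
    and "\<And>a x. a \<in> carrier R \<Longrightarrow> x \<in> carrier M \<Longrightarrow> f (a \<odot>\<^bsub>M\<^esub> x) = a \<odot>\<^bsub>N\<^esub> f x"
  shows "(\<lambda>x \<in> carrier M. f x) \<in> module_hom R M N"
  by (rule module_homI) (use assms in auto)

lemma (in left_module) smult_zero_left [simp]:
  assumes "x \<in> carrier M" shows "\<zero>\<^bsub>R\<^esub> \<odot>\<^bsub>M\<^esub> x = \<zero>\<^bsub>M\<^esub>"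
proof -
  have "additive_map R M (\<lambda>a. a \<odot>\<^bsub>M\<^esub> x)"
    using assms by (auto simp: additive_map_def smult_l_distr)
  from additive_map_zero[OF R.abelian_group_axioms M.abelian_group_axioms this] show ?thesis .
qed

lemma (in left_module) additive_map_smult:
  "a \<in> carrier R \<Longrightarrow> additive_map M M (\<lambda>x. a \<odot>\<^bsub>M\<^esub> x)"
  "x \<in> carrier M \<Longrightarrow> additive_map R M (\<lambda>a. a \<odot>\<^bsub>M\<^esub> x)"
  by (auto simp: additive_map_def smult_l_distr smult_r_distr)

lemma (in left_module) smult_zero_right [simp]:
  assumes "a \<in> carrier R" shows "a \<odot>\<^bsub>M\<^esub> \<zero>\<^bsub>M\<^esub> = \<zero>\<^bsub>M\<^esub>"
  using additive_map_zero[OF M.abelian_group_axioms M.abelian_group_axioms additive_map_smult(1)[OF assms]] .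

lemma (in left_module) smult_minus_left:
  assumes "a \<in> carrier R" "b \<in> carrier R" "x \<in> carrier M"
  shows "(a \<ominus>\<^bsub>R\<^esub> b) \<odot>\<^bsub>M\<^esub> x = a \<odot>\<^bsub>M\<^esub> x \<ominus>\<^bsub>M\<^esub> b \<odot>\<^bsub>M\<^esub> x"
  using additive_map_minus[OF R.abelian_group_axioms M.abelian_group_axioms additive_map_smult(2)]
    assms by simp

lemma (in left_module) finsum_smult_right:
  assumes "a \<in> carrier R" "finite S" "c \<in> S \<rightarrow> carrier M"
  shows "a \<odot>\<^bsub>M\<^esub> (\<Oplus>\<^bsub>M\<^esub> s \<in> S. c s) = (\<Oplus>\<^bsub>M\<^esub> s \<in> S. a \<odot>\<^bsub>M\<^esub> c s)"
  using additive_map_finsum[OF M.abelian_group_axioms M.abelian_group_axioms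
    additive_map_smult(1)[OF assms(1)] assms(2,3)] .

lemma (in left_module) finsum_smult_left:
  assumes "x \<in> carrier M" "finite S" "c \<in> S \<rightarrow> carrier R"
  shows "(\<Oplus>\<^bsub>R\<^esub> s \<in> S. c s) \<odot>\<^bsub>M\<^esub> x = (\<Oplus>\<^bsub>M\<^esub> s \<in> S. c s \<odot>\<^bsub>M\<^esub> x)"
  using additive_map_finsum[OF R.abelian_group_axioms M.abelian_group_axioms
    additive_map_smult(2)[OF assms(1)] assms(2,3)] .


lemma module_iso_inverse:
  assumes "left_module R M" "left_module R N" "j \<in> module_iso R M N"
  shows "(\<lambda>y \<in> carrier N. inv_into (carrier M) j y) \<in> module_hom R N M" (is "?i \<in> _")
    and "x \<in> carrier M \<Longrightarrow> (\<lambda>y \<in> carrier N. inv_into (carrier M) j y) (j x) = x"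
    and "y \<in> carrier N \<Longrightarrow> j ((\<lambda>y \<in> carrier N. inv_into (carrier M) j y) y) = y"
proof -
  interpret M: left_module R M by fact
  interpret N: left_module R N by fact
  have j: "j \<in> module_hom R M N" "inj_on j (carrier M)" "j ` carrier M = carrier N"
    using assms(3) by (auto simp: module_iso_def bij_betw_def)
  show 1: "?i (j x) = x" if "x \<in> carrier M" for x using that j by (auto simp: module_homD(1)[OF j(1)])
  show 2: "j (?i y) = y" if "y \<in> carrier N" for y using that j by (auto simp: f_inv_into_f)
  have c: "?i y \<in> carrier M" if "y \<in> carrier N" for y
    using that inv_into_into[of y j "carrier M"] j(3) by simp
  show "?i \<in> module_hom R N M"
  proof (rule module_homI)
    fix x y assume xy: "x \<in> carrier N" "y \<in> carrier N"
    have "j (?i (x \<oplus>\<^bsub>N\<^esub> y)) = j (?i x \<oplus>\<^bsub>M\<^esub> ?i y)"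
      using xy c 2 module_homD(2)[OF j(1)] by (metis N.M.a_closed)
    then show "?i (x \<oplus>\<^bsub>N\<^esub> y) = ?i x \<oplus>\<^bsub>M\<^esub> ?i y"
      using j(2) c xy by (meson M.M.a_closed N.M.a_closed inj_onD)
  next
    fix a y assume ay: "a \<in> carrier R" "y \<in> carrier N"
    have "j (?i (a \<odot>\<^bsub>N\<^esub> y)) = j (a \<odot>\<^bsub>M\<^esub> ?i y)"
      using ay c 2 module_homD(3)[OF j(1)] by (metis N.smult_closed)
    then show "?i (a \<odot>\<^bsub>N\<^esub> y) = a \<odot>\<^bsub>M\<^esub> ?i y"
      using j(2) c ay by (meson M.smult_closed N.smult_closed inj_onD)
  qed (use c in auto)
qed

lemma (in left_module) module_hom_compose:
  assumes "f \<in> module_hom R M N" "g \<in> module_hom R N P"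
  shows "(\<lambda>x \<in> carrier M. g (f x)) \<in> module_hom R M P"
  by (rule restrict_module_homI) (auto simp: module_homD[OF assms(1)] module_homD[OF assms(2)])


section \<open>Finitely generated modules\<close>

text \<open>Phrased for an arbitrary ring of scalars, so that it covers submodules and linear subspaces.\<close>

definition is_submodule ::
    "('k, 'x) ring_scheme \<Rightarrow> ('k, 'v, 'y) module_scheme \<Rightarrow> 'v set \<Rightarrow> bool" where
  "is_submodule K V U \<longleftrightarrow> U \<subseteq> carrier V \<and> \<zero>\<^bsub>V\<^esub> \<in> U \<and>
     (\<forall>x \<in> U. \<forall>y \<in> U. x \<oplus>\<^bsub>V\<^esub> y \<in> U) \<and> (\<forall>k \<in> carrier K. \<forall>x \<in> U. k \<odot>\<^bsub>V\<^esub> x \<in> U)"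

lemma (in left_module) combination_add:
  assumes "T \<subseteq> carrier M" "c \<in> T \<rightarrow> carrier R" "d \<in> T \<rightarrow> carrier R"
  shows "(\<Oplus>\<^bsub>M\<^esub> b \<in> T. (c b \<oplus>\<^bsub>R\<^esub> d b) \<odot>\<^bsub>M\<^esub> b) = (\<Oplus>\<^bsub>M\<^esub> b \<in> T. c b \<odot>\<^bsub>M\<^esub> b) \<oplus>\<^bsub>M\<^esub> (\<Oplus>\<^bsub>M\<^esub> b \<in> T. d b \<odot>\<^bsub>M\<^esub> b)"
proof -
  have cl: "(\<lambda>b. c b \<odot>\<^bsub>M\<^esub> b) \<in> T \<rightarrow> carrier M" "(\<lambda>b. d b \<odot>\<^bsub>M\<^esub> b) \<in> T \<rightarrow> carrier M"
    using assms by auto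
  have "(\<Oplus>\<^bsub>M\<^esub> b \<in> T. (c b \<oplus>\<^bsub>R\<^esub> d b) \<odot>\<^bsub>M\<^esub> b) = (\<Oplus>\<^bsub>M\<^esub> b \<in> T. c b \<odot>\<^bsub>M\<^esub> b \<oplus>\<^bsub>M\<^esub> d b \<odot>\<^bsub>M\<^esub> b)"
    using assms cl by (intro M.finsum_cong') (auto simp: Pi_iff smult_l_distr subset_iff)
  then show ?thesis using cl by (simp add: M.finsum_addf)
qed

lemma (in left_module) combination_smult:
  assumes "finite T" "T \<subseteq> carrier M" "c \<in> T \<rightarrow> carrier R" "k \<in> carrier R"
  shows "(\<Oplus>\<^bsub>M\<^esub> b \<in> T. (k \<otimes>\<^bsub>R\<^esub> c b) \<odot>\<^bsub>M\<^esub> b) = k \<odot>\<^bsub>M\<^esub> (\<Oplus>\<^bsub>M\<^esub> b \<in> T. c b \<odot>\<^bsub>M\<^esub> b)"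
proof -
  have cl: "(\<lambda>b. c b \<odot>\<^bsub>M\<^esub> b) \<in> T \<rightarrow> carrier M" using assms by auto
  have "(\<Oplus>\<^bsub>M\<^esub> b \<in> T. (k \<otimes>\<^bsub>R\<^esub> c b) \<odot>\<^bsub>M\<^esub> b) = (\<Oplus>\<^bsub>M\<^esub> b \<in> T. k \<odot>\<^bsub>M\<^esub> (c b \<odot>\<^bsub>M\<^esub> b))"
    using assms cl by (intro M.finsum_cong') (auto simp: Pi_iff smult_assoc subset_iff)
  then show ?thesis using cl assms by (simp add: finsum_smult_right)
qed

lemma (in left_module) submodule_combinations:
  assumes "finite T" "T \<subseteq> carrier M"
  shows "is_submodule R M {\<Oplus>\<^bsub>M\<^esub> b \<in> T. c b \<odot>\<^bsub>M\<^esub> b |c. c \<in> T \<rightarrow> carrier R}" (is "is_submodule R M ?U")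
    and "T \<subseteq> {\<Oplus>\<^bsub>M\<^esub> b \<in> T. c b \<odot>\<^bsub>M\<^esub> b |c. c \<in> T \<rightarrow> carrier R}"
proof -
  let ?comb = "\<lambda>c. \<Oplus>\<^bsub>M\<^esub> b \<in> T. c b \<odot>\<^bsub>M\<^esub> b"
  have cl: "(\<lambda>b. c b \<odot>\<^bsub>M\<^esub> b) \<in> T \<rightarrow> carrier M" if "c \<in> T \<rightarrow> carrier R" for c
    using that assms by auto
  show "is_submodule R M ?U" unfolding is_submodule_def
  proof (intro conjI ballI)
    show "?U \<subseteq> carrier M" using cl by (auto intro!: M.finsum_closed)
    have "?comb (\<lambda>b. \<zero>\<^bsub>R\<^esub>) = (\<Oplus>\<^bsub>M\<^esub> b \<in> T. \<zero>\<^bsub>M\<^esub>)"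
      using assms by (intro M.finsum_cong') auto
    then have "\<zero>\<^bsub>M\<^esub> = ?comb (\<lambda>b. \<zero>\<^bsub>R\<^esub>)" by (simp add: M.finsum_zero)
    then show "\<zero>\<^bsub>M\<^esub> \<in> ?U" by (auto intro!: exI[of _ "\<lambda>b. \<zero>\<^bsub>R\<^esub>"])
  next
    fix x y assume "x \<in> ?U" "y \<in> ?U"
    then obtain c d where cd: "c \<in> T \<rightarrow> carrier R" "d \<in> T \<rightarrow> carrier R" "x = ?comb c" "y = ?comb d"
      by auto
    have "x \<oplus>\<^bsub>M\<^esub> y = ?comb (\<lambda>b. c b \<oplus>\<^bsub>R\<^esub> d b)"
      unfolding cd(3,4) using combination_add[OF assms(2) cd(1,2)] by simp
    moreover have "(\<lambda>b. c b \<oplus>\<^bsub>R\<^esub> d b) \<in> T \<rightarrow> carrier R" using cd by auto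
    ultimately show "x \<oplus>\<^bsub>M\<^esub> y \<in> ?U" by (intro CollectI exI conjI)
  next
    fix k x assume k: "k \<in> carrier R" and "x \<in> ?U"
    then obtain c where c: "c \<in> T \<rightarrow> carrier R" "x = ?comb c" by auto
    have "k \<odot>\<^bsub>M\<^esub> x = ?comb (\<lambda>b. k \<otimes>\<^bsub>R\<^esub> c b)"
      unfolding c(2) using combination_smult[OF assms c(1) k] by simp
    moreover have "(\<lambda>b. k \<otimes>\<^bsub>R\<^esub> c b) \<in> T \<rightarrow> carrier R" using c k by auto
    ultimately show "k \<odot>\<^bsub>M\<^esub> x \<in> ?U" by (intro CollectI exI conjI)
  qed
  show "T \<subseteq> ?U"
  proof
    fix b assume b: "b \<in> T"
    let ?c = "\<lambda>b'. if b' = b then \<one>\<^bsub>R\<^esub> else \<zero>\<^bsub>R\<^esub>"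
    have "?comb ?c = (\<Oplus>\<^bsub>M\<^esub> b' \<in> T. if b = b' then b' else \<zero>\<^bsub>M\<^esub>)"
      using assms by (intro M.finsum_cong') auto
    also have "\<dots> = b" using b assms by (intro M.finsum_singleton) auto
    finally have "b = ?comb ?c" by simp
    moreover have "?c \<in> T \<rightarrow> carrier R" by auto
    ultimately show "b \<in> ?U" by (intro CollectI exI conjI)
  qed
qed

text \<open>Generation in the form of a closure condition: to check that a set of generators suffices, no
  coefficients have to be written down.\<close>

lemma (in left_module) finitely_generatedI:
  assumes "finite T" "T \<subseteq> carrier M" "\<And>U. is_submodule R M U \<Longrightarrow> T \<subseteq> U \<Longrightarrow> carrier M \<subseteq> U"
  shows "finitely_generated R M"
proof -
  have "carrier M \<subseteq> {\<Oplus>\<^bsub>M\<^esub> b \<in> T. c b \<odot>\<^bsub>M\<^esub> b |c. c \<in> T \<rightarrow> carrier R}"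
    using assms submodule_combinations by blast
  then show ?thesis unfolding finitely_generated_def using assms(1,2) by (intro exI[of _ T]) auto
qed

lemma (in left_module) finitely_generatedD:
  assumes "finitely_generated R M"
  obtains T where "finite T" "T \<subseteq> carrier M" "\<And>U. is_submodule R M U \<Longrightarrow> T \<subseteq> U \<Longrightarrow> carrier M \<subseteq> U"
    "\<And>x. x \<in> carrier M \<Longrightarrow> \<exists>c \<in> T \<rightarrow> carrier R. x = (\<Oplus>\<^bsub>M\<^esub> s \<in> T. c s \<odot>\<^bsub>M\<^esub> s)"
proof -
  obtain T where T: "finite T" "T \<subseteq> carrier M"
    "\<And>x. x \<in> carrier M \<Longrightarrow> \<exists>c \<in> T \<rightarrow> carrier R. x = (\<Oplus>\<^bsub>M\<^esub> s \<in> T. c s \<odot>\<^bsub>M\<^esub> s)"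
    using assms by (auto simp: finitely_generated_def)
  moreover have "carrier M \<subseteq> U" if U: "is_submodule R M U" "T \<subseteq> U" for U
  proof
    fix x assume "x \<in> carrier M"
    then obtain c where c: "c \<in> T \<rightarrow> carrier R" "x = (\<Oplus>\<^bsub>M\<^esub> s \<in> T. c s \<odot>\<^bsub>M\<^esub> s)" using T by blast
    show "x \<in> U" unfolding c(2)
      using U c T(1) by (intro M.finsum_mem) (auto simp: is_submodule_def Pi_iff)
  qed
  ultimately show thesis using that by blast
qed

section \<open>Linear algebra over a field\<close>

locale linear_space = left_module K V + field K
  for K :: "('k, 'x) ring_scheme" (structure) and V :: "('k, 'v, 'y) module_scheme" (structure)

lemma (in linear_space) field_inv:
  assumes "c \<in> carrier K" "c \<noteq> \<zero>\<^bsub>K\<^esub>"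
  shows "inv\<^bsub>K\<^esub> c \<in> carrier K" "inv\<^bsub>K\<^esub> c \<otimes>\<^bsub>K\<^esub> c = \<one>\<^bsub>K\<^esub>" "c \<otimes>\<^bsub>K\<^esub> inv\<^bsub>K\<^esub> c = \<one>\<^bsub>K\<^esub>"
proof -
  have "c \<in> Units K" using assms field_Units by blast
  then show "inv\<^bsub>K\<^esub> c \<in> carrier K" "inv\<^bsub>K\<^esub> c \<otimes>\<^bsub>K\<^esub> c = \<one>\<^bsub>K\<^esub>" "c \<otimes>\<^bsub>K\<^esub> inv\<^bsub>K\<^esub> c = \<one>\<^bsub>K\<^esub>"
    by (auto intro: R.Units_l_inv R.Units_r_inv)
qed

definition linear_form ::
    "('k, 'x) ring_scheme \<Rightarrow> ('k, 'v, 'y) module_scheme \<Rightarrow> ('v \<Rightarrow> 'k) \<Rightarrow> bool" where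
  "linear_form K V w \<longleftrightarrow> additive_map V K w \<and>
     (\<forall>k \<in> carrier K. \<forall>x \<in> carrier V. w (k \<odot>\<^bsub>V\<^esub> x) = k \<otimes>\<^bsub>K\<^esub> w x)"

text \<open>The coordinates are part of the data: they express a basis through linear forms that expand
  every vector.\<close>

definition dual_basis ::
    "('k, 'x) ring_scheme \<Rightarrow> ('k, 'v, 'y) module_scheme \<Rightarrow> 'v set \<Rightarrow> ('v \<Rightarrow> 'v \<Rightarrow> 'k) \<Rightarrow> bool" where
  "dual_basis K V B w \<longleftrightarrow> finite B \<and> B \<subseteq> carrier V \<and> (\<forall>b \<in> B. linear_form K V (w b)) \<and>
     (\<forall>x \<in> carrier V. x = (\<Oplus>\<^bsub>V\<^esub> b \<in> B. w b x \<odot>\<^bsub>V\<^esub> b))"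

lemma linear_formD:
  assumes "linear_form K V w"
  shows "x \<in> carrier V \<Longrightarrow> w x \<in> carrier K"
    and "x \<in> carrier V \<Longrightarrow> y \<in> carrier V \<Longrightarrow> w (x \<oplus>\<^bsub>V\<^esub> y) = w x \<oplus>\<^bsub>K\<^esub> w y"
    and "k \<in> carrier K \<Longrightarrow> x \<in> carrier V \<Longrightarrow> w (k \<odot>\<^bsub>V\<^esub> x) = k \<otimes>\<^bsub>K\<^esub> w x"
  using assms by (auto simp: linear_form_def additive_map_def)

lemma dual_basisD:
  assumes "dual_basis K V B w"
  shows "finite B" "B \<subseteq> carrier V" "b \<in> B \<Longrightarrow> linear_form K V (w b)"
    "x \<in> carrier V \<Longrightarrow> (\<Oplus>\<^bsub>V\<^esub> b \<in> B. w b x \<odot>\<^bsub>V\<^esub> b) = x"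
  using assms by (auto simp: dual_basis_def)

lemma (in linear_space) linear_form_minus:
  assumes "linear_form K V w" "x \<in> carrier V" "y \<in> carrier V"
  shows "w (x \<ominus>\<^bsub>V\<^esub> y) = w x \<ominus>\<^bsub>K\<^esub> w y"
  using additive_map_minus[OF M.abelian_group_axioms R.abelian_group_axioms _ assms(2,3)] assms(1)
  by (auto simp: linear_form_def)

lemma (in linear_space) is_submodule_minus:
  assumes "is_submodule K V U" "x \<in> U" "y \<in> U"
  shows "x \<ominus>\<^bsub>V\<^esub> y \<in> U"
proof -
  have y: "y \<in> carrier V" using assms by (auto simp: is_submodule_def)
  have "(\<ominus>\<^bsub>K\<^esub> \<one>\<^bsub>K\<^esub>) \<odot>\<^bsub>V\<^esub> y \<oplus>\<^bsub>V\<^esub> y = (\<ominus>\<^bsub>K\<^esub> \<one>\<^bsub>K\<^esub>) \<odot>\<^bsub>V\<^esub> y \<oplus>\<^bsub>V\<^esub> \<one>\<^bsub>K\<^esub> \<odot>\<^bsub>V\<^esub> y" using y by simp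
  also have "\<dots> = \<zero>\<^bsub>V\<^esub>" using y by (subst smult_l_distr[symmetric]) (auto simp: R.l_neg)
  finally have "\<ominus>\<^bsub>V\<^esub> y = (\<ominus>\<^bsub>K\<^esub> \<one>\<^bsub>K\<^esub>) \<odot>\<^bsub>V\<^esub> y"
    using y by (metis M.minus_equality R.a_inv_closed R.one_closed smult_closed)
  then show ?thesis using assms unfolding a_minus_def by (auto simp: is_submodule_def)
qed

text \<open>A spanning set of minimal size has unique coordinates, and uniqueness makes them linear.\<close>

lemma (in linear_space) ex_dual_basis:
  assumes "finitely_generated K V"
  obtains B w where "dual_basis K V B w"
proof -
  obtain T where T: "finite T" "T \<subseteq> carrier V" "\<And>U. is_submodule K V U \<Longrightarrow> T \<subseteq> U \<Longrightarrow> carrier V \<subseteq> U"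
    using finitely_generatedD[OF assms] by metis
  define spans where "spans S \<longleftrightarrow> finite S \<and> S \<subseteq> carrier V \<and>
    (\<forall>U. is_submodule K V U \<longrightarrow> S \<subseteq> U \<longrightarrow> carrier V \<subseteq> U)" for S
  have "spans T" using T unfolding spans_def by blast
  then obtain B where B: "spans B" "\<And>S. spans S \<Longrightarrow> card B \<le> card S"
    using ex_has_least_nat[of spans T card] by blast
  have finB: "finite B" "B \<subseteq> carrier V" using B(1) by (auto simp: spans_def)
  let ?comb = "\<lambda>c. \<Oplus>\<^bsub>V\<^esub> b \<in> B. c b \<odot>\<^bsub>V\<^esub> b"
  have cl: "(\<lambda>b. c b \<odot>\<^bsub>V\<^esub> b) \<in> B \<rightarrow> carrier V" if "c \<in> B \<rightarrow> carrier K" for c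
    using that finB by auto
  note comb_add = combination_add[OF finB(2)] and comb_smult = combination_smult[OF finB]
  have zero_unique: "\<forall>b \<in> B. c b = \<zero>\<^bsub>K\<^esub>"
    if c: "c \<in> B \<rightarrow> carrier K" "?comb c = \<zero>\<^bsub>V\<^esub>" for c
  proof (rule ccontr)
    assume "\<not> ?thesis"
    then obtain t where t: "t \<in> B" "c t \<noteq> \<zero>\<^bsub>K\<^esub>" by blast
    have ct: "c t \<in> carrier K" "inv\<^bsub>K\<^esub> c t \<in> carrier K" "inv\<^bsub>K\<^esub> c t \<otimes>\<^bsub>K\<^esub> c t = \<one>\<^bsub>K\<^esub>"
      using field_inv[OF _ t(2)] c(1) t(1) by auto
    have "spans (B - {t})" unfolding spans_def
    proof (intro conjI allI impI)
      fix U assume U: "is_submodule K V U" "B - {t} \<subseteq> U"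
      let ?r = "\<Oplus>\<^bsub>V\<^esub> b \<in> B - {t}. c b \<odot>\<^bsub>V\<^esub> b"
      have rU: "?r \<in> U"
        using U c finB by (intro M.finsum_mem) (auto simp: is_submodule_def Pi_iff)
      have rV: "?r \<in> carrier V" and tV: "t \<in> carrier V"
        using rU U finB t by (auto simp: is_submodule_def)
      have "?comb c = (\<Oplus>\<^bsub>V\<^esub> b \<in> insert t (B - {t}). c b \<odot>\<^bsub>V\<^esub> b)"
        using t by (simp add: insert_absorb)
      also have "\<dots> = c t \<odot>\<^bsub>V\<^esub> t \<oplus>\<^bsub>V\<^esub> ?r"
        using finB c tV ct by (intro M.finsum_insert) auto
      finally have "c t \<odot>\<^bsub>V\<^esub> t \<oplus>\<^bsub>V\<^esub> ?r = \<zero>\<^bsub>V\<^esub>" using c by simp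
      then have "c t \<odot>\<^bsub>V\<^esub> t = \<zero>\<^bsub>V\<^esub> \<ominus>\<^bsub>V\<^esub> ?r"
        using M.minus_equality[of "c t \<odot>\<^bsub>V\<^esub> t" ?r] rV tV ct by (simp add: M.minus_eq)
      then have "c t \<odot>\<^bsub>V\<^esub> t \<in> U"
        using is_submodule_minus[OF U(1) _ rU] U(1) by (auto simp: is_submodule_def)
      then have "inv\<^bsub>K\<^esub> c t \<odot>\<^bsub>V\<^esub> (c t \<odot>\<^bsub>V\<^esub> t) \<in> U" using U(1) ct by (auto simp: is_submodule_def)
      then have "t \<in> U" using ct tV by (simp add: smult_assoc[symmetric])
      then have "B \<subseteq> U" using U by auto
      then show "carrier V \<subseteq> U" using B(1) U(1) by (auto simp: spans_def)
    qed (use finB in auto)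
    from B(2)[OF this] have "card B \<le> card (B - {t})" .
    then show False using t finB by (metis card_Diff1_less not_le)
  qed
  have uniq: "\<forall>b \<in> B. c b = d b"
    if cd: "c \<in> B \<rightarrow> carrier K" "d \<in> B \<rightarrow> carrier K" "?comb c = ?comb d" for c d
  proof -
    have m: "(\<lambda>b. (\<ominus>\<^bsub>K\<^esub> \<one>\<^bsub>K\<^esub>) \<otimes>\<^bsub>K\<^esub> d b) \<in> B \<rightarrow> carrier K" using cd by auto
    have dV: "?comb d \<in> carrier V" using cl cd by (auto intro!: M.finsum_closed)
    have "?comb (\<lambda>b. c b \<oplus>\<^bsub>K\<^esub> (\<ominus>\<^bsub>K\<^esub> \<one>\<^bsub>K\<^esub>) \<otimes>\<^bsub>K\<^esub> d b) = \<one>\<^bsub>K\<^esub> \<odot>\<^bsub>V\<^esub> ?comb d \<oplus>\<^bsub>V\<^esub> (\<ominus>\<^bsub>K\<^esub> \<one>\<^bsub>K\<^esub>) \<odot>\<^bsub>V\<^esub> ?comb d"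
      using cd m dV by (simp add: comb_add comb_smult)
    also have "\<dots> = \<zero>\<^bsub>V\<^esub>" using dV
      by (subst smult_l_distr[symmetric]) (auto simp: R.r_neg)
    finally have *: "\<forall>b \<in> B. c b \<oplus>\<^bsub>K\<^esub> (\<ominus>\<^bsub>K\<^esub> \<one>\<^bsub>K\<^esub>) \<otimes>\<^bsub>K\<^esub> d b = \<zero>\<^bsub>K\<^esub>"
      using cd m by (intro zero_unique) auto
    show ?thesis
    proof
      fix b assume "b \<in> B"
      then have cb: "c b \<in> carrier K" "d b \<in> carrier K" using cd by auto
      have "c b \<oplus>\<^bsub>K\<^esub> (\<ominus>\<^bsub>K\<^esub> \<one>\<^bsub>K\<^esub>) \<otimes>\<^bsub>K\<^esub> d b = \<zero>\<^bsub>K\<^esub>" using * \<open>b \<in> B\<close> by blast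
      then have "c b \<oplus>\<^bsub>K\<^esub> \<ominus>\<^bsub>K\<^esub> d b = \<zero>\<^bsub>K\<^esub>" using cb by (simp add: R.l_minus)
      then show "c b = d b" using cb by (metis R.a_inv_closed R.minus_equality R.minus_minus)
    qed
  qed
  have ex: "\<exists>c. c \<in> B \<rightarrow> carrier K \<and> x = ?comb c" if x: "x \<in> carrier V" for x
  proof -
    have "carrier V \<subseteq> {?comb c |c. c \<in> B \<rightarrow> carrier K}"
      using B(1) submodule_combinations[OF finB] unfolding spans_def by blast
    then show ?thesis using x by auto
  qed
  define coord where "coord x = (SOME c. c \<in> B \<rightarrow> carrier K \<and> x = ?comb c)" for x
  have coord: "coord x \<in> B \<rightarrow> carrier K" "?comb (coord x) = x" if "x \<in> carrier V" for x
    using someI_ex[OF ex[OF that]] by (auto simp: coord_def)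
  have "linear_form K V (\<lambda>x. coord x b)" if b: "b \<in> B" for b
    unfolding linear_form_def additive_map_def
  proof (intro conjI ballI)
    show "(\<lambda>x. coord x b) \<in> carrier V \<rightarrow> carrier K" using coord b by auto
  next
    fix x y assume xy: "x \<in> carrier V" "y \<in> carrier V"
    have "\<forall>b \<in> B. coord (x \<oplus>\<^bsub>V\<^esub> y) b = coord x b \<oplus>\<^bsub>K\<^esub> coord y b"
      using coord[of x] coord[of y] coord[of "x \<oplus>\<^bsub>V\<^esub> y"] comb_add[of "coord x" "coord y"] xy
      by (intro uniq) auto
    then show "coord (x \<oplus>\<^bsub>V\<^esub> y) b = coord x b \<oplus>\<^bsub>K\<^esub> coord y b" using b by auto
  next
    fix k x assume kx: "k \<in> carrier K" "x \<in> carrier V"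
    have "\<forall>b \<in> B. coord (k \<odot>\<^bsub>V\<^esub> x) b = k \<otimes>\<^bsub>K\<^esub> coord x b"
      using coord[of x] coord[of "k \<odot>\<^bsub>V\<^esub> x"] comb_smult[of "coord x" k] kx
      by (intro uniq) auto
    then show "coord (k \<odot>\<^bsub>V\<^esub> x) b = k \<otimes>\<^bsub>K\<^esub> coord x b" using b by auto
  qed
  then have "dual_basis K V B (\<lambda>b x. coord x b)"
    unfolding dual_basis_def using finB coord by auto
  then show thesis by (rule that)
qed

text \<open>The finite-dimensional form of the double annihilator theorem, proved by induction on \<open>F\<close>: if
  \<open>w\<close> is not redundant, some vector \<open>v\<close> is killed by the other members of \<open>F\<close> but not by \<open>w\<close>,
  and subtracting a multiple of \<open>w\<close> from \<open>\<xi>\<close> reduces to fewer functionals. Membership in \<open>W\<close> is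
  only meant up to equality on the carrier, so that \<open>W\<close> may consist of arbitrary functions.\<close>

lemma (in linear_space) linear_form_mem:
  assumes W: "\<And>w. w \<in> W \<Longrightarrow> linear_form K V w"
    and Wadd: "\<And>w w'. w \<in> W \<Longrightarrow> w' \<in> W \<Longrightarrow> \<exists>u \<in> W. \<forall>x \<in> carrier V. u x = w x \<oplus>\<^bsub>K\<^esub> w' x"
    and Wsmult: "\<And>k w. k \<in> carrier K \<Longrightarrow> w \<in> W \<Longrightarrow> \<exists>u \<in> W. \<forall>x \<in> carrier V. u x = k \<otimes>\<^bsub>K\<^esub> w x"
    and Wzero: "\<exists>u \<in> W. \<forall>x \<in> carrier V. u x = \<zero>\<^bsub>K\<^esub>"
    and F: "finite F" "F \<subseteq> W"
    and ker: "linear_form K V \<xi>" "\<And>x. x \<in> carrier V \<Longrightarrow> \<forall>w \<in> F. w x = \<zero>\<^bsub>K\<^esub> \<Longrightarrow> \<xi> x = \<zero>\<^bsub>K\<^esub>"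
  shows "\<exists>u \<in> W. \<forall>x \<in> carrier V. u x = \<xi> x"
  using F ker
proof (induction F arbitrary: \<xi> rule: finite_induct)
  case empty
  then show ?case using Wzero by auto
next
  case (insert w F)
  have w: "w \<in> W" "linear_form K V w" using insert.prems W by auto
  show ?case
  proof (cases "\<forall>x \<in> carrier V. (\<forall>w' \<in> F. w' x = \<zero>\<^bsub>K\<^esub>) \<longrightarrow> w x = \<zero>\<^bsub>K\<^esub>")
    case True
    then show ?thesis using insert by auto
  next
    case False
    then obtain v where v: "v \<in> carrier V" "\<forall>w' \<in> F. w' v = \<zero>\<^bsub>K\<^esub>" "w v \<noteq> \<zero>\<^bsub>K\<^esub>" by auto
    have wv: "w v \<in> carrier K" using linear_formD(1)[OF w(2)] v by auto
    have iv: "inv\<^bsub>K\<^esub> w v \<in> carrier K" "inv\<^bsub>K\<^esub> w v \<otimes>\<^bsub>K\<^esub> w v = \<one>\<^bsub>K\<^esub>"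
      using field_inv[OF wv v(3)] by auto
    have \<xi>v: "\<xi> v \<in> carrier K" using linear_formD(1)[OF insert.prems(2)] v by auto
    let ?k = "\<xi> v \<otimes>\<^bsub>K\<^esub> inv\<^bsub>K\<^esub> w v"
    have k: "?k \<in> carrier K" using \<xi>v iv by auto
    let ?\<xi>' = "\<lambda>x. \<xi> x \<ominus>\<^bsub>K\<^esub> ?k \<otimes>\<^bsub>K\<^esub> w x"
    have lf: "linear_form K V ?\<xi>'"
      unfolding linear_form_def additive_map_def
    proof (intro conjI ballI)
      show "?\<xi>' \<in> carrier V \<rightarrow> carrier K"
        using linear_formD(1)[OF insert.prems(2)] linear_formD(1)[OF w(2)] k by auto
    next
      fix x y assume xy: "x \<in> carrier V" "y \<in> carrier V"
      have c: "\<xi> x \<in> carrier K" "\<xi> y \<in> carrier K" "w x \<in> carrier K" "w y \<in> carrier K"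
        using xy linear_formD(1)[OF insert.prems(2)] linear_formD(1)[OF w(2)] by auto
      show "?\<xi>' (x \<oplus>\<^bsub>V\<^esub> y) = ?\<xi>' x \<oplus>\<^bsub>K\<^esub> ?\<xi>' y"
        using xy c k linear_formD(2)[OF insert.prems(2)] linear_formD(2)[OF w(2)]
        by (simp add: R.r_distr R.minus_eq R.minus_add R.a_ac)
    next
      fix a x assume ax: "a \<in> carrier K" "x \<in> carrier V"
      have c: "\<xi> x \<in> carrier K" "w x \<in> carrier K"
        using ax linear_formD(1)[OF insert.prems(2)] linear_formD(1)[OF w(2)] by auto
      show "?\<xi>' (a \<odot>\<^bsub>V\<^esub> x) = a \<otimes>\<^bsub>K\<^esub> ?\<xi>' x"
        using ax c k linear_formD(3)[OF insert.prems(2)] linear_formD(3)[OF w(2)]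
        by (simp add: R.r_distr R.minus_eq R.r_minus m_lcomm)
    qed
    have kill: "?\<xi>' x = \<zero>\<^bsub>K\<^esub>" if x: "x \<in> carrier V" "\<forall>w' \<in> F. w' x = \<zero>\<^bsub>K\<^esub>" for x
    proof -
      have wx: "w x \<in> carrier K" "\<xi> x \<in> carrier K"
        using x linear_formD(1)[OF w(2)] linear_formD(1)[OF insert.prems(2)] by auto
      let ?c = "w x \<otimes>\<^bsub>K\<^esub> inv\<^bsub>K\<^esub> w v"
      let ?y = "x \<ominus>\<^bsub>V\<^esub> ?c \<odot>\<^bsub>V\<^esub> v"
      have c: "?c \<in> carrier K" "?c \<odot>\<^bsub>V\<^esub> v \<in> carrier V" using wx iv v by auto
      have gen: "u ?y = u x \<ominus>\<^bsub>K\<^esub> ?c \<otimes>\<^bsub>K\<^esub> u v" if "linear_form K V u" for u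
        using linear_form_minus[OF that x(1) c(2)] linear_formD(3)[OF that c(1) v(1)] by simp
      have "w ?y = \<zero>\<^bsub>K\<^esub>"
        using gen[OF w(2)] wx wv iv by (simp add: R.m_assoc R.r_neg R.minus_eq)
      moreover have "w' ?y = \<zero>\<^bsub>K\<^esub>" if "w' \<in> F" for w'
      proof -
        have "w' \<in> W" "w' x = \<zero>\<^bsub>K\<^esub>" "w' v = \<zero>\<^bsub>K\<^esub>" using that insert.prems x v by auto
        then show ?thesis using gen[OF W, of w'] c by (simp add: R.minus_eq)
      qed
      ultimately have "\<xi> ?y = \<zero>\<^bsub>K\<^esub>"
        using x c by (intro insert.prems(3)) auto
      then have "\<xi> x \<ominus>\<^bsub>K\<^esub> ?c \<otimes>\<^bsub>K\<^esub> \<xi> v = \<zero>\<^bsub>K\<^esub>" using gen[OF insert.prems(2)] by simp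
      moreover have "?c \<otimes>\<^bsub>K\<^esub> \<xi> v = ?k \<otimes>\<^bsub>K\<^esub> w x" using wx iv \<xi>v by (simp add: m_ac)
      ultimately show ?thesis by simp
    qed
    obtain u where u: "u \<in> W" "\<forall>x \<in> carrier V. u x = ?\<xi>' x"
      using insert.IH[OF _ lf kill] insert.prems by auto
    obtain u2 where u2: "u2 \<in> W" "\<forall>x \<in> carrier V. u2 x = ?k \<otimes>\<^bsub>K\<^esub> w x"
      using Wsmult[OF k w(1)] by auto
    obtain u3 where u3: "u3 \<in> W" "\<forall>x \<in> carrier V. u3 x = u x \<oplus>\<^bsub>K\<^esub> u2 x"
      using Wadd[OF u(1) u2(1)] by auto
    have "u3 x = \<xi> x" if x: "x \<in> carrier V" for x
      using u u2 u3 x k linear_formD(1)[OF w(2) x] linear_formD(1)[OF insert.prems(2) x]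
      by (simp add: R.minus_eq R.a_assoc R.l_neg)
    then show ?thesis using u3 by auto
  qed
qed

text \<open>The descending chain condition without dimensions: with respect to a coordinate system, the set of positions
  of leading coefficients of elements of a subspace determines the is_submodule among all larger ones.\<close>

lemma (in linear_space) minimal_subspace:
  assumes db: "dual_basis K V B w" and ne: "U0 \<in> \<U>" and sub: "\<And>U. U \<in> \<U> \<Longrightarrow> is_submodule K V U"
  obtains U where "U \<in> \<U>" "\<And>U'. U' \<in> \<U> \<Longrightarrow> U' \<subseteq> U \<Longrightarrow> U' = U"
proof -
  obtain n :: nat and e where e: "e ` {i. i < n} = B"
    using dual_basisD(1)[OF db] by (metis finite_imp_nat_seg_image_inj_on)
  let ?w = "\<lambda>i. w (e i)"
  have lf: "linear_form K V (?w i)" if "i < n" for i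
    using dual_basisD(3)[OF db] e that by blast
  define P where "P U = {i. i < n \<and> (\<exists>x \<in> U. ?w i x = \<one>\<^bsub>K\<^esub> \<and> (\<forall>j. i < j \<and> j < n \<longrightarrow> ?w j x = \<zero>\<^bsub>K\<^esub>))}"
    for U
  have finP: "finite (P U)" for U by (auto simp: P_def)
  obtain U where U: "U \<in> \<U>" "\<And>U'. U' \<in> \<U> \<Longrightarrow> card (P U) \<le> card (P U')"
    using ex_has_least_nat[of "\<lambda>U. U \<in> \<U>" U0 "\<lambda>U. card (P U)"] ne by blast
  have "U \<subseteq> U'" if U': "U' \<in> \<U>" "U' \<subseteq> U" for U'
  proof -
    note sU = sub[OF U(1)] and sU' = sub[OF U'(1)]
    have "P U' \<subseteq> P U" using U' by (auto simp: P_def)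
    then have PP: "P U' = P U" using finP U(2)[OF U'(1)] by (metis card_seteq)
    have "\<forall>x \<in> U. (\<forall>j. i \<le> j \<and> j < n \<longrightarrow> ?w j x = \<zero>\<^bsub>K\<^esub>) \<longrightarrow> x \<in> U'" if "i \<le> n" for i
      using that
    proof (induction i)
      case 0
      show ?case
      proof (intro ballI impI)
        fix x assume x: "x \<in> U" "\<forall>j. 0 \<le> j \<and> j < n \<longrightarrow> ?w j x = \<zero>\<^bsub>K\<^esub>"
        have xV: "x \<in> carrier V" using x sU by (auto simp: is_submodule_def)
        have "x = (\<Oplus>\<^bsub>V\<^esub> b \<in> B. w b x \<odot>\<^bsub>V\<^esub> b)" using dual_basisD(4)[OF db xV] by simp
        also have "\<dots> = (\<Oplus>\<^bsub>V\<^esub> b \<in> B. \<zero>\<^bsub>V\<^esub>)"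
        proof (intro M.finsum_cong')
          fix b assume b: "b \<in> B"
          then obtain j where "j < n" "b = e j" using e by auto
          then show "w b x \<odot>\<^bsub>V\<^esub> b = \<zero>\<^bsub>V\<^esub>" using x b dual_basisD(2)[OF db] by auto
        qed auto
        finally show "x \<in> U'" using sU' by (simp add: M.finsum_zero is_submodule_def)
      qed
    next
      case (Suc i)
      show ?case
      proof (intro ballI impI)
        fix x assume x: "x \<in> U" "\<forall>j. Suc i \<le> j \<and> j < n \<longrightarrow> ?w j x = \<zero>\<^bsub>K\<^esub>"
        have i: "i < n" using Suc by simp
        have xV: "x \<in> carrier V" using x sU by (auto simp: is_submodule_def)
        let ?c = "?w i x"
        have c: "?c \<in> carrier K" using linear_formD(1)[OF lf[OF i] xV] .
        show "x \<in> U'"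
        proof (cases "?c = \<zero>\<^bsub>K\<^esub>")
          case True
          then have "\<forall>j. i \<le> j \<and> j < n \<longrightarrow> ?w j x = \<zero>\<^bsub>K\<^esub>" using x
            by (metis le_antisym not_less_eq_eq)
          then show ?thesis using Suc x by auto
        next
          case False
          have iv: "inv\<^bsub>K\<^esub> ?c \<in> carrier K" "inv\<^bsub>K\<^esub> ?c \<otimes>\<^bsub>K\<^esub> ?c = \<one>\<^bsub>K\<^esub>"
            using field_inv[OF c False] by auto
          have "i \<in> P U" unfolding P_def
          proof (intro CollectI conjI i bexI[of _ "inv\<^bsub>K\<^esub> ?c \<odot>\<^bsub>V\<^esub> x"] allI impI)
            show "?w i (inv\<^bsub>K\<^esub> ?c \<odot>\<^bsub>V\<^esub> x) = \<one>\<^bsub>K\<^esub>" using linear_formD(3)[OF lf[OF i] iv(1) xV] iv by simp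
            show "?w j (inv\<^bsub>K\<^esub> ?c \<odot>\<^bsub>V\<^esub> x) = \<zero>\<^bsub>K\<^esub>" if "i < j \<and> j < n" for j
              using linear_formD(3)[OF lf iv(1) xV, of j] that x iv by simp
            show "inv\<^bsub>K\<^esub> ?c \<odot>\<^bsub>V\<^esub> x \<in> U" using sU iv x by (auto simp: is_submodule_def)
          qed
          then obtain y where y: "y \<in> U'" "?w i y = \<one>\<^bsub>K\<^esub>" "\<forall>j. i < j \<and> j < n \<longrightarrow> ?w j y = \<zero>\<^bsub>K\<^esub>"
            unfolding PP[symmetric] by (auto simp: P_def)
          have yV: "y \<in> carrier V" and cyU': "?c \<odot>\<^bsub>V\<^esub> y \<in> U'" using y c sU' by (auto simp: is_submodule_def)
          let ?z = "x \<ominus>\<^bsub>V\<^esub> ?c \<odot>\<^bsub>V\<^esub> y"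
          have zU: "?z \<in> U" using is_submodule_minus[OF sU x(1)] cyU' U' by auto
          have "?w j ?z = \<zero>\<^bsub>K\<^esub>" if j: "i \<le> j" "j < n" for j
          proof -
            have "?w j ?z = ?w j x \<ominus>\<^bsub>K\<^esub> ?c \<otimes>\<^bsub>K\<^esub> ?w j y"
              using linear_form_minus[OF lf[OF j(2)] xV] linear_formD(3)[OF lf[OF j(2)] c yV] c yV by simp
            then show ?thesis using j x y c by (cases "j = i") (auto simp: R.r_neg R.minus_eq)
          qed
          then have zU': "?z \<in> U'" using Suc zU by auto
          have "?z \<oplus>\<^bsub>V\<^esub> ?c \<odot>\<^bsub>V\<^esub> y = x" using xV yV c by (simp add: M.minus_eq M.a_assoc M.l_neg)
          then show ?thesis using zU' cyU' sU' by (metis is_submodule_def)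
        qed
      qed
    qed
    from this[of n] show ?thesis by auto
  qed
  then have "U' = U" if "U' \<in> \<U>" "U' \<subseteq> U" for U' using that by (intro equalityI)
  then show thesis by (rule that[OF U(1)])
qed


section \<open>Powers of a module\<close>

definition power_module :: "('r, 'm, 'y) module_scheme \<Rightarrow> 's set \<Rightarrow> ('r, 's \<Rightarrow> 'm) module" where
  "power_module N S =
    \<lparr>carrier = S \<rightarrow>\<^sub>E carrier N, mult = undefined, one = undefined, zero = (\<lambda>s \<in> S. \<zero>\<^bsub>N\<^esub>),
     add = (\<lambda>p q. \<lambda>s \<in> S. p s \<oplus>\<^bsub>N\<^esub> q s), smult = (\<lambda>a p. \<lambda>s \<in> S. a \<odot>\<^bsub>N\<^esub> p s)\<rparr>"

definition power_single :: "('r, 'm, 'y) module_scheme \<Rightarrow> 's set \<Rightarrow> 's \<Rightarrow> 'm \<Rightarrow> 's \<Rightarrow> 'm" where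
  "power_single N S t x = (\<lambda>s \<in> S. if s = t then x else \<zero>\<^bsub>N\<^esub>)"

lemma power_module_simps [simp]:
  "carrier (power_module N S) = S \<rightarrow>\<^sub>E carrier N" "zero (power_module N S) = (\<lambda>s \<in> S. \<zero>\<^bsub>N\<^esub>)"
  "add (power_module N S) = (\<lambda>p q. \<lambda>s \<in> S. p s \<oplus>\<^bsub>N\<^esub> q s)"
  "smult (power_module N S) = (\<lambda>a p. \<lambda>s \<in> S. a \<odot>\<^bsub>N\<^esub> p s)"
  by (simp_all add: power_module_def)

context left_module
begin

lemma left_module_power: "left_module R (power_module M S)"
proof (intro left_module.intro left_module_axioms.intro R.ring_axioms)
  show "abelian_group (power_module M S)"
  proof (rule abelian_groupI)
    fix p q r
    assume pqr: "p \<in> carrier (power_module M S)" "q \<in> carrier (power_module M S)"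
      "r \<in> carrier (power_module M S)"
    then have c: "p s \<in> carrier M" "q s \<in> carrier M" "r s \<in> carrier M" if "s \<in> S" for s
      using that by auto
    show "\<exists>q \<in> carrier (power_module M S). q \<oplus>\<^bsub>power_module M S\<^esub> p = \<zero>\<^bsub>power_module M S\<^esub>"
      using c by (intro bexI[of _ "\<lambda>s \<in> S. \<ominus>\<^bsub>M\<^esub> p s"]) (simp_all add: M.l_neg fun_eq_iff)
    show "\<zero>\<^bsub>power_module M S\<^esub> \<oplus>\<^bsub>power_module M S\<^esub> p = p"
    proof (rule extensionalityI)
      show "p \<in> extensional S" using pqr by (simp add: PiE_def)
    qed (use c in simp_all)
    show "p \<oplus>\<^bsub>power_module M S\<^esub> q \<oplus>\<^bsub>power_module M S\<^esub> r
        = p \<oplus>\<^bsub>power_module M S\<^esub> (q \<oplus>\<^bsub>power_module M S\<^esub> r)"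
      using c by (simp add: M.a_assoc fun_eq_iff)
    show "p \<oplus>\<^bsub>power_module M S\<^esub> q = q \<oplus>\<^bsub>power_module M S\<^esub> p"
      using c by (simp add: M.a_comm fun_eq_iff)
    show "p \<oplus>\<^bsub>power_module M S\<^esub> q \<in> carrier (power_module M S)" using c by simp
  qed simp_all
  fix a b p q
  assume "a \<in> carrier R" "b \<in> carrier R"
    and pq: "p \<in> carrier (power_module M S)" "q \<in> carrier (power_module M S)"
  moreover from pq have c: "p s \<in> carrier M" "q s \<in> carrier M" if "s \<in> S" for s using that by auto
  ultimately show "a \<odot>\<^bsub>power_module M S\<^esub> p \<in> carrier (power_module M S)"
    "(a \<oplus>\<^bsub>R\<^esub> b) \<odot>\<^bsub>power_module M S\<^esub> p
      = a \<odot>\<^bsub>power_module M S\<^esub> p \<oplus>\<^bsub>power_module M S\<^esub> b \<odot>\<^bsub>power_module M S\<^esub> p"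
    "a \<odot>\<^bsub>power_module M S\<^esub> (p \<oplus>\<^bsub>power_module M S\<^esub> q)
      = a \<odot>\<^bsub>power_module M S\<^esub> p \<oplus>\<^bsub>power_module M S\<^esub> a \<odot>\<^bsub>power_module M S\<^esub> q"
    "(a \<otimes>\<^bsub>R\<^esub> b) \<odot>\<^bsub>power_module M S\<^esub> p = a \<odot>\<^bsub>power_module M S\<^esub> (b \<odot>\<^bsub>power_module M S\<^esub> p)"
    using c by (simp_all add: smult_l_distr smult_r_distr smult_assoc fun_eq_iff)
next
  fix p assume p: "p \<in> carrier (power_module M S)"
  show "\<one>\<^bsub>R\<^esub> \<odot>\<^bsub>power_module M S\<^esub> p = p"
  proof (rule extensionalityI)
    show "p \<in> extensional S" using p by (simp add: PiE_def)
    fix s assume s: "s \<in> S"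
    then have "p s \<in> carrier M" using p by auto
    then show "(\<one>\<^bsub>R\<^esub> \<odot>\<^bsub>power_module M S\<^esub> p) s = p s" using s by simp
  qed simp
qed

lemma power_single_closed [simp]:
  "x \<in> carrier M \<Longrightarrow> power_single M S t x \<in> carrier (power_module M S)"
  by (auto simp: power_single_def)

lemma power_single_hom:
  "(\<lambda>x \<in> carrier M. power_single M S t x) \<in> module_hom R M (power_module M S)"
  by (rule restrict_module_homI) (auto simp: power_single_def fun_eq_iff)

lemma power_decomposition:
  assumes "finite S" "p \<in> carrier (power_module M S)"
  shows "p = (\<Oplus>\<^bsub>power_module M S\<^esub> t \<in> S. power_single M S t (p t))" (is "p = ?q")
proof -
  let ?P = "power_module M S"
  interpret P: left_module R ?P by (rule left_module_power)
  have pM: "p t \<in> carrier M" if "t \<in> S" for t using assms that by auto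
  have qc: "?q \<in> carrier ?P"
    using pM power_single_closed by (intro P.M.finsum_closed) (auto simp del: power_module_simps)
  have "p s = ?q s" if s: "s \<in> S" for s
  proof -
    have "additive_map ?P M (\<lambda>p. p s)" using s by (auto simp: additive_map_def PiE_iff)
    then have "?q s = (\<Oplus>\<^bsub>M\<^esub> t \<in> S. power_single M S t (p t) s)"
      using pM assms power_single_closed
      by (intro additive_map_finsum[OF P.M.abelian_group_axioms M.abelian_group_axioms])
        (auto simp del: power_module_simps)
    also have "\<dots> = (\<Oplus>\<^bsub>M\<^esub> t \<in> S. if s = t then p t else \<zero>\<^bsub>M\<^esub>)"
      using s pM by (intro M.finsum_cong') (auto simp: power_single_def)
    also have "\<dots> = p s" using s pM assms by (intro M.finsum_singleton) auto
    finally show ?thesis by simp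
  qed
  moreover have "p \<in> extensional S" "?q \<in> extensional S" using assms(2) qc by (simp_all add: PiE_def)
  ultimately show ?thesis by (intro extensionalityI)
qed

lemma fg_left_module_power:
  assumes "finite S" "finitely_generated R M"
  shows "fg_left_module R (power_module M S)"
proof -
  let ?P = "power_module M S"
  interpret P: left_module R ?P by (rule left_module_power)
  obtain T where T: "finite T" "T \<subseteq> carrier M" "\<And>U. is_submodule R M U \<Longrightarrow> T \<subseteq> U \<Longrightarrow> carrier M \<subseteq> U"
    using finitely_generatedD[OF assms(2)] by metis
  have "finitely_generated R ?P"
  proof (rule P.finitely_generatedI)
    show "finite (\<Union>s \<in> S. power_single M S s ` T)" using assms T(1) by simp
    show "(\<Union>s \<in> S. power_single M S s ` T) \<subseteq> carrier ?P"
    proof (rule UN_least)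
      show "power_single M S s ` T \<subseteq> carrier ?P" for s
        using T(2) power_single_closed by (auto simp del: power_module_simps)
    qed
  next
    fix U assume U: "is_submodule R ?P U" "(\<Union>s \<in> S. power_single M S s ` T) \<subseteq> U"
    have *: "power_single M S s x \<in> U" if "s \<in> S" "x \<in> carrier M" for s x
    proof -
      note hom = module_homD[OF power_single_hom[of S s]]
      have "is_submodule R M {x \<in> carrier M. power_single M S s x \<in> U}"
        unfolding is_submodule_def
      proof (intro conjI ballI)
        have "power_single M S s \<zero>\<^bsub>M\<^esub> = \<zero>\<^bsub>?P\<^esub>" by (auto simp: power_single_def)
        then show "\<zero>\<^bsub>M\<^esub> \<in> {x \<in> carrier M. power_single M S s x \<in> U}"
          using U by (simp add: is_submodule_def del: power_module_simps)
        fix x y assume x: "x \<in> {x \<in> carrier M. power_single M S s x \<in> U}"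
          and y: "y \<in> {x \<in> carrier M. power_single M S s x \<in> U}"
        then show "x \<oplus>\<^bsub>M\<^esub> y \<in> {x \<in> carrier M. power_single M S s x \<in> U}"
          using hom(2)[of x y] U by (simp add: is_submodule_def del: power_module_simps)
      next
        fix k x assume x: "x \<in> {x \<in> carrier M. power_single M S s x \<in> U}" and k: "k \<in> carrier R"
        then show "k \<odot>\<^bsub>M\<^esub> x \<in> {x \<in> carrier M. power_single M S s x \<in> U}"
          using hom(3)[of k x] U by (simp add: is_submodule_def del: power_module_simps)
      qed auto
      moreover have "T \<subseteq> {x \<in> carrier M. power_single M S s x \<in> U}" using T(2) U(2) that(1) by blast
      ultimately have "carrier M \<subseteq> {x \<in> carrier M. power_single M S s x \<in> U}" by (rule T(3))
      then show ?thesis using that(2) by blast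
    qed
    show "carrier ?P \<subseteq> U"
    proof
      fix p assume p: "p \<in> carrier ?P"
      have "power_single M S t (p t) \<in> U" if "t \<in> S" for t
        using * that p by auto
      then have "(\<Oplus>\<^bsub>?P\<^esub> t \<in> S. power_single M S t (p t)) \<in> U"
        using U(1) assms(1) unfolding is_submodule_def by (intro P.M.finsum_mem) blast+
      then show "p \<in> U" using power_decomposition[OF assms(1) p] by simp
    qed
  qed
  then show ?thesis using P.left_module_axioms
    by (intro fg_left_module.intro fg_left_module_axioms.intro)
qed

end

lemma (in left_module) combination_hom:
  assumes S: "finite S" "S \<subseteq> carrier M"
  shows "(\<lambda>p \<in> carrier (power_module (regular R) S). \<Oplus>\<^bsub>M\<^esub> s \<in> S. p s \<odot>\<^bsub>M\<^esub> s)
    \<in> module_hom R (power_module (regular R) S) M" (is "?q \<in> module_hom R ?P M")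
proof -
  interpret P: left_module R ?P
    by (intro left_module.left_module_power R.left_module_regular)
  have cl: "(\<lambda>s. p s \<odot>\<^bsub>M\<^esub> s) \<in> S \<rightarrow> carrier M" if "p \<in> carrier ?P" for p
    using that S(2) by auto
  show ?thesis
  proof (rule P.restrict_module_homI)
    fix p p' assume pp: "p \<in> carrier ?P" "p' \<in> carrier ?P"
    have "(\<Oplus>\<^bsub>M\<^esub> s \<in> S. (p \<oplus>\<^bsub>?P\<^esub> p') s \<odot>\<^bsub>M\<^esub> s) = (\<Oplus>\<^bsub>M\<^esub> s \<in> S. p s \<odot>\<^bsub>M\<^esub> s \<oplus>\<^bsub>M\<^esub> p' s \<odot>\<^bsub>M\<^esub> s)"
      using pp S(2) by (intro M.finsum_cong') (auto simp: smult_l_distr subset_iff PiE_mem[of _ S "\<lambda>_. carrier R"])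
    then show "(\<Oplus>\<^bsub>M\<^esub> s \<in> S. (p \<oplus>\<^bsub>?P\<^esub> p') s \<odot>\<^bsub>M\<^esub> s)
        = (\<Oplus>\<^bsub>M\<^esub> s \<in> S. p s \<odot>\<^bsub>M\<^esub> s) \<oplus>\<^bsub>M\<^esub> (\<Oplus>\<^bsub>M\<^esub> s \<in> S. p' s \<odot>\<^bsub>M\<^esub> s)"
      using cl[OF pp(1)] cl[OF pp(2)] by (simp add: M.finsum_addf)
  next
    fix a p assume ap: "a \<in> carrier R" "p \<in> carrier ?P"
    have "(\<Oplus>\<^bsub>M\<^esub> s \<in> S. (a \<odot>\<^bsub>?P\<^esub> p) s \<odot>\<^bsub>M\<^esub> s) = (\<Oplus>\<^bsub>M\<^esub> s \<in> S. a \<odot>\<^bsub>M\<^esub> (p s \<odot>\<^bsub>M\<^esub> s))"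
      using ap S(2) by (intro M.finsum_cong') (auto simp: smult_assoc subset_iff PiE_mem[of _ S "\<lambda>_. carrier R"])
    then show "(\<Oplus>\<^bsub>M\<^esub> s \<in> S. (a \<odot>\<^bsub>?P\<^esub> p) s \<odot>\<^bsub>M\<^esub> s) = a \<odot>\<^bsub>M\<^esub> (\<Oplus>\<^bsub>M\<^esub> s \<in> S. p s \<odot>\<^bsub>M\<^esub> s)"
      using cl[OF ap(2)] ap S(1) by (simp add: finsum_smult_right)
  qed (simp only: M.finsum_closed[OF cl])
qed

text \<open>The identity of \<open>M\<close> lifts along the canonical surjection from the free module on a finite set
  of generators; the components of the lift are the coordinates. The free module has to be moved to
  the type of test modules first.\<close>

lemma projective_coordinates:
  fixes M :: "'r fgmod"
  assumes M: "fg_left_module R M" and proj: "projective R M"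
  obtains S f where "finite S" "S \<subseteq> carrier M" "\<And>s. s \<in> S \<Longrightarrow> f s \<in> module_hom R M (regular R)"
    "\<And>m. m \<in> carrier M \<Longrightarrow> (\<Oplus>\<^bsub>M\<^esub> s \<in> S. f s m \<odot>\<^bsub>M\<^esub> s) = m"
proof -
  interpret M: fg_left_module R M by fact
  obtain S where S: "finite S" "S \<subseteq> carrier M"
    "\<And>x. x \<in> carrier M \<Longrightarrow> \<exists>c \<in> S \<rightarrow> carrier R. x = (\<Oplus>\<^bsub>M\<^esub> s \<in> S. c s \<odot>\<^bsub>M\<^esub> s)"
    using M.finitely_generated by (auto simp: finitely_generated_def)
  interpret Reg: left_module R "regular R" by (rule M.R.left_module_regular)
  have fgr: "finitely_generated R (regular R)"
  proof (rule Reg.finitely_generatedI[of "{\<one>\<^bsub>R\<^esub>}"])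
    fix U assume U: "is_submodule R (regular R) U" "{\<one>\<^bsub>R\<^esub>} \<subseteq> U"
    show "carrier (regular R) \<subseteq> U"
    proof
      fix a assume a: "a \<in> carrier (regular R)"
      have "\<forall>k \<in> carrier R. \<forall>x \<in> U. k \<otimes>\<^bsub>R\<^esub> x \<in> U" using U(1) by (simp add: is_submodule_def)
      then have "a \<otimes>\<^bsub>R\<^esub> \<one>\<^bsub>R\<^esub> \<in> U" using U(2) a by fastforce
      then show "a \<in> U" using a by simp
    qed
  qed simp_all
  let ?P = "power_module (regular R) S"
  interpret P: fg_left_module R ?P by (rule Reg.fg_left_module_power[OF S(1) fgr])
  obtain U :: "'r fgmod" and j where U: "fg_left_module R U" "j \<in> module_iso R ?P U"
    by (rule P.fg_left_module_universe)
  interpret U: fg_left_module R U by fact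
  define i where "i = (\<lambda>y \<in> carrier U. inv_into (carrier ?P) j y)"
  have i: "i \<in> module_hom R U ?P" "\<And>x. x \<in> carrier ?P \<Longrightarrow> i (j x) = x"
    using module_iso_inverse(1,2)[OF P.left_module_axioms U.left_module_axioms U(2), folded i_def]
    by blast+
  have jU: "j x \<in> carrier U" if "x \<in> carrier ?P" for x
  proof -
    have "j \<in> module_hom R ?P U" using U(2) unfolding module_iso_def by simp
    then show ?thesis using that by (rule module_homD(1))
  qed
  define q where "q = (\<lambda>p \<in> carrier ?P. \<Oplus>\<^bsub>M\<^esub> s \<in> S. p s \<odot>\<^bsub>M\<^esub> s)"
  have q: "q \<in> module_hom R ?P M" unfolding q_def by (rule M.combination_hom[OF S(1,2)])
  define g where "g = (\<lambda>u \<in> carrier U. q (i u))"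
  have g: "g \<in> module_hom R U M" unfolding g_def by (rule U.module_hom_compose[OF i(1) q])
  have "m \<in> g ` carrier U" if m: "m \<in> carrier M" for m
  proof -
    obtain c where c: "c \<in> S \<rightarrow> carrier R" "m = (\<Oplus>\<^bsub>M\<^esub> s \<in> S. c s \<odot>\<^bsub>M\<^esub> s)" using S(3)[OF m] by blast
    have p: "restrict c S \<in> carrier ?P" using c(1) by auto
    have "m = q (restrict c S)" 
      unfolding c(2) q_def using p c(1) S(2)
      by (simp, intro M.M.finsum_cong') (simp_all add: Pi_iff subset_iff)
    then show ?thesis using p i(2)[OF p] jU[OF p] by (intro image_eqI[of _ _ "j (restrict c S)"]) (simp_all add: g_def)
  qed
  then have surj: "g ` carrier U = carrier M" using module_homD(1)[OF g] by blast
  have id: "(\<lambda>m \<in> carrier M. m) \<in> module_hom R M M" by (rule M.restrict_module_homI) auto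
  obtain h where h: "h \<in> module_hom R M U" "\<And>m. m \<in> carrier M \<Longrightarrow> g (h m) = m"
    using proj[unfolded projective_def, rule_format, of U M g "\<lambda>m \<in> carrier M. m"] U(1) M g surj id by auto
  have ih: "(\<lambda>m \<in> carrier M. i (h m)) \<in> module_hom R M ?P" by (rule M.module_hom_compose[OF h(1) i(1)])
  define f where "f s = (\<lambda>m \<in> carrier M. i (h m) s)" for s
  have "f s \<in> module_hom R M (regular R)" if s: "s \<in> S" for s unfolding f_def
  proof (rule M.restrict_module_homI)
    fix m m' assume mm: "m \<in> carrier M" "m' \<in> carrier M"
    show "i (h m) s \<in> carrier (regular R)" using module_homD(1)[OF ih mm(1)] mm s by auto
    show "i (h (m \<oplus>\<^bsub>M\<^esub> m')) s = i (h m) s \<oplus>\<^bsub>regular R\<^esub> i (h m') s"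
      using module_homD(2)[OF ih mm] mm s by simp
  next
    fix a m assume am: "a \<in> carrier R" "m \<in> carrier M"
    show "i (h (a \<odot>\<^bsub>M\<^esub> m)) s = a \<odot>\<^bsub>regular R\<^esub> i (h m) s"
      using module_homD(3)[OF ih am] am s by simp
  qed
  moreover have "(\<Oplus>\<^bsub>M\<^esub> s \<in> S. f s m \<odot>\<^bsub>M\<^esub> s) = m" if m: "m \<in> carrier M" for m
  proof -
    have "m = q (i (h m))" using h(2)[OF m] module_homD(1)[OF h(1) m] by (simp add: g_def)
    then show ?thesis using module_homD(1)[OF ih m] m by (simp add: q_def f_def)
  qed
  ultimately show thesis using that S(1,2) by blast
qed

text \<open>Dually, a jointly injective finite family of maps to \<open>N\<close> embeds \<open>M\<close> into a power of \<open>N\<close>, and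
  the identity of \<open>M\<close> extends to a retraction of this embedding.\<close>

lemma injective_coordinates:
  fixes M :: "'r fgmod" and N :: "('r, 'n, 'y) module_scheme"
  assumes M: "fg_left_module R M" and inj: "injective R M"
    and N: "fg_left_module R N" and T: "finite T" "\<And>t. t \<in> T \<Longrightarrow> g t \<in> module_hom R M N"
    and ker: "\<And>m m'. m \<in> carrier M \<Longrightarrow> m' \<in> carrier M \<Longrightarrow> (\<forall>t \<in> T. g t m = g t m') \<Longrightarrow> m = m'"
  obtains r where "\<And>t. t \<in> T \<Longrightarrow> r t \<in> module_hom R N M"
    "\<And>m. m \<in> carrier M \<Longrightarrow> (\<Oplus>\<^bsub>M\<^esub> t \<in> T. r t (g t m)) = m"
proof -
  interpret M: fg_left_module R M by fact
  interpret N: fg_left_module R N by fact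
  let ?P = "power_module N T"
  interpret P: fg_left_module R ?P by (rule N.fg_left_module_power[OF T(1) N.finitely_generated])
  obtain V :: "'r fgmod" and j where V: "fg_left_module R V" "j \<in> module_iso R ?P V"
    by (rule P.fg_left_module_universe)
  interpret V: fg_left_module R V by fact
  have j: "j \<in> module_hom R ?P V" "inj_on j (carrier ?P)"
    using V(2) by (auto simp: module_iso_def bij_betw_def)
  define p where "p = (\<lambda>m \<in> carrier M. \<lambda>t \<in> T. g t m)"
  have p: "p \<in> module_hom R M ?P" unfolding p_def
    by (rule M.restrict_module_homI) (use T in \<open>simp_all add: module_homD[OF T(2)] fun_eq_iff\<close>)
  have jp: "(\<lambda>m \<in> carrier M. j (p m)) \<in> module_hom R M V" by (rule M.module_hom_compose[OF p j(1)])
  have jpinj: "inj_on (\<lambda>m \<in> carrier M. j (p m)) (carrier M)"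
  proof (rule inj_onI)
    fix m m' assume m: "m \<in> carrier M" "m' \<in> carrier M"
      "(\<lambda>m \<in> carrier M. j (p m)) m = (\<lambda>m \<in> carrier M. j (p m)) m'"
    then have "p m = p m'" using j(2) module_homD(1)[OF p] by (auto dest: inj_onD)
    then have eq: "(\<lambda>t \<in> T. g t m) = (\<lambda>t \<in> T. g t m')" using m by (simp add: p_def)
    have "\<forall>t \<in> T. g t m = g t m'"
    proof
      fix t assume "t \<in> T"
      then show "g t m = g t m'" using fun_cong[OF eq, of t] by simp
    qed
    then show "m = m'" using m ker by blast
  qed
  have id: "(\<lambda>m \<in> carrier M. m) \<in> module_hom R M M" by (rule M.restrict_module_homI) auto
  obtain h where h: "h \<in> module_hom R V M" "\<And>m. m \<in> carrier M \<Longrightarrow> h (j (p m)) = m"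
    using inj[unfolded injective_def, rule_format, of M V "\<lambda>m \<in> carrier M. j (p m)" "\<lambda>m \<in> carrier M. m"]
      V(1) M jp jpinj id by auto
  note sing = N.power_single_hom[of T]
  define hj where "hj = (\<lambda>x \<in> carrier ?P. h (j x))"
  have hj: "hj \<in> module_hom R ?P M" unfolding hj_def by (rule P.module_hom_compose[OF j(1) h(1)])
  define r where "r t = (\<lambda>x \<in> carrier N. hj ((\<lambda>x \<in> carrier N. power_single N T t x) x))" for t
  have "r t \<in> module_hom R N M" for t unfolding r_def by (rule N.module_hom_compose[OF sing hj])
  moreover have "(\<Oplus>\<^bsub>M\<^esub> t \<in> T. r t (g t m)) = m" if m: "m \<in> carrier M" for m
  proof -
    have pm: "p m \<in> carrier ?P" using module_homD(1)[OF p m] .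
    have gN: "g t m \<in> carrier N" if "t \<in> T" for t using T(2)[OF that] m by (rule module_homD(1))
    have "m = hj (p m)" using h(2)[OF m] pm by (simp add: hj_def)
    also have "\<dots> = hj (\<Oplus>\<^bsub>?P\<^esub> t \<in> T. power_single N T t (p m t))"
      using N.power_decomposition[OF T(1) pm] by simp
    also have "\<dots> = (\<Oplus>\<^bsub>M\<^esub> t \<in> T. hj (power_single N T t (p m t)))"
      using gN m T by (intro additive_map_finsum[OF P.M.abelian_group_axioms M.M.abelian_group_axioms
            module_hom_additive[OF hj]]) (auto simp: p_def simp del: power_module_simps)
    also have "\<dots> = (\<Oplus>\<^bsub>M\<^esub> t \<in> T. r t (g t m))"
      using gN m module_homD(1)[OF hj] N.power_single_closed
      by (intro M.M.finsum_cong') (auto simp: r_def p_def simp del: power_module_simps)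
    finally show ?thesis by simp
  qed
  ultimately show thesis using that by blast
qed


section \<open>Dual modules and evaluation\<close>

lemma dual_simps [simp]:
  "carrier (dual R M) = module_hom R M (regular R)" "zero (dual R M) = (\<lambda>x \<in> carrier M. \<zero>\<^bsub>R\<^esub>)"
  "add (dual R M) = (\<lambda>f g. \<lambda>x \<in> carrier M. f x \<oplus>\<^bsub>R\<^esub> g x)"
  "smult (dual R M) = (\<lambda>r f. \<lambda>x \<in> carrier M. f x \<otimes>\<^bsub>R\<^esub> r)"
  by (simp_all add: dual_def)

lemma (in left_module) dual_closed:
  "\<zero>\<^bsub>dual R M\<^esub> \<in> carrier (dual R M)"
  "f \<in> carrier (dual R M) \<Longrightarrow> g \<in> carrier (dual R M) \<Longrightarrow> f \<oplus>\<^bsub>dual R M\<^esub> g \<in> carrier (dual R M)"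
  "f \<in> carrier (dual R M) \<Longrightarrow> a \<in> carrier R \<Longrightarrow> a \<odot>\<^bsub>dual R M\<^esub> f \<in> carrier (dual R M)"
  by (auto intro!: restrict_module_homI simp: module_homD[where N="regular R", simplified]
      R.a_ac R.r_distr R.l_distr R.m_assoc)

text \<open>The side switches: the dual is a module over the opposite ring.\<close>

lemma (in left_module) left_module_dual: "left_module (opp R) (dual R M)"
proof (intro left_module.intro left_module_axioms.intro R.ring_opp)
  note D = module_homD[where N="regular R", simplified]
  show "abelian_group (dual R M)"
  proof (rule abelian_groupI)
    fix f assume f: "f \<in> carrier (dual R M)"
    have "(\<lambda>x \<in> carrier M. \<ominus>\<^bsub>R\<^esub> f x) \<in> carrier (dual R M)"
      using f by (auto intro!: restrict_module_homI simp: D R.r_minus R.minus_add)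
    then show "\<exists>g \<in> carrier (dual R M). g \<oplus>\<^bsub>dual R M\<^esub> f = \<zero>\<^bsub>dual R M\<^esub>"
      using f by (intro bexI[of _ "\<lambda>x \<in> carrier M. \<ominus>\<^bsub>R\<^esub> f x"]) (auto simp: D R.l_neg)
    show "\<zero>\<^bsub>dual R M\<^esub> \<oplus>\<^bsub>dual R M\<^esub> f = f"
      using f D(4)[of f R M] by (auto simp: D fun_eq_iff extensional_def)
  next
    fix f g h assume fgh: "f \<in> carrier (dual R M)" "g \<in> carrier (dual R M)" "h \<in> carrier (dual R M)"
    show "f \<oplus>\<^bsub>dual R M\<^esub> g \<oplus>\<^bsub>dual R M\<^esub> h = f \<oplus>\<^bsub>dual R M\<^esub> (g \<oplus>\<^bsub>dual R M\<^esub> h)"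
      using fgh by (auto simp: D R.a_ac fun_eq_iff)
    show "f \<oplus>\<^bsub>dual R M\<^esub> g = g \<oplus>\<^bsub>dual R M\<^esub> f"
      using fgh by (auto simp: D R.a_ac fun_eq_iff)
  qed (auto simp: dual_closed simp del: dual_simps)
  fix a b f g assume "a \<in> carrier (opp R)" "b \<in> carrier (opp R)" "f \<in> carrier (dual R M)" "g \<in> carrier (dual R M)"
  then show "(a \<oplus>\<^bsub>opp R\<^esub> b) \<odot>\<^bsub>dual R M\<^esub> f = a \<odot>\<^bsub>dual R M\<^esub> f \<oplus>\<^bsub>dual R M\<^esub> b \<odot>\<^bsub>dual R M\<^esub> f"
    "a \<odot>\<^bsub>dual R M\<^esub> (f \<oplus>\<^bsub>dual R M\<^esub> g) = a \<odot>\<^bsub>dual R M\<^esub> f \<oplus>\<^bsub>dual R M\<^esub> a \<odot>\<^bsub>dual R M\<^esub> g"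
    "(a \<otimes>\<^bsub>opp R\<^esub> b) \<odot>\<^bsub>dual R M\<^esub> f = a \<odot>\<^bsub>dual R M\<^esub> (b \<odot>\<^bsub>dual R M\<^esub> f)"
    by (auto simp: D R.l_distr R.r_distr R.m_assoc fun_eq_iff)
next
  fix f assume "f \<in> carrier (dual R M)"
  then show "\<one>\<^bsub>opp R\<^esub> \<odot>\<^bsub>dual R M\<^esub> f = f"
    using module_homD(4)[of f R M "regular R"] by (auto simp: module_homD[where N="regular R", simplified] fun_eq_iff extensional_def)
qed (use dual_closed in \<open>auto simp del: dual_simps\<close>)

lemma (in left_module) evaluation_hom:
  "evaluation R M \<in> module_hom R M (dual (opp R) (dual R M))"
proof -
  interpret D: left_module "opp R" "dual R M" by (rule left_module_dual)
  note H = module_homD[where N="regular R", simplified]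
  show ?thesis unfolding evaluation_def
  proof (rule restrict_module_homI)
    fix x assume x: "x \<in> carrier M"
    have "(\<lambda>f \<in> carrier (dual R M). f x) \<in> module_hom (opp R) (dual R M) (regular (opp R))"
      by (rule D.restrict_module_homI) (use x in \<open>auto simp: H\<close>)
    then show "(\<lambda>f \<in> carrier (dual R M). f x) \<in> carrier (dual (opp R) (dual R M))" by simp
  qed (auto simp: H fun_eq_iff)
qed


section \<open>Monoid algebras\<close>

text \<open>The linear extension to \<open>K[G]\<close> of a map \<open>\<phi>\<close> from \<open>G\<close> to a vector space. Associativity of the
  convolution product, the slices of a tensor and the action on a bimodule are all instances.\<close>

definition linear_ext :: "('k, 'x) ring_scheme \<Rightarrow> ('k, 'v, 'y) module_scheme \<Rightarrow> ('g \<Rightarrow> 'k) \<Rightarrow> ('g \<Rightarrow> 'v) \<Rightarrow> 'v" where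
  "linear_ext K V f \<phi> = (\<Oplus>\<^bsub>V\<^esub> p \<in> supp K f. f p \<odot>\<^bsub>V\<^esub> \<phi> p)"

lemma monoid_alg_simps:
  "carrier (monoid_alg K G) = {f. range f \<subseteq> carrier K \<and> supp K f \<subseteq> carrier G \<and> finite (supp K f)}"
  "mult (monoid_alg K G) = (\<lambda>f g z. \<Oplus>\<^bsub>K\<^esub> p \<in> {p \<in> supp K f \<times> supp K g. fst p \<otimes>\<^bsub>G\<^esub> snd p = z}.
     f (fst p) \<otimes>\<^bsub>K\<^esub> g (snd p))"
  "one (monoid_alg K G) = single K \<one>\<^bsub>G\<^esub> \<one>\<^bsub>K\<^esub>"
  "zero (monoid_alg K G) = (\<lambda>p. \<zero>\<^bsub>K\<^esub>)"
  "add (monoid_alg K G) = (\<lambda>f g p. f p \<oplus>\<^bsub>K\<^esub> g p)"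
  by (simp_all add: monoid_alg_def single_def)

locale monoid_ring_module = left_module K V + K: cring K + G: monoid G
  for K :: "('k, 'x) ring_scheme" (structure) and V :: "('k, 'v, 'y) module_scheme" (structure)
    and G :: "('g, 'z) monoid_scheme" (structure)
begin

abbreviation "F \<equiv> monoid_alg K G"

lemma FD:
  assumes "f \<in> carrier F"
  shows "f p \<in> carrier K" "supp K f \<subseteq> carrier G" "finite (supp K f)"
    and "p \<notin> carrier G \<Longrightarrow> f p = \<zero>\<^bsub>K\<^esub>"
  using assms by (auto simp: monoid_alg_simps supp_def)

lemma FI:
  assumes "\<And>p. f p \<in> carrier K" "finite S" "S \<subseteq> carrier G" "\<And>p. p \<notin> S \<Longrightarrow> f p = \<zero>\<^bsub>K\<^esub>"
  shows "f \<in> carrier F"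
proof -
  have "supp K f \<subseteq> S" using assms(4) by (auto simp: supp_def)
  then show ?thesis using assms(1-3) by (auto simp: monoid_alg_simps finite_subset)
qed

lemma single_closed [simp]: "p \<in> carrier G \<Longrightarrow> k \<in> carrier K \<Longrightarrow> single K p k \<in> carrier F"
  by (rule FI[of _ "{p}"]) (auto simp: single_def)

lemma add_closed: "f \<in> carrier F \<Longrightarrow> g \<in> carrier F \<Longrightarrow> f \<oplus>\<^bsub>F\<^esub> g \<in> carrier F"
  using FD(2,3)[of f] FD(2,3)[of g]
  by (intro FI[of _ "supp K f \<union> supp K g"]) (simp_all add: monoid_alg_simps(5) FD(1), simp add: supp_def)

lemma zero_closed': "\<zero>\<^bsub>F\<^esub> \<in> carrier F"
  by (rule FI[of _ "{}"]) (auto simp: monoid_alg_simps(4))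

lemma linear_ext_superset:
  assumes f: "f \<in> carrier F" and S: "finite S" "supp K f \<subseteq> S" and \<phi>: "\<phi> \<in> S \<rightarrow> carrier V"
  shows "linear_ext K V f \<phi> = (\<Oplus>\<^bsub>V\<^esub> p \<in> S. f p \<odot>\<^bsub>V\<^esub> \<phi> p)"
proof -
  have c: "\<phi> p \<in> carrier V" if "p \<in> S" for p using \<phi> that by auto
  show ?thesis unfolding linear_ext_def using S c FD(1)[OF f]
    by (intro M.add.finprod_mono_neutral_cong_left) (auto simp: supp_def)
qed

lemma linear_ext_closed [simp]:
  assumes "f \<in> carrier F" "\<phi> \<in> carrier G \<rightarrow> carrier V"
  shows "linear_ext K V f \<phi> \<in> carrier V"
  unfolding linear_ext_def using FD(1,2)[OF assms(1)] assms(2) by (intro M.finsum_closed) (auto simp: Pi_iff)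

lemma linear_ext_cong:
  assumes "f \<in> carrier F" "\<phi> \<in> carrier G \<rightarrow> carrier V" "\<And>p. p \<in> carrier G \<Longrightarrow> \<phi> p = \<psi> p"
  shows "linear_ext K V f \<phi> = linear_ext K V f \<psi>"
proof -
  have "\<psi> p \<in> carrier V" if "p \<in> carrier G" for p using assms(2,3) that by (metis Pi_mem)
  then show ?thesis unfolding linear_ext_def using FD(1,2)[OF assms(1)] assms(2,3)
    by (intro M.finsum_cong') (auto simp: Pi_iff)
qed

lemma linear_ext_add:
  assumes fg: "f \<in> carrier F" "g \<in> carrier F" and \<phi>: "\<phi> \<in> carrier G \<rightarrow> carrier V"
  shows "linear_ext K V (f \<oplus>\<^bsub>F\<^esub> g) \<phi> = linear_ext K V f \<phi> \<oplus>\<^bsub>V\<^esub> linear_ext K V g \<phi>"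
proof -
  let ?S = "supp K f \<union> supp K g"
  have S: "finite ?S" "\<phi> \<in> ?S \<rightarrow> carrier V" "supp K (f \<oplus>\<^bsub>F\<^esub> g) \<subseteq> ?S"
    using FD(2,3)[OF fg(1)] FD(2,3)[OF fg(2)] \<phi> by (auto simp: supp_def monoid_alg_simps(5))
  have c: "(\<lambda>p. f p \<odot>\<^bsub>V\<^esub> \<phi> p) \<in> ?S \<rightarrow> carrier V" "(\<lambda>p. g p \<odot>\<^bsub>V\<^esub> \<phi> p) \<in> ?S \<rightarrow> carrier V"
    using S(2) FD(1)[OF fg(1)] FD(1)[OF fg(2)] by auto
  have "linear_ext K V (f \<oplus>\<^bsub>F\<^esub> g) \<phi> = (\<Oplus>\<^bsub>V\<^esub> p \<in> ?S. f p \<odot>\<^bsub>V\<^esub> \<phi> p \<oplus>\<^bsub>V\<^esub> g p \<odot>\<^bsub>V\<^esub> \<phi> p)"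
    unfolding linear_ext_superset[OF add_closed[OF fg] S(1,3,2)] using c S(2) FD(1)[OF fg(1)] FD(1)[OF fg(2)]
    by (intro M.finsum_cong') (auto simp: smult_l_distr monoid_alg_simps(5) Pi_iff)
  also have "\<dots> = linear_ext K V f \<phi> \<oplus>\<^bsub>V\<^esub> linear_ext K V g \<phi>"
    using c S by (simp add: M.finsum_addf linear_ext_superset[OF fg(1) S(1) _ S(2)] linear_ext_superset[OF fg(2) S(1) _ S(2)])
  finally show ?thesis .
qed

lemma linear_ext_single:
  assumes "p \<in> carrier G" "k \<in> carrier K" "\<phi> p \<in> carrier V"
  shows "linear_ext K V (single K p k) \<phi> = k \<odot>\<^bsub>V\<^esub> \<phi> p"
proof -
  have "linear_ext K V (single K p k) \<phi> = (\<Oplus>\<^bsub>V\<^esub> q \<in> {p}. single K p k q \<odot>\<^bsub>V\<^esub> \<phi> q)"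
    using assms by (intro linear_ext_superset single_closed) (auto simp: supp_def single_def)
  then show ?thesis using assms by (simp add: single_def)
qed

lemma linear_ext_zero [simp]: "linear_ext K V \<zero>\<^bsub>F\<^esub> \<phi> = \<zero>\<^bsub>V\<^esub>"
  by (simp add: linear_ext_def supp_def monoid_alg_simps(4))

lemma mult_eq:
  assumes fg: "f \<in> carrier F" "g \<in> carrier F"
  shows "(f \<otimes>\<^bsub>F\<^esub> g) z
    = (\<Oplus>\<^bsub>K\<^esub> p \<in> supp K f. \<Oplus>\<^bsub>K\<^esub> q \<in> supp K g. if p \<otimes>\<^bsub>G\<^esub> q = z then f p \<otimes>\<^bsub>K\<^esub> g q else \<zero>\<^bsub>K\<^esub>)"
proof -
  have "(f \<otimes>\<^bsub>F\<^esub> g) z = (\<Oplus>\<^bsub>K\<^esub> x \<in> supp K f \<times> supp K g.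
      if fst x \<otimes>\<^bsub>G\<^esub> snd x = z then f (fst x) \<otimes>\<^bsub>K\<^esub> g (snd x) else \<zero>\<^bsub>K\<^esub>)"
    unfolding monoid_alg_simps using FD(1,3)[OF fg(1)] FD(1,3)[OF fg(2)]
    by (intro R.add.finprod_mono_neutral_cong_left) auto
  also have "\<dots> = (\<Oplus>\<^bsub>K\<^esub> p \<in> supp K f. \<Oplus>\<^bsub>K\<^esub> q \<in> supp K g. if p \<otimes>\<^bsub>G\<^esub> q = z then f p \<otimes>\<^bsub>K\<^esub> g q else \<zero>\<^bsub>K\<^esub>)"
    using FD(1,3)[OF fg(1)] FD(1,3)[OF fg(2)]
    by (subst R.finsum_Times) (simp_all only: fst_conv snd_conv, simp)
  finally show ?thesis .
qed

lemma mult_support: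
  assumes fg: "f \<in> carrier F" "g \<in> carrier F"
  shows "supp K (f \<otimes>\<^bsub>F\<^esub> g) \<subseteq> (\<lambda>(p, q). p \<otimes>\<^bsub>G\<^esub> q) ` (supp K f \<times> supp K g)"
proof
  fix z assume z: "z \<in> supp K (f \<otimes>\<^bsub>F\<^esub> g)"
  show "z \<in> (\<lambda>(p, q). p \<otimes>\<^bsub>G\<^esub> q) ` (supp K f \<times> supp K g)"
  proof (rule ccontr)
    assume "\<not> ?thesis"
    then have "{p \<in> supp K f \<times> supp K g. fst p \<otimes>\<^bsub>G\<^esub> snd p = z} = {}" by force
    then have "(f \<otimes>\<^bsub>F\<^esub> g) z = \<zero>\<^bsub>K\<^esub>" by (simp only: monoid_alg_simps R.finsum_empty)
    with z show False by (simp add: supp_def)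
  qed
qed

lemma mult_closed:
  assumes fg: "f \<in> carrier F" "g \<in> carrier F"
  shows "f \<otimes>\<^bsub>F\<^esub> g \<in> carrier F"
proof (rule FI[of _ "(\<lambda>(p, q). p \<otimes>\<^bsub>G\<^esub> q) ` (supp K f \<times> supp K g)"])
  show "(f \<otimes>\<^bsub>F\<^esub> g) z \<in> carrier K" for z
    unfolding mult_eq[OF fg] using FD(1)[OF fg(1)] FD(1)[OF fg(2)] by (auto intro!: R.finsum_closed)
  show "(f \<otimes>\<^bsub>F\<^esub> g) z = \<zero>\<^bsub>K\<^esub>" if "z \<notin> (\<lambda>(p, q). p \<otimes>\<^bsub>G\<^esub> q) ` (supp K f \<times> supp K g)" for z
    using mult_support[OF fg] that by (auto simp: supp_def)
qed (use FD(2,3)[OF fg(1)] FD(2,3)[OF fg(2)] in auto)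

text \<open>The value of a linear extension at a product is an iterated linear extension. As an element of
  \<open>K[G]\<close> is determined by its linear extensions, the ring axioms follow from this formula.\<close>

lemma linear_ext_mult:
  assumes fg: "f \<in> carrier F" "g \<in> carrier F" and \<phi>: "\<phi> \<in> carrier G \<rightarrow> carrier V"
  shows "linear_ext K V (f \<otimes>\<^bsub>F\<^esub> g) \<phi> = linear_ext K V f (\<lambda>p. linear_ext K V g (\<lambda>q. \<phi> (p \<otimes>\<^bsub>G\<^esub> q)))"
proof -
  let ?S = "supp K f" and ?T = "supp K g"
  let ?Z = "(\<lambda>(p, q). p \<otimes>\<^bsub>G\<^esub> q) ` (?S \<times> ?T)"
  note f = FD(1-3)[OF fg(1)] and g = FD(1-3)[OF fg(2)]
  have Z: "finite ?Z" "?Z \<subseteq> carrier G" using f g by auto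
  have \<phi>c: "\<phi> z \<in> carrier V" if "z \<in> carrier G" for z using \<phi> that by auto
  have pq: "p \<otimes>\<^bsub>G\<^esub> q \<in> carrier G" if "p \<in> ?S" "q \<in> ?T" for p q using that f g by auto
  have "linear_ext K V (f \<otimes>\<^bsub>F\<^esub> g) \<phi> = (\<Oplus>\<^bsub>V\<^esub> z \<in> ?Z. (f \<otimes>\<^bsub>F\<^esub> g) z \<odot>\<^bsub>V\<^esub> \<phi> z)"
    using Z \<phi> by (intro linear_ext_superset mult_closed fg mult_support) auto
  also have "\<dots> = (\<Oplus>\<^bsub>V\<^esub> z \<in> ?Z. \<Oplus>\<^bsub>V\<^esub> p \<in> ?S. \<Oplus>\<^bsub>V\<^esub> q \<in> ?T.
      if p \<otimes>\<^bsub>G\<^esub> q = z then (f p \<otimes>\<^bsub>K\<^esub> g q) \<odot>\<^bsub>V\<^esub> \<phi> z else \<zero>\<^bsub>V\<^esub>)"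
  proof (rule M.finsum_cong')
    fix z assume "z \<in> ?Z"
    then have z: "\<phi> z \<in> carrier V" using Z \<phi>c by blast
    have "(f \<otimes>\<^bsub>F\<^esub> g) z \<odot>\<^bsub>V\<^esub> \<phi> z = (\<Oplus>\<^bsub>V\<^esub> p \<in> ?S.
        (\<Oplus>\<^bsub>K\<^esub> q \<in> ?T. if p \<otimes>\<^bsub>G\<^esub> q = z then f p \<otimes>\<^bsub>K\<^esub> g q else \<zero>\<^bsub>K\<^esub>) \<odot>\<^bsub>V\<^esub> \<phi> z)"
      unfolding mult_eq[OF fg] using f g z by (intro finsum_smult_left) (auto intro!: R.finsum_closed)
    also have "\<dots> = (\<Oplus>\<^bsub>V\<^esub> p \<in> ?S. \<Oplus>\<^bsub>V\<^esub> q \<in> ?T.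
        (if p \<otimes>\<^bsub>G\<^esub> q = z then f p \<otimes>\<^bsub>K\<^esub> g q else \<zero>\<^bsub>K\<^esub>) \<odot>\<^bsub>V\<^esub> \<phi> z)"
      using f g z by (intro M.finsum_cong' finsum_smult_left) (auto intro!: M.finsum_closed)
    also have "\<dots> = (\<Oplus>\<^bsub>V\<^esub> p \<in> ?S. \<Oplus>\<^bsub>V\<^esub> q \<in> ?T.
        if p \<otimes>\<^bsub>G\<^esub> q = z then (f p \<otimes>\<^bsub>K\<^esub> g q) \<odot>\<^bsub>V\<^esub> \<phi> z else \<zero>\<^bsub>V\<^esub>)"
      using f g z by (intro M.finsum_cong' refl) (auto intro!: M.finsum_closed)
    finally show "(f \<otimes>\<^bsub>F\<^esub> g) z \<odot>\<^bsub>V\<^esub> \<phi> z = (\<Oplus>\<^bsub>V\<^esub> p \<in> ?S. \<Oplus>\<^bsub>V\<^esub> q \<in> ?T.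
        if p \<otimes>\<^bsub>G\<^esub> q = z then (f p \<otimes>\<^bsub>K\<^esub> g q) \<odot>\<^bsub>V\<^esub> \<phi> z else \<zero>\<^bsub>V\<^esub>)" .
  qed (use f g \<phi>c pq in \<open>auto intro!: M.finsum_closed smult_closed\<close>)
  also have "\<dots> = (\<Oplus>\<^bsub>V\<^esub> p \<in> ?S. \<Oplus>\<^bsub>V\<^esub> z \<in> ?Z. \<Oplus>\<^bsub>V\<^esub> q \<in> ?T.
      if p \<otimes>\<^bsub>G\<^esub> q = z then (f p \<otimes>\<^bsub>K\<^esub> g q) \<odot>\<^bsub>V\<^esub> \<phi> z else \<zero>\<^bsub>V\<^esub>)"
    using f g Z pq \<phi>c by (intro M.finsum_swap) (auto intro!: M.finsum_closed)
  also have "\<dots> = (\<Oplus>\<^bsub>V\<^esub> p \<in> ?S. \<Oplus>\<^bsub>V\<^esub> q \<in> ?T. \<Oplus>\<^bsub>V\<^esub> z \<in> ?Z.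
      if p \<otimes>\<^bsub>G\<^esub> q = z then (f p \<otimes>\<^bsub>K\<^esub> g q) \<odot>\<^bsub>V\<^esub> \<phi> z else \<zero>\<^bsub>V\<^esub>)"
    using f g Z pq \<phi>c by (intro M.finsum_cong' M.finsum_swap) (auto intro!: M.finsum_closed)
  also have "\<dots> = (\<Oplus>\<^bsub>V\<^esub> p \<in> ?S. f p \<odot>\<^bsub>V\<^esub> (\<Oplus>\<^bsub>V\<^esub> q \<in> ?T. g q \<odot>\<^bsub>V\<^esub> \<phi> (p \<otimes>\<^bsub>G\<^esub> q)))"
  proof (rule M.finsum_cong')
    fix p assume p: "p \<in> ?S"
    have "(\<Oplus>\<^bsub>V\<^esub> q \<in> ?T. \<Oplus>\<^bsub>V\<^esub> z \<in> ?Z. if p \<otimes>\<^bsub>G\<^esub> q = z then (f p \<otimes>\<^bsub>K\<^esub> g q) \<odot>\<^bsub>V\<^esub> \<phi> z else \<zero>\<^bsub>V\<^esub>)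
      = (\<Oplus>\<^bsub>V\<^esub> q \<in> ?T. f p \<odot>\<^bsub>V\<^esub> (g q \<odot>\<^bsub>V\<^esub> \<phi> (p \<otimes>\<^bsub>G\<^esub> q)))"
    proof (rule M.finsum_cong')
      fix q assume q: "q \<in> ?T"
      have c: "\<phi> (p \<otimes>\<^bsub>G\<^esub> q) \<in> carrier V" using \<phi>c pq p q by auto
      have "(\<Oplus>\<^bsub>V\<^esub> z \<in> ?Z. if p \<otimes>\<^bsub>G\<^esub> q = z then (f p \<otimes>\<^bsub>K\<^esub> g q) \<odot>\<^bsub>V\<^esub> \<phi> z else \<zero>\<^bsub>V\<^esub>)
        = (\<Oplus>\<^bsub>V\<^esub> z \<in> ?Z. if p \<otimes>\<^bsub>G\<^esub> q = z then (f p \<otimes>\<^bsub>K\<^esub> g q) \<odot>\<^bsub>V\<^esub> \<phi> (p \<otimes>\<^bsub>G\<^esub> q) else \<zero>\<^bsub>V\<^esub>)"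
        using c f g by (intro M.finsum_cong') auto
      also have "\<dots> = (f p \<otimes>\<^bsub>K\<^esub> g q) \<odot>\<^bsub>V\<^esub> \<phi> (p \<otimes>\<^bsub>G\<^esub> q)"
        using p q c f g Z by (intro M.finsum_delta) auto
      finally show "(\<Oplus>\<^bsub>V\<^esub> z \<in> ?Z. if p \<otimes>\<^bsub>G\<^esub> q = z then (f p \<otimes>\<^bsub>K\<^esub> g q) \<odot>\<^bsub>V\<^esub> \<phi> z else \<zero>\<^bsub>V\<^esub>)
        = f p \<odot>\<^bsub>V\<^esub> (g q \<odot>\<^bsub>V\<^esub> \<phi> (p \<otimes>\<^bsub>G\<^esub> q))" using c f g by (simp add: smult_assoc)
    qed (use f g \<phi>c pq p in auto)
    also have "\<dots> = f p \<odot>\<^bsub>V\<^esub> (\<Oplus>\<^bsub>V\<^esub> q \<in> ?T. g q \<odot>\<^bsub>V\<^esub> \<phi> (p \<otimes>\<^bsub>G\<^esub> q))"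
      using f g \<phi>c pq p by (intro finsum_smult_right[symmetric]) auto
    finally show "(\<Oplus>\<^bsub>V\<^esub> q \<in> ?T. \<Oplus>\<^bsub>V\<^esub> z \<in> ?Z. if p \<otimes>\<^bsub>G\<^esub> q = z then (f p \<otimes>\<^bsub>K\<^esub> g q) \<odot>\<^bsub>V\<^esub> \<phi> z else \<zero>\<^bsub>V\<^esub>)
      = f p \<odot>\<^bsub>V\<^esub> (\<Oplus>\<^bsub>V\<^esub> q \<in> ?T. g q \<odot>\<^bsub>V\<^esub> \<phi> (p \<otimes>\<^bsub>G\<^esub> q))" .
  qed (use f g \<phi>c pq in \<open>auto intro!: M.finsum_closed\<close>)
  finally show ?thesis by (simp add: linear_ext_def)
qed

lemma linear_ext_swap:
  assumes fg: "f \<in> carrier F" "g \<in> carrier F"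
    and \<phi>: "\<And>p q. p \<in> carrier G \<Longrightarrow> q \<in> carrier G \<Longrightarrow> \<phi> p q \<in> carrier V"
  shows "linear_ext K V f (\<lambda>p. linear_ext K V g (\<lambda>q. \<phi> p q)) = linear_ext K V g (\<lambda>q. linear_ext K V f (\<lambda>p. \<phi> p q))"
proof -
  note f = FD(1-3)[OF fg(1)] and g = FD(1-3)[OF fg(2)]
  have c: "\<phi> p q \<in> carrier V" if "p \<in> supp K f" "q \<in> supp K g" for p q using that f(2) g(2) \<phi> by blast
  have "linear_ext K V f (\<lambda>p. linear_ext K V g (\<lambda>q. \<phi> p q))
    = (\<Oplus>\<^bsub>V\<^esub> p \<in> supp K f. \<Oplus>\<^bsub>V\<^esub> q \<in> supp K g. f p \<odot>\<^bsub>V\<^esub> (g q \<odot>\<^bsub>V\<^esub> \<phi> p q))"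
    unfolding linear_ext_def using f(1,3) g(1,3) c
    by (intro M.finsum_cong' finsum_smult_right) (auto intro!: M.finsum_closed)
  also have "\<dots> = (\<Oplus>\<^bsub>V\<^esub> q \<in> supp K g. \<Oplus>\<^bsub>V\<^esub> p \<in> supp K f. f p \<odot>\<^bsub>V\<^esub> (g q \<odot>\<^bsub>V\<^esub> \<phi> p q))"
    using f(1,3) g(1,3) c by (intro M.finsum_swap) auto
  also have "\<dots> = (\<Oplus>\<^bsub>V\<^esub> q \<in> supp K g. \<Oplus>\<^bsub>V\<^esub> p \<in> supp K f. g q \<odot>\<^bsub>V\<^esub> (f p \<odot>\<^bsub>V\<^esub> \<phi> p q))"
    using f(1,3) g(1,3) c
    by (intro M.finsum_cong' refl) (auto intro!: M.finsum_closed simp: smult_assoc[symmetric] K.m_comm)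
  also have "\<dots> = linear_ext K V g (\<lambda>q. linear_ext K V f (\<lambda>p. \<phi> p q))"
    unfolding linear_ext_def using f(1,3) g(1,3) c
    by (intro M.finsum_cong' finsum_smult_right[symmetric]) (auto intro!: M.finsum_closed)
  finally show ?thesis .
qed

lemma F_induct [consumes 1, case_names zero single add]:
  assumes "f \<in> carrier F" and "P \<zero>\<^bsub>F\<^esub>"
    and "\<And>p k. p \<in> carrier G \<Longrightarrow> k \<in> carrier K \<Longrightarrow> P (single K p k)"
    and "\<And>f g. f \<in> carrier F \<Longrightarrow> g \<in> carrier F \<Longrightarrow> P f \<Longrightarrow> P g \<Longrightarrow> P (f \<oplus>\<^bsub>F\<^esub> g)"
  shows "P f"
proof -
  note f = FD[OF assms(1)]
  let ?r = "\<lambda>S p. if p \<in> S then f p else \<zero>\<^bsub>K\<^esub>"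
  have "?r S \<in> carrier F \<and> P (?r S)" if "S \<subseteq> supp K f" for S
  proof -
    have "finite S" using that f(3) by (rule finite_subset)
    then show ?thesis using that
    proof (induction S rule: finite_induct)
      case empty
      have "?r {} = \<zero>\<^bsub>F\<^esub>" by (simp add: monoid_alg_simps(4))
      then show ?case using assms(2) zero_closed' by simp
    next
      case (insert p S)
      have "?r (insert p S) = single K p (f p) \<oplus>\<^bsub>F\<^esub> ?r S"
        using insert.hyps f(1) by (auto simp: monoid_alg_simps(5) single_def)
      moreover have "p \<in> carrier G" using insert.prems f(2) by auto
      ultimately show ?case using insert f(1) assms(3,4) add_closed by (simp add: subset_iff)
    qed
  qed
  from this[of "supp K f"] have "P (?r (supp K f))" by simp
  moreover have "?r (supp K f) = f" by (auto simp: supp_def)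
  ultimately show ?thesis by simp
qed

end

lemma linear_ext_hom:
  assumes "monoid_ring_module K V G" "monoid_ring_module K W G" "f \<in> carrier (monoid_alg K G)"
    and "additive_map V W L" "\<And>k x. k \<in> carrier K \<Longrightarrow> x \<in> carrier V \<Longrightarrow> L (k \<odot>\<^bsub>V\<^esub> x) = k \<odot>\<^bsub>W\<^esub> L x"
    and \<phi>: "\<phi> \<in> carrier G \<rightarrow> carrier V"
  shows "L (linear_ext K V f \<phi>) = linear_ext K W f (\<lambda>p. L (\<phi> p))"
proof -
  interpret V: monoid_ring_module K V G by fact
  interpret W: monoid_ring_module K W G by fact
  note f = V.FD[OF assms(3)]
  have c: "\<phi> p \<in> carrier V" if "p \<in> supp K f" for p using \<phi> f(2) that by auto
  then have "L (linear_ext K V f \<phi>) = (\<Oplus>\<^bsub>W\<^esub> p \<in> supp K f. L (f p \<odot>\<^bsub>V\<^esub> \<phi> p))"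
    unfolding linear_ext_def using f(1,3)
    by (intro additive_map_finsum[OF V.M.abelian_group_axioms W.M.abelian_group_axioms assms(4)]) auto
  also have "\<dots> = linear_ext K W f (\<lambda>p. L (\<phi> p))" unfolding linear_ext_def
    using c f(1) additive_mapD(1)[OF assms(4)] by (intro W.M.finsum_cong') (auto simp: assms(5))
  finally show ?thesis .
qed

text \<open>Two elements agree as soon as their linear extensions of all scalar functions agree, since the
  coefficient at \<open>z\<close> is the linear extension of the indicator function of \<open>z\<close>.\<close>

lemma ring_monoid_alg:
  assumes "cring K" "monoid G"
  shows "ring (monoid_alg K G)"
proof -
  interpret K: cring K by fact
  interpret G: monoid G by fact
  interpret left_module K "regular K" by (rule K.left_module_regular)
  interpret monoid_ring_module K "regular K" G by unfold_locales
  let ?\<delta> = "\<lambda>z p. if p = z then \<one>\<^bsub>K\<^esub> else \<zero>\<^bsub>K\<^esub>"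
  have coeff: "linear_ext K (regular K) f (?\<delta> z) = f z" if f: "f \<in> carrier F" for f z
  proof -
    have "linear_ext K (regular K) f (?\<delta> z) = (\<Oplus>\<^bsub>K\<^esub> p \<in> insert z (supp K f). if z = p then f z else \<zero>\<^bsub>K\<^esub>)"
      using FD[OF f] by (subst linear_ext_superset[OF f, of "insert z (supp K f)"]) (auto intro!: K.finsum_cong')
    also have "\<dots> = f z" using FD[OF f] by (intro K.finsum_delta) auto
    finally show ?thesis .
  qed
  have eqI: "f = g"
    if "f \<in> carrier F" "g \<in> carrier F"
      "\<And>\<phi>. \<phi> \<in> carrier G \<rightarrow> carrier (regular K) \<Longrightarrow> linear_ext K (regular K) f \<phi> = linear_ext K (regular K) g \<phi>" for f g
  proof
    fix z show "f z = g z" using that(3)[of "?\<delta> z"] coeff that(1,2) by auto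
  qed
  have one: "\<one>\<^bsub>F\<^esub> \<in> carrier F" by (simp add: monoid_alg_simps(3))
  have lc: "(\<lambda>p. linear_ext K (regular K) g (\<lambda>q. \<phi> (p \<otimes>\<^bsub>G\<^esub> q))) \<in> carrier G \<rightarrow> carrier (regular K)"
    if "g \<in> carrier F" "\<phi> \<in> carrier G \<rightarrow> carrier (regular K)" for g \<phi>
    using that by (intro Pi_I linear_ext_closed) auto
  show ?thesis
  proof (rule ringI)
    show "abelian_group F"
    proof (rule abelian_groupI)
      fix f assume f: "f \<in> carrier F"
      have "(\<lambda>p. \<ominus>\<^bsub>K\<^esub> f p) \<in> carrier F"
        using FD[OF f] by (intro FI[of _ "supp K f"]) (auto simp: supp_def)
      then show "\<exists>g \<in> carrier F. g \<oplus>\<^bsub>F\<^esub> f = \<zero>\<^bsub>F\<^esub>"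
        using FD(1)[OF f] by (intro bexI[of _ "\<lambda>p. \<ominus>\<^bsub>K\<^esub> f p"]) (auto simp: monoid_alg_simps(4,5) K.l_neg)
      show "\<zero>\<^bsub>F\<^esub> \<oplus>\<^bsub>F\<^esub> f = f" using FD(1)[OF f] by (simp add: monoid_alg_simps(4,5))
    next
      fix f g assume "f \<in> carrier F" "g \<in> carrier F"
      then show "f \<oplus>\<^bsub>F\<^esub> g \<in> carrier F" by (rule add_closed)
    qed (auto simp: zero_closed' monoid_alg_simps(5) FD(1) K.a_ac)
  next
    show "monoid F"
    proof (rule monoidI)
      fix f g h assume fgh: "f \<in> carrier F" "g \<in> carrier F" "h \<in> carrier F"
      show "f \<otimes>\<^bsub>F\<^esub> g \<otimes>\<^bsub>F\<^esub> h = f \<otimes>\<^bsub>F\<^esub> (g \<otimes>\<^bsub>F\<^esub> h)"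
      proof (rule eqI)
        fix \<phi> :: "'c \<Rightarrow> 'a" assume \<phi>: "\<phi> \<in> carrier G \<rightarrow> carrier (regular K)"
        have "linear_ext K (regular K) (f \<otimes>\<^bsub>F\<^esub> g \<otimes>\<^bsub>F\<^esub> h) \<phi>
          = linear_ext K (regular K) f (\<lambda>p. linear_ext K (regular K) g (\<lambda>q. linear_ext K (regular K) h (\<lambda>r. \<phi> (p \<otimes>\<^bsub>G\<^esub> q \<otimes>\<^bsub>G\<^esub> r))))"
          using fgh \<phi> lc[OF fgh(3) \<phi>] by (simp add: linear_ext_mult mult_closed)
        also have "\<dots> = linear_ext K (regular K) f (\<lambda>p. linear_ext K (regular K) (g \<otimes>\<^bsub>F\<^esub> h) (\<lambda>q. \<phi> (p \<otimes>\<^bsub>G\<^esub> q)))"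
        proof (rule linear_ext_cong[OF fgh(1)])
          fix p assume p: "p \<in> carrier G"
          have "linear_ext K (regular K) (g \<otimes>\<^bsub>F\<^esub> h) (\<lambda>q. \<phi> (p \<otimes>\<^bsub>G\<^esub> q))
            = linear_ext K (regular K) g (\<lambda>q. linear_ext K (regular K) h (\<lambda>r. \<phi> (p \<otimes>\<^bsub>G\<^esub> (q \<otimes>\<^bsub>G\<^esub> r))))"
            using fgh \<phi> p by (intro linear_ext_mult) auto
          also have "\<dots> = linear_ext K (regular K) g (\<lambda>q. linear_ext K (regular K) h (\<lambda>r. \<phi> (p \<otimes>\<^bsub>G\<^esub> q \<otimes>\<^bsub>G\<^esub> r)))"
            using fgh \<phi> p by (intro linear_ext_cong Pi_I linear_ext_closed) (auto simp: G.m_assoc)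
          finally show "linear_ext K (regular K) g (\<lambda>q. linear_ext K (regular K) h (\<lambda>r. \<phi> (p \<otimes>\<^bsub>G\<^esub> q \<otimes>\<^bsub>G\<^esub> r)))
            = linear_ext K (regular K) (g \<otimes>\<^bsub>F\<^esub> h) (\<lambda>q. \<phi> (p \<otimes>\<^bsub>G\<^esub> q))" by simp
        qed (use fgh \<phi> in \<open>auto intro!: linear_ext_closed[simplified]\<close>)
        also have "\<dots> = linear_ext K (regular K) (f \<otimes>\<^bsub>F\<^esub> (g \<otimes>\<^bsub>F\<^esub> h)) \<phi>"
          using fgh \<phi> by (simp add: linear_ext_mult mult_closed)
        finally show "linear_ext K (regular K) (f \<otimes>\<^bsub>F\<^esub> g \<otimes>\<^bsub>F\<^esub> h) \<phi> = linear_ext K (regular K) (f \<otimes>\<^bsub>F\<^esub> (g \<otimes>\<^bsub>F\<^esub> h)) \<phi>" .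
      qed (use fgh in \<open>simp_all add: mult_closed\<close>)
    next
      fix f assume f: "f \<in> carrier F"
      show "\<one>\<^bsub>F\<^esub> \<otimes>\<^bsub>F\<^esub> f = f"
      proof (rule eqI)
        fix \<phi> :: "'c \<Rightarrow> 'a" assume \<phi>: "\<phi> \<in> carrier G \<rightarrow> carrier (regular K)"
        have c: "linear_ext K (regular K) f (\<lambda>q. \<phi> (\<one>\<^bsub>G\<^esub> \<otimes>\<^bsub>G\<^esub> q)) \<in> carrier (regular K)"
          using f \<phi> by (intro linear_ext_closed) auto
        have "linear_ext K (regular K) (\<one>\<^bsub>F\<^esub> \<otimes>\<^bsub>F\<^esub> f) \<phi> = linear_ext K (regular K) f (\<lambda>q. \<phi> (\<one>\<^bsub>G\<^esub> \<otimes>\<^bsub>G\<^esub> q))"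
          
          by (subst linear_ext_mult[OF one f \<phi>], subst monoid_alg_simps(3), subst linear_ext_single) (use c in auto)
        also have "\<dots> = linear_ext K (regular K) f \<phi>" using f \<phi> by (intro linear_ext_cong) auto
        finally show "linear_ext K (regular K) (\<one>\<^bsub>F\<^esub> \<otimes>\<^bsub>F\<^esub> f) \<phi> = linear_ext K (regular K) f \<phi>" .
      qed (use f one in \<open>simp_all add: mult_closed\<close>)
      show "f \<otimes>\<^bsub>F\<^esub> \<one>\<^bsub>F\<^esub> = f"
      proof (rule eqI)
        fix \<phi> :: "'c \<Rightarrow> 'a" assume \<phi>: "\<phi> \<in> carrier G \<rightarrow> carrier (regular K)"
        show "linear_ext K (regular K) (f \<otimes>\<^bsub>F\<^esub> \<one>\<^bsub>F\<^esub>) \<phi> = linear_ext K (regular K) f \<phi>"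
          unfolding linear_ext_mult[OF f one \<phi>]
        proof (rule linear_ext_cong[OF f lc[OF one \<phi>]])
          fix p assume p: "p \<in> carrier G"
          then have "\<phi> p \<in> carrier K" using \<phi> by auto
          with p show "linear_ext K (regular K) \<one>\<^bsub>F\<^esub> (\<lambda>q. \<phi> (p \<otimes>\<^bsub>G\<^esub> q)) = \<phi> p"
            unfolding monoid_alg_simps(3) by (subst linear_ext_single) auto
        qed
      qed (use f one in \<open>simp_all add: mult_closed\<close>)
    qed (simp_all add: mult_closed one)
  next
    fix f g h assume fgh: "f \<in> carrier F" "g \<in> carrier F" "h \<in> carrier F"
    show "(f \<oplus>\<^bsub>F\<^esub> g) \<otimes>\<^bsub>F\<^esub> h = f \<otimes>\<^bsub>F\<^esub> h \<oplus>\<^bsub>F\<^esub> g \<otimes>\<^bsub>F\<^esub> h"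
      by (rule eqI) (use fgh lc in \<open>simp_all add: mult_closed add_closed linear_ext_add linear_ext_mult\<close>)
    show "h \<otimes>\<^bsub>F\<^esub> (f \<oplus>\<^bsub>F\<^esub> g) = h \<otimes>\<^bsub>F\<^esub> f \<oplus>\<^bsub>F\<^esub> h \<otimes>\<^bsub>F\<^esub> g"
    proof (rule eqI)
      fix \<phi> :: "'c \<Rightarrow> 'a" assume \<phi>: "\<phi> \<in> carrier G \<rightarrow> carrier (regular K)"
      have \<phi>': "(\<lambda>q. \<phi> (p \<otimes>\<^bsub>G\<^esub> q)) \<in> carrier G \<rightarrow> carrier (regular K)" if "p \<in> carrier G" for p
        using that \<phi> by auto
      note sw = linear_ext_swap[OF fgh(3), of _ "\<lambda>p q. \<phi> (p \<otimes>\<^bsub>G\<^esub> q)"]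
      have pq: "\<phi> (p \<otimes>\<^bsub>G\<^esub> q) \<in> carrier (regular K)" if "p \<in> carrier G" "q \<in> carrier G" for p q
        using that \<phi> by auto
      have lc': "(\<lambda>q. linear_ext K (regular K) h (\<lambda>p. \<phi> (p \<otimes>\<^bsub>G\<^esub> q))) \<in> carrier G \<rightarrow> carrier (regular K)"
        using fgh \<phi> by (intro Pi_I linear_ext_closed) auto
      show "linear_ext K (regular K) (h \<otimes>\<^bsub>F\<^esub> (f \<oplus>\<^bsub>F\<^esub> g)) \<phi> = linear_ext K (regular K) (h \<otimes>\<^bsub>F\<^esub> f \<oplus>\<^bsub>F\<^esub> h \<otimes>\<^bsub>F\<^esub> g) \<phi>"
        using fgh \<phi> lc' pq by (simp add: mult_closed add_closed linear_ext_mult linear_ext_add sw)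
    qed (use fgh in \<open>simp_all add: mult_closed add_closed\<close>)
  qed
qed


section \<open>The dual space of an algebra\<close>

text \<open>The right module structure \<open>(\<xi> a)(x) = \<xi>(a x)\<close>, written as a left module over the opposite
  algebra. The commuting left structure \<open>(c \<xi>)(x) = \<xi>(x c)\<close> is \<open>left_act\<close> below.\<close>

definition right_dual ::
    "('k, 'x) ring_scheme \<Rightarrow> ('k, 'a, 'y) module_scheme \<Rightarrow> ('a, 'a \<Rightarrow> 'k) module" where
  "right_dual K A =
    \<lparr>carrier = module_hom K A (regular K), mult = undefined, one = undefined,
     zero = (\<lambda>x \<in> carrier A. \<zero>\<^bsub>K\<^esub>), add = (\<lambda>\<xi> \<eta>. \<lambda>x \<in> carrier A. \<xi> x \<oplus>\<^bsub>K\<^esub> \<eta> x),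
     smult = (\<lambda>a \<xi>. \<lambda>x \<in> carrier A. \<xi> (a \<otimes>\<^bsub>A\<^esub> x))\<rparr>"

definition left_act :: "('k, 'a, 'y) module_scheme \<Rightarrow> 'a \<Rightarrow> ('a \<Rightarrow> 'k) \<Rightarrow> 'a \<Rightarrow> 'k" where
  "left_act A c \<xi> = (\<lambda>x \<in> carrier A. \<xi> (x \<otimes>\<^bsub>A\<^esub> c))"

definition scal :: "('k, 'x) ring_scheme \<Rightarrow> ('k, 'a, 'y) module_scheme \<Rightarrow> 'k \<Rightarrow> ('a \<Rightarrow> 'k) \<Rightarrow> 'a \<Rightarrow> 'k" where
  "scal K A k \<xi> = (\<lambda>x \<in> carrier A. k \<otimes>\<^bsub>K\<^esub> \<xi> x)"

lemma right_dual_simps: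
  "carrier (right_dual K A) = module_hom K A (regular K)"
  "zero (right_dual K A) = (\<lambda>x \<in> carrier A. \<zero>\<^bsub>K\<^esub>)"
  "add (right_dual K A) = (\<lambda>\<xi> \<eta>. \<lambda>x \<in> carrier A. \<xi> x \<oplus>\<^bsub>K\<^esub> \<eta> x)"
  "smult (right_dual K A) = (\<lambda>a \<xi>. \<lambda>x \<in> carrier A. \<xi> (a \<otimes>\<^bsub>A\<^esub> x))"
  by (simp_all add: right_dual_def)

text \<open>A dual basis is fixed for the whole development. Its coordinate forms are chosen extensional, so
  that they are elements of the dual space.\<close>

locale based_algebra = fd_algebra K A
  for K :: "('k, 'x) ring_scheme" (structure) and A :: "('k, 'a, 'y) module_scheme" (structure) +
  fixes B :: "'a set" and w :: "'a \<Rightarrow> 'a \<Rightarrow> 'k"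
  assumes basis: "dual_basis K A B w" and w_closed: "\<And>b. b \<in> B \<Longrightarrow> w b \<in> carrier (right_dual K A)"

lemma (in fd_algebra) left_module_KA: "left_module K A"
  by (intro left_module.intro left_module_axioms.intro K.ring_axioms A.abelian_group_axioms)
    (auto simp: smult_l_distr smult_r_distr smult_assoc1)

lemma (in fd_algebra) linear_space_KA: "linear_space K A"
  by (intro linear_space.intro left_module_KA K.field_axioms)

lemma (in fd_algebra) ex_based_algebra: "\<exists>B w. based_algebra K A B w"
proof -
  interpret V: linear_space K A by (rule linear_space_KA)
  obtain B w where b: "dual_basis K A B w" using V.ex_dual_basis[OF finite_dimensional] by blast
  let ?w = "\<lambda>b. restrict (w b) (carrier A)"
  note lf = linear_formD[OF dual_basisD(3)[OF b]]
  have hom: "?w b \<in> carrier (right_dual K A)" if "b \<in> B" for b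
    unfolding right_dual_simps by (rule V.restrict_module_homI) (use that in \<open>auto simp: lf\<close>)
  have "linear_form K A (?w b)" if "b \<in> B" for b
    unfolding linear_form_def additive_map_def using that by (auto simp: lf)
  moreover have "x = (\<Oplus>\<^bsub>A\<^esub> b \<in> B. ?w b x \<odot>\<^bsub>A\<^esub> b)" if "x \<in> carrier A" for x
    using dual_basisD(4)[OF b that] that by simp
  ultimately have "dual_basis K A B ?w"
    using dual_basisD(1,2)[OF b] unfolding dual_basis_def by blast
  then show ?thesis
    using hom by (intro exI based_algebra.intro based_algebra_axioms.intro fd_algebra_axioms)
qed

context fd_algebra
begin

abbreviation "DA \<equiv> right_dual K A"

lemma DA_D:
  assumes "\<xi> \<in> carrier DA"
  shows "x \<in> carrier A \<Longrightarrow> \<xi> x \<in> carrier K"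
    and "x \<in> carrier A \<Longrightarrow> y \<in> carrier A \<Longrightarrow> \<xi> (x \<oplus>\<^bsub>A\<^esub> y) = \<xi> x \<oplus>\<^bsub>K\<^esub> \<xi> y"
    and "k \<in> carrier K \<Longrightarrow> x \<in> carrier A \<Longrightarrow> \<xi> (k \<odot>\<^bsub>A\<^esub> x) = k \<otimes>\<^bsub>K\<^esub> \<xi> x"
    and "\<xi> \<in> extensional (carrier A)"
    and "linear_form K A \<xi>" and "additive_map A K \<xi>"
  using module_homD[of \<xi> K A "regular K"] assms
  by (auto simp: right_dual_simps linear_form_def additive_map_def)

lemma DA_restrictI:
  assumes "linear_form K A \<xi>"
  shows "(\<lambda>x \<in> carrier A. \<xi> x) \<in> carrier DA"
proof -
  interpret V: left_module K A by (rule left_module_KA)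
  show ?thesis unfolding right_dual_simps
    by (rule V.restrict_module_homI) (use assms in \<open>auto simp: linear_formD\<close>)
qed

lemma DA_eqI:
  assumes "\<xi> \<in> carrier DA" "\<eta> \<in> carrier DA" "\<And>x. x \<in> carrier A \<Longrightarrow> \<xi> x = \<eta> x"
  shows "\<xi> = \<eta>"
  using assms DA_D(4) by (intro extensionalityI)

lemma DA_apply:
  assumes "x \<in> carrier A"
  shows "(\<xi> \<oplus>\<^bsub>DA\<^esub> \<eta>) x = \<xi> x \<oplus>\<^bsub>K\<^esub> \<eta> x" "\<zero>\<^bsub>DA\<^esub> x = \<zero>\<^bsub>K\<^esub>" "(a \<odot>\<^bsub>DA\<^esub> \<xi>) x = \<xi> (a \<otimes>\<^bsub>A\<^esub> x)"
    "left_act A c \<xi> x = \<xi> (x \<otimes>\<^bsub>A\<^esub> c)" "scal K A k \<xi> x = k \<otimes>\<^bsub>K\<^esub> \<xi> x"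
  using assms by (simp_all add: right_dual_simps left_act_def scal_def)

lemma DA_closed [simp]:
  "\<zero>\<^bsub>DA\<^esub> \<in> carrier DA"
  "\<xi> \<in> carrier DA \<Longrightarrow> \<eta> \<in> carrier DA \<Longrightarrow> \<xi> \<oplus>\<^bsub>DA\<^esub> \<eta> \<in> carrier DA"
  "\<xi> \<in> carrier DA \<Longrightarrow> a \<in> carrier A \<Longrightarrow> a \<odot>\<^bsub>DA\<^esub> \<xi> \<in> carrier DA"
  "\<xi> \<in> carrier DA \<Longrightarrow> c \<in> carrier A \<Longrightarrow> left_act A c \<xi> \<in> carrier DA"
  "\<xi> \<in> carrier DA \<Longrightarrow> k \<in> carrier K \<Longrightarrow> scal K A k \<xi> \<in> carrier DA"
proof -
  show "\<zero>\<^bsub>DA\<^esub> \<in> carrier DA" unfolding right_dual_simps(2)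
    by (rule DA_restrictI) (auto simp: linear_form_def additive_map_def)
  show "\<xi> \<in> carrier DA \<Longrightarrow> \<eta> \<in> carrier DA \<Longrightarrow> \<xi> \<oplus>\<^bsub>DA\<^esub> \<eta> \<in> carrier DA"
    unfolding right_dual_simps(3)
    by (rule DA_restrictI) (auto simp: linear_form_def additive_map_def DA_D K.a_ac K.r_distr)
  show "\<xi> \<in> carrier DA \<Longrightarrow> a \<in> carrier A \<Longrightarrow> a \<odot>\<^bsub>DA\<^esub> \<xi> \<in> carrier DA"
    unfolding right_dual_simps(4)
    by (rule DA_restrictI) (auto simp: linear_form_def additive_map_def DA_D A.r_distr smult_mult_right)
  show "\<xi> \<in> carrier DA \<Longrightarrow> c \<in> carrier A \<Longrightarrow> left_act A c \<xi> \<in> carrier DA"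
    unfolding left_act_def
    by (rule DA_restrictI) (auto simp: linear_form_def additive_map_def DA_D A.l_distr smult_mult_left)
  show "\<xi> \<in> carrier DA \<Longrightarrow> k \<in> carrier K \<Longrightarrow> scal K A k \<xi> \<in> carrier DA"
    unfolding scal_def
    by (rule DA_restrictI) (auto simp: linear_form_def additive_map_def DA_D K.r_distr K.m_ac)
qed

lemma left_module_DA: "left_module (opp A) DA"
proof (intro left_module.intro left_module_axioms.intro A.ring_opp)
  show "abelian_group DA"
  proof (rule abelian_groupI)
    fix \<xi> assume \<xi>: "\<xi> \<in> carrier DA"
    show "\<exists>\<eta> \<in> carrier DA. \<eta> \<oplus>\<^bsub>DA\<^esub> \<xi> = \<zero>\<^bsub>DA\<^esub>"
    proof (rule bexI)
      show "scal K A (\<ominus>\<^bsub>K\<^esub> \<one>\<^bsub>K\<^esub>) \<xi> \<oplus>\<^bsub>DA\<^esub> \<xi> = \<zero>\<^bsub>DA\<^esub>"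
        using \<xi> by (intro DA_eqI) (auto simp: DA_apply DA_D K.l_minus K.l_neg)
    qed (use \<xi> in auto)
  qed (auto intro!: DA_eqI simp: DA_apply DA_D K.a_ac)
qed (auto intro!: DA_eqI simp: DA_apply DA_D A.m_assoc A.l_distr)

text \<open>Scalars act through the algebra, hence homomorphisms of right modules are linear.\<close>

lemma scal_eq: "\<xi> \<in> carrier DA \<Longrightarrow> k \<in> carrier K \<Longrightarrow> scal K A k \<xi> = (k \<odot>\<^bsub>A\<^esub> \<one>\<^bsub>A\<^esub>) \<odot>\<^bsub>DA\<^esub> \<xi>"
  by (intro DA_eqI) (auto simp: DA_apply DA_D smult_mult_left)

lemma DA_finsum:
  assumes "finite S" "\<And>s. s \<in> S \<Longrightarrow> f s \<in> carrier DA" "x \<in> carrier A"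
  shows "(\<Oplus>\<^bsub>DA\<^esub> s \<in> S. f s) x = (\<Oplus>\<^bsub>K\<^esub> s \<in> S. f s x)"
proof -
  interpret D: left_module "opp A" DA by (rule left_module_DA)
  have "additive_map DA K (\<lambda>\<xi>. \<xi> x)" using assms(3) by (auto simp: additive_map_def DA_apply DA_D)
  then show ?thesis using assms
    by (intro additive_map_finsum[OF D.M.abelian_group_axioms K.abelian_group_axioms]) auto
qed

end

definition dual_linear :: "('k, 'x) ring_scheme \<Rightarrow> ('k, 'a, 'y) module_scheme \<Rightarrow>
    ('k, 'v, 'z) module_scheme \<Rightarrow> (('a \<Rightarrow> 'k) \<Rightarrow> 'v) \<Rightarrow> bool" where
  "dual_linear K A V l \<longleftrightarrow> additive_map (right_dual K A) V l \<and>
     (\<forall>k \<in> carrier K. \<forall>\<xi> \<in> carrier (right_dual K A). l (scal K A k \<xi>) = k \<odot>\<^bsub>V\<^esub> l \<xi>)"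

context based_algebra
begin

lemma B_finite: "finite B" and B_closed: "b \<in> B \<Longrightarrow> b \<in> carrier A"
  and expand: "x \<in> carrier A \<Longrightarrow> (\<Oplus>\<^bsub>A\<^esub> b \<in> B. w b x \<odot>\<^bsub>A\<^esub> b) = x"
  using dual_basisD[OF basis] by auto

lemma w_apply [simp]: "b \<in> B \<Longrightarrow> x \<in> carrier A \<Longrightarrow> w b x \<in> carrier K"
  using w_closed DA_D(1) by blast

lemma separate:
  assumes "x \<in> carrier A" "\<And>b. b \<in> B \<Longrightarrow> w b x = \<zero>\<^bsub>K\<^esub>"
  shows "x = \<zero>\<^bsub>A\<^esub>"
proof -
  have "x = (\<Oplus>\<^bsub>A\<^esub> b \<in> B. w b x \<odot>\<^bsub>A\<^esub> b)" using expand assms by simp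
  also have "\<dots> = (\<Oplus>\<^bsub>A\<^esub> b \<in> B. \<zero>\<^bsub>A\<^esub>)"
    using assms B_closed by (intro A.finsum_cong') auto
  finally show ?thesis by (simp add: A.finsum_zero)
qed

lemma DA_expand:
  assumes \<xi>: "\<xi> \<in> carrier DA"
  shows "\<xi> = (\<Oplus>\<^bsub>DA\<^esub> b \<in> B. scal K A (\<xi> b) (w b))"
proof -
  interpret D: left_module "opp A" DA by (rule left_module_DA)
  have c: "scal K A (\<xi> b) (w b) \<in> carrier DA" if "b \<in> B" for b
    using that \<xi> B_closed w_closed DA_D(1) by auto
  show ?thesis
  proof (rule DA_eqI[OF \<xi>])
    show "(\<Oplus>\<^bsub>DA\<^esub> b \<in> B. scal K A (\<xi> b) (w b)) \<in> carrier DA" using c by (intro D.M.finsum_closed) auto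
    fix x assume x: "x \<in> carrier A"
    have "\<xi> x = \<xi> (\<Oplus>\<^bsub>A\<^esub> b \<in> B. w b x \<odot>\<^bsub>A\<^esub> b)" using expand x by simp
    also have "\<dots> = (\<Oplus>\<^bsub>K\<^esub> b \<in> B. \<xi> (w b x \<odot>\<^bsub>A\<^esub> b))"
      using B_finite B_closed x
      by (intro additive_map_finsum[OF A.abelian_group_axioms K.abelian_group_axioms DA_D(6)[OF \<xi>]]) auto
    also have "\<dots> = (\<Oplus>\<^bsub>K\<^esub> b \<in> B. scal K A (\<xi> b) (w b) x)"
      using B_closed x DA_D[OF \<xi>] by (intro K.finsum_cong') (auto simp: DA_apply K.m_comm)
    finally show "\<xi> x = (\<Oplus>\<^bsub>DA\<^esub> b \<in> B. scal K A (\<xi> b) (w b)) x"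
      using DA_finsum[OF B_finite c x] by simp
  qed
qed

text \<open>The coordinate forms span the dual space, so a linear map on it is determined by its values at
  the coordinate forms.\<close>

lemma dual_linear_expand:
  assumes V: "left_module K V" and l: "dual_linear K A V l" and \<xi>: "\<xi> \<in> carrier DA"
  shows "l \<xi> = (\<Oplus>\<^bsub>V\<^esub> b \<in> B. \<xi> b \<odot>\<^bsub>V\<^esub> l (w b))"
proof -
  interpret V: left_module K V by fact
  interpret D: left_module "opp A" DA by (rule left_module_DA)
  have l1: "additive_map DA V l" and
    l2: "\<And>k \<xi>. k \<in> carrier K \<Longrightarrow> \<xi> \<in> carrier DA \<Longrightarrow> l (scal K A k \<xi>) = k \<odot>\<^bsub>V\<^esub> l \<xi>"
    using l by (auto simp: dual_linear_def)
  have \<xi>b: "\<xi> b \<in> carrier K" if "b \<in> B" for b using that \<xi> B_closed DA_D(1) by auto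
  have "l \<xi> = l (\<Oplus>\<^bsub>DA\<^esub> b \<in> B. scal K A (\<xi> b) (w b))" using DA_expand[OF \<xi>] by simp
  also have "\<dots> = (\<Oplus>\<^bsub>V\<^esub> b \<in> B. l (scal K A (\<xi> b) (w b)))"
    using B_finite \<xi>b w_closed
    by (intro additive_map_finsum[OF D.M.abelian_group_axioms V.M.abelian_group_axioms l1]) auto
  also have "\<dots> = (\<Oplus>\<^bsub>V\<^esub> b \<in> B. \<xi> b \<odot>\<^bsub>V\<^esub> l (w b))"
    using \<xi>b w_closed additive_mapD(1)[OF l1] by (intro V.M.finsum_cong') (auto simp: l2)
  finally show ?thesis .
qed

lemma finitely_generated_DA: "finitely_generated (opp A) DA"
proof -
  interpret D: left_module "opp A" DA by (rule left_module_DA)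
  show ?thesis
  proof (rule D.finitely_generatedI)
    show "finite (w ` B)" "w ` B \<subseteq> carrier DA" using B_finite w_closed by auto
    fix U assume U: "is_submodule (opp A) DA U" "w ` B \<subseteq> U"
    show "carrier DA \<subseteq> U"
    proof
      fix \<xi> assume \<xi>: "\<xi> \<in> carrier DA"
      have "scal K A (\<xi> b) (w b) \<in> U" if "b \<in> B" for b
        using that U \<xi> B_closed DA_D(1) w_closed by (auto simp: scal_eq is_submodule_def)
      then have "(\<Oplus>\<^bsub>DA\<^esub> b \<in> B. scal K A (\<xi> b) (w b)) \<in> U"
        using U(1) B_finite by (intro D.M.finsum_mem) (auto simp: is_submodule_def)
      then show "\<xi> \<in> U" using DA_expand[OF \<xi>] by simp
    qed
  qed
qed

end


section \<open>The enveloping algebra as a space of linear maps\<close>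

sublocale fd_algebra \<subseteq> T: monoid_ring_module K A "A \<times>\<times> opp A"
proof (intro monoid_ring_module.intro left_module_KA K.cring_axioms DirProd_monoid)
  show "monoid A" by (rule A.monoid_axioms)
  show "monoid (opp A)" using A.ring_opp by (simp add: ring_def)
qed

text \<open>The linear map \<open>\<xi> \<mapsto> \<Sum> \<xi>(a\<^sub>i) b\<^sub>i\<close> attached to a representative \<open>\<Sum> a\<^sub>i \<otimes> b\<^sub>i\<close> of a tensor.\<close>

definition slice :: "('k, 'x) ring_scheme \<Rightarrow> ('k, 'a, 'y) module_scheme \<Rightarrow> ('a \<times> 'a \<Rightarrow> 'k) \<Rightarrow> ('a \<Rightarrow> 'k) \<Rightarrow> 'a" where
  "slice K A f \<xi> = linear_ext K A f (\<lambda>p. \<xi> (fst p) \<odot>\<^bsub>A\<^esub> snd p)"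

definition env_ideal :: "('k, 'x) ring_scheme \<Rightarrow> ('k, 'a, 'y) module_scheme \<Rightarrow> ('a \<times> 'a \<Rightarrow> 'k) set" where
  "env_ideal K A = Idl\<^bsub>monoid_alg K (A \<times>\<times> opp A)\<^esub> (bilinear_relations K A (opp A))"

definition env_class ::
    "('k, 'x) ring_scheme \<Rightarrow> ('k, 'a, 'y) module_scheme \<Rightarrow> ('a \<times> 'a \<Rightarrow> 'k) \<Rightarrow> ('a \<times> 'a \<Rightarrow> 'k) set" where
  "env_class K A f = env_ideal K A +>\<^bsub>monoid_alg K (A \<times>\<times> opp A)\<^esub> f"

definition pure :: "('k, 'x) ring_scheme \<Rightarrow> ('k, 'a, 'y) module_scheme \<Rightarrow> 'a \<Rightarrow> 'a \<Rightarrow> ('a \<times> 'a \<Rightarrow> 'k) set" where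
  "pure K A a b = env_class K A (single K (a, b) \<one>\<^bsub>K\<^esub>)"

definition env_slice ::
    "('k, 'x) ring_scheme \<Rightarrow> ('k, 'a, 'y) module_scheme \<Rightarrow> ('a \<times> 'a \<Rightarrow> 'k) set \<Rightarrow> ('a \<Rightarrow> 'k) \<Rightarrow> 'a" where
  "env_slice K A t \<xi> = slice K A (SOME f. f \<in> carrier (monoid_alg K (A \<times>\<times> opp A)) \<and> env_class K A f = t) \<xi>"

lemma carrier_env [simp]: "p \<in> carrier (A \<times>\<times> opp A) \<longleftrightarrow> fst p \<in> carrier A \<and> snd p \<in> carrier A"
  by (cases p) (simp add: DirProd_def)

lemma mult_env: "p \<otimes>\<^bsub>A \<times>\<times> opp A\<^esub> q = (fst p \<otimes>\<^bsub>A\<^esub> fst q, snd q \<otimes>\<^bsub>A\<^esub> snd p)"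
  by (cases p; cases q) (simp add: DirProd_def)

context fd_algebra
begin

lemma ring_F: "ring T.F"
  by (intro ring_monoid_alg K.cring_axioms T.G.monoid_axioms)

lemma slice_arg: "\<xi> \<in> carrier DA \<Longrightarrow> (\<lambda>p. \<xi> (fst p) \<odot>\<^bsub>A\<^esub> snd p) \<in> carrier (A \<times>\<times> opp A) \<rightarrow> carrier A"
  using DA_D(1) by auto

lemma slice_closed [simp]: "f \<in> carrier T.F \<Longrightarrow> \<xi> \<in> carrier DA \<Longrightarrow> slice K A f \<xi> \<in> carrier A"
  unfolding slice_def by (intro T.linear_ext_closed slice_arg)

lemma slice_additive: "\<xi> \<in> carrier DA \<Longrightarrow> additive_map T.F A (\<lambda>f. slice K A f \<xi>)"
  unfolding additive_map_def slice_def by (auto intro!: T.linear_ext_closed T.linear_ext_add slice_arg simp del: carrier_env)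

lemma slice_single:
  "a \<in> carrier A \<Longrightarrow> b \<in> carrier A \<Longrightarrow> k \<in> carrier K \<Longrightarrow> \<xi> \<in> carrier DA \<Longrightarrow>
    slice K A (single K (a, b) k) \<xi> = (k \<otimes>\<^bsub>K\<^esub> \<xi> a) \<odot>\<^bsub>A\<^esub> b"
  unfolding slice_def using DA_D(1) by (subst T.linear_ext_single) (auto simp: smult_assoc1)

lemma A_mult_hom:
  assumes "a \<in> carrier A" "b \<in> carrier A"
  shows "additive_map A A (\<lambda>x. a \<otimes>\<^bsub>A\<^esub> x \<otimes>\<^bsub>A\<^esub> b)"
    and "k \<in> carrier K \<Longrightarrow> x \<in> carrier A \<Longrightarrow> a \<otimes>\<^bsub>A\<^esub> (k \<odot>\<^bsub>A\<^esub> x) \<otimes>\<^bsub>A\<^esub> b = k \<odot>\<^bsub>A\<^esub> (a \<otimes>\<^bsub>A\<^esub> x \<otimes>\<^bsub>A\<^esub> b)"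
  using assms by (auto simp: additive_map_def A.l_distr A.r_distr smult_mult_left smult_mult_right)

lemma linear_ext_mult_sides:
  assumes "a \<in> carrier A" "b \<in> carrier A" "f \<in> carrier T.F" "\<phi> \<in> carrier (A \<times>\<times> opp A) \<rightarrow> carrier A"
  shows "a \<otimes>\<^bsub>A\<^esub> linear_ext K A f \<phi> \<otimes>\<^bsub>A\<^esub> b = linear_ext K A f (\<lambda>p. a \<otimes>\<^bsub>A\<^esub> \<phi> p \<otimes>\<^bsub>A\<^esub> b)"
  using linear_ext_hom[OF T.monoid_ring_module_axioms T.monoid_ring_module_axioms assms(3)
    A_mult_hom(1)[OF assms(1,2)] A_mult_hom(2)[OF assms(1,2)] assms(4)] by simp

text \<open>The outer and the inner multiplication of \<open>A \<otimes> A\<close> become operations on the slice: multiplying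
  by \<open>a \<otimes> b\<close> on the left twists the argument by the right action of \<open>a\<close> and multiplies the value
  by \<open>b\<close> on the right; multiplying on the right uses the left action and left multiplication.
  Both formulas also show that the tensors with zero slice form an ideal.\<close>

lemma slice_mult_left:
  assumes fg: "f \<in> carrier T.F" "g \<in> carrier T.F" and \<xi>: "\<xi> \<in> carrier DA"
  shows "slice K A (f \<otimes>\<^bsub>T.F\<^esub> g) \<xi> = linear_ext K A f (\<lambda>p. slice K A g (fst p \<odot>\<^bsub>DA\<^esub> \<xi>) \<otimes>\<^bsub>A\<^esub> snd p)"
proof -
  have "slice K A (f \<otimes>\<^bsub>T.F\<^esub> g) \<xi> = linear_ext K A f (\<lambda>p. linear_ext K A g (\<lambda>q.
      \<xi> (fst p \<otimes>\<^bsub>A\<^esub> fst q) \<odot>\<^bsub>A\<^esub> (snd q \<otimes>\<^bsub>A\<^esub> snd p)))"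
    unfolding slice_def T.linear_ext_mult[OF fg slice_arg[OF \<xi>]] by (simp add: mult_env)
  also have "\<dots> = linear_ext K A f (\<lambda>p. slice K A g (fst p \<odot>\<^bsub>DA\<^esub> \<xi>) \<otimes>\<^bsub>A\<^esub> snd p)"
  proof (rule T.linear_ext_cong[OF fg(1)])
    show "(\<lambda>p. linear_ext K A g (\<lambda>q. \<xi> (fst p \<otimes>\<^bsub>A\<^esub> fst q) \<odot>\<^bsub>A\<^esub> (snd q \<otimes>\<^bsub>A\<^esub> snd p)))
        \<in> carrier (A \<times>\<times> opp A) \<rightarrow> carrier A"
      using fg \<xi> DA_D(1) by (intro Pi_I T.linear_ext_closed) auto
    fix p assume p: "p \<in> carrier (A \<times>\<times> opp A)"
    then have p\<xi>: "fst p \<odot>\<^bsub>DA\<^esub> \<xi> \<in> carrier DA" and p2: "snd p \<in> carrier A" using \<xi> by auto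
    have "\<one>\<^bsub>A\<^esub> \<otimes>\<^bsub>A\<^esub> slice K A g (fst p \<odot>\<^bsub>DA\<^esub> \<xi>) \<otimes>\<^bsub>A\<^esub> snd p
      = linear_ext K A g (\<lambda>q. \<one>\<^bsub>A\<^esub> \<otimes>\<^bsub>A\<^esub> ((fst p \<odot>\<^bsub>DA\<^esub> \<xi>) (fst q) \<odot>\<^bsub>A\<^esub> snd q) \<otimes>\<^bsub>A\<^esub> snd p)"
      unfolding slice_def using p2 fg slice_arg[OF p\<xi>] by (intro linear_ext_mult_sides) auto
    also have "\<dots> = linear_ext K A g (\<lambda>q. \<xi> (fst p \<otimes>\<^bsub>A\<^esub> fst q) \<odot>\<^bsub>A\<^esub> (snd q \<otimes>\<^bsub>A\<^esub> snd p))"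
      using p \<xi> DA_D(1)[OF \<xi>]
      by (intro T.linear_ext_cong[OF fg(2)]) (auto simp: DA_apply smult_mult_left)
    finally show "linear_ext K A g (\<lambda>q. \<xi> (fst p \<otimes>\<^bsub>A\<^esub> fst q) \<odot>\<^bsub>A\<^esub> (snd q \<otimes>\<^bsub>A\<^esub> snd p))
      = slice K A g (fst p \<odot>\<^bsub>DA\<^esub> \<xi>) \<otimes>\<^bsub>A\<^esub> snd p" using p\<xi> fg by simp
  qed
  finally show ?thesis .
qed

lemma slice_mult_right:
  assumes fg: "f \<in> carrier T.F" "g \<in> carrier T.F" and \<xi>: "\<xi> \<in> carrier DA"
  shows "slice K A (f \<otimes>\<^bsub>T.F\<^esub> g) \<xi> = linear_ext K A g (\<lambda>q. snd q \<otimes>\<^bsub>A\<^esub> slice K A f (left_act A (fst q) \<xi>))"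
proof -
  have "slice K A (f \<otimes>\<^bsub>T.F\<^esub> g) \<xi> = linear_ext K A f (\<lambda>p. linear_ext K A g (\<lambda>q.
      \<xi> (fst p \<otimes>\<^bsub>A\<^esub> fst q) \<odot>\<^bsub>A\<^esub> (snd q \<otimes>\<^bsub>A\<^esub> snd p)))"
    unfolding slice_def T.linear_ext_mult[OF fg slice_arg[OF \<xi>]] by (simp add: mult_env)
  also have "\<dots> = linear_ext K A g (\<lambda>q. linear_ext K A f (\<lambda>p.
      \<xi> (fst p \<otimes>\<^bsub>A\<^esub> fst q) \<odot>\<^bsub>A\<^esub> (snd q \<otimes>\<^bsub>A\<^esub> snd p)))"
    using DA_D(1)[OF \<xi>] by (intro T.linear_ext_swap fg) auto
  also have "\<dots> = linear_ext K A g (\<lambda>q. snd q \<otimes>\<^bsub>A\<^esub> slice K A f (left_act A (fst q) \<xi>))"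
  proof (rule T.linear_ext_cong[OF fg(2)])
    show "(\<lambda>q. linear_ext K A f (\<lambda>p. \<xi> (fst p \<otimes>\<^bsub>A\<^esub> fst q) \<odot>\<^bsub>A\<^esub> (snd q \<otimes>\<^bsub>A\<^esub> snd p)))
        \<in> carrier (A \<times>\<times> opp A) \<rightarrow> carrier A"
      using fg \<xi> DA_D(1) by (intro Pi_I T.linear_ext_closed) auto
    fix q assume q: "q \<in> carrier (A \<times>\<times> opp A)"
    then have q\<xi>: "left_act A (fst q) \<xi> \<in> carrier DA" and q2: "snd q \<in> carrier A" using \<xi> by auto
    have "snd q \<otimes>\<^bsub>A\<^esub> slice K A f (left_act A (fst q) \<xi>) \<otimes>\<^bsub>A\<^esub> \<one>\<^bsub>A\<^esub>
      = linear_ext K A f (\<lambda>p. snd q \<otimes>\<^bsub>A\<^esub> (left_act A (fst q) \<xi> (fst p) \<odot>\<^bsub>A\<^esub> snd p) \<otimes>\<^bsub>A\<^esub> \<one>\<^bsub>A\<^esub>)"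
      unfolding slice_def using q2 fg slice_arg[OF q\<xi>] by (intro linear_ext_mult_sides) auto
    also have "\<dots> = linear_ext K A f (\<lambda>p. \<xi> (fst p \<otimes>\<^bsub>A\<^esub> fst q) \<odot>\<^bsub>A\<^esub> (snd q \<otimes>\<^bsub>A\<^esub> snd p))"
      using q \<xi> DA_D(1)[OF \<xi>]
      by (intro T.linear_ext_cong[OF fg(1)]) (auto simp: DA_apply smult_mult_right)
    finally show "linear_ext K A f (\<lambda>p. \<xi> (fst p \<otimes>\<^bsub>A\<^esub> fst q) \<odot>\<^bsub>A\<^esub> (snd q \<otimes>\<^bsub>A\<^esub> snd p))
      = snd q \<otimes>\<^bsub>A\<^esub> slice K A f (left_act A (fst q) \<xi>)" using q\<xi> q2 fg by simp
  qed
  finally show ?thesis .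
qed

lemma linear_ext_zero_fun:
  assumes "f \<in> carrier T.F" "\<And>p. p \<in> carrier (A \<times>\<times> opp A) \<Longrightarrow> \<phi> p = \<zero>\<^bsub>A\<^esub>"
  shows "linear_ext K A f \<phi> = \<zero>\<^bsub>A\<^esub>"
proof -
  have "linear_ext K A f \<phi> = (\<Oplus>\<^bsub>A\<^esub> p \<in> supp K f. \<zero>\<^bsub>A\<^esub>)"
    unfolding linear_ext_def using T.FD(1,2)[OF assms(1)] assms(2)
    by (intro A.finsum_cong') (auto simp: subset_iff simp del: carrier_env)
  then show ?thesis by (simp add: A.finsum_zero)
qed

lemma smult_opp [simp]: "smult (opp A) = smult A"
  by (simp add: opp_def)

lemma bilinear_relationsI:
  shows "\<lbrakk>a \<in> carrier A; a' \<in> carrier A; b \<in> carrier A\<rbrakk> \<Longrightarrow>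
      single K (a \<oplus>\<^bsub>A\<^esub> a', b) \<one>\<^bsub>K\<^esub> \<ominus>\<^bsub>T.F\<^esub> (single K (a, b) \<one>\<^bsub>K\<^esub> \<oplus>\<^bsub>T.F\<^esub> single K (a', b) \<one>\<^bsub>K\<^esub>)
      \<in> bilinear_relations K A (opp A)"
    and "\<lbrakk>a \<in> carrier A; b \<in> carrier A; b' \<in> carrier A\<rbrakk> \<Longrightarrow>
      single K (a, b \<oplus>\<^bsub>A\<^esub> b') \<one>\<^bsub>K\<^esub> \<ominus>\<^bsub>T.F\<^esub> (single K (a, b) \<one>\<^bsub>K\<^esub> \<oplus>\<^bsub>T.F\<^esub> single K (a, b') \<one>\<^bsub>K\<^esub>)
      \<in> bilinear_relations K A (opp A)"
    and "\<lbrakk>k \<in> carrier K; a \<in> carrier A; b \<in> carrier A\<rbrakk> \<Longrightarrow>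
      single K (k \<odot>\<^bsub>A\<^esub> a, b) \<one>\<^bsub>K\<^esub> \<ominus>\<^bsub>T.F\<^esub> single K (a, b) k \<in> bilinear_relations K A (opp A)"
    and "\<lbrakk>k \<in> carrier K; a \<in> carrier A; b \<in> carrier A\<rbrakk> \<Longrightarrow>
      single K (a, k \<odot>\<^bsub>A\<^esub> b) \<one>\<^bsub>K\<^esub> \<ominus>\<^bsub>T.F\<^esub> single K (a, b) k \<in> bilinear_relations K A (opp A)"
proof -
  show "\<lbrakk>a \<in> carrier A; a' \<in> carrier A; b \<in> carrier A\<rbrakk> \<Longrightarrow>
      single K (a \<oplus>\<^bsub>A\<^esub> a', b) \<one>\<^bsub>K\<^esub> \<ominus>\<^bsub>T.F\<^esub> (single K (a, b) \<one>\<^bsub>K\<^esub> \<oplus>\<^bsub>T.F\<^esub> single K (a', b) \<one>\<^bsub>K\<^esub>)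
      \<in> bilinear_relations K A (opp A)"
    unfolding bilinear_relations_def Let_def smult_opp opp_simps
    by (rule UnI1, rule UnI1, rule UnI1, rule CollectI, rule exI[of _ a], rule exI[of _ "a'"], rule exI[of _ b])
      simp
  show "\<lbrakk>a \<in> carrier A; b \<in> carrier A; b' \<in> carrier A\<rbrakk> \<Longrightarrow>
      single K (a, b \<oplus>\<^bsub>A\<^esub> b') \<one>\<^bsub>K\<^esub> \<ominus>\<^bsub>T.F\<^esub> (single K (a, b) \<one>\<^bsub>K\<^esub> \<oplus>\<^bsub>T.F\<^esub> single K (a, b') \<one>\<^bsub>K\<^esub>)
      \<in> bilinear_relations K A (opp A)"
    unfolding bilinear_relations_def Let_def smult_opp opp_simps
    by (rule UnI1, rule UnI1, rule UnI2, rule CollectI, rule exI[of _ a], rule exI[of _ b], rule exI[of _ "b'"])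
      simp
  show "\<lbrakk>k \<in> carrier K; a \<in> carrier A; b \<in> carrier A\<rbrakk> \<Longrightarrow>
      single K (k \<odot>\<^bsub>A\<^esub> a, b) \<one>\<^bsub>K\<^esub> \<ominus>\<^bsub>T.F\<^esub> single K (a, b) k \<in> bilinear_relations K A (opp A)"
    unfolding bilinear_relations_def Let_def smult_opp opp_simps
    by (rule UnI1, rule UnI2, rule CollectI, rule exI[of _ k], rule exI[of _ a], rule exI[of _ b])
      simp
  show "\<lbrakk>k \<in> carrier K; a \<in> carrier A; b \<in> carrier A\<rbrakk> \<Longrightarrow>
      single K (a, k \<odot>\<^bsub>A\<^esub> b) \<one>\<^bsub>K\<^esub> \<ominus>\<^bsub>T.F\<^esub> single K (a, b) k \<in> bilinear_relations K A (opp A)"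
    unfolding bilinear_relations_def Let_def smult_opp opp_simps
    by (rule UnI2, rule CollectI, rule exI[of _ k], rule exI[of _ a], rule exI[of _ b])
      simp
qed

lemma relations_closed: "bilinear_relations K A (opp A) \<subseteq> carrier T.F"
proof -
  interpret F: ring T.F by (rule ring_F)
  show ?thesis unfolding bilinear_relations_def Let_def
    by (auto simp: smult_closed intro!: F.minus_closed F.a_closed T.single_closed)
qed

lemma ideal_slice_kernel:
  "ideal {f \<in> carrier T.F. \<forall>\<xi> \<in> carrier DA. slice K A f \<xi> = \<zero>\<^bsub>A\<^esub>} T.F" (is "ideal ?N _")
proof (rule idealI[OF ring_F])
  interpret F: ring T.F by (rule ring_F)
  note add = slice_additive[THEN additive_mapD(2)]
  show "subgroup ?N (add_monoid T.F)"
  proof (rule F.add.subgroupI)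
    show "?N \<noteq> {}"
      using additive_map_zero[OF F.abelian_group_axioms A.abelian_group_axioms slice_additive] by blast
    fix f assume f: "f \<in> ?N"
    have "slice K A (\<ominus>\<^bsub>T.F\<^esub> f) \<xi> = \<zero>\<^bsub>A\<^esub>" if \<xi>: "\<xi> \<in> carrier DA" for \<xi>
    proof -
      have "slice K A (\<zero>\<^bsub>T.F\<^esub> \<ominus>\<^bsub>T.F\<^esub> f) \<xi> = \<zero>\<^bsub>A\<^esub> \<ominus>\<^bsub>A\<^esub> \<zero>\<^bsub>A\<^esub>"
        using f \<xi> additive_map_zero[OF F.abelian_group_axioms A.abelian_group_axioms slice_additive[OF \<xi>]]
          additive_map_minus[OF F.abelian_group_axioms A.abelian_group_axioms slice_additive[OF \<xi>], of "\<zero>\<^bsub>T.F\<^esub>" f]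
        by simp
      then show ?thesis using f by (simp add: F.minus_eq A.minus_eq)
    qed
    then show "\<ominus>\<^bsub>T.F\<^esub> f \<in> ?N" using f by simp
  qed (auto simp: add)
next
  fix f g assume f: "f \<in> {f \<in> carrier T.F. \<forall>\<xi> \<in> carrier DA. slice K A f \<xi> = \<zero>\<^bsub>A\<^esub>}" and g: "g \<in> carrier T.F"
  show "g \<otimes>\<^bsub>T.F\<^esub> f \<in> ?N"
    using f g T.mult_closed by (auto simp: slice_mult_left intro!: linear_ext_zero_fun)
  show "f \<otimes>\<^bsub>T.F\<^esub> g \<in> ?N"
    using f g T.mult_closed by (auto simp: slice_mult_right intro!: linear_ext_zero_fun)
qed

lemma ideal_env_ideal: "ideal (env_ideal K A) T.F"
  unfolding env_ideal_def using ring.genideal_ideal[OF ring_F relations_closed] .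

text \<open>Slices are well defined on the tensor product: the bilinearity relations have zero slice, and
  the tensors with zero slice form an ideal.\<close>

lemma slice_env_ideal:
  assumes "f \<in> env_ideal K A" "\<xi> \<in> carrier DA"
  shows "slice K A f \<xi> = \<zero>\<^bsub>A\<^esub>"
proof -
  interpret F: ring T.F by (rule ring_F)
  note sub = additive_map_minus[OF F.abelian_group_axioms A.abelian_group_axioms slice_additive]
  note add = slice_additive[THEN additive_mapD(2)]
  have "bilinear_relations K A (opp A) \<subseteq> {f \<in> carrier T.F. \<forall>\<xi> \<in> carrier DA. slice K A f \<xi> = \<zero>\<^bsub>A\<^esub>}"
  proof (intro subsetI CollectI conjI ballI)
    fix f assume f: "f \<in> bilinear_relations K A (opp A)"
    show "f \<in> carrier T.F" using f relations_closed by auto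
    fix \<xi> assume \<xi>: "\<xi> \<in> carrier DA"
    note D = DA_D(1-3)[OF \<xi>]
    have comm: "\<xi> a \<odot>\<^bsub>A\<^esub> (k \<odot>\<^bsub>A\<^esub> b) = k \<odot>\<^bsub>A\<^esub> (\<xi> a \<odot>\<^bsub>A\<^esub> b)"
      if "a \<in> carrier A" "b \<in> carrier A" "k \<in> carrier K" for a b k
      using that D by (simp add: smult_assoc1[symmetric] K.m_comm)
    show "slice K A f \<xi> = \<zero>\<^bsub>A\<^esub>"
      using f \<xi> unfolding bilinear_relations_def Let_def
      by (auto simp: sub add slice_single D smult_closed A.minus_eq A.r_neg smult_l_distr smult_r_distr
          smult_assoc1 K.m_comm comm)
  qed
  then have "env_ideal K A \<subseteq> {f \<in> carrier T.F. \<forall>\<xi> \<in> carrier DA. slice K A f \<xi> = \<zero>\<^bsub>A\<^esub>}"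
    unfolding env_ideal_def by (intro F.genideal_minimal ideal_slice_kernel)
  then show ?thesis using assms by auto
qed

abbreviation "E \<equiv> env_alg K A"

lemma env_alg_eq_quotient: "E = T.F Quot env_ideal K A"
  by (simp add: env_alg_def tensor_alg_def env_ideal_def Let_def)

lemma ring_E: "ring E"
  unfolding env_alg_eq_quotient by (rule ideal.quotient_is_ring[OF ideal_env_ideal])

lemma class_hom: "env_class K A \<in> ring_hom T.F E"
proof -
  have "env_class K A = (+>\<^bsub>T.F\<^esub>) (env_ideal K A)" by (auto simp: env_class_def fun_eq_iff)
  then show ?thesis unfolding env_alg_eq_quotient using ideal.rcos_ring_hom[OF ideal_env_ideal] by simp
qed

lemma class_additive: "additive_map T.F E (env_class K A)"
  using class_hom by (auto simp: additive_map_def ring_hom_def)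

lemma class_surj: "t \<in> carrier E \<Longrightarrow> \<exists>f \<in> carrier T.F. env_class K A f = t"
  unfolding env_alg_eq_quotient by (auto simp: FactRing_def A_RCOSETS_def' env_class_def)

lemma class_eq_iff:
  "f \<in> carrier T.F \<Longrightarrow> g \<in> carrier T.F \<Longrightarrow>
    env_class K A f = env_class K A g \<longleftrightarrow> f \<ominus>\<^bsub>T.F\<^esub> g \<in> env_ideal K A"
  unfolding env_class_def using ring.quotient_eq_iff_same_a_r_cos[OF ring_F ideal_env_ideal] by simp

lemma mem_class:
  assumes "f \<in> carrier T.F" "g \<in> env_class K A f"
  shows "g \<in> carrier T.F \<and> env_class K A g = env_class K A f"
proof -
  interpret F: ring T.F by (rule ring_F)
  interpret ideal "env_ideal K A" T.F by (rule ideal_env_ideal)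
  obtain i where i: "i \<in> env_ideal K A" "g = i \<oplus>\<^bsub>T.F\<^esub> f"
    using assms(2) by (auto simp: env_class_def a_r_coset_def')
  then have iF: "i \<in> carrier T.F" by (simp add: Icarr)
  then have g: "g \<in> carrier T.F" using i assms by simp
  have "g \<ominus>\<^bsub>T.F\<^esub> f = i" using i iF assms by (simp add: F.minus_eq F.a_assoc F.r_neg)
  then show ?thesis using g i class_eq_iff[OF g assms(1)] by simp
qed

lemma self_mem_class: "f \<in> carrier T.F \<Longrightarrow> f \<in> env_class K A f"
  unfolding env_class_def using abelian_subgroup.a_rcos_self[OF abelian_subgroupI3] ideal_env_ideal
  by (metis ideal.axioms(1) ring.is_abelian_group ring_F)

lemma slice_cong:
  assumes "f \<in> carrier T.F" "g \<in> carrier T.F" "env_class K A f = env_class K A g" "\<xi> \<in> carrier DA"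
  shows "slice K A f \<xi> = slice K A g \<xi>"
proof -
  interpret F: ring T.F by (rule ring_F)
  have "slice K A (f \<ominus>\<^bsub>T.F\<^esub> g) \<xi> = \<zero>\<^bsub>A\<^esub>"
    using class_eq_iff assms slice_env_ideal by blast
  then have "slice K A f \<xi> \<ominus>\<^bsub>A\<^esub> slice K A g \<xi> = \<zero>\<^bsub>A\<^esub>"
    using additive_map_minus[OF F.abelian_group_axioms A.abelian_group_axioms slice_additive[OF assms(4)] assms(1,2)]
    by simp
  then show ?thesis using assms slice_closed by (auto intro: A.minus_zero_imp_eq)
qed

lemma env_slice_class:
  assumes "f \<in> carrier T.F" "\<xi> \<in> carrier DA"
  shows "env_slice K A (env_class K A f) \<xi> = slice K A f \<xi>"
proof -
  let ?P = "\<lambda>g. g \<in> carrier T.F \<and> env_class K A g = env_class K A f"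
  have "?P (SOME g. ?P g)" using assms by (intro someI[of ?P f]) auto
  then show ?thesis unfolding env_slice_def using assms by (intro slice_cong) auto
qed

lemma pure_closed [simp]: "a \<in> carrier A \<Longrightarrow> b \<in> carrier A \<Longrightarrow> pure K A a b \<in> carrier E"
  unfolding pure_def using additive_mapD(1)[OF class_additive] by simp

lemma env_slice_closed [simp]:
  assumes "t \<in> carrier E" "\<xi> \<in> carrier DA" shows "env_slice K A t \<xi> \<in> carrier A"
  using class_surj[OF assms(1)] assms(2) env_slice_class by force

lemma env_slice_additive:
  assumes \<xi>: "\<xi> \<in> carrier DA" shows "additive_map E A (\<lambda>t. env_slice K A t \<xi>)"
  unfolding additive_map_def
proof (intro conjI ballI)
  show "(\<lambda>t. env_slice K A t \<xi>) \<in> carrier E \<rightarrow> carrier A" using \<xi> by auto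
  fix s t assume "s \<in> carrier E" "t \<in> carrier E"
  then obtain f g where fg: "f \<in> carrier T.F" "env_class K A f = s" "g \<in> carrier T.F" "env_class K A g = t"
    using class_surj by metis
  then have "s \<oplus>\<^bsub>E\<^esub> t = env_class K A (f \<oplus>\<^bsub>T.F\<^esub> g)" using additive_mapD(2)[OF class_additive] by auto
  then show "env_slice K A (s \<oplus>\<^bsub>E\<^esub> t) \<xi> = env_slice K A s \<xi> \<oplus>\<^bsub>A\<^esub> env_slice K A t \<xi>"
    using fg \<xi> T.add_closed[OF fg(1,3)] additive_mapD(2)[OF slice_additive[OF \<xi>]] env_slice_class by auto
qed

lemma env_slice_pure:
  "a \<in> carrier A \<Longrightarrow> b \<in> carrier A \<Longrightarrow> \<xi> \<in> carrier DA \<Longrightarrow> env_slice K A (pure K A a b) \<xi> = \<xi> a \<odot>\<^bsub>A\<^esub> b"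
  unfolding pure_def by (simp add: env_slice_class slice_single DA_D(1))

lemma env_slice_mult_left:
  assumes "a \<in> carrier A" "b \<in> carrier A" "t \<in> carrier E" "\<xi> \<in> carrier DA"
  shows "env_slice K A (pure K A a b \<otimes>\<^bsub>E\<^esub> t) \<xi> = env_slice K A t (a \<odot>\<^bsub>DA\<^esub> \<xi>) \<otimes>\<^bsub>A\<^esub> b"
proof -
  obtain f where f: "f \<in> carrier T.F" "env_class K A f = t" using class_surj assms by blast
  have s: "single K (a, b) \<one>\<^bsub>K\<^esub> \<in> carrier T.F" using assms by simp
  have "pure K A a b \<otimes>\<^bsub>E\<^esub> t = env_class K A (single K (a, b) \<one>\<^bsub>K\<^esub> \<otimes>\<^bsub>T.F\<^esub> f)"
    unfolding pure_def using ring_hom_mult[OF class_hom s f(1)] f(2) by simp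
  moreover have "slice K A (single K (a, b) \<one>\<^bsub>K\<^esub> \<otimes>\<^bsub>T.F\<^esub> f) \<xi> = slice K A f (a \<odot>\<^bsub>DA\<^esub> \<xi>) \<otimes>\<^bsub>A\<^esub> b"
    unfolding slice_mult_left[OF s f(1) assms(4)] using assms f by (subst T.linear_ext_single) auto
  ultimately show ?thesis using f(1) assms T.mult_closed[OF s f(1)] T.mult_closed[OF f(1) s]
    by (simp add: env_slice_class f(2)[symmetric])
qed

lemma env_slice_mult_right:
  assumes "a \<in> carrier A" "b \<in> carrier A" "t \<in> carrier E" "\<xi> \<in> carrier DA"
  shows "env_slice K A (t \<otimes>\<^bsub>E\<^esub> pure K A a b) \<xi> = b \<otimes>\<^bsub>A\<^esub> env_slice K A t (left_act A a \<xi>)"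
proof -
  obtain f where f: "f \<in> carrier T.F" "env_class K A f = t" using class_surj assms by blast
  have s: "single K (a, b) \<one>\<^bsub>K\<^esub> \<in> carrier T.F" using assms by simp
  have "t \<otimes>\<^bsub>E\<^esub> pure K A a b = env_class K A (f \<otimes>\<^bsub>T.F\<^esub> single K (a, b) \<one>\<^bsub>K\<^esub>)"
    unfolding pure_def using ring_hom_mult[OF class_hom f(1) s] f(2) by simp
  moreover have "slice K A (f \<otimes>\<^bsub>T.F\<^esub> single K (a, b) \<one>\<^bsub>K\<^esub>) \<xi> = b \<otimes>\<^bsub>A\<^esub> slice K A f (left_act A a \<xi>)"
    unfolding slice_mult_right[OF f(1) s assms(4)] using assms f by (subst T.linear_ext_single) auto
  ultimately show ?thesis using f(1) assms T.mult_closed[OF s f(1)] T.mult_closed[OF f(1) s]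
    by (simp add: env_slice_class f(2)[symmetric])
qed

lemma rel_class:
  assumes "f \<in> carrier T.F" "g \<in> carrier T.F" "f \<ominus>\<^bsub>T.F\<^esub> g \<in> bilinear_relations K A (opp A)"
  shows "env_class K A f = env_class K A g"
  using assms class_eq_iff ring.genideal_self[OF ring_F relations_closed] by (auto simp: env_ideal_def)

lemma pure_additive:
  "b \<in> carrier A \<Longrightarrow> additive_map A E (\<lambda>a. pure K A a b)"
  "a \<in> carrier A \<Longrightarrow> additive_map A E (\<lambda>b. pure K A a b)"
proof -
  interpret F: ring T.F by (rule ring_F)
  note add = additive_mapD(2)[OF class_additive, symmetric]
  show "additive_map A E (\<lambda>a. pure K A a b)" if b: "b \<in> carrier A"
    unfolding additive_map_def
  proof (intro conjI ballI)
    fix a a' assume aa: "a \<in> carrier A" "a' \<in> carrier A"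
    show "pure K A (a \<oplus>\<^bsub>A\<^esub> a') b = pure K A a b \<oplus>\<^bsub>E\<^esub> pure K A a' b"
      unfolding pure_def using aa b
      by (subst add, simp, simp, intro rel_class bilinear_relationsI) simp_all
  qed (use b in auto)
  show "additive_map A E (\<lambda>b. pure K A a b)" if a: "a \<in> carrier A"
    unfolding additive_map_def
  proof (intro conjI ballI)
    fix b b' assume bb: "b \<in> carrier A" "b' \<in> carrier A"
    show "pure K A a (b \<oplus>\<^bsub>A\<^esub> b') = pure K A a b \<oplus>\<^bsub>E\<^esub> pure K A a b'"
      unfolding pure_def using bb a
      by (subst add, simp, simp, intro rel_class bilinear_relationsI) simp_all
  qed (use a in auto)
qed

lemma pure_smult:
  assumes "k \<in> carrier K" "a \<in> carrier A" "b \<in> carrier A"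
  shows "env_class K A (single K (a, b) k) = pure K A (k \<odot>\<^bsub>A\<^esub> a) b"
    and "pure K A (k \<odot>\<^bsub>A\<^esub> a) b = pure K A a (k \<odot>\<^bsub>A\<^esub> b)"
proof -
  show 1: "env_class K A (single K (a, b) k) = pure K A (k \<odot>\<^bsub>A\<^esub> a) b"
    unfolding pure_def using assms
    by (intro rel_class[symmetric] bilinear_relationsI) simp_all
  have "env_class K A (single K (a, b) k) = pure K A a (k \<odot>\<^bsub>A\<^esub> b)"
    unfolding pure_def using assms
    by (intro rel_class[symmetric] bilinear_relationsI) simp_all
  then show "pure K A (k \<odot>\<^bsub>A\<^esub> a) b = pure K A a (k \<odot>\<^bsub>A\<^esub> b)" using 1 by simp
qed

text \<open>Scalar multiples of pure tensors are pure tensors, and so is zero.\<close>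

lemma E_induct [consumes 1, case_names pure add]:
  assumes "t \<in> carrier E"
    and pure: "\<And>a b. a \<in> carrier A \<Longrightarrow> b \<in> carrier A \<Longrightarrow> P (pure K A a b)"
    and add: "\<And>s t. s \<in> carrier E \<Longrightarrow> t \<in> carrier E \<Longrightarrow> P s \<Longrightarrow> P t \<Longrightarrow> P (s \<oplus>\<^bsub>E\<^esub> t)"
  shows "P t"
proof -
  interpret E: ring E by (rule ring_E)
  interpret F: ring T.F by (rule ring_F)
  obtain f where f: "f \<in> carrier T.F" "env_class K A f = t" using class_surj assms by blast
  from f(1) have "P (env_class K A f)"
  proof (induction f rule: T.F_induct)
    case zero
    have "env_class K A \<zero>\<^bsub>T.F\<^esub> = pure K A \<zero>\<^bsub>A\<^esub> \<zero>\<^bsub>A\<^esub>"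
      using additive_map_zero[OF F.abelian_group_axioms E.abelian_group_axioms class_additive]
        additive_map_zero[OF A.abelian_group_axioms E.abelian_group_axioms pure_additive(1)] by simp
    then show ?case using pure by simp
  next
    case (single p k)
    then obtain a b where "p = (a, b)" "a \<in> carrier A" "b \<in> carrier A" by (cases p) auto
    then show ?case using single pure_smult(1) pure by simp
  next
    case (add f g)
    then show ?case using additive_mapD[OF class_additive] assms(3) by simp
  qed
  then show ?thesis using f by simp
qed

end

context based_algebra
begin

text \<open>Expanding the left factor in the basis recovers a tensor from its slices at the coordinate forms.
  This is the only place where the relations have to generate the kernel of the slice map; it
  gives injectivity, and its right-hand side is the inverse map.\<close>

lemma env_expand:
  assumes "t \<in> carrier E"
  shows "t = (\<Oplus>\<^bsub>E\<^esub> b \<in> B. pure K A b (env_slice K A t (w b)))"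
  using assms
proof (induction t rule: E_induct)
  case (pure a c)
  interpret E: ring E by (rule ring_E)
  have "(\<Oplus>\<^bsub>E\<^esub> b \<in> B. pure K A b (env_slice K A (pure K A a c) (w b))) = (\<Oplus>\<^bsub>E\<^esub> b \<in> B. pure K A (w b a \<odot>\<^bsub>A\<^esub> b) c)"
    using pure B_closed w_closed by (intro E.finsum_cong') (auto simp: env_slice_pure pure_smult(2))
  also have "\<dots> = pure K A (\<Oplus>\<^bsub>A\<^esub> b \<in> B. w b a \<odot>\<^bsub>A\<^esub> b) c"
    using pure B_closed B_finite
    by (intro additive_map_finsum[OF A.abelian_group_axioms E.abelian_group_axioms pure_additive(1), symmetric]) auto
  finally show ?case using pure expand by simp
next
  case (add s t)
  interpret E: ring E by (rule ring_E)
  have c: "env_slice K A s (w b) \<in> carrier A" "env_slice K A t (w b) \<in> carrier A" if "b \<in> B" for b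
    using add w_closed that by auto
  have "(\<Oplus>\<^bsub>E\<^esub> b \<in> B. pure K A b (env_slice K A (s \<oplus>\<^bsub>E\<^esub> t) (w b)))
    = (\<Oplus>\<^bsub>E\<^esub> b \<in> B. pure K A b (env_slice K A s (w b)) \<oplus>\<^bsub>E\<^esub> pure K A b (env_slice K A t (w b)))"
    using add(1,2) c B_closed w_closed
    by (intro E.finsum_cong')
      (auto simp: additive_mapD(2)[OF env_slice_additive] additive_mapD(2)[OF pure_additive(2)])
  also have "\<dots> = s \<oplus>\<^bsub>E\<^esub> t"
    using c B_closed add(3,4)[symmetric] by (subst E.finsum_addf) auto
  finally show ?case by simp
qed

lemma env_slice_inject:
  assumes "s \<in> carrier E" "t \<in> carrier E" "\<And>\<xi>. \<xi> \<in> carrier DA \<Longrightarrow> env_slice K A s \<xi> = env_slice K A t \<xi>"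
  shows "s = t"
proof -
  interpret E: ring E by (rule ring_E)
  have "s = (\<Oplus>\<^bsub>E\<^esub> b \<in> B. pure K A b (env_slice K A s (w b)))" by (rule env_expand[OF assms(1)])
  also have "\<dots> = (\<Oplus>\<^bsub>E\<^esub> b \<in> B. pure K A b (env_slice K A t (w b)))"
    using assms w_closed B_closed by (intro E.finsum_cong') auto
  also have "\<dots> = t" using env_expand[OF assms(2)] by simp
  finally show ?thesis .
qed

lemma env_slice_dual_linear:
  assumes "t \<in> carrier E" shows "dual_linear K A A (env_slice K A t)"
  using assms
proof (induction t rule: E_induct)
  case (pure a b)
  then show ?case
    by (auto simp: dual_linear_def additive_map_def env_slice_pure DA_apply DA_D(1) smult_l_distr smult_assoc1)
next
  case (add s t)
  note sl = additive_mapD(2)[OF env_slice_additive]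
  have s: "\<And>\<xi>. \<xi> \<in> carrier DA \<Longrightarrow> env_slice K A s \<xi> \<in> carrier A" "\<And>\<xi>. \<xi> \<in> carrier DA \<Longrightarrow> env_slice K A t \<xi> \<in> carrier A"
    using add by auto
  show ?case using add
    by (auto simp: dual_linear_def additive_map_def sl s smult_r_distr A.a_ac)
qed

lemma env_slice_surj:
  assumes l: "dual_linear K A A l"
  obtains t where "t \<in> carrier E" "\<And>\<xi>. \<xi> \<in> carrier DA \<Longrightarrow> env_slice K A t \<xi> = l \<xi>"
proof -
  interpret E: ring E by (rule ring_E)
  have lc: "l (w b) \<in> carrier A" if "b \<in> B" for b
    using l that w_closed by (auto simp: dual_linear_def additive_map_def)
  let ?t = "\<Oplus>\<^bsub>E\<^esub> b \<in> B. pure K A b (l (w b))"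
  have "?t \<in> carrier E" using lc B_closed by (intro E.finsum_closed) auto
  moreover have "env_slice K A ?t \<xi> = l \<xi>" if \<xi>: "\<xi> \<in> carrier DA" for \<xi>
  proof -
    have "env_slice K A ?t \<xi> = (\<Oplus>\<^bsub>A\<^esub> b \<in> B. env_slice K A (pure K A b (l (w b))) \<xi>)"
      using lc B_closed B_finite
      by (intro additive_map_finsum[OF E.abelian_group_axioms A.abelian_group_axioms env_slice_additive[OF \<xi>]]) auto
    also have "\<dots> = (\<Oplus>\<^bsub>A\<^esub> b \<in> B. \<xi> b \<odot>\<^bsub>A\<^esub> l (w b))"
      using lc B_closed \<xi> DA_D(1)[OF \<xi>] by (intro A.finsum_cong') (auto simp: env_slice_pure)
    also have "\<dots> = l \<xi>" using dual_linear_expand[OF left_module_KA l \<xi>] by simp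
    finally show ?thesis .
  qed
  ultimately show thesis using that by blast
qed

abbreviation "RB \<equiv> regular_bimodule K A"

lemma RB_simps [simp]: "carrier RB = carrier A" "zero RB = zero A" "add RB = add A"
  by (simp_all add: regular_bimodule_def)

text \<open>The action of a representative on \<open>A\<close> depends on its slices only. Hence the action is well
  defined on the enveloping algebra, and the image under \<open>the_elem\<close> is a singleton.\<close>

lemma linear_ext_bimodule:
  assumes "f \<in> carrier T.F" "x \<in> carrier A"
  shows "linear_ext K A f (\<lambda>p. fst p \<otimes>\<^bsub>A\<^esub> x \<otimes>\<^bsub>A\<^esub> snd p)
    = (\<Oplus>\<^bsub>A\<^esub> b \<in> B. b \<otimes>\<^bsub>A\<^esub> x \<otimes>\<^bsub>A\<^esub> slice K A f (w b))"
  using assms(1)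
proof (induction f rule: T.F_induct)
  case zero
  have "slice K A \<zero>\<^bsub>T.F\<^esub> (w b) = \<zero>\<^bsub>A\<^esub>" for b by (simp add: slice_def)
  then have "(\<Oplus>\<^bsub>A\<^esub> b \<in> B. b \<otimes>\<^bsub>A\<^esub> x \<otimes>\<^bsub>A\<^esub> slice K A \<zero>\<^bsub>T.F\<^esub> (w b)) = (\<Oplus>\<^bsub>A\<^esub> b \<in> B. \<zero>\<^bsub>A\<^esub>)"
    using B_closed assms(2) by (intro A.finsum_cong') auto
  then show ?case by (simp add: A.finsum_zero)
next
  case (single p k)
  obtain a c where p: "p = (a, c)" "a \<in> carrier A" "c \<in> carrier A" using single by (cases p) auto
  have "(\<Oplus>\<^bsub>A\<^esub> b \<in> B. b \<otimes>\<^bsub>A\<^esub> x \<otimes>\<^bsub>A\<^esub> slice K A (single K p k) (w b))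
    = (\<Oplus>\<^bsub>A\<^esub> b \<in> B. \<one>\<^bsub>A\<^esub> \<otimes>\<^bsub>A\<^esub> (w b a \<odot>\<^bsub>A\<^esub> b) \<otimes>\<^bsub>A\<^esub> (k \<odot>\<^bsub>A\<^esub> (x \<otimes>\<^bsub>A\<^esub> c)))"
    using p single(2) assms(2) B_closed w_closed
    by (intro A.finsum_cong')
      (auto simp: slice_single smult_mult_left smult_mult_right smult_assoc1[symmetric] A.m_assoc K.m_comm)
  also have "\<dots> = \<one>\<^bsub>A\<^esub> \<otimes>\<^bsub>A\<^esub> (\<Oplus>\<^bsub>A\<^esub> b \<in> B. w b a \<odot>\<^bsub>A\<^esub> b) \<otimes>\<^bsub>A\<^esub> (k \<odot>\<^bsub>A\<^esub> (x \<otimes>\<^bsub>A\<^esub> c))"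
    using p single(2) assms(2) B_closed B_finite
    by (intro additive_map_finsum[OF A.abelian_group_axioms A.abelian_group_axioms A_mult_hom(1), symmetric]) auto
  also have "\<dots> = k \<odot>\<^bsub>A\<^esub> (a \<otimes>\<^bsub>A\<^esub> x \<otimes>\<^bsub>A\<^esub> c)"
    using p single(2) assms(2) expand by (simp add: smult_mult_right A.m_assoc)
  finally show ?case using p single(2) assms(2) by (subst T.linear_ext_single) auto
next
  case (add f g)
  have c: "slice K A f (w b) \<in> carrier A" "slice K A g (w b) \<in> carrier A" if "b \<in> B" for b
    using add w_closed that by auto
  have "(\<Oplus>\<^bsub>A\<^esub> b \<in> B. b \<otimes>\<^bsub>A\<^esub> x \<otimes>\<^bsub>A\<^esub> slice K A (f \<oplus>\<^bsub>T.F\<^esub> g) (w b))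
    = (\<Oplus>\<^bsub>A\<^esub> b \<in> B. b \<otimes>\<^bsub>A\<^esub> x \<otimes>\<^bsub>A\<^esub> slice K A f (w b) \<oplus>\<^bsub>A\<^esub> b \<otimes>\<^bsub>A\<^esub> x \<otimes>\<^bsub>A\<^esub> slice K A g (w b))"
    using add(1,2) c B_closed w_closed assms(2)
    by (intro A.finsum_cong') (auto simp: additive_mapD(2)[OF slice_additive] A.r_distr)
  also have "\<dots> = (\<Oplus>\<^bsub>A\<^esub> b \<in> B. b \<otimes>\<^bsub>A\<^esub> x \<otimes>\<^bsub>A\<^esub> slice K A f (w b)) \<oplus>\<^bsub>A\<^esub> (\<Oplus>\<^bsub>A\<^esub> b \<in> B. b \<otimes>\<^bsub>A\<^esub> x \<otimes>\<^bsub>A\<^esub> slice K A g (w b))"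
    using c B_closed assms(2) by (intro A.finsum_addf) auto
  also have "\<dots> = linear_ext K A (f \<oplus>\<^bsub>T.F\<^esub> g) (\<lambda>p. fst p \<otimes>\<^bsub>A\<^esub> x \<otimes>\<^bsub>A\<^esub> snd p)"
    using add assms(2) by (subst T.linear_ext_add) auto
  finally show ?case by simp
qed

lemma RB_smult_class:
  assumes f: "f \<in> carrier T.F" and x: "x \<in> carrier A"
  shows "env_class K A f \<odot>\<^bsub>RB\<^esub> x = (\<Oplus>\<^bsub>A\<^esub> b \<in> B. b \<otimes>\<^bsub>A\<^esub> x \<otimes>\<^bsub>A\<^esub> slice K A f (w b))"
proof -
  let ?act = "\<lambda>f. \<Oplus>\<^bsub>A\<^esub> p \<in> supp K f. f p \<odot>\<^bsub>A\<^esub> (fst p \<otimes>\<^bsub>A\<^esub> x \<otimes>\<^bsub>A\<^esub> snd p)"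
  have "?act g = ?act f" if "g \<in> env_class K A f" for g
  proof -
    have g: "g \<in> carrier T.F" "env_class K A g = env_class K A f" using mem_class[OF f that] by auto
    have "(\<Oplus>\<^bsub>A\<^esub> b \<in> B. b \<otimes>\<^bsub>A\<^esub> x \<otimes>\<^bsub>A\<^esub> slice K A g (w b)) = (\<Oplus>\<^bsub>A\<^esub> b \<in> B. b \<otimes>\<^bsub>A\<^esub> x \<otimes>\<^bsub>A\<^esub> slice K A f (w b))"
      using B_closed w_closed f g x slice_cong[OF g(1) f g(2)] by (intro A.finsum_cong') auto
    then show ?thesis using linear_ext_bimodule[OF g(1) x] linear_ext_bimodule[OF f x] by (simp add: linear_ext_def)
  qed
  then have "?act ` env_class K A f = {?act f}" using self_mem_class[OF f] by blast
  then show ?thesis using linear_ext_bimodule[OF f x] by (simp add: regular_bimodule_def linear_ext_def)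
qed

lemma RB_smult:
  assumes "t \<in> carrier E" and x: "x \<in> carrier A"
  shows "t \<odot>\<^bsub>RB\<^esub> x = (\<Oplus>\<^bsub>A\<^esub> b \<in> B. b \<otimes>\<^bsub>A\<^esub> x \<otimes>\<^bsub>A\<^esub> env_slice K A t (w b))"
proof -
  obtain f where f: "f \<in> carrier T.F" "env_class K A f = t" using class_surj assms by blast
  then show ?thesis using RB_smult_class[OF f(1) x] w_closed B_closed x
    by (auto simp: env_slice_class intro!: A.finsum_cong')
qed

lemma RB_smult_closed [simp]: "t \<in> carrier E \<Longrightarrow> x \<in> carrier A \<Longrightarrow> t \<odot>\<^bsub>RB\<^esub> x \<in> carrier A"
  using B_closed w_closed by (auto simp: RB_smult intro!: A.finsum_closed)

lemma RB_additive:
  assumes "x \<in> carrier A" shows "additive_map E A (\<lambda>t. t \<odot>\<^bsub>RB\<^esub> x)"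
  unfolding additive_map_def
proof (intro conjI ballI)
  interpret E: ring E by (rule ring_E)
  fix s t assume st: "s \<in> carrier E" "t \<in> carrier E"
  have "(\<Oplus>\<^bsub>A\<^esub> b \<in> B. b \<otimes>\<^bsub>A\<^esub> x \<otimes>\<^bsub>A\<^esub> env_slice K A (s \<oplus>\<^bsub>E\<^esub> t) (w b))
    = (\<Oplus>\<^bsub>A\<^esub> b \<in> B. b \<otimes>\<^bsub>A\<^esub> x \<otimes>\<^bsub>A\<^esub> env_slice K A s (w b) \<oplus>\<^bsub>A\<^esub> b \<otimes>\<^bsub>A\<^esub> x \<otimes>\<^bsub>A\<^esub> env_slice K A t (w b))"
    using st B_closed w_closed assms
    by (intro A.finsum_cong') (auto simp: additive_mapD(2)[OF env_slice_additive] A.r_distr)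
  then show "(s \<oplus>\<^bsub>E\<^esub> t) \<odot>\<^bsub>RB\<^esub> x = s \<odot>\<^bsub>RB\<^esub> x \<oplus>\<^bsub>A\<^esub> t \<odot>\<^bsub>RB\<^esub> x"
    using st B_closed w_closed assms by (simp add: RB_smult)
qed (use assms in auto)

lemma RB_pure:
  assumes "a \<in> carrier A" "b \<in> carrier A" "x \<in> carrier A"
  shows "pure K A a b \<odot>\<^bsub>RB\<^esub> x = a \<otimes>\<^bsub>A\<^esub> x \<otimes>\<^bsub>A\<^esub> b"
proof -
  have "pure K A a b \<odot>\<^bsub>RB\<^esub> x = linear_ext K A (single K (a, b) \<one>\<^bsub>K\<^esub>) (\<lambda>p. fst p \<otimes>\<^bsub>A\<^esub> x \<otimes>\<^bsub>A\<^esub> snd p)"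
    unfolding pure_def using assms by (simp add: RB_smult_class linear_ext_bimodule)
  also have "\<dots> = a \<otimes>\<^bsub>A\<^esub> x \<otimes>\<^bsub>A\<^esub> b" using assms by (subst T.linear_ext_single) auto
  finally show ?thesis .
qed

end


section \<open>Reflexivity in terms of the dual space\<close>

definition twist ::
    "('k, 'x) ring_scheme \<Rightarrow> ('k, 'a, 'y) module_scheme \<Rightarrow> 'a \<Rightarrow> 'a \<Rightarrow> (('a \<Rightarrow> 'k) \<Rightarrow> 'a) \<Rightarrow> ('a \<Rightarrow> 'k) \<Rightarrow> 'a" where
  "twist K A d c l = (\<lambda>\<xi> \<in> carrier (right_dual K A). d \<otimes>\<^bsub>A\<^esub> l (left_act A c \<xi>))"

text \<open>The counterpart of an element of the bidual of the bimodule \<open>A\<close>. The third condition is linearity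
  over the enveloping algebra, restricted to pure tensors.\<close>

definition equivariant ::
    "('k, 'x) ring_scheme \<Rightarrow> ('k, 'a, 'y) module_scheme \<Rightarrow>
     ((('a \<Rightarrow> 'k) \<Rightarrow> 'a) \<Rightarrow> ('a \<Rightarrow> 'k) \<Rightarrow> 'a) \<Rightarrow> bool" where
  "equivariant K A \<phi> \<longleftrightarrow>
    (let D = right_dual K A; H = module_hom (opp A) D (regular (opp A)) in
      (\<forall>h \<in> H. dual_linear K A A (\<phi> h)) \<and>
      (\<forall>h \<in> H. \<forall>h' \<in> H. \<forall>\<xi> \<in> carrier D. \<phi> (\<lambda>\<xi> \<in> carrier D. h \<xi> \<oplus>\<^bsub>A\<^esub> h' \<xi>) \<xi> = \<phi> h \<xi> \<oplus>\<^bsub>A\<^esub> \<phi> h' \<xi>) \<and>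
      (\<forall>h \<in> H. \<forall>c \<in> carrier A. \<forall>d \<in> carrier A. \<forall>\<xi> \<in> carrier D.
         \<phi> (twist K A d c h) \<xi> = d \<otimes>\<^bsub>A\<^esub> \<phi> h (left_act A c \<xi>)))"

text \<open>Injectivity and surjectivity of the evaluation map, after the translation.\<close>

definition dual_reflexive :: "('k, 'x) ring_scheme \<Rightarrow> ('k, 'a, 'y) module_scheme \<Rightarrow> bool" where
  "dual_reflexive K A \<longleftrightarrow>
    (let D = right_dual K A; H = module_hom (opp A) D (regular (opp A)) in
      (\<forall>x \<in> carrier A. (\<forall>h \<in> H. \<forall>\<xi> \<in> carrier D. h \<xi> \<otimes>\<^bsub>A\<^esub> x = \<zero>\<^bsub>A\<^esub>) \<longrightarrow> x = \<zero>\<^bsub>A\<^esub>) \<and>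
      (\<forall>\<phi>. equivariant K A \<phi> \<longrightarrow>
         (\<exists>x \<in> carrier A. \<forall>h \<in> H. \<forall>\<xi> \<in> carrier D. \<phi> h \<xi> = h \<xi> \<otimes>\<^bsub>A\<^esub> x)))"

context fd_algebra
begin

abbreviation "H \<equiv> module_hom (opp A) DA (regular (opp A))"

lemma HD:
  assumes "h \<in> H"
  shows "\<xi> \<in> carrier DA \<Longrightarrow> h \<xi> \<in> carrier A"
    and "\<xi> \<in> carrier DA \<Longrightarrow> \<eta> \<in> carrier DA \<Longrightarrow> h (\<xi> \<oplus>\<^bsub>DA\<^esub> \<eta>) = h \<xi> \<oplus>\<^bsub>A\<^esub> h \<eta>"
    and "\<xi> \<in> carrier DA \<Longrightarrow> a \<in> carrier A \<Longrightarrow> h (a \<odot>\<^bsub>DA\<^esub> \<xi>) = h \<xi> \<otimes>\<^bsub>A\<^esub> a"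
    and "\<xi> \<in> carrier DA \<Longrightarrow> k \<in> carrier K \<Longrightarrow> h (scal K A k \<xi>) = k \<odot>\<^bsub>A\<^esub> h \<xi>"
proof -
  note D = module_homD[OF assms, simplified]
  show "\<xi> \<in> carrier DA \<Longrightarrow> h \<xi> \<in> carrier A" by (rule D(1))
  show "\<xi> \<in> carrier DA \<Longrightarrow> \<eta> \<in> carrier DA \<Longrightarrow> h (\<xi> \<oplus>\<^bsub>DA\<^esub> \<eta>) = h \<xi> \<oplus>\<^bsub>A\<^esub> h \<eta>" by (rule D(2))
  show 3: "\<xi> \<in> carrier DA \<Longrightarrow> a \<in> carrier A \<Longrightarrow> h (a \<odot>\<^bsub>DA\<^esub> \<xi>) = h \<xi> \<otimes>\<^bsub>A\<^esub> a" for a by (rule D(3))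
  show "\<xi> \<in> carrier DA \<Longrightarrow> k \<in> carrier K \<Longrightarrow> h (scal K A k \<xi>) = k \<odot>\<^bsub>A\<^esub> h \<xi>"
    using D(1) by (simp add: scal_eq 3 smult_mult_right)
qed

lemma HI:
  assumes "\<And>\<xi>. \<xi> \<in> carrier DA \<Longrightarrow> h \<xi> \<in> carrier A"
    and "\<And>\<xi> \<eta>. \<xi> \<in> carrier DA \<Longrightarrow> \<eta> \<in> carrier DA \<Longrightarrow> h (\<xi> \<oplus>\<^bsub>DA\<^esub> \<eta>) = h \<xi> \<oplus>\<^bsub>A\<^esub> h \<eta>"
    and "\<And>\<xi> a. \<xi> \<in> carrier DA \<Longrightarrow> a \<in> carrier A \<Longrightarrow> h (a \<odot>\<^bsub>DA\<^esub> \<xi>) = h \<xi> \<otimes>\<^bsub>A\<^esub> a"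
  shows "(\<lambda>\<xi> \<in> carrier DA. h \<xi>) \<in> H"
  using left_module.restrict_module_homI[OF left_module_DA, of h "regular (opp A)"] assms by simp

lemma left_act_hom:
  assumes "c \<in> carrier A" "\<xi> \<in> carrier DA" "\<eta> \<in> carrier DA"
  shows "left_act A c (\<xi> \<oplus>\<^bsub>DA\<^esub> \<eta>) = left_act A c \<xi> \<oplus>\<^bsub>DA\<^esub> left_act A c \<eta>"
    and "a \<in> carrier A \<Longrightarrow> left_act A c (a \<odot>\<^bsub>DA\<^esub> \<xi>) = a \<odot>\<^bsub>DA\<^esub> left_act A c \<xi>"
    and "k \<in> carrier K \<Longrightarrow> left_act A c (scal K A k \<xi>) = scal K A k (left_act A c \<xi>)"
    and "left_act A \<one>\<^bsub>A\<^esub> \<xi> = \<xi>"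
  using assms by (auto intro!: DA_eqI simp: DA_apply A.m_assoc)

lemma twist_closed:
  assumes "h \<in> H" "c \<in> carrier A" "d \<in> carrier A"
  shows "twist K A d c h \<in> H"
  unfolding twist_def using assms
  by (intro HI) (auto simp: left_act_hom HD A.r_distr A.m_assoc)

lemma DA_one [simp]: "\<xi> \<in> carrier DA \<Longrightarrow> \<one>\<^bsub>A\<^esub> \<odot>\<^bsub>DA\<^esub> \<xi> = \<xi>"
  by (intro DA_eqI) (auto simp: DA_apply)

end

context based_algebra
begin

lemma pure_mult:
  assumes "a \<in> carrier A" "b \<in> carrier A" "c \<in> carrier A" "d \<in> carrier A"
  shows "pure K A a b \<otimes>\<^bsub>E\<^esub> pure K A c d = pure K A (a \<otimes>\<^bsub>A\<^esub> c) (d \<otimes>\<^bsub>A\<^esub> b)"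
proof -
  interpret E: ring E by (rule ring_E)
  show ?thesis using assms
    by (intro env_slice_inject) (auto simp: env_slice_mult_left env_slice_pure DA_apply smult_mult_left DA_D(1))
qed

lemma one_E: "\<one>\<^bsub>E\<^esub> = pure K A \<one>\<^bsub>A\<^esub> \<one>\<^bsub>A\<^esub>"
proof -
  have "\<one>\<^bsub>A \<times>\<times> opp A\<^esub> = (\<one>\<^bsub>A\<^esub>, \<one>\<^bsub>A\<^esub>)" by (simp add: DirProd_def)
  then show ?thesis unfolding pure_def using ring_hom_one[OF class_hom] by (simp add: monoid_alg_simps(3))
qed

lemma left_module_RB: "left_module E RB"
proof (intro left_module.intro left_module_axioms.intro ring_E)
  interpret E: ring E by (rule ring_E)
  show "abelian_group RB" by (rule abelian_groupI) (auto simp: A.a_ac intro: A.ex_a_inv)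
  note add = additive_mapD(2)[OF RB_additive]
  show r: "t \<odot>\<^bsub>RB\<^esub> (x \<oplus>\<^bsub>RB\<^esub> y) = t \<odot>\<^bsub>RB\<^esub> x \<oplus>\<^bsub>RB\<^esub> t \<odot>\<^bsub>RB\<^esub> y"
    if "t \<in> carrier E" "x \<in> carrier RB" "y \<in> carrier RB" for t x y
    using that
  proof (induction t rule: E_induct)
    case (pure a b)
    then show ?case by (simp add: RB_pure A.l_distr A.r_distr)
  next
    case (add s t)
    then show ?case by (simp add: additive_mapD(2)[OF RB_additive] A.a_ac)
  qed
  show "(s \<oplus>\<^bsub>E\<^esub> t) \<odot>\<^bsub>RB\<^esub> x = s \<odot>\<^bsub>RB\<^esub> x \<oplus>\<^bsub>RB\<^esub> t \<odot>\<^bsub>RB\<^esub> x"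
    if "s \<in> carrier E" "t \<in> carrier E" "x \<in> carrier RB" for s t x using that by (simp add: add)
  show "(s \<otimes>\<^bsub>E\<^esub> t) \<odot>\<^bsub>RB\<^esub> x = s \<odot>\<^bsub>RB\<^esub> (t \<odot>\<^bsub>RB\<^esub> x)"
    if "s \<in> carrier E" "t \<in> carrier E" "x \<in> carrier RB" for s t x
    using that
  proof (induction s rule: E_induct)
    case (pure a b)
    from pure(3,1,2,4) show ?case
    proof (induction t rule: E_induct)
      case (pure c d)
      then show ?case by (simp add: RB_pure pure_mult A.m_assoc)
    next
      case (add u v)
      then show ?case using r by (simp add: additive_mapD(2)[OF RB_additive] E.r_distr)
    qed
  next
    case (add u v)
    then show ?case by (simp add: additive_mapD(2)[OF RB_additive] E.l_distr)
  qed
  show "\<one>\<^bsub>E\<^esub> \<odot>\<^bsub>RB\<^esub> x = x" if "x \<in> carrier RB" for x using that by (simp add: one_E RB_pure)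
qed auto

text \<open>A bimodule map \<open>f\<close> from \<open>A\<close> to its enveloping algebra is determined by \<open>t = f 1\<close>, and
  \<open>a t = t a\<close> for all \<open>a\<close>. In terms of the slices of \<open>t\<close> this says that \<open>\<xi> \<mapsto> t(\<xi>)\<close> is a
  homomorphism of right modules.\<close>

definition slice_at_one :: "('a \<Rightarrow> ('a \<times> 'a \<Rightarrow> 'k) set) \<Rightarrow> ('a \<Rightarrow> 'k) \<Rightarrow> 'a" where
  "slice_at_one f = (\<lambda>\<xi> \<in> carrier DA. env_slice K A (f \<one>\<^bsub>A\<^esub>) \<xi>)"

lemma dual_RB_D:
  assumes "f \<in> carrier (dual E RB)"
  shows "x \<in> carrier A \<Longrightarrow> f x \<in> carrier E"
    and "x \<in> carrier A \<Longrightarrow> y \<in> carrier A \<Longrightarrow> f (x \<oplus>\<^bsub>A\<^esub> y) = f x \<oplus>\<^bsub>E\<^esub> f y"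
    and "t \<in> carrier E \<Longrightarrow> x \<in> carrier A \<Longrightarrow> f (t \<odot>\<^bsub>RB\<^esub> x) = t \<otimes>\<^bsub>E\<^esub> f x"
    and "f \<in> extensional (carrier A)"
  using module_homD[of f E RB "regular E"] assms by simp_all

text \<open>From \<open>f x = (1 \<otimes> x) (f 1)\<close>.\<close>

lemma slice_at_one_apply:
  assumes f: "f \<in> carrier (dual E RB)" and x: "x \<in> carrier A" and \<xi>: "\<xi> \<in> carrier DA"
  shows "env_slice K A (f x) \<xi> = slice_at_one f \<xi> \<otimes>\<^bsub>A\<^esub> x"
proof -
  have "f x = f (pure K A \<one>\<^bsub>A\<^esub> x \<odot>\<^bsub>RB\<^esub> \<one>\<^bsub>A\<^esub>)" using x by (simp add: RB_pure)
  also have "\<dots> = pure K A \<one>\<^bsub>A\<^esub> x \<otimes>\<^bsub>E\<^esub> f \<one>\<^bsub>A\<^esub>" using dual_RB_D(3)[OF f] x by simp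
  finally show ?thesis using x \<xi> dual_RB_D(1)[OF f] by (simp add: env_slice_mult_left slice_at_one_def)
qed

text \<open>Here \<open>f a\<close> is computed in two ways, as \<open>(a \<otimes> 1) (f 1)\<close> and as \<open>(1 \<otimes> a) (f 1)\<close>.\<close>

lemma slice_at_one_closed:
  assumes f: "f \<in> carrier (dual E RB)"
  shows "slice_at_one f \<in> H"
  unfolding slice_at_one_def
proof (rule HI)
  have f1: "f \<one>\<^bsub>A\<^esub> \<in> carrier E" using dual_RB_D(1)[OF f] by simp
  note dl = env_slice_dual_linear[OF f1, unfolded dual_linear_def]
  show "env_slice K A (f \<one>\<^bsub>A\<^esub>) \<xi> \<in> carrier A" if "\<xi> \<in> carrier DA" for \<xi> using that f1 by simp
  show "env_slice K A (f \<one>\<^bsub>A\<^esub>) (\<xi> \<oplus>\<^bsub>DA\<^esub> \<eta>) = env_slice K A (f \<one>\<^bsub>A\<^esub>) \<xi> \<oplus>\<^bsub>A\<^esub> env_slice K A (f \<one>\<^bsub>A\<^esub>) \<eta>"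
    if "\<xi> \<in> carrier DA" "\<eta> \<in> carrier DA" for \<xi> \<eta> using that additive_mapD(2)[OF conjunct1[OF dl]] by simp
  show "env_slice K A (f \<one>\<^bsub>A\<^esub>) (a \<odot>\<^bsub>DA\<^esub> \<xi>) = env_slice K A (f \<one>\<^bsub>A\<^esub>) \<xi> \<otimes>\<^bsub>A\<^esub> a"
    if \<xi>: "\<xi> \<in> carrier DA" and a: "a \<in> carrier A" for \<xi> a
  proof -
    have "env_slice K A (f a) \<xi> = env_slice K A (f \<one>\<^bsub>A\<^esub>) \<xi> \<otimes>\<^bsub>A\<^esub> a"
      using slice_at_one_apply[OF f a \<xi>] \<xi> by (simp add: slice_at_one_def)
    moreover have "f a = f (pure K A a \<one>\<^bsub>A\<^esub> \<odot>\<^bsub>RB\<^esub> \<one>\<^bsub>A\<^esub>)" using a by (simp add: RB_pure)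
    then have "f a = pure K A a \<one>\<^bsub>A\<^esub> \<otimes>\<^bsub>E\<^esub> f \<one>\<^bsub>A\<^esub>" using dual_RB_D(3)[OF f] a by simp
    ultimately show ?thesis using a \<xi> f1 by (simp add: env_slice_mult_left)
  qed
qed

text \<open>The bimodule map belonging to \<open>h\<close> sends \<open>x\<close> to the tensor whose slices are \<open>h(\<xi>) x\<close>.\<close>

lemma slice_at_one_surj:
  assumes h: "h \<in> H"
  obtains f where "f \<in> carrier (dual E RB)" "slice_at_one f = h"
proof -
  interpret E: ring E by (rule ring_E)
  interpret RB: left_module E RB by (rule left_module_RB)
  note hD = HD[OF h]
  have ex: "\<exists>t. t \<in> carrier E \<and> (\<forall>\<xi> \<in> carrier DA. env_slice K A t \<xi> = h \<xi> \<otimes>\<^bsub>A\<^esub> x)"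
    if x: "x \<in> carrier A" for x
  proof -
    have "dual_linear K A A (\<lambda>\<xi>. h \<xi> \<otimes>\<^bsub>A\<^esub> x)"
      unfolding dual_linear_def additive_map_def using hD x by (auto simp: A.l_distr smult_mult_left)
    then show ?thesis by (rule env_slice_surj) blast
  qed
  define f0 where "f0 x = (SOME t. t \<in> carrier E \<and> (\<forall>\<xi> \<in> carrier DA. env_slice K A t \<xi> = h \<xi> \<otimes>\<^bsub>A\<^esub> x))" for x
  have f0: "f0 x \<in> carrier E" "\<And>\<xi>. \<xi> \<in> carrier DA \<Longrightarrow> env_slice K A (f0 x) \<xi> = h \<xi> \<otimes>\<^bsub>A\<^esub> x"
    if "x \<in> carrier A" for x
    using someI_ex[OF ex[OF that]] unfolding f0_def by blast+
  have "f0 (t \<odot>\<^bsub>RB\<^esub> x) = t \<otimes>\<^bsub>E\<^esub> f0 x" if "t \<in> carrier E" "x \<in> carrier A" for t x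
    using that
  proof (induction t rule: E_induct)
    case (pure a b)
    then show ?case using f0 hD
      by (intro env_slice_inject) (auto simp: env_slice_mult_left RB_pure A.m_assoc)
  next
    case (add s t)
    have "f0 ((s \<oplus>\<^bsub>E\<^esub> t) \<odot>\<^bsub>RB\<^esub> x) = f0 (s \<odot>\<^bsub>RB\<^esub> x) \<oplus>\<^bsub>E\<^esub> f0 (t \<odot>\<^bsub>RB\<^esub> x)"
      using add(1,2,5) f0 hD
      by (intro env_slice_inject)
        (auto simp: additive_mapD(2)[OF env_slice_additive] additive_mapD(2)[OF RB_additive] A.r_distr)
    then show ?case using add f0 by (simp add: E.l_distr)
  qed
  moreover have "f0 (x \<oplus>\<^bsub>A\<^esub> y) = f0 x \<oplus>\<^bsub>E\<^esub> f0 y" if "x \<in> carrier A" "y \<in> carrier A" for x y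
    using that f0 hD
    by (intro env_slice_inject) (auto simp: additive_mapD(2)[OF env_slice_additive] A.r_distr)
  ultimately have f: "restrict f0 (carrier A) \<in> carrier (dual E RB)"
    using RB.restrict_module_homI[of f0 "regular E"] f0 by simp
  have "slice_at_one (restrict f0 (carrier A)) = h"
  proof (rule extensionalityI)
    show "h \<in> extensional (carrier DA)" using module_homD(4)[OF h] .
  qed (use f0 hD in \<open>auto simp: slice_at_one_def\<close>)
  with f show thesis by (rule that)
qed

lemma slice_at_one_inject:
  assumes f: "f \<in> carrier (dual E RB)" and g: "g \<in> carrier (dual E RB)" and eq: "slice_at_one f = slice_at_one g"
  shows "f = g"
proof (rule extensionalityI)
  show "f \<in> extensional (carrier A)" "g \<in> extensional (carrier A)" using dual_RB_D(4) f g by auto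
  show "f x = g x" if "x \<in> carrier A" for x
    using that f g eq dual_RB_D(1) by (intro env_slice_inject) (auto simp: slice_at_one_apply)
qed

lemma slice_at_one_smult:
  assumes f: "f \<in> carrier (dual E RB)" and "c \<in> carrier A" "d \<in> carrier A"
  shows "slice_at_one (pure K A c d \<odot>\<^bsub>dual E RB\<^esub> f) = twist K A d c (slice_at_one f)"
proof (rule extensionalityI)
  fix \<xi> assume "\<xi> \<in> carrier DA"
  then show "slice_at_one (pure K A c d \<odot>\<^bsub>dual E RB\<^esub> f) \<xi> = twist K A d c (slice_at_one f) \<xi>"
    using assms dual_RB_D(1)[OF f] by (simp add: slice_at_one_def twist_def env_slice_mult_right)
qed (simp_all add: slice_at_one_def twist_def)

lemma slice_at_one_add:
  assumes f: "f \<in> carrier (dual E RB)" and g: "g \<in> carrier (dual E RB)"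
  shows "slice_at_one (f \<oplus>\<^bsub>dual E RB\<^esub> g) = (\<lambda>\<xi> \<in> carrier DA. slice_at_one f \<xi> \<oplus>\<^bsub>A\<^esub> slice_at_one g \<xi>)"
proof (rule extensionalityI)
  fix \<xi> assume "\<xi> \<in> carrier DA"
  then show "slice_at_one (f \<oplus>\<^bsub>dual E RB\<^esub> g) \<xi> = (\<lambda>\<xi> \<in> carrier DA. slice_at_one f \<xi> \<oplus>\<^bsub>A\<^esub> slice_at_one g \<xi>) \<xi>"
    using dual_RB_D(1)[OF f] dual_RB_D(1)[OF g]
    by (simp add: slice_at_one_def additive_mapD(2)[OF env_slice_additive])
qed (simp_all add: slice_at_one_def)

lemma equivariantD:
  assumes "equivariant K A \<phi>" "h \<in> H"
  shows "dual_linear K A A (\<phi> h)"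
    and "h' \<in> H \<Longrightarrow> \<xi> \<in> carrier DA \<Longrightarrow>
      \<phi> (\<lambda>\<xi> \<in> carrier DA. h \<xi> \<oplus>\<^bsub>A\<^esub> h' \<xi>) \<xi> = \<phi> h \<xi> \<oplus>\<^bsub>A\<^esub> \<phi> h' \<xi>"
    and "c \<in> carrier A \<Longrightarrow> d \<in> carrier A \<Longrightarrow> \<xi> \<in> carrier DA \<Longrightarrow>
      \<phi> (twist K A d c h) \<xi> = d \<otimes>\<^bsub>A\<^esub> \<phi> h (left_act A c \<xi>)"
    and "\<xi> \<in> carrier DA \<Longrightarrow> \<phi> h \<xi> \<in> carrier A"
  using assms by (auto simp: equivariant_def Let_def dual_linear_def additive_map_def)

lemma equivariant_bidual:
  assumes \<phi>: "equivariant K A \<phi>"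
  obtains \<Psi> where "\<Psi> \<in> carrier (dual (opp E) (dual E RB))"
    "\<And>f \<xi>. f \<in> carrier (dual E RB) \<Longrightarrow> \<xi> \<in> carrier DA \<Longrightarrow> env_slice K A (\<Psi> f) \<xi> = \<phi> (slice_at_one f) \<xi>"
proof -
  interpret E: ring E by (rule ring_E)
  interpret RB: left_module E RB by (rule left_module_RB)
  interpret D: left_module "opp E" "dual E RB" by (rule RB.left_module_dual)
  let ?D = "carrier (dual E RB)"
  have ex: "\<exists>t. t \<in> carrier E \<and> (\<forall>\<xi> \<in> carrier DA. env_slice K A t \<xi> = \<phi> (slice_at_one f) \<xi>)" if "f \<in> ?D" for f
    using equivariantD(1)[OF \<phi> slice_at_one_closed[OF that]] by (rule env_slice_surj) blast
  define P where "P f = (SOME t. t \<in> carrier E \<and> (\<forall>\<xi> \<in> carrier DA. env_slice K A t \<xi> = \<phi> (slice_at_one f) \<xi>))" for f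
  have P: "P f \<in> carrier E" "\<And>\<xi>. \<xi> \<in> carrier DA \<Longrightarrow> env_slice K A (P f) \<xi> = \<phi> (slice_at_one f) \<xi>" if "f \<in> ?D" for f
    using someI_ex[OF ex[OF that]] unfolding P_def by blast+
  have Padd: "P (f \<oplus>\<^bsub>dual E RB\<^esub> g) = P f \<oplus>\<^bsub>E\<^esub> P g" if fg: "f \<in> ?D" "g \<in> ?D" for f g
  proof (rule env_slice_inject)
    have c: "f \<oplus>\<^bsub>dual E RB\<^esub> g \<in> ?D" using fg by (rule D.M.a_closed)
    show "P (f \<oplus>\<^bsub>dual E RB\<^esub> g) \<in> carrier E" "P f \<oplus>\<^bsub>E\<^esub> P g \<in> carrier E" using P c fg by auto
    fix \<xi> assume \<xi>: "\<xi> \<in> carrier DA"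
    show "env_slice K A (P (f \<oplus>\<^bsub>dual E RB\<^esub> g)) \<xi> = env_slice K A (P f \<oplus>\<^bsub>E\<^esub> P g) \<xi>"
      using P(2)[OF c \<xi>] P[OF fg(1)] P[OF fg(2)] \<xi> slice_at_one_add[OF fg]
        equivariantD(2)[OF \<phi> slice_at_one_closed[OF fg(1)] slice_at_one_closed[OF fg(2)] \<xi>]
      by (simp add: additive_mapD(2)[OF env_slice_additive])
  qed
  have smult: "P (t \<odot>\<^bsub>dual E RB\<^esub> f) = P f \<otimes>\<^bsub>E\<^esub> t" if "t \<in> carrier E" and f: "f \<in> ?D" for t f
    using that(1)
  proof (induction t rule: E_induct)
    case (pure c d)
    have c: "pure K A c d \<odot>\<^bsub>dual E RB\<^esub> f \<in> ?D" using pure f D.smult_closed by simp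
    show ?case
    proof (rule env_slice_inject)
      show "P (pure K A c d \<odot>\<^bsub>dual E RB\<^esub> f) \<in> carrier E" "P f \<otimes>\<^bsub>E\<^esub> pure K A c d \<in> carrier E"
        using P(1)[OF c] P(1)[OF f] pure by auto
      fix \<xi> assume \<xi>: "\<xi> \<in> carrier DA"
      show "env_slice K A (P (pure K A c d \<odot>\<^bsub>dual E RB\<^esub> f)) \<xi> = env_slice K A (P f \<otimes>\<^bsub>E\<^esub> pure K A c d) \<xi>"
        unfolding P(2)[OF c \<xi>] slice_at_one_smult[OF f pure]
        using equivariantD(3)[OF \<phi> slice_at_one_closed[OF f] pure \<xi>] P[OF f] pure \<xi>
        by (simp add: env_slice_mult_right)
    qed
  next
    case (add s t)
    have "P ((s \<oplus>\<^bsub>E\<^esub> t) \<odot>\<^bsub>dual E RB\<^esub> f) = P (s \<odot>\<^bsub>dual E RB\<^esub> f \<oplus>\<^bsub>dual E RB\<^esub> t \<odot>\<^bsub>dual E RB\<^esub> f)"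
      using D.smult_l_distr[of s t f] add(1,2) f by simp
    also have "\<dots> = P (s \<odot>\<^bsub>dual E RB\<^esub> f) \<oplus>\<^bsub>E\<^esub> P (t \<odot>\<^bsub>dual E RB\<^esub> f)"
      using add(1,2) f D.smult_closed by (intro Padd) auto
    finally show ?case using add P(1)[OF f] by (simp add: E.r_distr del: dual_simps)
  qed
  have "restrict P ?D \<in> carrier (dual (opp E) (dual E RB))"
    unfolding dual_simps(1)[of "opp E"]
    by (rule D.restrict_module_homI) (use P Padd smult in \<open>simp_all\<close>)
  moreover have "env_slice K A (restrict P ?D f) \<xi> = \<phi> (slice_at_one f) \<xi>" if "f \<in> ?D" "\<xi> \<in> carrier DA" for f \<xi>
    using P that by simp
  ultimately show thesis by (rule that)
qed

lemma bidual_equivariant: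
  assumes \<Psi>: "\<Psi> \<in> carrier (dual (opp E) (dual E RB))"
  obtains \<phi> where "equivariant K A \<phi>"
    "\<And>f \<xi>. f \<in> carrier (dual E RB) \<Longrightarrow> \<xi> \<in> carrier DA \<Longrightarrow> env_slice K A (\<Psi> f) \<xi> = \<phi> (slice_at_one f) \<xi>"
proof -
  interpret E: ring E by (rule ring_E)
  interpret RB: left_module E RB by (rule left_module_RB)
  interpret D: left_module "opp E" "dual E RB" by (rule RB.left_module_dual)
  let ?D = "carrier (dual E RB)"
  note PD = module_homD[OF \<Psi>[unfolded dual_simps(1)[of "opp E"]]]
  have P1: "\<Psi> f \<in> carrier E" if "f \<in> ?D" for f using PD(1)[OF that] by simp
  have P2: "\<Psi> (f \<oplus>\<^bsub>dual E RB\<^esub> g) = \<Psi> f \<oplus>\<^bsub>E\<^esub> \<Psi> g" if "f \<in> ?D" "g \<in> ?D" for f g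
    using PD(2)[OF that] by simp
  have P3: "\<Psi> (t \<odot>\<^bsub>dual E RB\<^esub> f) = \<Psi> f \<otimes>\<^bsub>E\<^esub> t" if "t \<in> carrier E" "f \<in> ?D" for t f
    using PD(3)[of t f] that by simp
  define iv where "iv h = (SOME f. f \<in> ?D \<and> slice_at_one f = h)" for h
  have iv: "iv (slice_at_one f) = f" if f: "f \<in> ?D" for f
  proof -
    have "iv (slice_at_one f) \<in> ?D \<and> slice_at_one (iv (slice_at_one f)) = slice_at_one f"
      unfolding iv_def by (rule someI[of _ f]) (use f in auto)
    then show ?thesis using slice_at_one_inject f by blast
  qed
  define \<phi> where "\<phi> h = env_slice K A (\<Psi> (iv h))" for h
  have \<phi>: "\<phi> (slice_at_one f) = env_slice K A (\<Psi> f)" if "f \<in> ?D" for f by (simp add: \<phi>_def iv[OF that])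
  have "equivariant K A \<phi>"
    unfolding equivariant_def Let_def
  proof (intro conjI ballI)
    fix h assume h: "h \<in> H"
    obtain f where f: "f \<in> ?D" "slice_at_one f = h" using slice_at_one_surj[OF h] .
    show "dual_linear K A A (\<phi> h)" using \<phi>[OF f(1)] f(2) env_slice_dual_linear[OF P1[OF f(1)]] by simp
    fix h' \<xi> assume h': "h' \<in> H" and \<xi>: "\<xi> \<in> carrier DA"
    obtain f' where f': "f' \<in> ?D" "slice_at_one f' = h'" using slice_at_one_surj[OF h'] .
    have c: "f \<oplus>\<^bsub>dual E RB\<^esub> f' \<in> ?D" using f f' D.M.a_closed by blast
    show "\<phi> (\<lambda>\<xi> \<in> carrier DA. h \<xi> \<oplus>\<^bsub>A\<^esub> h' \<xi>) \<xi> = \<phi> h \<xi> \<oplus>\<^bsub>A\<^esub> \<phi> h' \<xi>"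
      using slice_at_one_add[OF f(1) f'(1)] \<phi>[OF c] \<phi>[OF f(1)] \<phi>[OF f'(1)] f f' P1 P2 \<xi>
      by (simp add: additive_mapD(2)[OF env_slice_additive] del: dual_simps)
  next
    fix h c d \<xi> assume h: "h \<in> H" and cd: "c \<in> carrier A" "d \<in> carrier A" and \<xi>: "\<xi> \<in> carrier DA"
    obtain f where f: "f \<in> ?D" "slice_at_one f = h" using slice_at_one_surj[OF h] .
    have c: "pure K A c d \<odot>\<^bsub>dual E RB\<^esub> f \<in> ?D" using cd f D.smult_closed by simp
    show "\<phi> (twist K A d c h) \<xi> = d \<otimes>\<^bsub>A\<^esub> \<phi> h (left_act A c \<xi>)"
      using slice_at_one_smult[OF f(1) cd] \<phi>[OF c] \<phi>[OF f(1)] f P1 P3 cd \<xi>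
      by (simp add: env_slice_mult_right del: dual_simps)
  qed
  then show thesis using \<phi> by (intro that[of \<phi>]) simp_all
qed

text \<open>An element of the bidual and an equivariant map determine each other, and evaluation at \<open>x\<close>
  corresponds to \<open>h \<mapsto> h x\<close>.\<close>

theorem reflexive_iff_dual_reflexive:
  "reflexive E RB \<longleftrightarrow> dual_reflexive K A"
proof -
  interpret E: ring E by (rule ring_E)
  interpret RB: left_module E RB by (rule left_module_RB)
  let ?D = "carrier (dual E RB)"
  have ev: "evaluation E RB x f = f x" if "x \<in> carrier A" "f \<in> ?D" for x f
    using that by (simp add: evaluation_def)
  have refl: "reflexive E RB \<longleftrightarrow>
      bij_betw (evaluation E RB) (carrier A) (carrier (dual (opp E) (dual E RB)))"
    using RB.evaluation_hom by (simp add: reflexive_def module_iso_def)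
  have evc: "evaluation E RB x \<in> carrier (dual (opp E) (dual E RB))" if "x \<in> carrier A" for x
    using module_homD(1)[OF RB.evaluation_hom] that by simp
  have eq_iff: "evaluation E RB x = evaluation E RB y \<longleftrightarrow> (\<forall>h \<in> H. \<forall>\<xi> \<in> carrier DA. h \<xi> \<otimes>\<^bsub>A\<^esub> x = h \<xi> \<otimes>\<^bsub>A\<^esub> y)"
    if x: "x \<in> carrier A" and y: "y \<in> carrier A" for x y
  proof
    assume eq: "evaluation E RB x = evaluation E RB y"
    show "\<forall>h \<in> H. \<forall>\<xi> \<in> carrier DA. h \<xi> \<otimes>\<^bsub>A\<^esub> x = h \<xi> \<otimes>\<^bsub>A\<^esub> y"
    proof (intro ballI)
      fix h \<xi> assume h: "h \<in> H" and \<xi>: "\<xi> \<in> carrier DA"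
      obtain f where f: "f \<in> ?D" "slice_at_one f = h" using slice_at_one_surj[OF h] .
      have "f x = f y" using eq ev x y f(1) by metis
      then show "h \<xi> \<otimes>\<^bsub>A\<^esub> x = h \<xi> \<otimes>\<^bsub>A\<^esub> y" using slice_at_one_apply[OF f(1) _ \<xi>] x y f(2) by metis
    qed
  next
    assume eq: "\<forall>h \<in> H. \<forall>\<xi> \<in> carrier DA. h \<xi> \<otimes>\<^bsub>A\<^esub> x = h \<xi> \<otimes>\<^bsub>A\<^esub> y"
    have "f x = f y" if f: "f \<in> ?D" for f
      using eq slice_at_one_closed[OF f] x y dual_RB_D(1)[OF f]
      by (intro env_slice_inject) (simp_all add: slice_at_one_apply[OF f])
    then show "evaluation E RB x = evaluation E RB y"
      using x y by (auto simp: evaluation_def intro!: restrict_ext)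
  qed
  show ?thesis
  proof
    assume "reflexive E RB"
    then have bij: "inj_on (evaluation E RB) (carrier A)"
      "evaluation E RB ` carrier A = carrier (dual (opp E) (dual E RB))"
      using refl by (auto simp only: bij_betw_def)
    show "dual_reflexive K A"
      unfolding dual_reflexive_def Let_def
    proof (intro conjI ballI allI impI)
      fix x assume x: "x \<in> carrier A" "\<forall>h \<in> H. \<forall>\<xi> \<in> carrier DA. h \<xi> \<otimes>\<^bsub>A\<^esub> x = \<zero>\<^bsub>A\<^esub>"
      then have "evaluation E RB x = evaluation E RB \<zero>\<^bsub>A\<^esub>"
        using HD(1) by (subst eq_iff) auto
      then show "x = \<zero>\<^bsub>A\<^esub>" using bij(1) x(1) by (auto dest: inj_onD)
    next
      fix \<phi> assume "equivariant K A \<phi>"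
      then obtain \<Psi> where \<Psi>: "\<Psi> \<in> carrier (dual (opp E) (dual E RB))"
        "\<And>f \<xi>. f \<in> ?D \<Longrightarrow> \<xi> \<in> carrier DA \<Longrightarrow> env_slice K A (\<Psi> f) \<xi> = \<phi> (slice_at_one f) \<xi>"
        by (rule equivariant_bidual) blast
      obtain x where x: "x \<in> carrier A" "\<Psi> = evaluation E RB x" using \<Psi>(1) bij(2) by blast
      have "\<phi> h \<xi> = h \<xi> \<otimes>\<^bsub>A\<^esub> x" if h: "h \<in> H" and \<xi>: "\<xi> \<in> carrier DA" for h \<xi>
      proof -
        obtain f where f: "f \<in> ?D" "slice_at_one f = h" using slice_at_one_surj[OF h] .
        show ?thesis using \<Psi>(2)[OF f(1) \<xi>] ev[OF x(1) f(1)] slice_at_one_apply[OF f(1) x(1) \<xi>] x(2) f(2) by simp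
      qed
      then show "\<exists>x \<in> carrier A. \<forall>h \<in> H. \<forall>\<xi> \<in> carrier DA. \<phi> h \<xi> = h \<xi> \<otimes>\<^bsub>A\<^esub> x" using x(1) by blast
    qed
  next
    assume "dual_reflexive K A"
    then have inj: "\<And>x. x \<in> carrier A \<Longrightarrow> (\<forall>h \<in> H. \<forall>\<xi> \<in> carrier DA. h \<xi> \<otimes>\<^bsub>A\<^esub> x = \<zero>\<^bsub>A\<^esub>) \<Longrightarrow> x = \<zero>\<^bsub>A\<^esub>"
      and surj: "\<And>\<phi>. equivariant K A \<phi> \<Longrightarrow> \<exists>x \<in> carrier A. \<forall>h \<in> H. \<forall>\<xi> \<in> carrier DA. \<phi> h \<xi> = h \<xi> \<otimes>\<^bsub>A\<^esub> x"
      unfolding dual_reflexive_def Let_def by blast+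
    have "inj_on (evaluation E RB) (carrier A)"
    proof (rule inj_onI)
      fix x y assume xy: "x \<in> carrier A" "y \<in> carrier A" "evaluation E RB x = evaluation E RB y"
      then have "\<forall>h \<in> H. \<forall>\<xi> \<in> carrier DA. h \<xi> \<otimes>\<^bsub>A\<^esub> x = h \<xi> \<otimes>\<^bsub>A\<^esub> y" using eq_iff by blast
      then have "\<forall>h \<in> H. \<forall>\<xi> \<in> carrier DA. h \<xi> \<otimes>\<^bsub>A\<^esub> (x \<ominus>\<^bsub>A\<^esub> y) = \<zero>\<^bsub>A\<^esub>"
        using HD(1) xy by (auto simp: A.minus_eq A.r_distr A.r_minus A.r_neg)
      then have "x \<ominus>\<^bsub>A\<^esub> y = \<zero>\<^bsub>A\<^esub>" using inj xy by simp
      then show "x = y" using xy A.minus_zero_imp_eq by blast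
    qed
    moreover have "evaluation E RB ` carrier A = carrier (dual (opp E) (dual E RB))"
    proof (intro equalityI subsetI)
      fix \<Psi> assume \<Psi>: "\<Psi> \<in> carrier (dual (opp E) (dual E RB))"
      then obtain \<phi> where \<phi>: "equivariant K A \<phi>"
        "\<And>f \<xi>. f \<in> ?D \<Longrightarrow> \<xi> \<in> carrier DA \<Longrightarrow> env_slice K A (\<Psi> f) \<xi> = \<phi> (slice_at_one f) \<xi>"
        by (rule bidual_equivariant) blast
      obtain x where x: "x \<in> carrier A" "\<And>h \<xi>. h \<in> H \<Longrightarrow> \<xi> \<in> carrier DA \<Longrightarrow> \<phi> h \<xi> = h \<xi> \<otimes>\<^bsub>A\<^esub> x"
        using surj[OF \<phi>(1)] by blast
      note PD = module_homD[OF \<Psi>[unfolded dual_simps(1)[of "opp E"]]]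
      note EX = module_homD[OF evc[OF x(1), unfolded dual_simps(1)[of "opp E"]]]
      have "\<Psi> = evaluation E RB x"
      proof (rule extensionalityI[OF PD(4) EX(4)])
        fix f assume f: "f \<in> ?D"
        have "\<Psi> f = f x"
        proof (rule env_slice_inject)
          show "\<Psi> f \<in> carrier E" using PD(1)[OF f] by simp
          show "f x \<in> carrier E" using dual_RB_D(1)[OF f x(1)] .
          fix \<xi> assume \<xi>: "\<xi> \<in> carrier DA"
          show "env_slice K A (\<Psi> f) \<xi> = env_slice K A (f x) \<xi>"
            using \<phi>(2)[OF f \<xi>] x(2)[OF slice_at_one_closed[OF f] \<xi>] slice_at_one_apply[OF f x(1) \<xi>] by simp
        qed
        then show "\<Psi> f = evaluation E RB x f" using ev[OF x(1) f] by simp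
      qed
      then show "\<Psi> \<in> evaluation E RB ` carrier A" using x(1) by blast
    qed (use evc in blast)
    ultimately show "reflexive E RB" unfolding refl bij_betw_def by blast
  qed
qed

end


section \<open>A faithful projective-injective module with the double centraliser property\<close>

context based_algebra
begin

text \<open>A homomorphism \<open>G\<close> to the dual space is determined by the linear form \<open>\<xi> \<mapsto> G(\<xi>)(1)\<close>, and
  linear forms on the dual space are evaluations because \<open>A\<close> is finite-dimensional.\<close>

lemma endomorphism_DA:
  assumes G: "G \<in> module_hom (opp A) DA DA"
  obtains c where "c \<in> carrier A" "\<And>\<xi>. \<xi> \<in> carrier DA \<Longrightarrow> G \<xi> = left_act A c \<xi>"
proof -
  note GD = module_homD[OF G, simplified]
  let ?l = "\<lambda>\<xi>. G \<xi> \<one>\<^bsub>A\<^esub>"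
  have lK: "?l \<xi> \<in> carrier K" if "\<xi> \<in> carrier DA" for \<xi> using that GD(1) DA_D(1) by simp
  interpret RK: left_module K "regular K" by (rule K.left_module_regular)
  have "dual_linear K A (regular K) ?l"
    unfolding dual_linear_def additive_map_def
  proof (intro conjI ballI)
    fix \<xi> \<eta> assume "\<xi> \<in> carrier DA" "\<eta> \<in> carrier DA"
    then show "G (\<xi> \<oplus>\<^bsub>DA\<^esub> \<eta>) \<one>\<^bsub>A\<^esub> = G \<xi> \<one>\<^bsub>A\<^esub> \<oplus>\<^bsub>regular K\<^esub> G \<eta> \<one>\<^bsub>A\<^esub>" using GD by (simp add: DA_apply)
  next
    fix k \<xi> assume k: "k \<in> carrier K" and \<xi>: "\<xi> \<in> carrier DA"
    have "G (scal K A k \<xi>) = scal K A k (G \<xi>)" using k \<xi> GD(1,3) by (simp add: scal_eq)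
    then show "G (scal K A k \<xi>) \<one>\<^bsub>A\<^esub> = k \<odot>\<^bsub>regular K\<^esub> G \<xi> \<one>\<^bsub>A\<^esub>" by (simp add: DA_apply)
  qed (use lK in simp)
  then have expand: "?l \<xi> = (\<Oplus>\<^bsub>K\<^esub> b \<in> B. \<xi> b \<otimes>\<^bsub>K\<^esub> ?l (w b))" if "\<xi> \<in> carrier DA" for \<xi>
    using dual_linear_expand[OF RK.left_module_axioms _ that] by simp
  let ?c = "\<Oplus>\<^bsub>A\<^esub> b \<in> B. ?l (w b) \<odot>\<^bsub>A\<^esub> b"
  have c: "?c \<in> carrier A" using B_closed w_closed lK by (intro A.finsum_closed) auto
  have l: "?l \<xi> = \<xi> ?c" if \<xi>: "\<xi> \<in> carrier DA" for \<xi>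
  proof -
    have "\<xi> ?c = (\<Oplus>\<^bsub>K\<^esub> b \<in> B. \<xi> (?l (w b) \<odot>\<^bsub>A\<^esub> b))"
      using B_closed B_finite w_closed lK
      by (intro additive_map_finsum[OF A.abelian_group_axioms K.abelian_group_axioms DA_D(6)[OF \<xi>]]) auto
    also have "\<dots> = (\<Oplus>\<^bsub>K\<^esub> b \<in> B. \<xi> b \<otimes>\<^bsub>K\<^esub> ?l (w b))"
      using B_closed w_closed lK DA_D[OF \<xi>] by (intro K.finsum_cong') (auto simp: K.m_comm)
    finally show ?thesis using expand[OF \<xi>] by simp
  qed
  have "G \<xi> = left_act A ?c \<xi>" if \<xi>: "\<xi> \<in> carrier DA" for \<xi>
  proof (rule DA_eqI)
    fix x assume x: "x \<in> carrier A"
    have "G \<xi> x = ?l (x \<odot>\<^bsub>DA\<^esub> \<xi>)" using GD(1,3) x \<xi> by (simp add: DA_apply)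
    then show "G \<xi> x = left_act A ?c \<xi> x" using l x \<xi> c by (simp add: DA_apply)
  qed (use \<xi> c GD(1) in auto)
  with c show thesis by (rule that)
qed

lemma H_zero: "(\<lambda>\<xi> \<in> carrier DA. \<zero>\<^bsub>A\<^esub>) \<in> H"
  and H_add: "h \<in> H \<Longrightarrow> h' \<in> H \<Longrightarrow> (\<lambda>\<xi> \<in> carrier DA. h \<xi> \<oplus>\<^bsub>A\<^esub> h' \<xi>) \<in> H"
  by (intro HI; auto simp: HD A.a_ac A.l_distr)+

text \<open>Additivity for finite sums. The statement that the combination lies in \<open>H\<close> is carried along
  because the induction step needs it.\<close>

lemma equivariant_combination:
  assumes \<phi>: "equivariant K A \<phi>" and "finite I"
    and "\<And>i. i \<in> I \<Longrightarrow> h i \<in> H" "\<And>i. i \<in> I \<Longrightarrow> c i \<in> carrier A" "\<And>i. i \<in> I \<Longrightarrow> d i \<in> carrier A"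
  shows "(\<lambda>\<xi> \<in> carrier DA. \<Oplus>\<^bsub>A\<^esub> i \<in> I. d i \<otimes>\<^bsub>A\<^esub> h i (left_act A (c i) \<xi>)) \<in> H \<and>
    (\<forall>\<xi> \<in> carrier DA. \<phi> (\<lambda>\<xi> \<in> carrier DA. \<Oplus>\<^bsub>A\<^esub> i \<in> I. d i \<otimes>\<^bsub>A\<^esub> h i (left_act A (c i) \<xi>)) \<xi>
      = (\<Oplus>\<^bsub>A\<^esub> i \<in> I. d i \<otimes>\<^bsub>A\<^esub> \<phi> (h i) (left_act A (c i) \<xi>)))"
  using assms(2-)
proof (induction I rule: finite_induct)
  case empty
  let ?z = "\<lambda>\<xi> \<in> carrier DA. \<zero>\<^bsub>A\<^esub>"
  have "?z = twist K A \<zero>\<^bsub>A\<^esub> \<one>\<^bsub>A\<^esub> ?z" unfolding twist_def by (rule restrict_ext) auto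
  then have "\<phi> ?z \<xi> = \<zero>\<^bsub>A\<^esub>" if "\<xi> \<in> carrier DA" for \<xi>
    using equivariantD(3,4)[OF \<phi> H_zero] that by (metis A.l_null A.one_closed A.zero_closed DA_closed(4))
  then show ?case using H_zero by (simp only: A.finsum_empty) blast
next
  case (insert j I)
  let ?r = "\<lambda>\<xi> \<in> carrier DA. \<Oplus>\<^bsub>A\<^esub> i \<in> I. d i \<otimes>\<^bsub>A\<^esub> h i (left_act A (c i) \<xi>)"
  let ?t = "twist K A (d j) (c j) (h j)"
  have IH: "?r \<in> H" "\<And>\<xi>. \<xi> \<in> carrier DA \<Longrightarrow> \<phi> ?r \<xi> = (\<Oplus>\<^bsub>A\<^esub> i \<in> I. d i \<otimes>\<^bsub>A\<^esub> \<phi> (h i) (left_act A (c i) \<xi>))"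
    using insert.IH[OF insert.prems(1)[OF insertI2] insert.prems(2)[OF insertI2] insert.prems(3)[OF insertI2]]
    by blast+
  have t: "?t \<in> H" using insert.prems by (intro twist_closed) auto
  have hc: "d i \<otimes>\<^bsub>A\<^esub> h i (left_act A (c i) \<xi>) \<in> carrier A" if "i \<in> insert j I" "\<xi> \<in> carrier DA" for i \<xi>
    using that insert.prems HD(1) by auto
  have eq: "(\<lambda>\<xi> \<in> carrier DA. \<Oplus>\<^bsub>A\<^esub> i \<in> insert j I. d i \<otimes>\<^bsub>A\<^esub> h i (left_act A (c i) \<xi>))
    = (\<lambda>\<xi> \<in> carrier DA. ?t \<xi> \<oplus>\<^bsub>A\<^esub> ?r \<xi>)"
  proof (rule restrict_ext)
    fix \<xi> assume \<xi>: "\<xi> \<in> carrier DA"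
    have "(\<Oplus>\<^bsub>A\<^esub> i \<in> insert j I. d i \<otimes>\<^bsub>A\<^esub> h i (left_act A (c i) \<xi>))
      = d j \<otimes>\<^bsub>A\<^esub> h j (left_act A (c j) \<xi>) \<oplus>\<^bsub>A\<^esub> (\<Oplus>\<^bsub>A\<^esub> i \<in> I. d i \<otimes>\<^bsub>A\<^esub> h i (left_act A (c i) \<xi>))"
      using insert.hyps hc[OF _ \<xi>] by (intro A.finsum_insert) auto
    then show "(\<Oplus>\<^bsub>A\<^esub> i \<in> insert j I. d i \<otimes>\<^bsub>A\<^esub> h i (left_act A (c i) \<xi>)) = ?t \<xi> \<oplus>\<^bsub>A\<^esub> ?r \<xi>"
      using \<xi> by (simp add: twist_def)
  qed
  have "\<phi> (\<lambda>\<xi> \<in> carrier DA. ?t \<xi> \<oplus>\<^bsub>A\<^esub> ?r \<xi>) \<xi>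
    = (\<Oplus>\<^bsub>A\<^esub> i \<in> insert j I. d i \<otimes>\<^bsub>A\<^esub> \<phi> (h i) (left_act A (c i) \<xi>))" if \<xi>: "\<xi> \<in> carrier DA" for \<xi>
  proof -
    have pc: "d i \<otimes>\<^bsub>A\<^esub> \<phi> (h i) (left_act A (c i) \<xi>) \<in> carrier A" if "i \<in> insert j I" for i
      using that insert.prems equivariantD(4)[OF \<phi>] \<xi> by auto
    have "(\<Oplus>\<^bsub>A\<^esub> i \<in> insert j I. d i \<otimes>\<^bsub>A\<^esub> \<phi> (h i) (left_act A (c i) \<xi>))
      = d j \<otimes>\<^bsub>A\<^esub> \<phi> (h j) (left_act A (c j) \<xi>) \<oplus>\<^bsub>A\<^esub> (\<Oplus>\<^bsub>A\<^esub> i \<in> I. d i \<otimes>\<^bsub>A\<^esub> \<phi> (h i) (left_act A (c i) \<xi>))"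
      using insert.hyps pc by (intro A.finsum_insert) auto
    then show ?thesis
      using equivariantD(2)[OF \<phi> t IH(1) \<xi>] IH(2)[OF \<xi>] equivariantD(3)[OF \<phi>, of "h j" "c j" "d j" \<xi>]
        insert.prems \<xi> by simp
  qed
  then show ?case unfolding eq using H_add[OF t IH(1)] by blast
qed

lemma equivariant_sum:
  assumes \<phi>: "equivariant K A \<phi>" and "finite I"
    and "\<And>i. i \<in> I \<Longrightarrow> h i \<in> H" "\<And>i. i \<in> I \<Longrightarrow> c i \<in> carrier A" "\<And>i. i \<in> I \<Longrightarrow> d i \<in> carrier A"
    and u: "u \<in> H" "\<And>\<xi>. \<xi> \<in> carrier DA \<Longrightarrow> u \<xi> = (\<Oplus>\<^bsub>A\<^esub> i \<in> I. d i \<otimes>\<^bsub>A\<^esub> h i (left_act A (c i) \<xi>))"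
    and \<xi>: "\<xi> \<in> carrier DA"
  shows "\<phi> u \<xi> = (\<Oplus>\<^bsub>A\<^esub> i \<in> I. d i \<otimes>\<^bsub>A\<^esub> \<phi> (h i) (left_act A (c i) \<xi>))"
proof -
  have "u = (\<lambda>\<xi> \<in> carrier DA. \<Oplus>\<^bsub>A\<^esub> i \<in> I. d i \<otimes>\<^bsub>A\<^esub> h i (left_act A (c i) \<xi>))"
    using module_homD(4)[OF u(1)] u(2) by (intro extensionalityI[of u "carrier DA"]) auto
  then show ?thesis using equivariant_combination[OF assms(1-5)] \<xi> by simp
qed

end

text \<open>What projectivity and injectivity contribute: coordinates \<open>f\<close> with values in \<open>A\<close>, and a
  decomposition of the identity of \<open>M\<close> into maps through the dual space. The carrier type of \<open>M\<close> is
  arbitrary here.\<close>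

locale coordinatised_module = based_algebra K A B w + left_module "opp A" M
  for K :: "('k, 'x) ring_scheme" (structure) and A :: "('k, 'a, 'y) module_scheme" (structure)
    and B w and M :: "('a, 'm, 'z) module_scheme" (structure) +
  fixes S :: "'m set" and f :: "'m \<Rightarrow> 'm \<Rightarrow> 'a" and T :: "'t set"
    and g :: "'t \<Rightarrow> 'm \<Rightarrow> 'a \<Rightarrow> 'k" and r :: "'t \<Rightarrow> ('a \<Rightarrow> 'k) \<Rightarrow> 'm"
  assumes faithful: "faithful (opp A) M"
    and S: "finite S" "S \<subseteq> carrier M"
    and f: "\<And>s. s \<in> S \<Longrightarrow> f s \<in> module_hom (opp A) M (regular (opp A))"
    and f_sum: "\<And>m. m \<in> carrier M \<Longrightarrow> (\<Oplus>\<^bsub>M\<^esub> s \<in> S. f s m \<odot>\<^bsub>M\<^esub> s) = m"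
    and T: "finite T"
    and g: "\<And>t. t \<in> T \<Longrightarrow> g t \<in> module_hom (opp A) M DA"
    and r: "\<And>t. t \<in> T \<Longrightarrow> r t \<in> module_hom (opp A) DA M"
    and r_sum: "\<And>m. m \<in> carrier M \<Longrightarrow> (\<Oplus>\<^bsub>M\<^esub> t \<in> T. r t (g t m)) = m"
begin

lemma regular_homD:
  assumes "u \<in> module_hom (opp A) M (regular (opp A))"
  shows "m \<in> carrier M \<Longrightarrow> u m \<in> carrier A"
    and "m \<in> carrier M \<Longrightarrow> m' \<in> carrier M \<Longrightarrow> u (m \<oplus>\<^bsub>M\<^esub> m') = u m \<oplus>\<^bsub>A\<^esub> u m'"
    and "a \<in> carrier A \<Longrightarrow> m \<in> carrier M \<Longrightarrow> u (a \<odot>\<^bsub>M\<^esub> m) = u m \<otimes>\<^bsub>A\<^esub> a"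
    and "additive_map M A u"
  using module_homD[OF assms] by (simp_all add: additive_map_def)

lemma smult_smult:
  "a \<in> carrier A \<Longrightarrow> b \<in> carrier A \<Longrightarrow> m \<in> carrier M \<Longrightarrow> a \<odot>\<^bsub>M\<^esub> (b \<odot>\<^bsub>M\<^esub> m) = (b \<otimes>\<^bsub>A\<^esub> a) \<odot>\<^bsub>M\<^esub> m"
  using smult_assoc[of a b m] by simp

lemma f_separates:
  assumes "m \<in> carrier M" "m' \<in> carrier M" "\<And>s. s \<in> S \<Longrightarrow> f s m = f s m'"
  shows "m = m'"
proof -
  have "m = (\<Oplus>\<^bsub>M\<^esub> s \<in> S. f s m \<odot>\<^bsub>M\<^esub> s)" using f_sum assms by simp
  also have "\<dots> = (\<Oplus>\<^bsub>M\<^esub> s \<in> S. f s m' \<odot>\<^bsub>M\<^esub> s)"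
    using assms S(2) regular_homD(1)[OF f] by (intro M.finsum_cong') (simp_all add: subset_iff)
  finally show ?thesis using f_sum assms by simp
qed

lemma faithfulD:
  assumes "a \<in> carrier A" "b \<in> carrier A" "\<And>m. m \<in> carrier M \<Longrightarrow> a \<odot>\<^bsub>M\<^esub> m = b \<odot>\<^bsub>M\<^esub> m"
  shows "a = b"
proof -
  have "a \<ominus>\<^bsub>opp A\<^esub> b \<in> carrier (opp A)"
    using R.minus_closed[of a b] assms(1,2) by simp
  moreover have "(a \<ominus>\<^bsub>opp A\<^esub> b) \<odot>\<^bsub>M\<^esub> m = \<zero>\<^bsub>M\<^esub>" if "m \<in> carrier M" for m
    using assms that by (simp add: smult_minus_left M.minus_eq M.r_neg)
  ultimately have "a \<ominus>\<^bsub>opp A\<^esub> b = \<zero>\<^bsub>opp A\<^esub>" using faithful unfolding faithful_def by blast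
  then show ?thesis using assms R.minus_zero_imp_eq by simp
qed

abbreviation "hcomp u v \<equiv> (\<lambda>\<xi> \<in> carrier DA. u (v \<xi>))"

lemma comp_closed:
  assumes "u \<in> module_hom (opp A) M (regular (opp A))" "v \<in> module_hom (opp A) DA M"
  shows "hcomp u v \<in> H"
  by (rule left_module.module_hom_compose[OF left_module_DA assms(2,1)])

text \<open>If \<open>x\<close> kills all values of \<open>H\<close>, then in particular those of \<open>f\<^sub>s r\<^sub>t\<close>; since the \<open>f\<^sub>s\<close>
  separate points and the images of the \<open>r\<^sub>t\<close> span \<open>M\<close>, it kills the faithful module \<open>M\<close>.\<close>

lemma trace_annihilator:
  assumes x: "x \<in> carrier A" and kill: "\<And>h \<xi>. h \<in> H \<Longrightarrow> \<xi> \<in> carrier DA \<Longrightarrow> h \<xi> \<otimes>\<^bsub>A\<^esub> x = \<zero>\<^bsub>A\<^esub>"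
  shows "x = \<zero>\<^bsub>A\<^esub>"
proof (rule faithfulD[OF x])
  fix m assume m: "m \<in> carrier M"
  have "x \<odot>\<^bsub>M\<^esub> r t \<xi> = \<zero>\<^bsub>M\<^esub>" if t: "t \<in> T" and \<xi>: "\<xi> \<in> carrier DA" for t \<xi>
  proof (rule f_separates)
    have rM: "r t \<xi> \<in> carrier M" using module_homD(1)[OF r[OF t] \<xi>] .
    show "x \<odot>\<^bsub>M\<^esub> r t \<xi> \<in> carrier M" "\<zero>\<^bsub>M\<^esub> \<in> carrier M" using rM x by simp_all
    fix s assume s: "s \<in> S"
    have "f s (x \<odot>\<^bsub>M\<^esub> r t \<xi>) = hcomp (f s) (r t) \<xi> \<otimes>\<^bsub>A\<^esub> x"
      using regular_homD(3)[OF f[OF s] x rM] \<xi> by simp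
    also have "\<dots> = \<zero>\<^bsub>A\<^esub>" using kill[OF comp_closed[OF f[OF s] r[OF t]] \<xi>] .
    also have "\<dots> = f s \<zero>\<^bsub>M\<^esub>"
      using additive_map_zero[OF M.abelian_group_axioms A.abelian_group_axioms regular_homD(4)[OF f[OF s]]] by simp
    finally show "f s (x \<odot>\<^bsub>M\<^esub> r t \<xi>) = f s \<zero>\<^bsub>M\<^esub>" .
  qed
  then have z: "x \<odot>\<^bsub>M\<^esub> r t (g t m) = \<zero>\<^bsub>M\<^esub>" if "t \<in> T" for t
    using that module_homD(1)[OF g m] by simp
  have rgM: "r t (g t m) \<in> carrier M" if "t \<in> T" for t
    using that module_homD(1)[OF r module_homD(1)[OF g m]] by simp
  have "x \<odot>\<^bsub>M\<^esub> m = x \<odot>\<^bsub>M\<^esub> (\<Oplus>\<^bsub>M\<^esub> t \<in> T. r t (g t m))" using r_sum m by simp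
  also have "\<dots> = (\<Oplus>\<^bsub>M\<^esub> t \<in> T. x \<odot>\<^bsub>M\<^esub> r t (g t m))"
    using T x rgM by (intro finsum_smult_right) simp_all
  also have "\<dots> = (\<Oplus>\<^bsub>M\<^esub> t \<in> T. \<zero>\<^bsub>M\<^esub>)" using z by (intro M.finsum_cong') simp_all
  finally show "x \<odot>\<^bsub>M\<^esub> m = \<zero>\<^bsub>A\<^esub> \<odot>\<^bsub>M\<^esub> m" using m smult_zero_left[OF m] by (simp add: M.finsum_zero)
qed simp

end

locale equivariant_module = coordinatised_module +
  fixes \<phi> assumes \<phi>: "equivariant K A \<phi>"
begin

text \<open>Forced by the desired identity \<open>\<phi>(f r) = f theta r\<close>: write \<open>m\<close> as the sum of the \<open>r\<^sub>t(g\<^sub>t m)\<close>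
  and expand in the coordinates \<open>f\<^sub>s\<close>.\<close>

definition theta where
  "theta m = (\<Oplus>\<^bsub>M\<^esub> t \<in> T. \<Oplus>\<^bsub>M\<^esub> s \<in> S. \<phi> (hcomp (f s) (r t)) (g t m) \<odot>\<^bsub>M\<^esub> s)"

lemma phi_closed: "h \<in> H \<Longrightarrow> \<xi> \<in> carrier DA \<Longrightarrow> \<phi> h \<xi> \<in> carrier A"
  using equivariantD(4)[OF \<phi>] .

lemma theta_term_closed:
  assumes "m \<in> carrier M" "t \<in> T" "s \<in> S"
  shows "\<phi> (hcomp (f s) (r t)) (g t m) \<odot>\<^bsub>M\<^esub> s \<in> carrier M"
  using assms S(2) phi_closed[OF comp_closed[OF f r] module_homD(1)[OF g]] by (simp add: subset_iff)

lemma theta_closed: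
  assumes "m \<in> carrier M" shows "theta m \<in> carrier M"
  unfolding theta_def using theta_term_closed[OF assms]
  by (intro M.finsum_closed Pi_I) simp_all

lemma phi_comp_expand:
  assumes u: "u \<in> module_hom (opp A) M (regular (opp A))" and v: "v \<in> module_hom (opp A) DA M"
    and \<xi>: "\<xi> \<in> carrier DA"
  shows "\<phi> (hcomp u v) \<xi> = (\<Oplus>\<^bsub>A\<^esub> s \<in> S. u s \<otimes>\<^bsub>A\<^esub> \<phi> (hcomp (f s) v) \<xi>)"
proof -
  have uS: "u s \<in> carrier A" if "s \<in> S" for s using that S(2) regular_homD(1)[OF u] by blast
  have cf: "hcomp (f s) v \<in> H" if "s \<in> S" for s using comp_closed[OF f[OF that] v] .
  have "hcomp u v \<eta> = (\<Oplus>\<^bsub>A\<^esub> s \<in> S. u s \<otimes>\<^bsub>A\<^esub> hcomp (f s) v (left_act A \<one>\<^bsub>A\<^esub> \<eta>))" if \<eta>: "\<eta> \<in> carrier DA" for \<eta>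
  proof -
    have vM: "v \<eta> \<in> carrier M" using module_homD(1)[OF v \<eta>] .
    have fc: "f s (v \<eta>) \<in> carrier A" if "s \<in> S" for s using regular_homD(1)[OF f[OF that] vM] .
    have "u (v \<eta>) = u (\<Oplus>\<^bsub>M\<^esub> s \<in> S. f s (v \<eta>) \<odot>\<^bsub>M\<^esub> s)" using f_sum vM by simp
    also have "\<dots> = (\<Oplus>\<^bsub>A\<^esub> s \<in> S. u (f s (v \<eta>) \<odot>\<^bsub>M\<^esub> s))"
      using S fc
      by (intro additive_map_finsum[OF M.abelian_group_axioms A.abelian_group_axioms regular_homD(4)[OF u]])
        (simp_all add: subset_iff)
    also have "\<dots> = (\<Oplus>\<^bsub>A\<^esub> s \<in> S. u s \<otimes>\<^bsub>A\<^esub> hcomp (f s) v (left_act A \<one>\<^bsub>A\<^esub> \<eta>))"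
      using S(2) fc uS \<eta> left_act_hom(4)[OF A.one_closed \<eta> \<eta>]
      by (intro A.finsum_cong') (simp_all add: subset_iff regular_homD(3)[OF u])
    finally show ?thesis using \<eta> by simp
  qed
  then have "\<phi> (hcomp u v) \<xi> = (\<Oplus>\<^bsub>A\<^esub> s \<in> S. u s \<otimes>\<^bsub>A\<^esub> \<phi> (hcomp (f s) v) (left_act A \<one>\<^bsub>A\<^esub> \<xi>))"
    using cf uS by (intro equivariant_sum[OF \<phi> S(1) _ _ _ comp_closed[OF u v] _ \<xi>]) simp_all
  then show ?thesis using left_act_hom(4)[OF A.one_closed \<xi> \<xi>] by simp
qed

lemma hom_theta:
  assumes u: "u \<in> module_hom (opp A) M (regular (opp A))" and m: "m \<in> carrier M"
  shows "u (theta m) = (\<Oplus>\<^bsub>A\<^esub> t \<in> T. \<phi> (hcomp u (r t)) (g t m))"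
proof -
  note uadd = additive_map_finsum[OF M.abelian_group_axioms A.abelian_group_axioms regular_homD(4)[OF u]]
  note tc = theta_term_closed[OF m]
  have gm: "g t m \<in> carrier DA" if "t \<in> T" for t using module_homD(1)[OF g[OF that] m] .
  have pc: "\<phi> (hcomp (f s) (r t)) (g t m) \<in> carrier A" if "s \<in> S" "t \<in> T" for s t
    using phi_closed[OF comp_closed[OF f[OF that(1)] r[OF that(2)]] gm[OF that(2)]] .
  have uS: "u s \<in> carrier A" if "s \<in> S" for s using that S(2) regular_homD(1)[OF u] by blast
  have "u (theta m) = (\<Oplus>\<^bsub>A\<^esub> t \<in> T. u (\<Oplus>\<^bsub>M\<^esub> s \<in> S. \<phi> (hcomp (f s) (r t)) (g t m) \<odot>\<^bsub>M\<^esub> s))"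
    unfolding theta_def using tc by (intro uadd T Pi_I M.finsum_closed) simp
  also have "\<dots> = (\<Oplus>\<^bsub>A\<^esub> t \<in> T. \<phi> (hcomp u (r t)) (g t m))"
  proof (rule A.finsum_cong')
    fix t assume t: "t \<in> T"
    have "u (\<Oplus>\<^bsub>M\<^esub> s \<in> S. \<phi> (hcomp (f s) (r t)) (g t m) \<odot>\<^bsub>M\<^esub> s)
      = (\<Oplus>\<^bsub>A\<^esub> s \<in> S. u (\<phi> (hcomp (f s) (r t)) (g t m) \<odot>\<^bsub>M\<^esub> s))"
      using tc t by (intro uadd S(1) Pi_I) simp
    also have "\<dots> = (\<Oplus>\<^bsub>A\<^esub> s \<in> S. u s \<otimes>\<^bsub>A\<^esub> \<phi> (hcomp (f s) (r t)) (g t m))"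
      using pc t S(2) uS by (intro A.finsum_cong') (simp_all add: regular_homD(3)[OF u] subset_iff)
    also have "\<dots> = \<phi> (hcomp u (r t)) (g t m)" using phi_comp_expand[OF u r[OF t] gm[OF t]] by simp
    finally show "u (\<Oplus>\<^bsub>M\<^esub> s \<in> S. \<phi> (hcomp (f s) (r t)) (g t m) \<odot>\<^bsub>M\<^esub> s) = \<phi> (hcomp u (r t)) (g t m)" .
  qed (use phi_closed[OF comp_closed[OF u r] gm] in simp_all)
  finally show ?thesis .
qed

text \<open>The coordinates \<open>g\<^sub>t v\<close> of a map \<open>v\<close> from the dual space to \<open>M\<close> are endomorphisms of the dual
  space, hence left multiplications, and \<open>\<phi>\<close> is compatible with those. This is what makes the
  choice of coordinates in \<open>theta\<close> irrelevant.\<close>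

lemma phi_comp:
  assumes u: "u \<in> module_hom (opp A) M (regular (opp A))" and v: "v \<in> module_hom (opp A) DA M"
    and \<xi>: "\<xi> \<in> carrier DA"
  shows "\<phi> (hcomp u v) \<xi> = u (theta (v \<xi>))"
proof -
  have "\<exists>c. c \<in> carrier A \<and> (\<forall>\<eta> \<in> carrier DA. g t (v \<eta>) = left_act A c \<eta>)" if t: "t \<in> T" for t
  proof -
    have "(\<lambda>\<eta> \<in> carrier DA. g t (v \<eta>)) \<in> module_hom (opp A) DA DA"
      by (rule left_module.module_hom_compose[OF left_module_DA v g[OF t]])
    then show ?thesis
    proof (rule endomorphism_DA)
      fix c assume c: "c \<in> carrier A"
        "\<And>\<eta>. \<eta> \<in> carrier DA \<Longrightarrow> (\<lambda>\<eta> \<in> carrier DA. g t (v \<eta>)) \<eta> = left_act A c \<eta>"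
      have "\<forall>\<eta> \<in> carrier DA. g t (v \<eta>) = left_act A c \<eta>"
      proof
        fix \<eta> assume "\<eta> \<in> carrier DA"
        then show "g t (v \<eta>) = left_act A c \<eta>" using c(2)[of \<eta>] by simp
      qed
      with c(1) show ?thesis by blast
    qed
  qed
  then obtain c where c: "\<And>t. t \<in> T \<Longrightarrow> c t \<in> carrier A"
    "\<And>t \<eta>. t \<in> T \<Longrightarrow> \<eta> \<in> carrier DA \<Longrightarrow> g t (v \<eta>) = left_act A (c t) \<eta>" by metis
  have cu: "hcomp u (r t) \<in> H" if "t \<in> T" for t using comp_closed[OF u r[OF that]] .
  have "hcomp u v \<eta> = (\<Oplus>\<^bsub>A\<^esub> t \<in> T. \<one>\<^bsub>A\<^esub> \<otimes>\<^bsub>A\<^esub> hcomp u (r t) (left_act A (c t) \<eta>))"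
    if \<eta>: "\<eta> \<in> carrier DA" for \<eta>
  proof -
    have vM: "v \<eta> \<in> carrier M" using module_homD(1)[OF v \<eta>] .
    have gc: "g t (v \<eta>) \<in> carrier DA" if "t \<in> T" for t using module_homD(1)[OF g[OF that] vM] .
    have rc: "r t (g t (v \<eta>)) \<in> carrier M" if "t \<in> T" for t using module_homD(1)[OF r[OF that] gc[OF that]] .
    have "u (v \<eta>) = u (\<Oplus>\<^bsub>M\<^esub> t \<in> T. r t (g t (v \<eta>)))" using r_sum vM by simp
    also have "\<dots> = (\<Oplus>\<^bsub>A\<^esub> t \<in> T. u (r t (g t (v \<eta>))))"
      using T rc
      by (intro additive_map_finsum[OF M.abelian_group_axioms A.abelian_group_axioms regular_homD(4)[OF u]]) simp_all
    also have "\<dots> = (\<Oplus>\<^bsub>A\<^esub> t \<in> T. \<one>\<^bsub>A\<^esub> \<otimes>\<^bsub>A\<^esub> hcomp u (r t) (left_act A (c t) \<eta>))"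
    proof (rule A.finsum_cong')
      fix t assume t: "t \<in> T"
      have "u (r t (g t (v \<eta>))) \<in> carrier A" using regular_homD(1)[OF u rc[OF t]] .
      then show "u (r t (g t (v \<eta>))) = \<one>\<^bsub>A\<^esub> \<otimes>\<^bsub>A\<^esub> hcomp u (r t) (left_act A (c t) \<eta>)"
        using c(2)[OF t \<eta>] gc[OF t] by simp
    next
      show "(\<lambda>t. \<one>\<^bsub>A\<^esub> \<otimes>\<^bsub>A\<^esub> hcomp u (r t) (left_act A (c t) \<eta>)) \<in> T \<rightarrow> carrier A"
        using HD(1)[OF cu] c(1) \<eta> by (intro Pi_I A.m_closed) simp_all
    qed simp
    finally show ?thesis using \<eta> by simp
  qed
  then have "\<phi> (hcomp u v) \<xi> = (\<Oplus>\<^bsub>A\<^esub> t \<in> T. \<one>\<^bsub>A\<^esub> \<otimes>\<^bsub>A\<^esub> \<phi> (hcomp u (r t)) (left_act A (c t) \<xi>))"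
    using cu c(1) by (intro equivariant_sum[OF \<phi> T _ _ _ comp_closed[OF u v] _ \<xi>]) simp_all
  also have "\<dots> = (\<Oplus>\<^bsub>A\<^esub> t \<in> T. \<phi> (hcomp u (r t)) (g t (v \<xi>)))"
    using c \<xi> phi_closed[OF cu] by (intro A.finsum_cong') simp_all
  also have "\<dots> = u (theta (v \<xi>))" using hom_theta[OF u module_homD(1)[OF v \<xi>]] by simp
  finally show ?thesis .
qed

lemma theta_add:
  assumes "m \<in> carrier M" "m' \<in> carrier M"
  shows "theta (m \<oplus>\<^bsub>M\<^esub> m') = theta m \<oplus>\<^bsub>M\<^esub> theta m'"
proof (rule f_separates)
  show "theta (m \<oplus>\<^bsub>M\<^esub> m') \<in> carrier M" "theta m \<oplus>\<^bsub>M\<^esub> theta m' \<in> carrier M"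
    using assms theta_closed by simp_all
  fix s assume s: "s \<in> S"
  have gm: "g t m \<in> carrier DA" "g t m' \<in> carrier DA" if "t \<in> T" for t
    using module_homD(1)[OF g[OF that]] assms by simp_all
  have cf: "hcomp (f s) (r t) \<in> H" if "t \<in> T" for t using comp_closed[OF f[OF s] r[OF that]] .
  have "f s (theta (m \<oplus>\<^bsub>M\<^esub> m')) = (\<Oplus>\<^bsub>A\<^esub> t \<in> T. \<phi> (hcomp (f s) (r t)) (g t m) \<oplus>\<^bsub>A\<^esub> \<phi> (hcomp (f s) (r t)) (g t m'))"
  proof -
    have "\<phi> (hcomp (f s) (r t)) (g t (m \<oplus>\<^bsub>M\<^esub> m'))
      = \<phi> (hcomp (f s) (r t)) (g t m) \<oplus>\<^bsub>A\<^esub> \<phi> (hcomp (f s) (r t)) (g t m')" if t: "t \<in> T" for t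
      using equivariantD(1)[OF \<phi> cf[OF t]] gm[OF t] module_homD(2)[OF g[OF t] assms]
      by (simp add: dual_linear_def additive_map_def)
    then show ?thesis unfolding hom_theta[OF f[OF s] M.a_closed[OF assms]]
      using phi_closed[OF cf] gm by (intro A.finsum_cong') simp_all
  qed
  also have "\<dots> = f s (theta m) \<oplus>\<^bsub>A\<^esub> f s (theta m')"
    unfolding hom_theta[OF f[OF s] assms(1)] hom_theta[OF f[OF s] assms(2)]
    using phi_closed[OF cf] gm by (intro A.finsum_addf) simp_all
  finally show "f s (theta (m \<oplus>\<^bsub>M\<^esub> m')) = f s (theta m \<oplus>\<^bsub>M\<^esub> theta m')"
    using regular_homD(2)[OF f[OF s]] assms theta_closed by simp
qed

text \<open>For \<open>u : M \<rightarrow> A\<close> and \<open>v : D \<rightarrow> M\<close>, both \<open>u theta b v\<close> and \<open>u b theta v\<close> equal \<open>\<phi>(u b v)\<close>.\<close>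

lemma theta_commutes:
  assumes b: "b \<in> module_hom (opp A) M M" and m: "m \<in> carrier M"
  shows "theta (b m) = b (theta m)"
proof (rule f_separates)
  have bM: "b m \<in> carrier M" if "m \<in> carrier M" for m using module_homD(1)[OF b that] .
  show "theta (b m) \<in> carrier M" "b (theta m) \<in> carrier M" using bM theta_closed m by simp_all
  fix s assume s: "s \<in> S"
  have fb: "(\<lambda>m \<in> carrier M. f s (b m)) \<in> module_hom (opp A) M (regular (opp A))" (is "?fb \<in> _")
    by (rule module_hom_compose[OF b f[OF s]])
  have br: "(\<lambda>\<xi> \<in> carrier DA. b (r t \<xi>)) \<in> module_hom (opp A) DA M" if "t \<in> T" for t
    by (rule left_module.module_hom_compose[OF left_module_DA r[OF that] b])
  have gm: "g t m \<in> carrier DA" if "t \<in> T" for t using module_homD(1)[OF g[OF that] m] .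
  have rg: "r t (g t m) \<in> carrier M" if "t \<in> T" for t using module_homD(1)[OF r[OF that] gm[OF that]] .
  have add: "additive_map M A (\<lambda>m. f s (theta (b m)))"
    unfolding additive_map_def using theta_add theta_closed bM module_homD(2)[OF b] regular_homD[OF f[OF s]]
    by simp
  have "f s (b (theta m)) = ?fb (theta m)" using theta_closed m by simp
  also have "\<dots> = (\<Oplus>\<^bsub>A\<^esub> t \<in> T. \<phi> (hcomp ?fb (r t)) (g t m))" by (rule hom_theta[OF fb m])
  also have "\<dots> = (\<Oplus>\<^bsub>A\<^esub> t \<in> T. f s (theta (b (r t (g t m)))))"
  proof (rule A.finsum_cong')
    fix t assume t: "t \<in> T"
    have "hcomp ?fb (r t) = hcomp (f s) (\<lambda>\<xi> \<in> carrier DA. b (r t \<xi>))"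
      using module_homD(1)[OF r[OF t]] by (intro restrict_ext) simp
    then show "\<phi> (hcomp ?fb (r t)) (g t m) = f s (theta (b (r t (g t m))))"
      using phi_comp[OF f[OF s] br[OF t] gm[OF t]] gm[OF t] by simp
  qed (use additive_mapD(1)[OF add] rg in simp_all)
  also have "\<dots> = f s (theta (b (\<Oplus>\<^bsub>M\<^esub> t \<in> T. r t (g t m))))"
    using T rg
    by (intro additive_map_finsum[OF M.abelian_group_axioms A.abelian_group_axioms add, symmetric]) simp_all
  finally show "f s (theta (b m)) = f s (b (theta m))" using r_sum[OF m] by simp
qed

text \<open>For \<open>m\<close> in \<open>M\<close> the map \<open>\<xi> \<mapsto> m h(\<xi>)\<close> goes from the dual space to \<open>M\<close>, so the previous
  identity applies to it, and faithfulness of \<open>M\<close> cancels \<open>m\<close>.\<close>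

lemma phi_multiplication:
  assumes x: "x \<in> carrier A" and \<theta>: "\<And>m. m \<in> carrier M \<Longrightarrow> theta m = x \<odot>\<^bsub>M\<^esub> m"
    and h: "h \<in> H" and \<xi>: "\<xi> \<in> carrier DA"
  shows "\<phi> h \<xi> = h \<xi> \<otimes>\<^bsub>A\<^esub> x"
proof (rule faithfulD)
  note hD = HD[OF h]
  show c: "\<phi> h \<xi> \<in> carrier A" "h \<xi> \<otimes>\<^bsub>A\<^esub> x \<in> carrier A" using phi_closed[OF h \<xi>] hD(1) \<xi> x by simp_all
  fix m assume m: "m \<in> carrier M"
  show "\<phi> h \<xi> \<odot>\<^bsub>M\<^esub> m = (h \<xi> \<otimes>\<^bsub>A\<^esub> x) \<odot>\<^bsub>M\<^esub> m"
  proof (rule f_separates)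
    fix s assume s: "s \<in> S"
    have v: "(\<lambda>\<xi> \<in> carrier DA. h \<xi> \<odot>\<^bsub>M\<^esub> m) \<in> module_hom (opp A) DA M" (is "?v \<in> _")
      using hD m smult_l_distr
      by (intro left_module.restrict_module_homI[OF left_module_DA]) (simp_all add: smult_smult)
    have fm: "f s m \<in> carrier A" using regular_homD(1)[OF f[OF s] m] .
    have "hcomp (f s) ?v = twist K A (f s m) \<one>\<^bsub>A\<^esub> h"
      unfolding twist_def
    proof (rule restrict_ext)
      fix \<eta> assume \<eta>: "\<eta> \<in> carrier DA"
      then show "f s (?v \<eta>) = f s m \<otimes>\<^bsub>A\<^esub> h (left_act A \<one>\<^bsub>A\<^esub> \<eta>)"
        using hD(1) m regular_homD(3)[OF f[OF s]] left_act_hom(4)[OF A.one_closed \<eta> \<eta>] by simp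
    qed
    then have "f s m \<otimes>\<^bsub>A\<^esub> \<phi> h \<xi> = \<phi> (hcomp (f s) ?v) \<xi>"
      using equivariantD(3)[OF \<phi> h A.one_closed fm \<xi>] left_act_hom(4)[OF A.one_closed \<xi> \<xi>] by simp
    also have "\<dots> = f s (theta (h \<xi> \<odot>\<^bsub>M\<^esub> m))" using phi_comp[OF f[OF s] v \<xi>] \<xi> by simp
    also have "\<dots> = f s m \<otimes>\<^bsub>A\<^esub> (h \<xi> \<otimes>\<^bsub>A\<^esub> x)"
      using \<theta> hD(1)[OF \<xi>] m x by (simp add: smult_smult regular_homD(3)[OF f[OF s]])
    finally show "f s (\<phi> h \<xi> \<odot>\<^bsub>M\<^esub> m) = f s ((h \<xi> \<otimes>\<^bsub>A\<^esub> x) \<odot>\<^bsub>M\<^esub> m)"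
      using c m by (simp add: regular_homD(3)[OF f[OF s]])
  qed (use c m in simp_all)
qed

end

lemma over_end_simps:
  "carrier (over_end M) = carrier M" "add (over_end M) = add M" "smult (over_end M) = (\<lambda>h x. h x)"
  by (simp_all add: over_end_def)

lemma carrier_end_ring: "carrier (end_ring R M) = module_hom R M M"
  by (simp add: end_ring_def)

lemma (in coordinatised_module) double_centraliser_imp_dual_reflexive:
  assumes "double_centraliser A M"
  shows "dual_reflexive K A"
  unfolding dual_reflexive_def Let_def
proof (intro conjI ballI allI impI)
  fix x assume x: "x \<in> carrier A" and kill: "\<forall>h \<in> H. \<forall>\<xi> \<in> carrier DA. h \<xi> \<otimes>\<^bsub>A\<^esub> x = \<zero>\<^bsub>A\<^esub>"
  show "x = \<zero>\<^bsub>A\<^esub>" 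
  proof (rule trace_annihilator[OF x])
    fix h \<xi> assume "h \<in> H" "\<xi> \<in> carrier DA"
    then show "h \<xi> \<otimes>\<^bsub>A\<^esub> x = \<zero>\<^bsub>A\<^esub>" using kill by blast
  qed
next
  fix \<phi> assume "equivariant K A \<phi>"
  then interpret equivariant_module K A B w M S f T g r \<phi> by unfold_locales
  let ?E = "end_ring (opp A) M"
  let ?\<theta> = "\<lambda>m \<in> carrier M. theta m"
  have "?\<theta> \<in> module_hom ?E (over_end M) (over_end M)"
  proof (rule module_homI)
    fix b m assume "b \<in> carrier ?E" "m \<in> carrier (over_end M)"
    then have bm: "b \<in> module_hom (opp A) M M" "m \<in> carrier M" by (simp_all add: over_end_simps carrier_end_ring)
    then have "b m \<in> carrier M" by (rule module_homD(1))
    then show "?\<theta> (b \<odot>\<^bsub>over_end M\<^esub> m) = b \<odot>\<^bsub>over_end M\<^esub> ?\<theta> m"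
      using theta_commutes[OF bm] bm by (simp add: over_end_simps)
  qed (simp_all add: over_end_simps theta_closed theta_add)
  then have "?\<theta> \<in> carrier (opp (end_ring ?E (over_end M)))"
    unfolding opp_simps carrier_end_ring .
  moreover have "(\<lambda>a. \<lambda>m \<in> carrier M. a \<odot>\<^bsub>M\<^esub> m) ` carrier A = carrier (opp (end_ring ?E (over_end M)))"
    using assms unfolding double_centraliser_def by (intro bij_betw_imp_surj_on) (simp add: ring_iso_def)
  ultimately obtain x where x: "x \<in> carrier A" "?\<theta> = (\<lambda>m \<in> carrier M. x \<odot>\<^bsub>M\<^esub> m)" by blast
  have "theta m = x \<odot>\<^bsub>M\<^esub> m" if "m \<in> carrier M" for m using fun_cong[OF x(2), of m] that by simp
  then show "\<exists>x \<in> carrier A. \<forall>h \<in> H. \<forall>\<xi> \<in> carrier DA. \<phi> h \<xi> = h \<xi> \<otimes>\<^bsub>A\<^esub> x"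
    using phi_multiplication[OF x(1)] x(1) by blast
qed

text \<open>The maps \<open>g\<close> into the dual space are the compositions of the coordinates of \<open>M\<close> with the
  coordinate forms of \<open>A\<close>, that is, \<open>m \<mapsto> (a \<mapsto> w\<^sub>b (f\<^sub>s(m) a))\<close>.\<close>

theorem (in based_algebra) projective_injective_imp_dual_reflexive:
  fixes M :: "'a fgmod"
  assumes M: "fg_left_module (opp A) M" and faithful: "faithful (opp A) M"
    and proj: "projective (opp A) M" and inj: "injective (opp A) M" and dc: "double_centraliser A M"
  shows "dual_reflexive K A"
proof -
  interpret M: fg_left_module "opp A" M by fact
  interpret D: left_module "opp A" DA by (rule left_module_DA)
  have D: "fg_left_module (opp A) DA"
    by (intro fg_left_module.intro left_module_DA fg_left_module_axioms.intro finitely_generated_DA)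
  obtain S f where S: "finite S" "S \<subseteq> carrier M"
    and f: "\<And>s. s \<in> S \<Longrightarrow> f s \<in> module_hom (opp A) M (regular (opp A))"
    and f_sum: "\<And>m. m \<in> carrier M \<Longrightarrow> (\<Oplus>\<^bsub>M\<^esub> s \<in> S. f s m \<odot>\<^bsub>M\<^esub> s) = m"
    using projective_coordinates[OF M proj] by blast
  have fD: "f s m \<in> carrier A" if "s \<in> S" "m \<in> carrier M" for s m
    using module_homD(1)[OF f[OF that(1)] that(2)] by simp
  define g where "g t = (\<lambda>m \<in> carrier M. f (fst t) m \<odot>\<^bsub>DA\<^esub> w (snd t))" for t
  have g: "g t \<in> module_hom (opp A) M DA" if t: "t \<in> S \<times> B" for t
    unfolding g_def
  proof (rule M.restrict_module_homI)
    have st: "fst t \<in> S" "w (snd t) \<in> carrier DA" using t w_closed by (auto simp: mem_Times_iff)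
    note fD' = fD[OF st(1)] and fh = module_homD[OF f[OF st(1)]]
    show "f (fst t) m \<odot>\<^bsub>DA\<^esub> w (snd t) \<in> carrier DA" if "m \<in> carrier M" for m
      using fD'[OF that] st(2) by simp
    fix m assume m: "m \<in> carrier M"
    show "f (fst t) (m \<oplus>\<^bsub>M\<^esub> m') \<odot>\<^bsub>DA\<^esub> w (snd t)
      = f (fst t) m \<odot>\<^bsub>DA\<^esub> w (snd t) \<oplus>\<^bsub>DA\<^esub> f (fst t) m' \<odot>\<^bsub>DA\<^esub> w (snd t)"
      if m': "m' \<in> carrier M" for m'
      using fh(2)[OF m m'] fD'[OF m] fD'[OF m'] st(2) D.smult_l_distr by simp
    show "f (fst t) (a \<odot>\<^bsub>M\<^esub> m) \<odot>\<^bsub>DA\<^esub> w (snd t) = a \<odot>\<^bsub>DA\<^esub> (f (fst t) m \<odot>\<^bsub>DA\<^esub> w (snd t))"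
      if a: "a \<in> carrier (opp A)" for a
      using fh(3)[OF a m] fD'[OF m] st(2) a D.smult_assoc[of a "f (fst t) m"] by simp
  qed
  have ker: "m = m'" if m: "m \<in> carrier M" "m' \<in> carrier M" and eq: "\<forall>t \<in> S \<times> B. g t m = g t m'" for m m'
  proof -
    have "f s m = f s m'" if s: "s \<in> S" for s
    proof -
      note c = fD[OF s m(1)] fD[OF s m(2)]
      have "f s m \<ominus>\<^bsub>A\<^esub> f s m' = \<zero>\<^bsub>A\<^esub>"
      proof (rule separate)
        fix b assume b: "b \<in> B"
        have "g (s, b) m \<one>\<^bsub>A\<^esub> = g (s, b) m' \<one>\<^bsub>A\<^esub>" using eq s b by simp
        then have "w b (f s m) = w b (f s m')" using m c by (simp add: g_def DA_apply)
        then show "w b (f s m \<ominus>\<^bsub>A\<^esub> f s m') = \<zero>\<^bsub>K\<^esub>"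
          using additive_map_minus[OF A.abelian_group_axioms K.abelian_group_axioms DA_D(6)[OF w_closed[OF b]] c]
            c b by (simp add: K.minus_eq K.r_neg)
      qed (use c in simp)
      then show ?thesis using A.minus_zero_imp_eq[OF c] by simp
    qed
    then have "(\<Oplus>\<^bsub>M\<^esub> s \<in> S. f s m \<odot>\<^bsub>M\<^esub> s) = (\<Oplus>\<^bsub>M\<^esub> s \<in> S. f s m' \<odot>\<^bsub>M\<^esub> s)"
      using S(2) fD[OF _ m(2)] by (intro M.M.finsum_cong') (simp_all add: subset_iff)
    then show ?thesis using f_sum m by simp
  qed
  obtain r where r: "\<And>t. t \<in> S \<times> B \<Longrightarrow> r t \<in> module_hom (opp A) DA M"
    "\<And>m. m \<in> carrier M \<Longrightarrow> (\<Oplus>\<^bsub>M\<^esub> t \<in> S \<times> B. r t (g t m)) = m"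
  proof (rule injective_coordinates[OF M inj D, where T = "S \<times> B" and g = g])
    show "finite (S \<times> B)" using S(1) B_finite by simp
    show "\<And>t. t \<in> S \<times> B \<Longrightarrow> g t \<in> module_hom (opp A) M DA" by (rule g)
    show "\<And>m m'. m \<in> carrier M \<Longrightarrow> m' \<in> carrier M \<Longrightarrow> \<forall>t \<in> S \<times> B. g t m = g t m' \<Longrightarrow> m = m'"
      by (rule ker)
  next
    fix r assume "\<And>t. t \<in> S \<times> B \<Longrightarrow> r t \<in> module_hom (opp A) DA M"
      and "\<And>m. m \<in> carrier M \<Longrightarrow> (\<Oplus>\<^bsub>M\<^esub> t \<in> S \<times> B. r t (g t m)) = m"
    then show thesis by (rule that)
  qed
  interpret coordinatised_module K A B w M S f "S \<times> B" g r
    by unfold_locales (use faithful S f f_sum B_finite g r in simp_all)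
  show ?thesis by (rule double_centraliser_imp_dual_reflexive[OF dc])
qed


section \<open>A faithful idempotent\<close>

lemma (in based_algebra) minimal_subspace_A:
  assumes "U0 \<in> \<U>" "\<And>U. U \<in> \<U> \<Longrightarrow> is_submodule K A U"
  obtains U where "U \<in> \<U>" "\<And>U'. U' \<in> \<U> \<Longrightarrow> U' \<subseteq> U \<Longrightarrow> U' = U"
  using linear_space.minimal_subspace[OF linear_space_KA basis assms] by blast

context based_algebra
begin

lemma subspace_image:
  assumes "additive_map A A l" "\<And>k x. k \<in> carrier K \<Longrightarrow> x \<in> carrier A \<Longrightarrow> l (k \<odot>\<^bsub>A\<^esub> x) = k \<odot>\<^bsub>A\<^esub> l x"
  shows "is_submodule K A (l ` carrier A)"
  unfolding is_submodule_def
proof (intro conjI ballI)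
  show "l ` carrier A \<subseteq> carrier A" using additive_mapD(1)[OF assms(1)] by auto
  have "l \<zero>\<^bsub>A\<^esub> = \<zero>\<^bsub>A\<^esub>" by (rule additive_map_zero[OF A.abelian_group_axioms A.abelian_group_axioms assms(1)])
  then show "\<zero>\<^bsub>A\<^esub> \<in> l ` carrier A" by (metis A.zero_closed imageI)
  fix x assume "x \<in> l ` carrier A"
  then obtain x' where x: "x' \<in> carrier A" "x = l x'" by blast
  show "k \<odot>\<^bsub>A\<^esub> x \<in> l ` carrier A" if "k \<in> carrier K" for k
    using x that assms(2)[of k x', symmetric] by simp
  show "x \<oplus>\<^bsub>A\<^esub> y \<in> l ` carrier A" if "y \<in> l ` carrier A" for y
    using x that additive_mapD(2)[OF assms(1), symmetric] by auto
qed

text \<open>The chains \<open>n\<^sup>k A\<close> and \<open>A n\<^sup>k\<close> both stabilise. With \<open>s = n\<^sup>m\<close>, the resulting equations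
  \<open>s = s\<^sup>2 c = d s\<^sup>2\<close> make \<open>s c = d s\<close> an idempotent that fixes \<open>s\<close>: the projection onto the
  Fitting component on which \<open>n\<close> is invertible.\<close>

lemma fitting_idempotent:
  assumes n: "n \<in> carrier A"
  obtains m c d where "m \<ge> (1::nat)" "c \<in> carrier A" "d \<in> carrier A"
    "n [^]\<^bsub>A\<^esub> m = n [^]\<^bsub>A\<^esub> m \<otimes>\<^bsub>A\<^esub> n [^]\<^bsub>A\<^esub> m \<otimes>\<^bsub>A\<^esub> c"
    "n [^]\<^bsub>A\<^esub> m = d \<otimes>\<^bsub>A\<^esub> (n [^]\<^bsub>A\<^esub> m \<otimes>\<^bsub>A\<^esub> n [^]\<^bsub>A\<^esub> m)"
proof -
  let ?R = "\<lambda>k::nat. (\<lambda>a. n [^]\<^bsub>A\<^esub> k \<otimes>\<^bsub>A\<^esub> a) ` carrier A"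
  let ?L = "\<lambda>k::nat. (\<lambda>a. a \<otimes>\<^bsub>A\<^esub> n [^]\<^bsub>A\<^esub> k) ` carrier A"
  have nk: "n [^]\<^bsub>A\<^esub> (k::nat) \<in> carrier A" for k using n by simp
  have R: "is_submodule K A (?R k)" for k
    using nk by (intro subspace_image) (auto simp: additive_map_def A.r_distr smult_mult_right)
  have L: "is_submodule K A (?L k)" for k
    using nk by (intro subspace_image) (auto simp: additive_map_def A.l_distr smult_mult_left)
  have Rdec: "?R k' \<subseteq> ?R k" if "k \<le> k'" for k k'
  proof
    fix x assume "x \<in> ?R k'"
    then obtain a where a: "a \<in> carrier A" "x = n [^]\<^bsub>A\<^esub> k' \<otimes>\<^bsub>A\<^esub> a" by blast
    have "n [^]\<^bsub>A\<^esub> k' = n [^]\<^bsub>A\<^esub> k \<otimes>\<^bsub>A\<^esub> n [^]\<^bsub>A\<^esub> (k' - k)" using that n by (simp add: A.nat_pow_mult)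
    then have "x = n [^]\<^bsub>A\<^esub> k \<otimes>\<^bsub>A\<^esub> (n [^]\<^bsub>A\<^esub> (k' - k) \<otimes>\<^bsub>A\<^esub> a)" using a nk by (simp add: A.m_assoc)
    then show "x \<in> ?R k" using a(1) nk by blast
  qed
  have Ldec: "?L k' \<subseteq> ?L k" if "k \<le> k'" for k k'
  proof
    fix x assume "x \<in> ?L k'"
    then obtain a where a: "a \<in> carrier A" "x = a \<otimes>\<^bsub>A\<^esub> n [^]\<^bsub>A\<^esub> k'" by blast
    have "n [^]\<^bsub>A\<^esub> k' = n [^]\<^bsub>A\<^esub> (k' - k) \<otimes>\<^bsub>A\<^esub> n [^]\<^bsub>A\<^esub> k" using that n by (simp add: A.nat_pow_mult)
    then have "x = (a \<otimes>\<^bsub>A\<^esub> n [^]\<^bsub>A\<^esub> (k' - k)) \<otimes>\<^bsub>A\<^esub> n [^]\<^bsub>A\<^esub> k" using a nk by (simp add: A.m_assoc)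
    then show "x \<in> ?L k" using a(1) nk by blast
  qed
  obtain k where k: "\<And>k'. k \<le> k' \<Longrightarrow> ?R k' = ?R k"
  proof (rule minimal_subspace_A[of "?R 0" "range ?R"])
    fix U assume U: "U \<in> range ?R" "\<And>U'. U' \<in> range ?R \<Longrightarrow> U' \<subseteq> U \<Longrightarrow> U' = U"
    then obtain k where "U = ?R k" by blast
    then show thesis using U(2)[OF rangeI] Rdec that[of k] by blast
  qed (use R in blast)+
  obtain l where l: "\<And>l'. l \<le> l' \<Longrightarrow> ?L l' = ?L l"
  proof (rule minimal_subspace_A[of "?L 0" "range ?L"])
    fix U assume U: "U \<in> range ?L" "\<And>U'. U' \<in> range ?L \<Longrightarrow> U' \<subseteq> U \<Longrightarrow> U' = U"
    then obtain l where "U = ?L l" by blast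
    then show thesis using U(2)[OF rangeI] Ldec that[of l] by blast
  qed (use L in blast)+
  define m where "m = k + l + 1"
  let ?s = "n [^]\<^bsub>A\<^esub> m"
  have ss: "?s \<otimes>\<^bsub>A\<^esub> ?s = n [^]\<^bsub>A\<^esub> (m + m)" using n by (simp add: A.nat_pow_mult)
  have "?s \<in> ?R m" using nk by (intro image_eqI[of _ _ "\<one>\<^bsub>A\<^esub>"]) auto
  moreover have "?R m = ?R (m + m)" using k[of m] k[of "m + m"] by (simp add: m_def)
  ultimately obtain c where c: "c \<in> carrier A" "?s = n [^]\<^bsub>A\<^esub> (m + m) \<otimes>\<^bsub>A\<^esub> c" by blast
  have "?s \<in> ?L m" using nk by (intro image_eqI[of _ _ "\<one>\<^bsub>A\<^esub>"]) auto
  moreover have "?L m = ?L (m + m)" using l[of m] l[of "m + m"] by (simp add: m_def)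
  ultimately obtain d where d: "d \<in> carrier A" "?s = d \<otimes>\<^bsub>A\<^esub> n [^]\<^bsub>A\<^esub> (m + m)" by blast
  show thesis using that[of m c d] c d ss by (simp add: m_def)
qed

text \<open>Choose an idempotent \<open>e\<close> of \<open>I\<close> for which \<open>X = {x. e A x = 0}\<close> is minimal. If \<open>X\<close> is not zero,
  choose \<open>y\<close> in \<open>X\<close> with \<open>A y\<close> minimal. Then \<open>A i y = A y\<close> for some \<open>i\<close> in \<open>I\<close>, so \<open>y\<close> is fixed by
  an element of \<open>I\<close>, and by an element \<open>n\<close> of \<open>(1 - e) I (1 - e)\<close> since \<open>e y = 0\<close>. The idempotent
  \<open>e'\<close> obtained from \<open>n\<close> is orthogonal to \<open>e\<close> and fixes \<open>y\<close>, so \<open>e + e'\<close> contradicts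
  minimality.\<close>

lemma faithful_idempotent:
  assumes I: "I \<subseteq> carrier A" "\<zero>\<^bsub>A\<^esub> \<in> I" "\<And>a b. a \<in> I \<Longrightarrow> b \<in> I \<Longrightarrow> a \<oplus>\<^bsub>A\<^esub> b \<in> I"
    "\<And>a x. a \<in> I \<Longrightarrow> x \<in> carrier A \<Longrightarrow> a \<otimes>\<^bsub>A\<^esub> x \<in> I" "\<And>a x. a \<in> I \<Longrightarrow> x \<in> carrier A \<Longrightarrow> x \<otimes>\<^bsub>A\<^esub> a \<in> I"
    and ann: "\<And>x. x \<in> carrier A \<Longrightarrow> (\<forall>i \<in> I. i \<otimes>\<^bsub>A\<^esub> x = \<zero>\<^bsub>A\<^esub>) \<Longrightarrow> x = \<zero>\<^bsub>A\<^esub>"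
  obtains e where "e \<in> I" "e \<otimes>\<^bsub>A\<^esub> e = e"
    "\<And>x. x \<in> carrier A \<Longrightarrow> (\<forall>a \<in> carrier A. e \<otimes>\<^bsub>A\<^esub> (a \<otimes>\<^bsub>A\<^esub> x) = \<zero>\<^bsub>A\<^esub>) \<Longrightarrow> x = \<zero>\<^bsub>A\<^esub>"
proof -
  define X where "X e = {x \<in> carrier A. \<forall>a \<in> carrier A. e \<otimes>\<^bsub>A\<^esub> (a \<otimes>\<^bsub>A\<^esub> x) = \<zero>\<^bsub>A\<^esub>}" for e
  let ?idem = "\<lambda>e. e \<in> I \<and> e \<otimes>\<^bsub>A\<^esub> e = e"
  have X: "is_submodule K A (X e)" if "e \<in> carrier A" for e
    unfolding is_submodule_def X_def using that by (auto simp: A.r_distr smult_mult_right)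
  have "?idem \<zero>\<^bsub>A\<^esub>" using I by simp
  then have X0: "X \<zero>\<^bsub>A\<^esub> \<in> X ` {e. ?idem e}" by blast
  obtain U where U: "U \<in> X ` {e. ?idem e}" "\<And>U'. U' \<in> X ` {e. ?idem e} \<Longrightarrow> U' \<subseteq> U \<Longrightarrow> U' = U"
    by (rule minimal_subspace_A[OF X0]) (use X I(1) in blast)+
  then obtain e where e: "e \<in> I" "e \<otimes>\<^bsub>A\<^esub> e = e" "U = X e" by blast
  have eA: "e \<in> carrier A" using e I by blast
  have "X e \<subseteq> {\<zero>\<^bsub>A\<^esub>}"
  proof (rule ccontr)
    assume "\<not> X e \<subseteq> {\<zero>\<^bsub>A\<^esub>}"
    then obtain y0 where y0: "y0 \<in> X e" "y0 \<noteq> \<zero>\<^bsub>A\<^esub>" by blast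
    let ?P = "\<lambda>y. (\<lambda>a. a \<otimes>\<^bsub>A\<^esub> y) ` carrier A"
    have XA: "y \<in> carrier A" if "y \<in> X e" for y using that by (simp add: X_def)
    have P: "is_submodule K A (?P y)" if "y \<in> X e" for y
      using XA[OF that] by (intro subspace_image) (auto simp: additive_map_def A.l_distr smult_mult_left)
    have P0: "?P y0 \<in> ?P ` {y \<in> X e. y \<noteq> \<zero>\<^bsub>A\<^esub>}" using y0 by blast
    obtain Y where Y: "Y \<in> ?P ` {y \<in> X e. y \<noteq> \<zero>\<^bsub>A\<^esub>}"
      "\<And>Y'. Y' \<in> ?P ` {y \<in> X e. y \<noteq> \<zero>\<^bsub>A\<^esub>} \<Longrightarrow> Y' \<subseteq> Y \<Longrightarrow> Y' = Y"
      by (rule minimal_subspace_A[OF P0]) (use P in blast)+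
    then obtain y where y: "y \<in> X e" "y \<noteq> \<zero>\<^bsub>A\<^esub>" "Y = ?P y" by blast
    have yA: "y \<in> carrier A" using y XA by blast
    obtain i where i: "i \<in> I" "i \<otimes>\<^bsub>A\<^esub> y \<noteq> \<zero>\<^bsub>A\<^esub>" using ann[OF yA] y(2) by blast
    have iA: "i \<in> carrier A" using i I by blast
    have iy: "i \<otimes>\<^bsub>A\<^esub> y \<in> X e"
    proof -
      have "e \<otimes>\<^bsub>A\<^esub> (a \<otimes>\<^bsub>A\<^esub> (i \<otimes>\<^bsub>A\<^esub> y)) = \<zero>\<^bsub>A\<^esub>" if "a \<in> carrier A" for a
      proof -
        have "e \<otimes>\<^bsub>A\<^esub> ((a \<otimes>\<^bsub>A\<^esub> i) \<otimes>\<^bsub>A\<^esub> y) = \<zero>\<^bsub>A\<^esub>" using y(1) that iA unfolding X_def by blast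
        then show ?thesis using that iA yA by (simp add: A.m_assoc)
      qed
      then show ?thesis using iA yA by (simp add: X_def)
    qed
    have "?P (i \<otimes>\<^bsub>A\<^esub> y) \<subseteq> Y"
    proof
      fix x assume "x \<in> ?P (i \<otimes>\<^bsub>A\<^esub> y)"
      then obtain a where a: "a \<in> carrier A" "x = a \<otimes>\<^bsub>A\<^esub> (i \<otimes>\<^bsub>A\<^esub> y)" by blast
      then have "x = (a \<otimes>\<^bsub>A\<^esub> i) \<otimes>\<^bsub>A\<^esub> y" using iA yA by (simp add: A.m_assoc)
      then show "x \<in> Y" unfolding y(3) using a iA by blast
    qed
    then have "?P (i \<otimes>\<^bsub>A\<^esub> y) = Y" using iy i(2) by (intro Y(2)) blast+
    moreover have "y \<in> Y" unfolding y(3) using yA by (intro image_eqI[of _ _ "\<one>\<^bsub>A\<^esub>"]) auto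
    ultimately obtain a where a: "a \<in> carrier A" "y = a \<otimes>\<^bsub>A\<^esub> (i \<otimes>\<^bsub>A\<^esub> y)" by blast
    define f where "f = \<one>\<^bsub>A\<^esub> \<ominus>\<^bsub>A\<^esub> e"
    define n where "n = f \<otimes>\<^bsub>A\<^esub> (a \<otimes>\<^bsub>A\<^esub> i) \<otimes>\<^bsub>A\<^esub> f"
    have fA: "f \<in> carrier A" using eA by (simp add: f_def)
    have ef: "e \<otimes>\<^bsub>A\<^esub> f = \<zero>\<^bsub>A\<^esub>" "f \<otimes>\<^bsub>A\<^esub> e = \<zero>\<^bsub>A\<^esub>"
      using eA e(2) by (simp_all add: f_def A.minus_eq A.r_distr A.l_distr A.r_minus A.l_minus A.r_neg)
    have nI: "n \<in> I" unfolding n_def using i(1) a(1) fA by (intro I(4,5))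
    then have nA: "n \<in> carrier A" using I by blast
    have "e \<otimes>\<^bsub>A\<^esub> (\<one>\<^bsub>A\<^esub> \<otimes>\<^bsub>A\<^esub> y) = \<zero>\<^bsub>A\<^esub>" using y(1) unfolding X_def by blast
    then have ey: "e \<otimes>\<^bsub>A\<^esub> y = \<zero>\<^bsub>A\<^esub>" using yA by simp
    then have fy: "f \<otimes>\<^bsub>A\<^esub> y = y" using eA yA by (simp add: f_def A.minus_eq A.l_distr A.l_minus)
    have "n \<otimes>\<^bsub>A\<^esub> y = f \<otimes>\<^bsub>A\<^esub> (a \<otimes>\<^bsub>A\<^esub> (i \<otimes>\<^bsub>A\<^esub> (f \<otimes>\<^bsub>A\<^esub> y)))"
      unfolding n_def using fA a(1) iA yA by (simp add: A.m_assoc)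
    then have ny: "n \<otimes>\<^bsub>A\<^esub> y = y" using fy a(2)[symmetric] by simp
    have en: "e \<otimes>\<^bsub>A\<^esub> n = \<zero>\<^bsub>A\<^esub>" "n \<otimes>\<^bsub>A\<^esub> e = \<zero>\<^bsub>A\<^esub>"
    proof -
      have "e \<otimes>\<^bsub>A\<^esub> n = (e \<otimes>\<^bsub>A\<^esub> f) \<otimes>\<^bsub>A\<^esub> ((a \<otimes>\<^bsub>A\<^esub> i) \<otimes>\<^bsub>A\<^esub> f)"
        "n \<otimes>\<^bsub>A\<^esub> e = f \<otimes>\<^bsub>A\<^esub> (a \<otimes>\<^bsub>A\<^esub> i) \<otimes>\<^bsub>A\<^esub> (f \<otimes>\<^bsub>A\<^esub> e)"
        unfolding n_def using eA fA a(1) iA by (simp_all add: A.m_assoc)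
      then show "e \<otimes>\<^bsub>A\<^esub> n = \<zero>\<^bsub>A\<^esub>" "n \<otimes>\<^bsub>A\<^esub> e = \<zero>\<^bsub>A\<^esub>" using ef fA a(1) iA by simp_all
    qed
    obtain m c d where m: "m \<ge> (1::nat)" "c \<in> carrier A" "d \<in> carrier A"
      and sc0: "n [^]\<^bsub>A\<^esub> m = n [^]\<^bsub>A\<^esub> m \<otimes>\<^bsub>A\<^esub> n [^]\<^bsub>A\<^esub> m \<otimes>\<^bsub>A\<^esub> c"
      and ds0: "n [^]\<^bsub>A\<^esub> m = d \<otimes>\<^bsub>A\<^esub> (n [^]\<^bsub>A\<^esub> m \<otimes>\<^bsub>A\<^esub> n [^]\<^bsub>A\<^esub> m)"
      using fitting_idempotent[OF nA] by blast
    define s where "s = n [^]\<^bsub>A\<^esub> m"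
    have sA: "s \<in> carrier A" using nA by (simp add: s_def)
    have sc: "s \<otimes>\<^bsub>A\<^esub> s \<otimes>\<^bsub>A\<^esub> c = s" and ds: "d \<otimes>\<^bsub>A\<^esub> (s \<otimes>\<^bsub>A\<^esub> s) = s" using sc0 ds0 by (simp_all add: s_def)
    obtain m' where m': "m = Suc m'" using m(1) by (cases m) auto
    have s1: "s = n [^]\<^bsub>A\<^esub> m' \<otimes>\<^bsub>A\<^esub> n" and s2: "s = n \<otimes>\<^bsub>A\<^esub> n [^]\<^bsub>A\<^esub> m'"
      using nA A.nat_pow_Suc2[OF nA, of m'] by (simp_all add: s_def m')
    have sI: "s \<in> I" unfolding s1 using nI nA by (intro I(5)) auto
    have es: "e \<otimes>\<^bsub>A\<^esub> s = \<zero>\<^bsub>A\<^esub>"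
      unfolding s2 using en eA nA by (simp add: A.m_assoc[symmetric])
    have se: "s \<otimes>\<^bsub>A\<^esub> e = \<zero>\<^bsub>A\<^esub>"
      unfolding s1 using en eA nA by (simp add: A.m_assoc)
    have powy: "n [^]\<^bsub>A\<^esub> (j::nat) \<otimes>\<^bsub>A\<^esub> y = y" for j
      by (induction j) (use nA yA ny in \<open>auto simp: A.m_assoc\<close>)
    define e' where "e' = s \<otimes>\<^bsub>A\<^esub> c"
    have e'A: "e' \<in> carrier A" and e'I: "e' \<in> I" using sA sI m I(4) by (simp_all add: e'_def)
    have e'ds: "e' = d \<otimes>\<^bsub>A\<^esub> s"
    proof -
      have "e' = (d \<otimes>\<^bsub>A\<^esub> (s \<otimes>\<^bsub>A\<^esub> s)) \<otimes>\<^bsub>A\<^esub> c" by (simp add: e'_def ds)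
      also have "\<dots> = d \<otimes>\<^bsub>A\<^esub> (s \<otimes>\<^bsub>A\<^esub> s \<otimes>\<^bsub>A\<^esub> c)" using m sA by (simp add: A.m_assoc)
      finally show ?thesis by (simp add: sc)
    qed
    have e's: "e' \<otimes>\<^bsub>A\<^esub> s = s" using ds m sA by (simp add: e'ds A.m_assoc)
    have e'e': "e' \<otimes>\<^bsub>A\<^esub> e' = e'"
    proof -
      have "e' \<otimes>\<^bsub>A\<^esub> e' = (e' \<otimes>\<^bsub>A\<^esub> s) \<otimes>\<^bsub>A\<^esub> c" using e'A sA m by (simp add: e'_def A.m_assoc)
      then show ?thesis by (simp add: e's) (simp add: e'_def)
    qed
    have ee': "e \<otimes>\<^bsub>A\<^esub> e' = \<zero>\<^bsub>A\<^esub>" using es eA sA m by (simp add: e'_def A.m_assoc[symmetric])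
    have e'e: "e' \<otimes>\<^bsub>A\<^esub> e = \<zero>\<^bsub>A\<^esub>" using se eA sA m by (simp add: e'ds A.m_assoc)
    have e'y: "e' \<otimes>\<^bsub>A\<^esub> y = y"
    proof -
      have sy: "s \<otimes>\<^bsub>A\<^esub> y = y" using powy by (simp add: s_def)
      have "e' \<otimes>\<^bsub>A\<^esub> (s \<otimes>\<^bsub>A\<^esub> y) = (e' \<otimes>\<^bsub>A\<^esub> s) \<otimes>\<^bsub>A\<^esub> y" using e'A sA yA by (simp add: A.m_assoc)
      then show ?thesis by (simp add: e's sy)
    qed
    let ?g = "e \<oplus>\<^bsub>A\<^esub> e'"
    have gI: "?g \<in> I" using e(1) e'I by (rule I(3))
    have gg: "?g \<otimes>\<^bsub>A\<^esub> ?g = ?g" using eA e'A by (simp add: A.l_distr A.r_distr e(2) e'e' ee' e'e)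
    have eg: "e \<otimes>\<^bsub>A\<^esub> ?g = e" using eA e'A by (simp add: A.r_distr e(2) ee')
    have "X ?g \<subseteq> X e"
    proof
      fix x assume x: "x \<in> X ?g"
      have "e \<otimes>\<^bsub>A\<^esub> (b \<otimes>\<^bsub>A\<^esub> x) = \<zero>\<^bsub>A\<^esub>" if b: "b \<in> carrier A" for b
      proof -
        have xA: "x \<in> carrier A" and "?g \<otimes>\<^bsub>A\<^esub> (b \<otimes>\<^bsub>A\<^esub> x) = \<zero>\<^bsub>A\<^esub>" using x b by (simp_all add: X_def)
        then have "e \<otimes>\<^bsub>A\<^esub> (?g \<otimes>\<^bsub>A\<^esub> (b \<otimes>\<^bsub>A\<^esub> x)) = \<zero>\<^bsub>A\<^esub>" using eA by simp
        moreover have "e \<otimes>\<^bsub>A\<^esub> (?g \<otimes>\<^bsub>A\<^esub> (b \<otimes>\<^bsub>A\<^esub> x)) = (e \<otimes>\<^bsub>A\<^esub> ?g) \<otimes>\<^bsub>A\<^esub> (b \<otimes>\<^bsub>A\<^esub> x)"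
          using eA e'A b xA by (intro A.m_assoc[symmetric]) auto
        ultimately show ?thesis by (simp add: eg)
      qed
      then show "x \<in> X e" using x by (simp add: X_def)
    qed
    then have "X ?g = X e" using U(2)[of "X ?g"] gI gg e(3) by blast
    then have "?g \<otimes>\<^bsub>A\<^esub> (\<one>\<^bsub>A\<^esub> \<otimes>\<^bsub>A\<^esub> y) = \<zero>\<^bsub>A\<^esub>" using y(1) unfolding X_def by blast
    then have "y = \<zero>\<^bsub>A\<^esub>" using eA e'A yA by (simp add: A.l_distr ey e'y)
    then show False using y(2) by simp
  qed
  then have "x = \<zero>\<^bsub>A\<^esub>" if "x \<in> carrier A" "\<forall>a \<in> carrier A. e \<otimes>\<^bsub>A\<^esub> (a \<otimes>\<^bsub>A\<^esub> x) = \<zero>\<^bsub>A\<^esub>" for x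
    using that unfolding X_def by blast
  then show thesis using that e(1,2) by blast
qed

end


section \<open>The dual space is injective\<close>

definition restrict_scalars ::
    "('k, 'a, 'y) module_scheme \<Rightarrow> ('a, 'm, 'z) module_scheme \<Rightarrow> ('k, 'm) module" where
  "restrict_scalars A M =
    \<lparr>carrier = carrier M, mult = undefined, one = undefined, zero = zero M, add = add M,
     smult = (\<lambda>k x. (k \<odot>\<^bsub>A\<^esub> \<one>\<^bsub>A\<^esub>) \<odot>\<^bsub>M\<^esub> x)\<rparr>"

lemma restrict_scalars_simps [simp]:
  "carrier (restrict_scalars A M) = carrier M" "zero (restrict_scalars A M) = zero M"
  "add (restrict_scalars A M) = add M" "smult (restrict_scalars A M) = (\<lambda>k x. (k \<odot>\<^bsub>A\<^esub> \<one>\<^bsub>A\<^esub>) \<odot>\<^bsub>M\<^esub> x)"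
  by (simp_all add: restrict_scalars_def)

lemma (in fd_algebra) linear_space_restrict_scalars:
  assumes "left_module (opp A) M"
  shows "linear_space K (restrict_scalars A M)"
proof -
  interpret M: left_module "opp A" M by fact
  show ?thesis
  proof (intro linear_space.intro left_module.intro left_module_axioms.intro K.ring_axioms K.field_axioms)
    show "abelian_group (restrict_scalars A M)"
      by (rule abelian_groupI) (auto simp: M.M.a_ac intro: M.M.ex_a_inv)
  next
    fix a b x y assume ab: "a \<in> carrier K" "b \<in> carrier K"
      and x: "x \<in> carrier (restrict_scalars A M)"
    have 1: "(a \<oplus>\<^bsub>K\<^esub> b) \<odot>\<^bsub>A\<^esub> \<one>\<^bsub>A\<^esub> = a \<odot>\<^bsub>A\<^esub> \<one>\<^bsub>A\<^esub> \<oplus>\<^bsub>A\<^esub> b \<odot>\<^bsub>A\<^esub> \<one>\<^bsub>A\<^esub>" using ab by (simp add: smult_l_distr)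
    have 2: "(a \<otimes>\<^bsub>K\<^esub> b) \<odot>\<^bsub>A\<^esub> \<one>\<^bsub>A\<^esub> = (b \<odot>\<^bsub>A\<^esub> \<one>\<^bsub>A\<^esub>) \<otimes>\<^bsub>A\<^esub> (a \<odot>\<^bsub>A\<^esub> \<one>\<^bsub>A\<^esub>)"
      using ab by (simp add: smult_mult_left smult_assoc1[symmetric] K.m_comm)
    show "(a \<oplus>\<^bsub>K\<^esub> b) \<odot>\<^bsub>restrict_scalars A M\<^esub> x
      = a \<odot>\<^bsub>restrict_scalars A M\<^esub> x \<oplus>\<^bsub>restrict_scalars A M\<^esub> b \<odot>\<^bsub>restrict_scalars A M\<^esub> x"
      using ab x M.smult_l_distr by (simp add: 1)
    show "(a \<otimes>\<^bsub>K\<^esub> b) \<odot>\<^bsub>restrict_scalars A M\<^esub> x = a \<odot>\<^bsub>restrict_scalars A M\<^esub> (b \<odot>\<^bsub>restrict_scalars A M\<^esub> x)"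
      using ab x M.smult_assoc[of "a \<odot>\<^bsub>A\<^esub> \<one>\<^bsub>A\<^esub>" "b \<odot>\<^bsub>A\<^esub> \<one>\<^bsub>A\<^esub>" x] by (simp add: 2)
  next
    fix x assume "x \<in> carrier (restrict_scalars A M)"
    then show "\<one>\<^bsub>K\<^esub> \<odot>\<^bsub>restrict_scalars A M\<^esub> x = x" using M.smult_one by simp
  qed (simp_all add: M.smult_r_distr)
qed

lemma (in based_algebra) finitely_generated_restrict_scalars:
  assumes M: "fg_left_module (opp A) M"
  shows "finitely_generated K (restrict_scalars A M)"
proof -
  interpret M: fg_left_module "opp A" M by fact
  interpret V: linear_space K "restrict_scalars A M"
    by (rule linear_space_restrict_scalars) (rule M.left_module_axioms)
  obtain T where T: "finite T" "T \<subseteq> carrier M" and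
    gen: "\<And>U. is_submodule (opp A) M U \<Longrightarrow> T \<subseteq> U \<Longrightarrow> carrier M \<subseteq> U"
    by (rule M.finitely_generatedD[OF M.finitely_generated]) blast
  let ?G = "(\<lambda>(b, t). b \<odot>\<^bsub>M\<^esub> t) ` (B \<times> T)"
  show ?thesis
  proof (rule V.finitely_generatedI)
    show "finite ?G" using T(1) B_finite by simp
    show "?G \<subseteq> carrier (restrict_scalars A M)"
    proof
      fix z assume "z \<in> ?G"
      then obtain b t where "b \<in> B" "t \<in> T" "z = b \<odot>\<^bsub>M\<^esub> t" by auto
      then show "z \<in> carrier (restrict_scalars A M)" using B_closed T(2) by (simp add: subset_iff)
    qed
    fix U assume U: "is_submodule K (restrict_scalars A M) U" "?G \<subseteq> U"
    have Uadd: "\<And>x y. x \<in> U \<Longrightarrow> y \<in> U \<Longrightarrow> x \<oplus>\<^bsub>M\<^esub> y \<in> U" and U0: "\<zero>\<^bsub>M\<^esub> \<in> U" and UM: "U \<subseteq> carrier M"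
      and Usm: "\<And>k x. k \<in> carrier K \<Longrightarrow> x \<in> U \<Longrightarrow> (k \<odot>\<^bsub>A\<^esub> \<one>\<^bsub>A\<^esub>) \<odot>\<^bsub>M\<^esub> x \<in> U"
      using U(1) by (simp_all add: is_submodule_def)
    let ?W = "{v \<in> carrier M. \<forall>a \<in> carrier A. a \<odot>\<^bsub>M\<^esub> v \<in> U}"
    have "carrier M \<subseteq> ?W"
    proof (rule gen)
      show "is_submodule (opp A) M ?W"
        unfolding is_submodule_def
      proof (intro conjI ballI)
        fix a v assume a: "a \<in> carrier (opp A)" and v: "v \<in> ?W"
        then have "b \<odot>\<^bsub>M\<^esub> (a \<odot>\<^bsub>M\<^esub> v) \<in> U" if "b \<in> carrier A" for b
        proof -
          have "b \<odot>\<^bsub>M\<^esub> (a \<odot>\<^bsub>M\<^esub> v) = (a \<otimes>\<^bsub>A\<^esub> b) \<odot>\<^bsub>M\<^esub> v" using that a v M.smult_assoc[of b a v] by simp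
          then show ?thesis using that a v by simp
        qed
        then show "a \<odot>\<^bsub>M\<^esub> v \<in> ?W" using a v by simp
      qed (simp_all add: U0 Uadd M.smult_r_distr subset_iff)
      show "T \<subseteq> ?W"
      proof
        fix t assume t: "t \<in> T"
        then have tM: "t \<in> carrier M" using T(2) by blast
        have "a \<odot>\<^bsub>M\<^esub> t \<in> U" if a: "a \<in> carrier A" for a
        proof -
          have "additive_map A M (\<lambda>a. a \<odot>\<^bsub>M\<^esub> t)"
            using M.additive_map_smult(2)[OF tM] by (simp add: additive_map_def)
          then have "(\<Oplus>\<^bsub>A\<^esub> b \<in> B. w b a \<odot>\<^bsub>A\<^esub> b) \<odot>\<^bsub>M\<^esub> t = (\<Oplus>\<^bsub>M\<^esub> b \<in> B. (w b a \<odot>\<^bsub>A\<^esub> b) \<odot>\<^bsub>M\<^esub> t)"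
            using B_finite B_closed a
            by (intro additive_map_finsum[OF A.abelian_group_axioms M.M.abelian_group_axioms]) simp_all
          also have "\<dots> \<in> U"
          proof (rule M.M.finsum_mem[OF B_finite U0 UM Uadd])
            fix b assume b: "b \<in> B"
            have "(w b a \<odot>\<^bsub>A\<^esub> \<one>\<^bsub>A\<^esub>) \<odot>\<^bsub>M\<^esub> (b \<odot>\<^bsub>M\<^esub> t) \<in> U" using U(2) b t a by (intro Usm) auto
            moreover have "(w b a \<odot>\<^bsub>A\<^esub> \<one>\<^bsub>A\<^esub>) \<odot>\<^bsub>M\<^esub> (b \<odot>\<^bsub>M\<^esub> t) = (w b a \<odot>\<^bsub>A\<^esub> b) \<odot>\<^bsub>M\<^esub> t"
              using b a tM B_closed M.smult_assoc[of "w b a \<odot>\<^bsub>A\<^esub> \<one>\<^bsub>A\<^esub>" b t] by (simp add: smult_mult_right)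
            ultimately show "(w b a \<odot>\<^bsub>A\<^esub> b) \<odot>\<^bsub>M\<^esub> t \<in> U" by simp
          qed
          finally show ?thesis using expand[OF a] by simp
        qed
        then show "t \<in> ?W" using tM by simp
      qed
    qed
    then have "\<one>\<^bsub>A\<^esub> \<odot>\<^bsub>M\<^esub> v \<in> U" if "v \<in> carrier M" for v using that A.one_closed by blast
    then show "carrier (restrict_scalars A M) \<subseteq> U" using M.smult_one by (simp add: subset_iff)
  qed
qed

text \<open>A homomorphism \<open>k\<close> to the dual space is the same thing as the linear form \<open>x \<mapsto> k(x)(1)\<close>. The
  linear form extends from \<open>U\<close> to \<open>V\<close> because the restrictions of linear forms on \<open>V\<close> separate the
  points of \<open>U\<close>, finitely many of them being enough.\<close>

lemma (in based_algebra) DA_injective: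
  assumes U: "left_module (opp A) U" and V: "fg_left_module (opp A) V"
    and g: "g \<in> module_hom (opp A) U V" "inj_on g (carrier U)" and k: "k \<in> module_hom (opp A) U DA"
  obtains k' where "k' \<in> module_hom (opp A) V DA" "\<And>x. x \<in> carrier U \<Longrightarrow> k' (g x) = k x"
proof -
  interpret U: left_module "opp A" U by fact
  interpret V: fg_left_module "opp A" V by fact
  interpret UK: linear_space K "restrict_scalars A U" by (rule linear_space_restrict_scalars[OF U])
  interpret VK: linear_space K "restrict_scalars A V"
    by (rule linear_space_restrict_scalars) (rule V.left_module_axioms)
  obtain C v where C: "dual_basis K (restrict_scalars A V) C v"
    using VK.ex_dual_basis[OF finitely_generated_restrict_scalars[OF V]] by blast
  note gD = module_homD[OF g(1), simplified] and kD = module_homD[OF k, simplified]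
  let ?l = "\<lambda>x. k x \<one>\<^bsub>A\<^esub>"
  have lin: "linear_form K (restrict_scalars A U) ?l"
    unfolding linear_form_def additive_map_def
    using kD DA_D(1) by (simp add: DA_apply scal_eq[symmetric])
  define W where "W = {\<lambda>x. \<mu> (g x) |\<mu>. linear_form K (restrict_scalars A V) \<mu>}"
  have WI: "(\<lambda>x. \<mu> (g x)) \<in> W" if "linear_form K (restrict_scalars A V) \<mu>" for \<mu>
    using that unfolding W_def by blast
  have Wlin: "linear_form K (restrict_scalars A U) u" if u: "u \<in> W" for u
  proof -
    obtain \<mu> where \<mu>: "linear_form K (restrict_scalars A V) \<mu>" "u = (\<lambda>x. \<mu> (g x))" using u by (auto simp: W_def)
    note \<mu>D = linear_formD[OF \<mu>(1), simplified]
    show ?thesis unfolding \<mu>(2) linear_form_def additive_map_def using gD \<mu>D by simp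
  qed
  have Wadd: "\<exists>u \<in> W. \<forall>x \<in> carrier (restrict_scalars A U). u x = u1 x \<oplus>\<^bsub>K\<^esub> u2 x"
    if u: "u1 \<in> W" "u2 \<in> W" for u1 u2
  proof -
    obtain \<mu> \<nu> where \<mu>: "linear_form K (restrict_scalars A V) \<mu>" "u1 = (\<lambda>x. \<mu> (g x))"
      and \<nu>: "linear_form K (restrict_scalars A V) \<nu>" "u2 = (\<lambda>x. \<nu> (g x))"
      using u unfolding W_def by blast
    have "linear_form K (restrict_scalars A V) (\<lambda>z. \<mu> z \<oplus>\<^bsub>K\<^esub> \<nu> z)"
      using linear_formD[OF \<mu>(1)] linear_formD[OF \<nu>(1)]
      unfolding linear_form_def additive_map_def by (simp add: K.a_ac K.r_distr)
    then have "(\<lambda>x. \<mu> (g x) \<oplus>\<^bsub>K\<^esub> \<nu> (g x)) \<in> W" by (rule WI)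
    then show ?thesis unfolding \<mu>(2) \<nu>(2) by (rule rev_bexI) simp
  qed
  have Wsmult: "\<exists>u \<in> W. \<forall>x \<in> carrier (restrict_scalars A U). u x = c \<otimes>\<^bsub>K\<^esub> u1 x"
    if c: "c \<in> carrier K" and u: "u1 \<in> W" for c u1
  proof -
    obtain \<mu> where \<mu>: "linear_form K (restrict_scalars A V) \<mu>" "u1 = (\<lambda>x. \<mu> (g x))"
      using u unfolding W_def by blast
    have "linear_form K (restrict_scalars A V) (\<lambda>z. c \<otimes>\<^bsub>K\<^esub> \<mu> z)"
      using linear_formD[OF \<mu>(1)] c
      unfolding linear_form_def additive_map_def by (simp add: K.m_ac K.r_distr)
    then have "(\<lambda>x. c \<otimes>\<^bsub>K\<^esub> \<mu> (g x)) \<in> W" by (rule WI)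
    then show ?thesis unfolding \<mu>(2) by (rule rev_bexI) simp
  qed
  have Wzero: "\<exists>u \<in> W. \<forall>x \<in> carrier (restrict_scalars A U). u x = \<zero>\<^bsub>K\<^esub>"
  proof -
    have "linear_form K (restrict_scalars A V) (\<lambda>z. \<zero>\<^bsub>K\<^esub>)" unfolding linear_form_def additive_map_def by simp
    then have "(\<lambda>x. \<zero>\<^bsub>K\<^esub>) \<in> W" by (rule WI)
    then show ?thesis by (rule rev_bexI) simp
  qed
  let ?F = "(\<lambda>b x. v b (g x)) ` C"
  have F: "finite ?F" "?F \<subseteq> W" using dual_basisD(1,3)[OF C] by (auto simp: W_def)
  have ker: "?l x = \<zero>\<^bsub>K\<^esub>" if x: "x \<in> carrier (restrict_scalars A U)" "\<forall>u \<in> ?F. u x = \<zero>\<^bsub>K\<^esub>" for x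
  proof -
    have gx: "g x \<in> carrier V" using gD(1) x(1) by simp
    have "g x = (\<Oplus>\<^bsub>restrict_scalars A V\<^esub> b \<in> C. v b (g x) \<odot>\<^bsub>restrict_scalars A V\<^esub> b)"
      using dual_basisD(4)[OF C] gx by simp
    also have "\<dots> = (\<Oplus>\<^bsub>restrict_scalars A V\<^esub> b \<in> C. \<zero>\<^bsub>restrict_scalars A V\<^esub>)"
    proof (rule VK.M.finsum_cong')
      fix b assume b: "b \<in> C"
      have "v b (g x) = \<zero>\<^bsub>K\<^esub>" using x(2) b by simp
      then show "v b (g x) \<odot>\<^bsub>restrict_scalars A V\<^esub> b = \<zero>\<^bsub>restrict_scalars A V\<^esub>"
        using VK.smult_zero_left[of b] dual_basisD(2)[OF C] b by (simp only: subset_iff)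
    qed (use VK.M.zero_closed in blast)+
    also have "\<dots> = \<zero>\<^bsub>V\<^esub>" using VK.M.finsum_zero by simp
    finally have "g x = g \<zero>\<^bsub>U\<^esub>"
      using additive_map_zero[OF U.M.abelian_group_axioms V.M.abelian_group_axioms module_hom_additive[OF g(1)]] by simp
    then have "x = \<zero>\<^bsub>U\<^esub>" using g(2) x(1) by (simp add: inj_on_def)
    then show ?thesis
      using additive_map_zero[OF U.M.abelian_group_axioms _ module_hom_additive[OF k]] left_module_DA
      by (simp add: left_module_def DA_apply)
  qed
  have "\<exists>u \<in> W. \<forall>x \<in> carrier (restrict_scalars A U). u x = ?l x"
  proof (rule UK.linear_form_mem[where F = "?F"])
    show "finite ?F" "?F \<subseteq> W" by (rule F)+
    show "linear_form K (restrict_scalars A U) ?l" by (rule lin)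
  qed (fact Wlin Wadd Wsmult Wzero ker)+
  then obtain u where u: "u \<in> W" "\<forall>x \<in> carrier (restrict_scalars A U). u x = ?l x" ..
  obtain \<mu> where \<mu>': "linear_form K (restrict_scalars A V) \<mu>" "u = (\<lambda>x. \<mu> (g x))"
    using u(1) unfolding W_def by blast
  have \<mu>: "linear_form K (restrict_scalars A V) \<mu>" "\<And>x. x \<in> carrier U \<Longrightarrow> \<mu> (g x) = k x \<one>\<^bsub>A\<^esub>"
    using \<mu>' u(2) by simp_all
  note \<mu>D = linear_formD[OF \<mu>(1), simplified]
  have sa: "(k \<odot>\<^bsub>A\<^esub> a) \<odot>\<^bsub>V\<^esub> z = (k \<odot>\<^bsub>A\<^esub> \<one>\<^bsub>A\<^esub>) \<odot>\<^bsub>V\<^esub> (a \<odot>\<^bsub>V\<^esub> z)"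
    if "k \<in> carrier K" "a \<in> carrier A" "z \<in> carrier V" for k a z
    using that V.smult_assoc[of "k \<odot>\<^bsub>A\<^esub> \<one>\<^bsub>A\<^esub>" a z] by (simp add: smult_mult_right)
  define q where "q z = (\<lambda>a \<in> carrier A. \<mu> (a \<odot>\<^bsub>V\<^esub> z))" for z
  have q: "q z \<in> carrier DA" if z: "z \<in> carrier V" for z
    unfolding q_def
  proof (rule DA_restrictI)
    show "linear_form K A (\<lambda>a. \<mu> (a \<odot>\<^bsub>V\<^esub> z))"
      unfolding linear_form_def additive_map_def
    proof (intro conjI ballI)
      show "(\<lambda>a. \<mu> (a \<odot>\<^bsub>V\<^esub> z)) \<in> carrier A \<rightarrow> carrier K" using z \<mu>D(1) by simp
      show "\<mu> ((a \<oplus>\<^bsub>A\<^esub> a') \<odot>\<^bsub>V\<^esub> z) = \<mu> (a \<odot>\<^bsub>V\<^esub> z) \<oplus>\<^bsub>K\<^esub> \<mu> (a' \<odot>\<^bsub>V\<^esub> z)"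
        if "a \<in> carrier A" "a' \<in> carrier A" for a a'
        using z that \<mu>D(2) V.smult_l_distr[of a a' z] by simp
      show "\<mu> ((c \<odot>\<^bsub>A\<^esub> a) \<odot>\<^bsub>V\<^esub> z) = c \<otimes>\<^bsub>K\<^esub> \<mu> (a \<odot>\<^bsub>V\<^esub> z)" if "c \<in> carrier K" "a \<in> carrier A" for c a
        unfolding sa[OF that z] using z that by (intro \<mu>D(3)) simp_all
    qed
  qed
  have "(\<lambda>z \<in> carrier V. q z) \<in> module_hom (opp A) V DA"
  proof (rule V.restrict_module_homI)
    fix z z' assume z: "z \<in> carrier V" "z' \<in> carrier V"
    show "q (z \<oplus>\<^bsub>V\<^esub> z') = q z \<oplus>\<^bsub>DA\<^esub> q z'"
    proof (rule DA_eqI)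
      fix a assume "a \<in> carrier A"
      then show "q (z \<oplus>\<^bsub>V\<^esub> z') a = (q z \<oplus>\<^bsub>DA\<^esub> q z') a"
        using z \<mu>D(2) V.smult_r_distr[of a z z'] by (simp add: DA_apply) (simp add: q_def)
    qed (use q z in simp_all)
  next
    fix c z assume c: "c \<in> carrier (opp A)" and z: "z \<in> carrier V"
    show "q (c \<odot>\<^bsub>V\<^esub> z) = c \<odot>\<^bsub>DA\<^esub> q z"
    proof (rule DA_eqI)
      fix a assume "a \<in> carrier A"
      then show "q (c \<odot>\<^bsub>V\<^esub> z) a = (c \<odot>\<^bsub>DA\<^esub> q z) a"
        using z c V.smult_assoc[of a c z] by (simp add: DA_apply) (simp add: q_def)
    qed (use q c z in simp_all)
  qed (rule q)
  moreover have "(\<lambda>z \<in> carrier V. q z) (g x) = k x" if x: "x \<in> carrier U" for x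
  proof -
    have "q (g x) = k x"
    proof (rule DA_eqI)
      show "q (g x) \<in> carrier DA" "k x \<in> carrier DA" using q gD(1) kD(1) x by simp_all
      fix a assume a: "a \<in> carrier A"
      then have "q (g x) a = \<mu> (g (a \<odot>\<^bsub>U\<^esub> x))" using gD(3) x by (simp add: q_def)
      also have "\<dots> = (a \<odot>\<^bsub>DA\<^esub> k x) \<one>\<^bsub>A\<^esub>" using \<mu>(2) kD(3) x a U.smult_closed[of a x] by simp
      finally show "q (g x) a = k x a" using a by (simp add: DA_apply)
    qed
    then show ?thesis using gD(1) x by simp
  qed
  ultimately show thesis by (rule that)
qed


section \<open>Construction of the module\<close>

text \<open>Finite sums of values \<open>h(\<xi>)\<close>, generated one summand at a time so that statements about the ideal
  can be proved by induction.\<close>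

inductive_set trace_ideal :: "('k, 'x) ring_scheme \<Rightarrow> ('k, 'a, 'y) module_scheme \<Rightarrow> 'a set"
  for K :: "('k, 'x) ring_scheme" and A :: "('k, 'a, 'y) module_scheme" where
  trace_zero: "\<zero>\<^bsub>A\<^esub> \<in> trace_ideal K A"
| trace_add: "h \<in> module_hom (opp A) (right_dual K A) (regular (opp A)) \<Longrightarrow> \<xi> \<in> carrier (right_dual K A) \<Longrightarrow>
    i \<in> trace_ideal K A \<Longrightarrow> h \<xi> \<oplus>\<^bsub>A\<^esub> i \<in> trace_ideal K A"

context based_algebra
begin

lemma trace_closed: "i \<in> trace_ideal K A \<Longrightarrow> i \<in> carrier A"
  by (induction rule: trace_ideal.induct) (simp_all add: HD(1))

lemma trace_plus:
  assumes "i \<in> trace_ideal K A" "j \<in> trace_ideal K A"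
  shows "i \<oplus>\<^bsub>A\<^esub> j \<in> trace_ideal K A"
  using assms(1)
proof (induction rule: trace_ideal.induct)
  case trace_zero
  then show ?case using assms(2) trace_closed by simp
next
  case (trace_add h \<xi> i)
  then show ?case
    using trace_ideal.trace_add[OF trace_add(1,2,4)] assms(2) HD(1)[OF trace_add(1,2)]
      trace_closed by (simp add: A.a_assoc)
qed

lemma trace_mult_right:
  assumes "i \<in> trace_ideal K A" "x \<in> carrier A"
  shows "i \<otimes>\<^bsub>A\<^esub> x \<in> trace_ideal K A"
  using assms(1)
proof (induction rule: trace_ideal.induct)
  case (trace_add h \<xi> i)
  then show ?case
    using trace_ideal.trace_add[OF trace_add(1) DA_closed(3)[OF trace_add(2) assms(2)] trace_add(4)]
      assms(2) HD(1,3)[OF trace_add(1,2)] trace_closed by (simp add: A.l_distr)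
qed (use assms(2) trace_ideal.trace_zero in simp)

lemma trace_mult_left:
  assumes "i \<in> trace_ideal K A" "x \<in> carrier A"
  shows "x \<otimes>\<^bsub>A\<^esub> i \<in> trace_ideal K A"
  using assms(1)
proof (induction rule: trace_ideal.induct)
  case (trace_add h \<xi> i)
  have "twist K A x \<one>\<^bsub>A\<^esub> h \<in> H" using trace_add assms(2) by (intro twist_closed) auto
  from trace_ideal.trace_add[OF this trace_add(2,4)]
  have "x \<otimes>\<^bsub>A\<^esub> h \<xi> \<oplus>\<^bsub>A\<^esub> x \<otimes>\<^bsub>A\<^esub> i \<in> trace_ideal K A"
    using trace_add(2) left_act_hom(4)[OF A.one_closed trace_add(2) trace_add(2)] by (simp add: twist_def)
  then show ?case using assms(2) HD(1)[OF trace_add(1,2)] trace_closed[OF trace_add(3)] by (simp add: A.r_distr)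
qed (use assms(2) trace_ideal.trace_zero in simp)

lemma trace_value: "h \<in> H \<Longrightarrow> \<xi> \<in> carrier DA \<Longrightarrow> h \<xi> \<in> trace_ideal K A"
  using trace_ideal.trace_add[OF _ _ trace_ideal.trace_zero] HD(1) by fastforce

text \<open>Left multiplication by \<open>h(\<eta>)\<close> on \<open>A\<close> is \<open>h\<close> after \<open>a \<mapsto> \<eta> a\<close>, so it factors through the
  injective module \<open>D\<close>. This replaces the injectivity of \<open>eA\<close> as a summand of a power of \<open>D\<close>.\<close>

lemma trace_extension:
  assumes i: "i \<in> trace_ideal K A" and U: "left_module (opp A) U" and V: "fg_left_module (opp A) V"
    and g: "g \<in> module_hom (opp A) U V" "inj_on g (carrier U)"
    and u: "u \<in> module_hom (opp A) U (regular (opp A))"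
  shows "\<exists>v \<in> module_hom (opp A) V (regular (opp A)). \<forall>x \<in> carrier U. v (g x) = i \<otimes>\<^bsub>A\<^esub> u x"
  using i
proof (induction rule: trace_ideal.induct)
  interpret V: fg_left_module "opp A" V by fact
  note uD = module_homD[OF u, simplified]
  case trace_zero
  have "(\<lambda>z \<in> carrier V. \<zero>\<^bsub>A\<^esub>) \<in> module_hom (opp A) V (regular (opp A))"
    by (rule V.restrict_module_homI) simp_all
  then show ?case using uD(1) module_homD(1)[OF g(1)] by (intro bexI) simp_all
next
  interpret U: left_module "opp A" U by fact
  interpret V: fg_left_module "opp A" V by fact
  interpret D: left_module "opp A" DA by (rule left_module_DA)
  note uD = module_homD[OF u, simplified]
  case (trace_add h \<eta> i)
  have uA: "u x \<in> carrier A" if "x \<in> carrier U" for x using uD(1) that .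
  obtain v where v: "v \<in> module_hom (opp A) V (regular (opp A))" "\<And>x. x \<in> carrier U \<Longrightarrow> v (g x) = i \<otimes>\<^bsub>A\<^esub> u x"
    using trace_add.IH by blast
  note vD = module_homD[OF v(1), simplified] and hD = HD[OF trace_add(1)]
  have k: "(\<lambda>x \<in> carrier U. u x \<odot>\<^bsub>DA\<^esub> \<eta>) \<in> module_hom (opp A) U DA"
  proof (rule U.restrict_module_homI)
    show "u x \<odot>\<^bsub>DA\<^esub> \<eta> \<in> carrier DA" if "x \<in> carrier U" for x using uA that trace_add(2) by simp
    show "u (x \<oplus>\<^bsub>U\<^esub> y) \<odot>\<^bsub>DA\<^esub> \<eta> = u x \<odot>\<^bsub>DA\<^esub> \<eta> \<oplus>\<^bsub>DA\<^esub> u y \<odot>\<^bsub>DA\<^esub> \<eta>"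
      if "x \<in> carrier U" "y \<in> carrier U" for x y
      using uA uD(2) that trace_add(2) D.smult_l_distr[of "u x" "u y" \<eta>] by simp
    show "u (a \<odot>\<^bsub>U\<^esub> x) \<odot>\<^bsub>DA\<^esub> \<eta> = a \<odot>\<^bsub>DA\<^esub> (u x \<odot>\<^bsub>DA\<^esub> \<eta>)"
      if "a \<in> carrier (opp A)" "x \<in> carrier U" for a x
      using uA uD(3) that trace_add(2) D.smult_assoc[of a "u x" \<eta>] by simp
  qed
  obtain k' where k': "k' \<in> module_hom (opp A) V DA"
    "\<And>x. x \<in> carrier U \<Longrightarrow> k' (g x) = (\<lambda>x \<in> carrier U. u x \<odot>\<^bsub>DA\<^esub> \<eta>) x"
    using DA_injective[OF U V g k] by blast
  note k'D = module_homD[OF k'(1), simplified]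
  have "(\<lambda>z \<in> carrier V. h (k' z) \<oplus>\<^bsub>A\<^esub> v z) \<in> module_hom (opp A) V (regular (opp A))"
  proof (rule V.restrict_module_homI)
    have c: "h (k' z) \<in> carrier A" "v z \<in> carrier A" if "z \<in> carrier V" for z
      using that hD(1) k'D(1) vD(1) by simp_all
    show "h (k' z) \<oplus>\<^bsub>A\<^esub> v z \<in> carrier (regular (opp A))" if "z \<in> carrier V" for z using c that by simp
    show "h (k' (y \<oplus>\<^bsub>V\<^esub> z)) \<oplus>\<^bsub>A\<^esub> v (y \<oplus>\<^bsub>V\<^esub> z)
      = (h (k' y) \<oplus>\<^bsub>A\<^esub> v y) \<oplus>\<^bsub>regular (opp A)\<^esub> (h (k' z) \<oplus>\<^bsub>A\<^esub> v z)"
      if "y \<in> carrier V" "z \<in> carrier V" for y z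
      using c that k'D(1,2) vD(2) hD(2) by (simp add: A.a_ac)
    show "h (k' (a \<odot>\<^bsub>V\<^esub> z)) \<oplus>\<^bsub>A\<^esub> v (a \<odot>\<^bsub>V\<^esub> z) = a \<odot>\<^bsub>regular (opp A)\<^esub> (h (k' z) \<oplus>\<^bsub>A\<^esub> v z)"
      if "a \<in> carrier (opp A)" "z \<in> carrier V" for a z
      using c that k'D(1,3) vD(3) hD(3) by (simp add: A.l_distr)
  qed
  moreover have "(\<lambda>z \<in> carrier V. h (k' z) \<oplus>\<^bsub>A\<^esub> v z) (g x) = (h \<eta> \<oplus>\<^bsub>A\<^esub> i) \<otimes>\<^bsub>A\<^esub> u x" if x: "x \<in> carrier U" for x
    using k'(2)[OF x] v(2)[OF x] x module_homD(1)[OF g(1) x] uA[OF x] hD(1,3)[OF trace_add(2)]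
      trace_closed[OF trace_add(3)] by (simp add: A.l_distr)
  ultimately show ?case by blast
qed

text \<open>The functionals of the form \<open>\<eta> e b\<close> have no common zero when \<open>eA\<close> is faithful, so they span
  the dual space.\<close>

lemma DA_generated:
  assumes e: "e \<in> carrier A"
    and faith: "\<And>x. x \<in> carrier A \<Longrightarrow> (\<forall>a \<in> carrier A. e \<otimes>\<^bsub>A\<^esub> (a \<otimes>\<^bsub>A\<^esub> x) = \<zero>\<^bsub>A\<^esub>) \<Longrightarrow> x = \<zero>\<^bsub>A\<^esub>"
    and W: "W \<subseteq> carrier DA" "\<And>\<xi> \<eta>. \<xi> \<in> W \<Longrightarrow> \<eta> \<in> W \<Longrightarrow> \<xi> \<oplus>\<^bsub>DA\<^esub> \<eta> \<in> W"
      "\<And>k \<xi>. k \<in> carrier K \<Longrightarrow> \<xi> \<in> W \<Longrightarrow> scal K A k \<xi> \<in> W"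
    and gen: "\<And>b \<eta>. b \<in> carrier A \<Longrightarrow> \<eta> \<in> carrier DA \<Longrightarrow> (e \<otimes>\<^bsub>A\<^esub> b) \<odot>\<^bsub>DA\<^esub> \<eta> \<in> W"
  shows "carrier DA \<subseteq> W"
proof
  fix \<xi> assume \<xi>: "\<xi> \<in> carrier DA"
  let ?F = "(\<lambda>(b, c). (e \<otimes>\<^bsub>A\<^esub> b) \<odot>\<^bsub>DA\<^esub> w c) ` (B \<times> B)"
  have "\<exists>u \<in> W. \<forall>x \<in> carrier A. u x = \<xi> x"
  proof (rule linear_space.linear_form_mem[OF linear_space_KA, where F = ?F])
    show "linear_form K A u" if "u \<in> W" for u using that W(1) DA_D(5) by blast
    show "\<exists>u \<in> W. \<forall>x \<in> carrier A. u x = u1 x \<oplus>\<^bsub>K\<^esub> u2 x" if "u1 \<in> W" "u2 \<in> W" for u1 u2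
      using W(2)[OF that] by (rule rev_bexI) (simp add: DA_apply)
    show "\<exists>u \<in> W. \<forall>x \<in> carrier A. u x = k \<otimes>\<^bsub>K\<^esub> u1 x" if "k \<in> carrier K" "u1 \<in> W" for k u1
      using W(3)[OF that] by (rule rev_bexI) (simp add: DA_apply)
    show "\<exists>u \<in> W. \<forall>x \<in> carrier A. u x = \<zero>\<^bsub>K\<^esub>"
      using gen[OF A.zero_closed DA_closed(1)] by (rule rev_bexI) (use e in \<open>simp add: DA_apply\<close>)
    show "finite ?F" using B_finite by simp
    show "?F \<subseteq> W" using gen B_closed w_closed by auto
    show "linear_form K A \<xi>" by (rule DA_D(5)[OF \<xi>])
    fix x assume x: "x \<in> carrier A" and z: "\<forall>u \<in> ?F. u x = \<zero>\<^bsub>K\<^esub>"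
    have eb: "e \<otimes>\<^bsub>A\<^esub> (b \<otimes>\<^bsub>A\<^esub> x) = \<zero>\<^bsub>A\<^esub>" if b: "b \<in> B" for b
    proof (rule separate)
      have bA: "b \<in> carrier A" using B_closed[OF b] .
      show "e \<otimes>\<^bsub>A\<^esub> (b \<otimes>\<^bsub>A\<^esub> x) \<in> carrier A" using e bA x by simp
      fix c assume "c \<in> B"
      then have "(e \<otimes>\<^bsub>A\<^esub> b) \<odot>\<^bsub>DA\<^esub> w c \<in> ?F" using b by (intro image_eqI[of _ _ "(b, c)"]) simp_all
      with z have "((e \<otimes>\<^bsub>A\<^esub> b) \<odot>\<^bsub>DA\<^esub> w c) x = \<zero>\<^bsub>K\<^esub>" by (rule bspec)
      then show "w c (e \<otimes>\<^bsub>A\<^esub> (b \<otimes>\<^bsub>A\<^esub> x)) = \<zero>\<^bsub>K\<^esub>" using x e bA by (simp add: DA_apply A.m_assoc)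
    qed
    have "e \<otimes>\<^bsub>A\<^esub> (a \<otimes>\<^bsub>A\<^esub> x) = \<zero>\<^bsub>A\<^esub>" if a: "a \<in> carrier A" for a
    proof -
      have "e \<otimes>\<^bsub>A\<^esub> (a \<otimes>\<^bsub>A\<^esub> x) = e \<otimes>\<^bsub>A\<^esub> (\<Oplus>\<^bsub>A\<^esub> b \<in> B. w b a \<odot>\<^bsub>A\<^esub> b) \<otimes>\<^bsub>A\<^esub> x"
        using expand[OF a] e a x by (simp add: A.m_assoc)
      also have "\<dots> = (\<Oplus>\<^bsub>A\<^esub> b \<in> B. e \<otimes>\<^bsub>A\<^esub> (w b a \<odot>\<^bsub>A\<^esub> b) \<otimes>\<^bsub>A\<^esub> x)"
        using B_finite B_closed a e x
        by (intro additive_map_finsum[OF A.abelian_group_axioms A.abelian_group_axioms A_mult_hom(1)]) auto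
      also have "\<dots> = (\<Oplus>\<^bsub>A\<^esub> b \<in> B. \<zero>\<^bsub>A\<^esub>)"
        using B_closed a e x eb
        by (intro A.finsum_cong') (simp_all add: smult_mult_left smult_mult_right A.m_assoc)
      finally show ?thesis by (simp add: A.finsum_zero)
    qed
    then have "x = \<zero>\<^bsub>A\<^esub>" using faith[OF x] by blast
    then show "\<xi> x = \<zero>\<^bsub>K\<^esub>"
      using additive_map_zero[OF A.abelian_group_axioms K.abelian_group_axioms DA_D(6)[OF \<xi>]] by simp
  qed
  then obtain u where u: "u \<in> W" "\<forall>x \<in> carrier A. u x = \<xi> x" by blast
  then have "u = \<xi>" using W(1) \<xi> by (intro DA_eqI) auto
  then show "\<xi> \<in> W" using u(1) by simp
qed

end

text \<open>A copy \<open>M\<close> of \<open>eA\<close>, presented as a retract of the regular module: \<open>\<iota>\<close> is the inclusion and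
  \<open>\<pi>\<close> is \<open>a \<mapsto> e a\<close>. Test modules live in a type of their own, whence the copy.\<close>

locale idempotent_module = based_algebra K A B w + fg_left_module "opp A" M
  for K :: "('k, 'x) ring_scheme" (structure) and A :: "('k, 'a, 'y) module_scheme" (structure)
    and B w and M :: "('a, 'm, 'z) module_scheme" (structure) +
  fixes e :: 'a and \<iota> :: "'m \<Rightarrow> 'a" and \<pi> :: "'a \<Rightarrow> 'm"
  assumes e: "e \<in> trace_ideal K A"
    and e_faithful: "\<And>x. x \<in> carrier A \<Longrightarrow> (\<forall>a \<in> carrier A. e \<otimes>\<^bsub>A\<^esub> (a \<otimes>\<^bsub>A\<^esub> x) = \<zero>\<^bsub>A\<^esub>) \<Longrightarrow> x = \<zero>\<^bsub>A\<^esub>"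
    and \<iota>: "\<iota> \<in> module_hom (opp A) M (regular (opp A))"
    and \<pi>: "\<pi> \<in> module_hom (opp A) (regular (opp A)) M"
    and \<pi>\<iota>: "\<And>m. m \<in> carrier M \<Longrightarrow> \<pi> (\<iota> m) = m"
    and \<iota>\<pi>: "\<And>a. a \<in> carrier A \<Longrightarrow> \<iota> (\<pi> a) = e \<otimes>\<^bsub>A\<^esub> a"
begin

lemma eA: "e \<in> carrier A"
  using trace_closed[OF e] .

lemma \<iota>D:
  "m \<in> carrier M \<Longrightarrow> \<iota> m \<in> carrier A"
  "m \<in> carrier M \<Longrightarrow> m' \<in> carrier M \<Longrightarrow> \<iota> (m \<oplus>\<^bsub>M\<^esub> m') = \<iota> m \<oplus>\<^bsub>A\<^esub> \<iota> m'"
  "a \<in> carrier A \<Longrightarrow> m \<in> carrier M \<Longrightarrow> \<iota> (a \<odot>\<^bsub>M\<^esub> m) = \<iota> m \<otimes>\<^bsub>A\<^esub> a"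
  using module_homD[OF \<iota>] by simp_all

lemma \<pi>D:
  "x \<in> carrier A \<Longrightarrow> \<pi> x \<in> carrier M"
  "x \<in> carrier A \<Longrightarrow> y \<in> carrier A \<Longrightarrow> \<pi> (x \<oplus>\<^bsub>A\<^esub> y) = \<pi> x \<oplus>\<^bsub>M\<^esub> \<pi> y"
  "a \<in> carrier A \<Longrightarrow> x \<in> carrier A \<Longrightarrow> \<pi> (x \<otimes>\<^bsub>A\<^esub> a) = a \<odot>\<^bsub>M\<^esub> \<pi> x"
  using module_homD[OF \<pi>] by simp_all

lemma \<iota>_inject: "m \<in> carrier M \<Longrightarrow> m' \<in> carrier M \<Longrightarrow> \<iota> m = \<iota> m' \<Longrightarrow> m = m'"
  using \<pi>\<iota> by metis

lemma e_\<iota>: "m \<in> carrier M \<Longrightarrow> e \<otimes>\<^bsub>A\<^esub> \<iota> m = \<iota> m"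
  using \<iota>\<pi>[OF \<iota>D(1)] \<pi>\<iota> by simp

lemma \<pi>_e: "x \<in> carrier A \<Longrightarrow> \<pi> (e \<otimes>\<^bsub>A\<^esub> x) = \<pi> x"
  using \<iota>\<pi> \<pi>\<iota>[OF \<pi>D(1)] by simp

lemma module_faithful: "faithful (opp A) M"
  unfolding faithful_def
proof (intro ballI impI)
  fix a assume a: "a \<in> carrier (opp A)" and z: "\<forall>m \<in> carrier M. a \<odot>\<^bsub>M\<^esub> m = \<zero>\<^bsub>M\<^esub>"
  have "e \<otimes>\<^bsub>A\<^esub> (b \<otimes>\<^bsub>A\<^esub> a) = \<zero>\<^bsub>A\<^esub>" if b: "b \<in> carrier A" for b
  proof -
    have "\<iota> (a \<odot>\<^bsub>M\<^esub> \<pi> b) = \<iota> \<zero>\<^bsub>M\<^esub>" using z \<pi>D(1)[OF b] by simp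
    also have "\<dots> = \<zero>\<^bsub>A\<^esub>"
      using additive_map_zero[OF M.abelian_group_axioms _ module_hom_additive[OF \<iota>]] R.abelian_group_regular by simp
    finally show ?thesis using a b eA \<pi>D(1) by (simp add: \<iota>D(3) \<iota>\<pi> A.m_assoc)
  qed
  then show "a = \<zero>\<^bsub>opp A\<^esub>" using e_faithful[of a] a by simp
qed

text \<open>The element \<open>h(\<pi> 1)\<close> lifts to some \<open>u\<close>, and \<open>m \<mapsto> u \<iota>(m)\<close> is the lift of \<open>h\<close>.\<close>

lemma module_projective: "projective (opp A) M"
  unfolding projective_def
proof (intro allI impI, elim conjE)
  fix U V :: "'a fgmod" and g h
  assume U: "fg_left_module (opp A) U" and V: "fg_left_module (opp A) V"
    and g: "g \<in> module_hom (opp A) U V" "g ` carrier U = carrier V" and h: "h \<in> module_hom (opp A) M V"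
  interpret U: fg_left_module "opp A" U by fact
  have "h (\<pi> \<one>\<^bsub>A\<^esub>) \<in> g ` carrier U" unfolding g(2) using module_homD(1)[OF h] \<pi>D(1) by simp
  then obtain u where u: "u \<in> carrier U" "g u = h (\<pi> \<one>\<^bsub>A\<^esub>)" by (elim imageE) simp
  show "\<exists>h' \<in> module_hom (opp A) M U. \<forall>m \<in> carrier M. g (h' m) = h m"
  proof (intro bexI ballI)
    show "(\<lambda>m \<in> carrier M. \<iota> m \<odot>\<^bsub>U\<^esub> u) \<in> module_hom (opp A) M U"
    proof (rule restrict_module_homI)
      show "\<iota> m \<odot>\<^bsub>U\<^esub> u \<in> carrier U" if "m \<in> carrier M" for m using \<iota>D(1)[OF that] u(1) by simp
      show "\<iota> (m \<oplus>\<^bsub>M\<^esub> m') \<odot>\<^bsub>U\<^esub> u = \<iota> m \<odot>\<^bsub>U\<^esub> u \<oplus>\<^bsub>U\<^esub> \<iota> m' \<odot>\<^bsub>U\<^esub> u"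
        if "m \<in> carrier M" "m' \<in> carrier M" for m m'
        using \<iota>D(1)[OF that(1)] \<iota>D(1)[OF that(2)] u(1) U.smult_l_distr[of "\<iota> m" "\<iota> m'" u] \<iota>D(2)[OF that] by simp
      show "\<iota> (a \<odot>\<^bsub>M\<^esub> m) \<odot>\<^bsub>U\<^esub> u = a \<odot>\<^bsub>U\<^esub> (\<iota> m \<odot>\<^bsub>U\<^esub> u)"
        if "a \<in> carrier (opp A)" "m \<in> carrier M" for a m
        using that \<iota>D(1)[OF that(2)] u(1) U.smult_assoc[of a "\<iota> m" u] \<iota>D(3)[of a m] by simp
    qed
    fix m assume m: "m \<in> carrier M"
    have "g (\<iota> m \<odot>\<^bsub>U\<^esub> u) = \<iota> m \<odot>\<^bsub>V\<^esub> h (\<pi> \<one>\<^bsub>A\<^esub>)"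
      using module_homD(3)[OF g(1), of "\<iota> m" u] \<iota>D(1)[OF m] u by simp
    also have "\<dots> = h (\<iota> m \<odot>\<^bsub>M\<^esub> \<pi> \<one>\<^bsub>A\<^esub>)"
      using module_homD(3)[OF h, of "\<iota> m" "\<pi> \<one>\<^bsub>A\<^esub>"] \<iota>D(1)[OF m] \<pi>D(1) by simp
    also have "\<iota> m \<odot>\<^bsub>M\<^esub> \<pi> \<one>\<^bsub>A\<^esub> = m" using \<pi>D(3)[OF \<iota>D(1)[OF m] A.one_closed] \<iota>D(1)[OF m] \<pi>\<iota>[OF m] by simp
    finally show "g ((\<lambda>m \<in> carrier M. \<iota> m \<odot>\<^bsub>U\<^esub> u) m) = h m" using m by simp
  qed
qed

text \<open>The map \<open>\<iota> h\<close> equals \<open>e \<iota> h\<close>, which extends since \<open>e\<close> lies in the trace ideal.\<close>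

lemma module_injective: "injective (opp A) M"
  unfolding injective_def
proof (intro allI impI, elim conjE)
  fix U V :: "'a fgmod" and g h
  assume U: "fg_left_module (opp A) U" and V: "fg_left_module (opp A) V"
    and g: "g \<in> module_hom (opp A) U V" "inj_on g (carrier U)" and h: "h \<in> module_hom (opp A) U M"
  interpret U: fg_left_module "opp A" U by fact
  interpret V: fg_left_module "opp A" V by fact
  have u: "(\<lambda>x \<in> carrier U. \<iota> (h x)) \<in> module_hom (opp A) U (regular (opp A))"
    by (rule U.module_hom_compose[OF h \<iota>])
  obtain v where v: "v \<in> module_hom (opp A) V (regular (opp A))"
    "\<forall>x \<in> carrier U. v (g x) = e \<otimes>\<^bsub>A\<^esub> (\<lambda>x \<in> carrier U. \<iota> (h x)) x"
    using trace_extension[OF e U.left_module_axioms V g u] by (elim bexE)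
  show "\<exists>h' \<in> module_hom (opp A) V M. \<forall>x \<in> carrier U. h' (g x) = h x"
  proof (intro bexI ballI)
    show "(\<lambda>z \<in> carrier V. \<pi> (v z)) \<in> module_hom (opp A) V M" by (rule V.module_hom_compose[OF v(1) \<pi>])
    fix x assume x: "x \<in> carrier U"
    have hx: "h x \<in> carrier M" using module_homD(1)[OF h x] .
    have "v (g x) = \<iota> (h x)" using bspec[OF v(2) x] x e_\<iota>[OF hx] by simp
    then show "(\<lambda>z \<in> carrier V. \<pi> (v z)) (g x) = h x" using module_homD(1)[OF g(1) x] \<pi>\<iota>[OF hx] by simp
  qed
qed

end

locale bicommutant = idempotent_module +
  fixes \<theta>
  assumes \<theta>_closed: "\<And>m. m \<in> carrier M \<Longrightarrow> \<theta> m \<in> carrier M"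
    and \<theta>_add: "\<And>m m'. m \<in> carrier M \<Longrightarrow> m' \<in> carrier M \<Longrightarrow> \<theta> (m \<oplus>\<^bsub>M\<^esub> m') = \<theta> m \<oplus>\<^bsub>M\<^esub> \<theta> m'"
    and \<theta>_commutes: "\<And>b m. b \<in> module_hom (opp A) M M \<Longrightarrow> m \<in> carrier M \<Longrightarrow> \<theta> (b m) = b (\<theta> m)"
    and dual_reflexive: "dual_reflexive K A"
begin

text \<open>The map \<open>\<theta>\<close> seen on the algebra, \<open>x \<mapsto> \<theta>(e x)\<close>.\<close>

definition theta_A where "theta_A x = \<iota> (\<theta> (\<pi> x))"

lemma theta_A_closed [simp]: "x \<in> carrier A \<Longrightarrow> theta_A x \<in> carrier A"
  unfolding theta_A_def using \<iota>D(1) \<theta>_closed \<pi>D(1) by simp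

lemma theta_A_add: "x \<in> carrier A \<Longrightarrow> y \<in> carrier A \<Longrightarrow> theta_A (x \<oplus>\<^bsub>A\<^esub> y) = theta_A x \<oplus>\<^bsub>A\<^esub> theta_A y"
  unfolding theta_A_def using \<iota>D(2) \<theta>_add \<theta>_closed \<pi>D(1,2) by simp

lemma theta_A_e: "x \<in> carrier A \<Longrightarrow> theta_A (e \<otimes>\<^bsub>A\<^esub> x) = theta_A x" "x \<in> carrier A \<Longrightarrow> e \<otimes>\<^bsub>A\<^esub> theta_A x = theta_A x"
  unfolding theta_A_def using \<pi>_e e_\<iota> \<theta>_closed \<pi>D(1) by simp_all

text \<open>Commutation of \<open>\<theta>\<close> with the endomorphism \<open>m \<mapsto> e c m\<close> of \<open>eA\<close>.\<close>

lemma theta_A_mult: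
  assumes c: "c \<in> carrier A" and x: "x \<in> carrier A"
  shows "theta_A (c \<otimes>\<^bsub>A\<^esub> (e \<otimes>\<^bsub>A\<^esub> x)) = e \<otimes>\<^bsub>A\<^esub> (c \<otimes>\<^bsub>A\<^esub> theta_A x)"
proof -
  let ?b = "\<lambda>m \<in> carrier M. \<pi> (c \<otimes>\<^bsub>A\<^esub> \<iota> m)"
  have b: "?b \<in> module_hom (opp A) M M"
  proof (rule restrict_module_homI)
    show "\<pi> (c \<otimes>\<^bsub>A\<^esub> \<iota> m) \<in> carrier M" if "m \<in> carrier M" for m using that c \<iota>D(1) \<pi>D(1) by simp
    show "\<pi> (c \<otimes>\<^bsub>A\<^esub> \<iota> (m \<oplus>\<^bsub>M\<^esub> m')) = \<pi> (c \<otimes>\<^bsub>A\<^esub> \<iota> m) \<oplus>\<^bsub>M\<^esub> \<pi> (c \<otimes>\<^bsub>A\<^esub> \<iota> m')"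
      if "m \<in> carrier M" "m' \<in> carrier M" for m m'
      using that c \<iota>D(1,2) \<pi>D(2) by (simp add: A.r_distr)
    show "\<pi> (c \<otimes>\<^bsub>A\<^esub> \<iota> (a \<odot>\<^bsub>M\<^esub> m)) = a \<odot>\<^bsub>M\<^esub> \<pi> (c \<otimes>\<^bsub>A\<^esub> \<iota> m)"
      if "a \<in> carrier (opp A)" "m \<in> carrier M" for a m
      using that c \<iota>D(1,3) \<pi>D(3) by (simp add: A.m_assoc[symmetric])
  qed
  have "\<theta> (\<pi> (c \<otimes>\<^bsub>A\<^esub> (e \<otimes>\<^bsub>A\<^esub> x))) = \<theta> (?b (\<pi> x))" using x \<pi>D(1) \<iota>\<pi> by simp
  also have "\<dots> = \<pi> (c \<otimes>\<^bsub>A\<^esub> theta_A x)" using \<theta>_commutes[OF b \<pi>D(1)[OF x]] \<theta>_closed[OF \<pi>D(1)[OF x]] by (simp add: theta_A_def)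
  finally have "theta_A (c \<otimes>\<^bsub>A\<^esub> (e \<otimes>\<^bsub>A\<^esub> x)) = \<iota> (\<pi> (c \<otimes>\<^bsub>A\<^esub> theta_A x))" by (simp add: theta_A_def)
  then show ?thesis using c x \<iota>\<pi> by simp
qed

lemma theta_A_smult:
  assumes k: "k \<in> carrier K" and x: "x \<in> carrier A"
  shows "theta_A (k \<odot>\<^bsub>A\<^esub> x) = k \<odot>\<^bsub>A\<^esub> theta_A x"
proof -
  have "theta_A (k \<odot>\<^bsub>A\<^esub> x) = theta_A (e \<otimes>\<^bsub>A\<^esub> (k \<odot>\<^bsub>A\<^esub> x))" using theta_A_e(1)[of "k \<odot>\<^bsub>A\<^esub> x"] k x by simp
  also have "\<dots> = theta_A ((k \<odot>\<^bsub>A\<^esub> \<one>\<^bsub>A\<^esub>) \<otimes>\<^bsub>A\<^esub> (e \<otimes>\<^bsub>A\<^esub> x))" using k x eA by (simp add: smult_mult_left smult_mult_right)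
  also have "\<dots> = k \<odot>\<^bsub>A\<^esub> (e \<otimes>\<^bsub>A\<^esub> theta_A x)"
    using theta_A_mult[of "k \<odot>\<^bsub>A\<^esub> \<one>\<^bsub>A\<^esub>" x] k x eA by (simp add: smult_mult_left smult_mult_right)
  finally show ?thesis using theta_A_e(2)[OF x] by simp
qed

text \<open>The equation \<open>e a y = \<theta>(e a h(\<xi>))\<close> for all \<open>a\<close>: if \<open>\<theta>\<close> is multiplication by \<open>x\<close>, its solution
  is \<open>h(\<xi>) x\<close>.\<close>

definition solves where
  "solves h \<xi> y \<longleftrightarrow> y \<in> carrier A \<and> (\<forall>a \<in> carrier A. e \<otimes>\<^bsub>A\<^esub> (a \<otimes>\<^bsub>A\<^esub> y) = theta_A (a \<otimes>\<^bsub>A\<^esub> h \<xi>))"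

lemma solves_unique:
  assumes "solves h \<xi> y" "solves h \<xi> z"
  shows "y = z"
proof -
  have y: "y \<in> carrier A" and z: "z \<in> carrier A" using assms by (auto simp: solves_def)
  have "e \<otimes>\<^bsub>A\<^esub> (a \<otimes>\<^bsub>A\<^esub> (y \<ominus>\<^bsub>A\<^esub> z)) = \<zero>\<^bsub>A\<^esub>" if a: "a \<in> carrier A" for a
  proof -
    have "e \<otimes>\<^bsub>A\<^esub> (a \<otimes>\<^bsub>A\<^esub> y) = e \<otimes>\<^bsub>A\<^esub> (a \<otimes>\<^bsub>A\<^esub> z)" using assms a by (simp add: solves_def)
    then show ?thesis using a y z eA by (simp add: A.minus_eq A.r_distr A.r_minus A.r_neg)
  qed
  then have "y \<ominus>\<^bsub>A\<^esub> z = \<zero>\<^bsub>A\<^esub>" using e_faithful[of "y \<ominus>\<^bsub>A\<^esub> z"] y z by simp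
  then show ?thesis using A.minus_zero_imp_eq y z by simp
qed

lemma solves_add:
  assumes h: "h \<in> H" and \<xi>: "\<xi> \<in> carrier DA" "\<eta> \<in> carrier DA" and "solves h \<xi> y" "solves h \<eta> z"
  shows "solves h (\<xi> \<oplus>\<^bsub>DA\<^esub> \<eta>) (y \<oplus>\<^bsub>A\<^esub> z)"
  using assms(4,5) HD(1,2)[OF h] \<xi> eA unfolding solves_def by (simp add: A.r_distr theta_A_add)

lemma solves_scal:
  assumes h: "h \<in> H" and \<xi>: "\<xi> \<in> carrier DA" and k: "k \<in> carrier K" and "solves h \<xi> y"
  shows "solves h (scal K A k \<xi>) (k \<odot>\<^bsub>A\<^esub> y)"
  using assms(4) HD(1,4)[OF h] \<xi> k eA unfolding solves_def by (simp add: smult_mult_right theta_A_smult)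

text \<open>For \<open>\<xi> = \<eta> e b\<close> the value \<open>h(\<xi>) = h(\<eta>) e b\<close> gives the solution \<open>h(\<eta>) \<theta>(e b)\<close>, because
  \<open>e a h(\<eta>) e\<close> acts as an endomorphism of \<open>eA\<close>. The solvable \<open>\<xi>\<close> form a subspace.\<close>

lemma ex_solves:
  assumes h: "h \<in> H" and \<xi>: "\<xi> \<in> carrier DA"
  shows "\<exists>y. solves h \<xi> y"
proof -
  note hD = HD[OF h]
  let ?W = "{\<xi> \<in> carrier DA. \<exists>y. solves h \<xi> y}"
  have "carrier DA \<subseteq> ?W"
  proof (rule DA_generated[OF eA e_faithful])
    fix b \<eta> assume b: "b \<in> carrier A" and \<eta>: "\<eta> \<in> carrier DA"
    have eb: "e \<otimes>\<^bsub>A\<^esub> b \<in> carrier A" using b eA by simp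
    have "solves h ((e \<otimes>\<^bsub>A\<^esub> b) \<odot>\<^bsub>DA\<^esub> \<eta>) (h \<eta> \<otimes>\<^bsub>A\<^esub> theta_A b)"
      unfolding solves_def hD(3)[OF \<eta> eb]
    proof (intro conjI ballI)
      show "h \<eta> \<otimes>\<^bsub>A\<^esub> theta_A b \<in> carrier A" using hD(1)[OF \<eta>] b by simp
      fix a assume a: "a \<in> carrier A"
      have "theta_A ((a \<otimes>\<^bsub>A\<^esub> h \<eta>) \<otimes>\<^bsub>A\<^esub> (e \<otimes>\<^bsub>A\<^esub> b)) = e \<otimes>\<^bsub>A\<^esub> ((a \<otimes>\<^bsub>A\<^esub> h \<eta>) \<otimes>\<^bsub>A\<^esub> theta_A b)"
        using a b hD(1)[OF \<eta>] by (intro theta_A_mult) simp_all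
      then show "e \<otimes>\<^bsub>A\<^esub> (a \<otimes>\<^bsub>A\<^esub> (h \<eta> \<otimes>\<^bsub>A\<^esub> theta_A b)) = theta_A (a \<otimes>\<^bsub>A\<^esub> (h \<eta> \<otimes>\<^bsub>A\<^esub> (e \<otimes>\<^bsub>A\<^esub> b)))"
        using a b hD(1)[OF \<eta>] eA by (simp add: A.m_assoc)
    qed
    then show "(e \<otimes>\<^bsub>A\<^esub> b) \<odot>\<^bsub>DA\<^esub> \<eta> \<in> ?W" using eb \<eta> by auto
  next
    show "\<xi> \<oplus>\<^bsub>DA\<^esub> \<eta> \<in> ?W" if "\<xi> \<in> ?W" "\<eta> \<in> ?W" for \<xi> \<eta>
      using that solves_add[OF h, of \<xi> \<eta>] by (simp, blast)
    show "scal K A k \<xi> \<in> ?W" if "k \<in> carrier K" "\<xi> \<in> ?W" for k \<xi>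
      using that solves_scal[OF h, of \<xi> k] by (simp, blast)
  qed auto
  then show ?thesis using \<xi> by blast
qed

definition phi where "phi h \<xi> = (SOME y. solves h \<xi> y)"

lemma phi: "h \<in> H \<Longrightarrow> \<xi> \<in> carrier DA \<Longrightarrow> solves h \<xi> (phi h \<xi>)"
  unfolding phi_def using ex_solves by (rule someI_ex)

lemma phi_eqI: "h \<in> H \<Longrightarrow> \<xi> \<in> carrier DA \<Longrightarrow> solves h \<xi> y \<Longrightarrow> phi h \<xi> = y"
  by (rule solves_unique[OF phi])

lemma phi_closed: "h \<in> H \<Longrightarrow> \<xi> \<in> carrier DA \<Longrightarrow> phi h \<xi> \<in> carrier A"
  using phi[of h \<xi>] by (simp add: solves_def)

lemma equivariant_phi: "equivariant K A phi"
  unfolding equivariant_def Let_def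
proof (intro conjI ballI)
  fix h assume h: "h \<in> H"
  show "dual_linear K A A (phi h)"
    unfolding dual_linear_def additive_map_def
  proof (intro conjI ballI)
    show "phi h \<in> carrier DA \<rightarrow> carrier A" using phi_closed[OF h] by simp
    show "phi h (\<xi> \<oplus>\<^bsub>DA\<^esub> \<eta>) = phi h \<xi> \<oplus>\<^bsub>A\<^esub> phi h \<eta>" if "\<xi> \<in> carrier DA" "\<eta> \<in> carrier DA" for \<xi> \<eta>
      
      using that by (rule_tac phi_eqI[OF h DA_closed(2) solves_add[OF h _ _ phi[OF h] phi[OF h]]]) simp_all
    show "phi h (scal K A k \<xi>) = k \<odot>\<^bsub>A\<^esub> phi h \<xi>" if "k \<in> carrier K" "\<xi> \<in> carrier DA" for k \<xi>
      
      using that by (rule_tac phi_eqI[OF h DA_closed(5) solves_scal[OF h _ _ phi[OF h]]]) simp_all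
  qed
  show "phi (\<lambda>\<xi> \<in> carrier DA. h \<xi> \<oplus>\<^bsub>A\<^esub> h' \<xi>) \<xi> = phi h \<xi> \<oplus>\<^bsub>A\<^esub> phi h' \<xi>"
    if h': "h' \<in> H" and \<xi>: "\<xi> \<in> carrier DA" for h' \<xi>
  proof (rule phi_eqI[OF H_add[OF h h'] \<xi>])
    show "solves (\<lambda>\<xi> \<in> carrier DA. h \<xi> \<oplus>\<^bsub>A\<^esub> h' \<xi>) \<xi> (phi h \<xi> \<oplus>\<^bsub>A\<^esub> phi h' \<xi>)"
      using phi[OF h \<xi>] phi[OF h' \<xi>] HD(1)[OF h \<xi>] HD(1)[OF h' \<xi>] \<xi> eA
      unfolding solves_def by (simp add: A.r_distr theta_A_add)
  qed
  show "phi (twist K A d c h) \<xi> = d \<otimes>\<^bsub>A\<^esub> phi h (left_act A c \<xi>)"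
    if c: "c \<in> carrier A" and d: "d \<in> carrier A" and \<xi>: "\<xi> \<in> carrier DA" for c d \<xi>
  proof (rule phi_eqI[OF twist_closed[OF h c d] \<xi>])
    have c\<xi>: "left_act A c \<xi> \<in> carrier DA" using c \<xi> by simp
    have y: "phi h (left_act A c \<xi>) \<in> carrier A" using phi_closed[OF h c\<xi>] .
    have hc: "h (left_act A c \<xi>) \<in> carrier A" using HD(1)[OF h c\<xi>] .
    have "e \<otimes>\<^bsub>A\<^esub> (a \<otimes>\<^bsub>A\<^esub> (d \<otimes>\<^bsub>A\<^esub> phi h (left_act A c \<xi>))) = theta_A (a \<otimes>\<^bsub>A\<^esub> (d \<otimes>\<^bsub>A\<^esub> h (left_act A c \<xi>)))"
      if a: "a \<in> carrier A" for a
    proof -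
      have "e \<otimes>\<^bsub>A\<^esub> ((a \<otimes>\<^bsub>A\<^esub> d) \<otimes>\<^bsub>A\<^esub> phi h (left_act A c \<xi>)) = theta_A ((a \<otimes>\<^bsub>A\<^esub> d) \<otimes>\<^bsub>A\<^esub> h (left_act A c \<xi>))"
        using phi[OF h c\<xi>] a d by (simp add: solves_def)
      then show ?thesis using a d y hc by (simp add: A.m_assoc)
    qed
    then show "solves (twist K A d c h) \<xi> (d \<otimes>\<^bsub>A\<^esub> phi h (left_act A c \<xi>))"
      using d y \<xi> by (simp add: solves_def twist_def)
  qed
qed

text \<open>If \<open>x\<close> represents \<open>phi\<close>, then \<open>\<theta>(e i) = e i x\<close> first for the values \<open>i = h(\<xi>)\<close>, then for all
  \<open>i\<close> in the trace ideal, which contains \<open>eA\<close>.\<close>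

lemma bicommutant_multiplication:
  obtains x where "x \<in> carrier A" "\<And>m. m \<in> carrier M \<Longrightarrow> \<theta> m = x \<odot>\<^bsub>M\<^esub> m"
proof -
  obtain x where x: "x \<in> carrier A" "\<And>h \<xi>. h \<in> H \<Longrightarrow> \<xi> \<in> carrier DA \<Longrightarrow> phi h \<xi> = h \<xi> \<otimes>\<^bsub>A\<^esub> x"
  proof -
    have "\<forall>\<phi>. equivariant K A \<phi> \<longrightarrow> (\<exists>x \<in> carrier A. \<forall>h \<in> H. \<forall>\<xi> \<in> carrier DA. \<phi> h \<xi> = h \<xi> \<otimes>\<^bsub>A\<^esub> x)"
      using dual_reflexive unfolding dual_reflexive_def Let_def by (rule conjunct2)
    then have "\<exists>x \<in> carrier A. \<forall>h \<in> H. \<forall>\<xi> \<in> carrier DA. phi h \<xi> = h \<xi> \<otimes>\<^bsub>A\<^esub> x"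
      using equivariant_phi by (elim allE impE)
    then obtain x where x: "x \<in> carrier A" "\<forall>h \<in> H. \<forall>\<xi> \<in> carrier DA. phi h \<xi> = h \<xi> \<otimes>\<^bsub>A\<^esub> x" ..
    show thesis by (rule that[OF x(1)]) (use x(2) in simp)
  qed
  have trace: "theta_A i = e \<otimes>\<^bsub>A\<^esub> (i \<otimes>\<^bsub>A\<^esub> x)" if "i \<in> trace_ideal K A" for i
    using that
  proof (induction rule: trace_ideal.induct)
    case trace_zero
    have "additive_map A A theta_A" by (simp add: additive_map_def theta_A_add)
    then show ?case
      using additive_map_zero[OF A.abelian_group_axioms A.abelian_group_axioms] eA x(1) by simp
  next
    case (trace_add h \<xi> i)
    have hA: "h \<xi> \<in> carrier A" "i \<in> carrier A" using HD(1)[OF trace_add(1,2)] trace_closed trace_add(3) by auto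
    have "e \<otimes>\<^bsub>A\<^esub> (\<one>\<^bsub>A\<^esub> \<otimes>\<^bsub>A\<^esub> (h \<xi> \<otimes>\<^bsub>A\<^esub> x)) = theta_A (\<one>\<^bsub>A\<^esub> \<otimes>\<^bsub>A\<^esub> h \<xi>)"
      using bspec[OF conjunct2[OF phi[OF trace_add(1,2), unfolded solves_def]] A.one_closed]
        x(2)[OF trace_add(1,2)] by simp
    then have "theta_A (h \<xi>) = e \<otimes>\<^bsub>A\<^esub> (h \<xi> \<otimes>\<^bsub>A\<^esub> x)" using hA x(1) by simp
    then show ?case using trace_add(4) hA x(1) eA by (simp add: theta_A_add A.l_distr A.r_distr)
  qed
  have "\<theta> m = x \<odot>\<^bsub>M\<^esub> m" if m: "m \<in> carrier M" for m
  proof (rule \<iota>_inject)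
    have \<iota>m: "\<iota> m \<in> carrier A" using \<iota>D(1)[OF m] .
    show "\<theta> m \<in> carrier M" "x \<odot>\<^bsub>M\<^esub> m \<in> carrier M" using \<theta>_closed m x(1) by simp_all
    have "\<iota> m \<in> trace_ideal K A" using trace_mult_right[OF e \<iota>m] e_\<iota>[OF m] by simp
    from trace[OF this] have "theta_A (\<iota> m) = (e \<otimes>\<^bsub>A\<^esub> \<iota> m) \<otimes>\<^bsub>A\<^esub> x" using eA \<iota>m x(1) by (simp add: A.m_assoc)
    then have "theta_A (\<iota> m) = \<iota> m \<otimes>\<^bsub>A\<^esub> x" using e_\<iota>[OF m] by simp
    then show "\<iota> (\<theta> m) = \<iota> (x \<odot>\<^bsub>M\<^esub> m)" using \<pi>\<iota>[OF m] \<iota>D(3)[OF x(1) m] by (simp add: theta_A_def)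
  qed
  with x(1) show thesis by (rule that)
qed

end

lemma (in idempotent_module) module_double_centraliser:
  assumes "dual_reflexive K A"
  shows "double_centraliser A M"
proof -
  let ?B = "end_ring (opp A) M"
  let ?C = "opp (end_ring ?B (over_end M))"
  let ?L = "\<lambda>a. \<lambda>m \<in> carrier M. a \<odot>\<^bsub>M\<^esub> m"
  have carC: "carrier ?C = module_hom ?B (over_end M) (over_end M)"
    unfolding opp_simps carrier_end_ring ..
  have carB: "carrier ?B = module_hom (opp A) M M" by (rule carrier_end_ring)
  have smA: "a \<odot>\<^bsub>M\<^esub> m \<in> carrier M" if "a \<in> carrier A" "m \<in> carrier M" for a m using that by simp
  have L: "?L a \<in> carrier ?C" if a: "a \<in> carrier A" for a
    unfolding carC
  proof (rule module_homI)
    fix b m assume "b \<in> carrier ?B" "m \<in> carrier (over_end M)"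
    then have b: "b \<in> module_hom (opp A) M M" and m: "m \<in> carrier M" by (simp_all add: carB over_end_simps)
    have "b m \<in> carrier M" "b (a \<odot>\<^bsub>M\<^esub> m) = a \<odot>\<^bsub>M\<^esub> b m"
      using module_homD(1)[OF b m] module_homD(3)[OF b _ m, of a] a by simp_all
    then show "?L a (b \<odot>\<^bsub>over_end M\<^esub> m) = b \<odot>\<^bsub>over_end M\<^esub> ?L a m" using m by (simp add: over_end_simps)
  qed (use a in \<open>simp_all add: over_end_simps smult_r_distr\<close>)
  have "?L \<in> ring_hom A ?C"
  proof (rule ring_hom_memI)
    fix a b assume a: "a \<in> carrier A" and b: "b \<in> carrier A"
    have ab: "b \<odot>\<^bsub>M\<^esub> (a \<odot>\<^bsub>M\<^esub> m) = (a \<otimes>\<^bsub>A\<^esub> b) \<odot>\<^bsub>M\<^esub> m" if "m \<in> carrier M" for m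
      using smult_assoc[of b a m] a b that by simp
    have "compose (carrier M) (?L b) (?L a) = ?L (a \<otimes>\<^bsub>A\<^esub> b)"
      unfolding compose_def by (rule restrict_ext) (simp add: smA a ab)
    then show "?L (a \<otimes>\<^bsub>A\<^esub> b) = ?L a \<otimes>\<^bsub>?C\<^esub> ?L b" by (simp add: end_ring_def over_end_simps)
    have "?L (a \<oplus>\<^bsub>A\<^esub> b) = (\<lambda>m \<in> carrier M. ?L a m \<oplus>\<^bsub>M\<^esub> ?L b m)"
      using smult_l_distr[of a b] a b by (intro restrict_ext) simp
    then show "?L (a \<oplus>\<^bsub>A\<^esub> b) = ?L a \<oplus>\<^bsub>?C\<^esub> ?L b" by (simp add: end_ring_def over_end_simps)
  next
    have "?L \<one>\<^bsub>A\<^esub> = (\<lambda>m \<in> carrier M. m)" using smult_one by (intro restrict_ext) simp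
    then show "?L \<one>\<^bsub>A\<^esub> = \<one>\<^bsub>?C\<^esub>" by (simp add: end_ring_def over_end_simps)
  qed (rule L)
  moreover have "bij_betw ?L (carrier A) (carrier ?C)"
    unfolding bij_betw_def
  proof (intro conjI equalityI subsetI)
    show "inj_on ?L (carrier A)"
    proof (rule inj_onI)
      fix a b assume a: "a \<in> carrier A" and b: "b \<in> carrier A" and eq: "?L a = ?L b"
      have "a \<odot>\<^bsub>M\<^esub> m = b \<odot>\<^bsub>M\<^esub> m" if "m \<in> carrier M" for m using fun_cong[OF eq, of m] that by simp
      then have "(a \<ominus>\<^bsub>opp A\<^esub> b) \<odot>\<^bsub>M\<^esub> m = \<zero>\<^bsub>M\<^esub>" if "m \<in> carrier M" for m
        using a b that by (simp add: smult_minus_left M.minus_eq M.r_neg)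
      moreover have "a \<ominus>\<^bsub>opp A\<^esub> b \<in> carrier (opp A)" using R.minus_closed[of a b] a b by simp
      ultimately have "a \<ominus>\<^bsub>opp A\<^esub> b = \<zero>\<^bsub>opp A\<^esub>" using module_faithful unfolding faithful_def by blast
      then show "a = b" using R.minus_zero_imp_eq[of a b] a b by simp
    qed
  next
    fix \<theta> assume "\<theta> \<in> carrier ?C"
    then have \<theta>: "\<theta> \<in> module_hom ?B (over_end M) (over_end M)" unfolding carC .
    note tD = module_homD[OF \<theta>, unfolded over_end_simps carB]
    interpret bicommutant K A B w M e \<iota> \<pi> \<theta>
      by unfold_locales (use tD(1-3) assms in simp_all)
    obtain x where x: "x \<in> carrier A" "\<And>m. m \<in> carrier M \<Longrightarrow> \<theta> m = x \<odot>\<^bsub>M\<^esub> m"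
      by (rule bicommutant_multiplication) blast
    have "\<theta> = ?L x" by (rule extensionalityI[OF tD(4)]) (simp_all add: x(2))
    then show "\<theta> \<in> ?L ` carrier A" using x(1) by (rule image_eqI)
  qed (use L in blast)
  ultimately show ?thesis unfolding double_centraliser_def ring_iso_def by simp
qed

context based_algebra
begin

lemma ex_idempotent_module:
  assumes e: "e \<in> trace_ideal K A" "e \<otimes>\<^bsub>A\<^esub> e = e"
    and faith: "\<And>x. x \<in> carrier A \<Longrightarrow> (\<forall>a \<in> carrier A. e \<otimes>\<^bsub>A\<^esub> (a \<otimes>\<^bsub>A\<^esub> x) = \<zero>\<^bsub>A\<^esub>) \<Longrightarrow> x = \<zero>\<^bsub>A\<^esub>"
  obtains M :: "'a fgmod" and \<iota> \<pi> where "idempotent_module K A B w M e \<iota> \<pi>"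
proof -
  have eA: "e \<in> carrier A" by (rule trace_closed[OF e(1)])
  interpret Op: ring "opp A" by (rule A.ring_opp)
  interpret Reg: left_module "opp A" "regular (opp A)" by (rule Op.left_module_regular)
  let ?I = "(\<lambda>a. e \<otimes>\<^bsub>A\<^esub> a) ` carrier A"
  define N :: "('a, 'a) module" where "N = regular (opp A)\<lparr>carrier := ?I\<rparr>"
  have N_simps: "carrier N = ?I" "add N = add A" "zero N = zero A" "smult N = (\<lambda>x y. y \<otimes>\<^bsub>A\<^esub> x)"
    by (simp_all add: N_def)
  have NA: "x \<in> carrier A" "e \<otimes>\<^bsub>A\<^esub> x = x" if x: "x \<in> ?I" for x
  proof -
    obtain a where a: "a \<in> carrier A" "x = e \<otimes>\<^bsub>A\<^esub> a" using x by blast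
    then show "x \<in> carrier A" using eA by simp
    have "e \<otimes>\<^bsub>A\<^esub> (e \<otimes>\<^bsub>A\<^esub> a) = (e \<otimes>\<^bsub>A\<^esub> e) \<otimes>\<^bsub>A\<^esub> a" using a eA by (intro A.m_assoc[symmetric]) auto
    then show "e \<otimes>\<^bsub>A\<^esub> x = x" using a e(2) by simp
  qed
  have NI: "x \<in> ?I" if "x \<in> carrier A" "e \<otimes>\<^bsub>A\<^esub> x = x" for x using that by (metis imageI)
  have Nadd: "x \<oplus>\<^bsub>A\<^esub> y \<in> ?I" if "x \<in> ?I" "y \<in> ?I" for x y
    using NA[OF that(1)] NA[OF that(2)] eA by (intro NI) (simp_all add: A.r_distr)
  have Nmult: "x \<otimes>\<^bsub>A\<^esub> a \<in> ?I" if "x \<in> ?I" "a \<in> carrier A" for x a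
  proof (rule NI)
    show "x \<otimes>\<^bsub>A\<^esub> a \<in> carrier A" using NA[OF that(1)] that(2) by simp
    have "e \<otimes>\<^bsub>A\<^esub> (x \<otimes>\<^bsub>A\<^esub> a) = (e \<otimes>\<^bsub>A\<^esub> x) \<otimes>\<^bsub>A\<^esub> a"
      using NA(1)[OF that(1)] that(2) eA by (intro A.m_assoc[symmetric])
    then show "e \<otimes>\<^bsub>A\<^esub> (x \<otimes>\<^bsub>A\<^esub> a) = x \<otimes>\<^bsub>A\<^esub> a" using NA(2)[OF that(1)] by simp
  qed
  have Nzero: "\<zero>\<^bsub>A\<^esub> \<in> ?I" using eA by (intro NI) simp_all
  have Ninv: "\<ominus>\<^bsub>A\<^esub> x \<in> ?I" if "x \<in> ?I" for x
    using NA[OF that] eA by (intro NI) (simp_all add: A.r_minus)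
  have eI: "e \<in> ?I" using eA e(2) by (intro NI)
  have lmN: "left_module (opp A) N"
  proof (intro left_module.intro left_module_axioms.intro A.ring_opp)
    show "abelian_group N"
    proof (rule abelian_groupI)
      fix x assume "x \<in> carrier N"
      then have x: "x \<in> ?I" by (simp only: N_simps)
      show "\<exists>y \<in> carrier N. y \<oplus>\<^bsub>N\<^esub> x = \<zero>\<^bsub>N\<^esub>" unfolding N_simps
        using Ninv[OF x] NA(1)[OF x] by (intro bexI[of _ "\<ominus>\<^bsub>A\<^esub> x"]) (simp_all add: A.l_neg)
    qed (unfold N_simps, use Nadd Nzero NA(1) in \<open>simp_all add: A.a_ac\<close>)
  qed (unfold N_simps opp_simps, use Nmult NA(1) in \<open>simp_all add: A.l_distr A.r_distr A.m_assoc\<close>)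
  interpret N: left_module "opp A" N by (rule lmN)
  have "finitely_generated (opp A) N"
  proof (rule N.finitely_generatedI[of "{e}"])
    show "{e} \<subseteq> carrier N" using eI by (simp only: N_simps insert_subset empty_subsetI)
    fix U assume U: "is_submodule (opp A) N U" "{e} \<subseteq> U"
    show "carrier N \<subseteq> U"
    proof
      fix x assume "x \<in> carrier N"
      then obtain a where a: "a \<in> carrier A" "x = e \<otimes>\<^bsub>A\<^esub> a" unfolding N_simps by blast
      have "\<forall>k \<in> carrier A. \<forall>x \<in> U. x \<otimes>\<^bsub>A\<^esub> k \<in> U" using U(1) by (simp add: is_submodule_def N_simps)
      then show "x \<in> U" using a U(2) by simp
    qed
  qed simp
  then interpret N: fg_left_module "opp A" N
    by (intro fg_left_module.intro fg_left_module_axioms.intro lmN)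
  obtain M :: "'a fgmod" and j where M: "fg_left_module (opp A) M" and j: "j \<in> module_iso (opp A) N M"
    by (rule N.fg_left_module_universe)
  interpret M: fg_left_module "opp A" M by fact
  define i where "i = (\<lambda>m \<in> carrier M. inv_into (carrier N) j m)"
  note inv = module_iso_inverse[OF lmN M.left_module_axioms j, folded i_def]
  have jh: "j \<in> module_hom (opp A) N M" using j unfolding module_iso_def by simp
  have iI: "i m \<in> ?I" if "m \<in> carrier M" for m using module_homD(1)[OF inv(1) that] by (simp only: N_simps)
  have "i \<in> module_hom (opp A) M (regular (opp A))"
  proof (rule module_homI)
    show "i m \<in> carrier (regular (opp A))" if "m \<in> carrier M" for m using NA(1)[OF iI[OF that]] by simp
    show "i (m \<oplus>\<^bsub>M\<^esub> m') = i m \<oplus>\<^bsub>regular (opp A)\<^esub> i m'" if "m \<in> carrier M" "m' \<in> carrier M" for m m'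
      using module_homD(2)[OF inv(1) that] by (simp add: N_simps)
    show "i (a \<odot>\<^bsub>M\<^esub> m) = a \<odot>\<^bsub>regular (opp A)\<^esub> i m" if "a \<in> carrier (opp A)" "m \<in> carrier M" for a m
      using module_homD(3)[OF inv(1) that] by (simp add: N_simps)
  qed (rule module_homD(4)[OF inv(1)])
  moreover have "(\<lambda>a \<in> carrier (regular (opp A)). j (e \<otimes>\<^bsub>A\<^esub> a)) \<in> module_hom (opp A) (regular (opp A)) M"
  proof (rule Reg.restrict_module_homI)
    have ea: "e \<otimes>\<^bsub>A\<^esub> a \<in> carrier N" if "a \<in> carrier A" for a unfolding N_simps using that by (rule imageI)
    show "j (e \<otimes>\<^bsub>A\<^esub> a) \<in> carrier M" if "a \<in> carrier (regular (opp A))" for a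
      using module_homD(1)[OF jh ea] that by simp
    show "j (e \<otimes>\<^bsub>A\<^esub> (a \<oplus>\<^bsub>regular (opp A)\<^esub> b)) = j (e \<otimes>\<^bsub>A\<^esub> a) \<oplus>\<^bsub>M\<^esub> j (e \<otimes>\<^bsub>A\<^esub> b)"
      if "a \<in> carrier (regular (opp A))" "b \<in> carrier (regular (opp A))" for a b
      using module_homD(2)[OF jh ea ea, of a b] that eA by (simp add: N_simps A.r_distr)
    show "j (e \<otimes>\<^bsub>A\<^esub> (c \<odot>\<^bsub>regular (opp A)\<^esub> a)) = c \<odot>\<^bsub>M\<^esub> j (e \<otimes>\<^bsub>A\<^esub> a)"
      if "c \<in> carrier (opp A)" "a \<in> carrier (regular (opp A))" for c a
      using module_homD(3)[OF jh that(1) ea, of a] that eA by (simp add: N_simps A.m_assoc)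
  qed
  ultimately have "idempotent_module K A B w M e i (\<lambda>a \<in> carrier (regular (opp A)). j (e \<otimes>\<^bsub>A\<^esub> a))"
  proof (intro idempotent_module.intro idempotent_module_axioms.intro based_algebra_axioms M e(1) faith)
    fix m assume m: "m \<in> carrier M"
    show "(\<lambda>a \<in> carrier (regular (opp A)). j (e \<otimes>\<^bsub>A\<^esub> a)) (i m) = m"
      using NA[OF iI[OF m]] inv(3)[OF m] by simp
  next
    fix a assume a: "a \<in> carrier A"
    then have "e \<otimes>\<^bsub>A\<^esub> a \<in> carrier N" unfolding N_simps by (rule imageI)
    then show "i ((\<lambda>a \<in> carrier (regular (opp A)). j (e \<otimes>\<^bsub>A\<^esub> a)) a) = e \<otimes>\<^bsub>A\<^esub> a" using inv(2) a by simp
  qed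
  then show thesis by (rule that)
qed

theorem dual_reflexive_imp_projective_injective:
  assumes refl: "dual_reflexive K A"
  shows "\<exists>M :: 'a fgmod. fg_left_module (opp A) M \<and> faithful (opp A) M \<and>
    projective (opp A) M \<and> injective (opp A) M \<and> double_centraliser A M"
proof -
  have "x = \<zero>\<^bsub>A\<^esub>" if x: "x \<in> carrier A" and z: "\<forall>i \<in> trace_ideal K A. i \<otimes>\<^bsub>A\<^esub> x = \<zero>\<^bsub>A\<^esub>" for x
  proof -
    have "\<forall>h \<in> H. \<forall>\<xi> \<in> carrier DA. h \<xi> \<otimes>\<^bsub>A\<^esub> x = \<zero>\<^bsub>A\<^esub>" using z trace_value by blast
    moreover have "\<forall>x \<in> carrier A. (\<forall>h \<in> H. \<forall>\<xi> \<in> carrier DA. h \<xi> \<otimes>\<^bsub>A\<^esub> x = \<zero>\<^bsub>A\<^esub>) \<longrightarrow> x = \<zero>\<^bsub>A\<^esub>"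
      using refl unfolding dual_reflexive_def Let_def by (rule conjunct1)
    ultimately show ?thesis using x by simp
  qed
  then obtain e where e: "e \<in> trace_ideal K A" "e \<otimes>\<^bsub>A\<^esub> e = e"
    and faith: "\<And>x. x \<in> carrier A \<Longrightarrow> (\<forall>a \<in> carrier A. e \<otimes>\<^bsub>A\<^esub> (a \<otimes>\<^bsub>A\<^esub> x) = \<zero>\<^bsub>A\<^esub>) \<Longrightarrow> x = \<zero>\<^bsub>A\<^esub>"
    using faithful_idempotent[of "trace_ideal K A"] trace_closed trace_ideal.trace_zero trace_plus
      trace_mult_right trace_mult_left by blast
  obtain M :: "'a fgmod" and \<iota> \<pi> where "idempotent_module K A B w M e \<iota> \<pi>"
    by (rule ex_idempotent_module[OF e faith])
  then interpret M: idempotent_module K A B w M e \<iota> \<pi> .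
  show ?thesis
    using M.fg_left_module_axioms M.module_faithful M.module_projective M.module_injective
      M.module_double_centraliser[OF refl] by blast
qed

end


section \<open>The equivalence\<close>

theorem mainTheorem2:
  fixes K :: "('k, 'x) ring_scheme" and A :: "('k, 'a, 'y) module_scheme"
  assumes "fd_algebra K A"
  shows "(\<exists>M :: 'a fgmod. fg_left_module (opp A) M \<and> faithful (opp A) M \<and>
            projective (opp A) M \<and> injective (opp A) M \<and> double_centraliser A M)
         \<longleftrightarrow> reflexive (env_alg K A) (regular_bimodule K A)"
proof -
  obtain B w where "based_algebra K A B w" using fd_algebra.ex_based_algebra[OF assms] by blast
  then interpret based_algebra K A B w .
  show ?thesis
    unfolding reflexive_iff_dual_reflexive
    using projective_injective_imp_dual_reflexive dual_reflexive_imp_projective_injective by blast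
qed

end
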